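(* Let $k$ be an algebraically closed field, and let $\Lambda_n^2$ be one of the algebras $A_n^2=kA_n/\operatorname{rad}^2$ or $D_n^2=kD_n/\operatorname{rad}^2$ (the same type, $A$ or $D$, being used for all indices below). Then: (1) $|\tau\text{-tilt}\,\Lambda_n^2|=|\tau\text{-tilt}\,\Lambda_{n-1}^2|+|\tau\text{-tilt}\,\Lambda_{n-2}^2|$; (2) $|\mathrm{s}\tau\text{-tilt}\,\Lambda_n^2|=2\,|\mathrm{s}\tau\text{-tilt}\,\Lambda_{n-1}^2|+|\mathrm{s}\tau\text{-tilt}\,\Lambda_{n-2}^2|$.
   Context: $A_n$ is the linearly oriented quiver $n\to n-1\to\cdots\to 2\to 1$. $D_n$ is the quiver with points $1,\dots,n$ and arrows $n\to n-1\to\cdots\to 3$, $3\to 1$ and $3\to 2$. For such a quiver $Q$, $kQ/\operatorname{rad}^2$ is the path algebra modulo the square of its radical (all paths of length $2$ are zero). Modules are finitely generated left modules, with conventions such that an arrow $x\to y$ corresponds to $\operatorname{Ext}^1(S_x,S_y)\ne0$, where $S_x$ is the simple module at the point $x$. For a finite-dimensional $k$-algebra $\Lambda$, $\tau$ is the Auslander–Reiten translation and, for a module $M$, $|M|$ is the number of pairwise nonisomorphic indecomposable direct summands of $M$. A $\Lambda$-module $M$ is $\tau$-rigid if $\operatorname{Hom}_\Lambda(M,\tau M)=0$; it is $\tau$-tilting if it is $\tau$-rigid and $|M|=|\Lambda|$; it is support $\tau$-tilting if it is a $\tau$-tilting $\Lambda/\Lambda e\Lambda$-module for some idempotent $e$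 of $\Lambda$ (the zero module is included, with $e=1$). $\tau\text{-tilt}\,\Lambda$ and $\mathrm{s}\tau\text{-tilt}\,\Lambda$ denote the sets of isomorphism classes of basic $\tau$-tilting, respectively basic support $\tau$-tilting, $\Lambda$-modules, and $|\cdot|$ of a set is its cardinality. *)

theory Defs
  imports
    "HOL-Algebra.Algebraic_Closure"
    "HOL-Algebra.QuotRing"
    "HOL-Algebra.Ideal_Product"
    "Graph_Theory.Arc_Walk"
begin

section \<open>Left modules over a ring that need not be commutative\<close>

text \<open>
  The record \<^typ>\<open>('r, 'v) module\<close> of HOL-Algebra is used both for modules and for algebras.
  In a module the fields \<open>mult\<close> and \<open>one\<close> are irrelevant; in a \<open>K\<close>-algebra
  \<open>A :: ('k, 'r) module\<close> the field \<^term>\<open>smult\<close> is the scalar action of \<open>K\<close>.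
\<close>

locale left_module = R?: ring R + M?: abelian_group M
  for R :: "('r, 'p) ring_scheme" (structure) and M :: "('r, 'v) module" (structure) +
  assumes smult_closed: "\<lbrakk>a \<in> carrier R; x \<in> carrier M\<rbrakk> \<Longrightarrow> a \<odot>\<^bsub>M\<^esub> x \<in> carrier M"
    and smult_l_distr: "\<lbrakk>a \<in> carrier R; b \<in> carrier R; x \<in> carrier M\<rbrakk> \<Longrightarrow>
      (a \<oplus>\<^bsub>R\<^esub> b) \<odot>\<^bsub>M\<^esub> x = a \<odot>\<^bsub>M\<^esub> x \<oplus>\<^bsub>M\<^esub> b \<odot>\<^bsub>M\<^esub> x"
    and smult_r_distr: "\<lbrakk>a \<in> carrier R; x \<in> carrier M; y \<in> carrier M\<rbrakk> \<Longrightarrow>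
      a \<odot>\<^bsub>M\<^esub> (x \<oplus>\<^bsub>M\<^esub> y) = a \<odot>\<^bsub>M\<^esub> x \<oplus>\<^bsub>M\<^esub> a \<odot>\<^bsub>M\<^esub> y"
    and smult_assoc: "\<lbrakk>a \<in> carrier R; b \<in> carrier R; x \<in> carrier M\<rbrakk> \<Longrightarrow>
      (a \<otimes>\<^bsub>R\<^esub> b) \<odot>\<^bsub>M\<^esub> x = a \<odot>\<^bsub>M\<^esub> (b \<odot>\<^bsub>M\<^esub> x)"
    and smult_one: "x \<in> carrier M \<Longrightarrow> \<one>\<^bsub>R\<^esub> \<odot>\<^bsub>M\<^esub> x = x"

definition fg_module :: "('r, 'p) ring_scheme \<Rightarrow> ('r, 'v) module \<Rightarrow> bool" where
  "fg_module R M \<longleftrightarrow> left_module R M \<and>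
     (\<exists>S. finite S \<and> S \<subseteq> carrier M \<and>
          (\<forall>H. submodule H R M \<and> S \<subseteq> H \<longrightarrow> H = carrier M))"

definition regular_module :: "('r, 'p) ring_scheme \<Rightarrow> ('r, 'r) module" where
  "regular_module R = ring.extend (ring.truncate R) (module.fields (\<lambda>a b. a \<otimes>\<^bsub>R\<^esub> b))"

text \<open>Homomorphisms are extensional functions, so that equality in \<open>Hom\<close> is equality on the
  carrier of the domain.\<close>

definition module_Hom ::
  "('r, 'p) ring_scheme \<Rightarrow> ('r, 'v) module \<Rightarrow> ('r, 'w) module \<Rightarrow> ('v \<Rightarrow> 'w) set" where
  "module_Hom R M N = {h \<in> carrier M \<rightarrow>\<^sub>E carrier N.
     (\<forall>x\<in>carrier M. \<forall>y\<in>carrier M. h (x \<oplus>\<^bsub>M\<^esub> y) = h x \<oplus>\<^bsub>N\<^esub> h y) \<and>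
     (\<forall>a\<in>carrier R. \<forall>x\<in>carrier M. h (a \<odot>\<^bsub>M\<^esub> x) = a \<odot>\<^bsub>N\<^esub> h x)}"

definition module_iso ::
  "('r, 'p) ring_scheme \<Rightarrow> ('r, 'v) module \<Rightarrow> ('r, 'w) module \<Rightarrow> bool" where
  "module_iso R M N \<longleftrightarrow> (\<exists>h \<in> module_Hom R M N. bij_betw h (carrier M) (carrier N))"

definition iso_classes ::
  "('r, 'p) ring_scheme \<Rightarrow> ('r, 'v) module set \<Rightarrow> ('r, 'v) module set set" where
  "iso_classes R S = S // {(M, N) \<in> S \<times> S. module_iso R M N}"

definition quotient_module :: "('r, 'v) module \<Rightarrow> 'v set \<Rightarrow> ('r, 'v set) module" where
  "quotient_module M H = \<lparr>carrier = a_rcosets\<^bsub>M\<^esub> H, monoid.mult = undefined, one = undefined,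
     zero = H, add = set_add M, smult = (\<lambda>a C. \<Union>x\<in>C. H +>\<^bsub>M\<^esub> (a \<odot>\<^bsub>M\<^esub> x))\<rparr>"


section \<open>Indecomposable direct summands\<close>

definition complementary ::
  "('r, 'p) ring_scheme \<Rightarrow> ('r, 'v) module \<Rightarrow> 'v set \<Rightarrow> 'v set \<Rightarrow> bool" where
  "complementary R M N N' \<longleftrightarrow> submodule N R M \<and> submodule N' R M \<and>
     N \<inter> N' = {\<zero>\<^bsub>M\<^esub>} \<and> N <+>\<^bsub>M\<^esub> N' = carrier M"

definition direct_summand :: "('r, 'p) ring_scheme \<Rightarrow> ('r, 'v) module \<Rightarrow> 'v set \<Rightarrow> bool" where
  "direct_summand R M N \<longleftrightarrow> (\<exists>N'. complementary R M N N')"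

definition indecomposable :: "('r, 'p) ring_scheme \<Rightarrow> ('r, 'v) module \<Rightarrow> bool" where
  "indecomposable R M \<longleftrightarrow> carrier M \<noteq> {\<zero>\<^bsub>M\<^esub>} \<and>
     (\<forall>N N'. complementary R M N N' \<longrightarrow> N = {\<zero>\<^bsub>M\<^esub>} \<or> N' = {\<zero>\<^bsub>M\<^esub>})"

definition indec_summands :: "('r, 'p) ring_scheme \<Rightarrow> ('r, 'v) module \<Rightarrow> 'v set set" where
  "indec_summands R M = {N. direct_summand R M N \<and> indecomposable R (M\<lparr>carrier := N\<rparr>)}"

text \<open>The number \<open>|M|\<close> of isomorphism classes of indecomposable direct summands of \<open>M\<close>.\<close>

definition num_summands :: "('r, 'p) ring_scheme \<Rightarrow> ('r, 'v) module \<Rightarrow> nat" where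
  "num_summands R M = card (iso_classes R ((\<lambda>N. M\<lparr>carrier := N\<rparr>) ` indec_summands R M))"

definition internal_direct_sum ::
  "('r, 'p) ring_scheme \<Rightarrow> ('r, 'v) module \<Rightarrow> 'v set set \<Rightarrow> bool" where
  "internal_direct_sum R M S \<longleftrightarrow> finite S \<and> (\<forall>N\<in>S. submodule N R M) \<and>
     (\<forall>x\<in>carrier M. \<exists>!f. f \<in> (\<Pi>\<^sub>E N\<in>S. N) \<and> x = finsum M f S)"

definition basic_module :: "('r, 'p) ring_scheme \<Rightarrow> ('r, 'v) module \<Rightarrow> bool" where
  "basic_module R M \<longleftrightarrow> (\<exists>S. internal_direct_sum R M S \<and>
     (\<forall>N\<in>S. indecomposable R (M\<lparr>carrier := N\<rparr>)) \<and>
     (\<forall>N\<in>S. \<forall>N'\<in>S. N \<noteq> N' \<longrightarrow>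
        \<not> module_iso R (M\<lparr>carrier := N\<rparr>) (M\<lparr>carrier := N'\<rparr>)))"


section \<open>Minimal projective presentations and the Auslander--Reiten translation\<close>

text \<open>
  Projectivity is the lifting property in the category of finitely generated modules whose
  elements are of the same type \<open>'v\<close> as those of \<open>P\<close>.  It is used below only for a type \<open>'v\<close>
  that contains an isomorphic copy of every finitely generated module.
\<close>

definition projective_module :: "('r, 'p) ring_scheme \<Rightarrow> ('r, 'v) module \<Rightarrow> bool" where
  "projective_module R P \<longleftrightarrow> fg_module R P \<and>
     (\<forall>V :: ('r, 'v) module. \<forall>W :: ('r, 'v) module.
        \<forall>p \<in> module_Hom R V W. \<forall>h \<in> module_Hom R P W.
          fg_module R V \<and> fg_module R W \<and> p ` carrier V = carrier W \<longrightarrow>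
          (\<exists>h' \<in> module_Hom R P V. \<forall>x\<in>carrier P. p (h' x) = h x))"

definition superfluous :: "('r, 'p) ring_scheme \<Rightarrow> ('r, 'v) module \<Rightarrow> 'v set \<Rightarrow> bool" where
  "superfluous R M H \<longleftrightarrow> submodule H R M \<and>
     (\<forall>N. submodule N R M \<and> N <+>\<^bsub>M\<^esub> H = carrier M \<longrightarrow> N = carrier M)"

definition projective_cover ::
  "('r, 'p) ring_scheme \<Rightarrow> ('r, 'v) module \<Rightarrow> ('v \<Rightarrow> 'v) \<Rightarrow> ('r, 'v) module \<Rightarrow> bool" where
  "projective_cover R P p M \<longleftrightarrow> projective_module R P \<and> p \<in> module_Hom R P M \<and>
     p ` carrier P = carrier M \<and> superfluous R P (a_kernel P M p)"

text \<open>\<open>P\<^sub>1 \<rightarrow> P\<^sub>0 \<rightarrow> M \<rightarrow> 0\<close> with maps \<open>f\<close> and \<open>g\<close>.\<close>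

definition min_proj_presentation ::
  "('r, 'p) ring_scheme \<Rightarrow> ('r, 'v) module \<Rightarrow>
   ('r, 'v) module \<times> ('v \<Rightarrow> 'v) \<times> ('r, 'v) module \<times> ('v \<Rightarrow> 'v) \<Rightarrow> bool" where
  "min_proj_presentation R M = (\<lambda>(P1, f, P0, g).
     projective_cover R P0 g M \<and>
     projective_cover R P1 f (P0\<lparr>carrier := a_kernel P0 M g\<rparr>))"

text \<open>
  Right modules are represented by the same record, with \<^term>\<open>smult\<close> standing for the right
  action: \<open>a \<odot> h\<close> is \<open>h \<cdot> a\<close>.  The right module \<open>Hom\<^sub>R(P, R)\<close> has the action
  \<open>(h \<cdot> a)(x) = h(x) a\<close>.
\<close>

definition star_module :: "('r, 'p) ring_scheme \<Rightarrow> ('r, 'v) module \<Rightarrow> ('r, 'v \<Rightarrow> 'r) module" where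
  "star_module R P = \<lparr>carrier = module_Hom R P (regular_module R),
     monoid.mult = undefined, one = undefined,
     zero = (\<lambda>x\<in>carrier P. \<zero>\<^bsub>R\<^esub>),
     add = (\<lambda>h h'. \<lambda>x\<in>carrier P. h x \<oplus>\<^bsub>R\<^esub> h' x),
     smult = (\<lambda>a h. \<lambda>x\<in>carrier P. h x \<otimes>\<^bsub>R\<^esub> a)\<rparr>"

text \<open>The transpose of the presentation \<open>f : P\<^sub>1 \<rightarrow> P\<^sub>0\<close>: the cokernel of
  \<open>Hom\<^sub>R(P\<^sub>0, R) \<rightarrow> Hom\<^sub>R(P\<^sub>1, R)\<close>, \<open>h \<mapsto> h \<circ> f\<close>.\<close>

definition transpose_module ::
  "('r, 'p) ring_scheme \<Rightarrow> ('r, 'v) module \<Rightarrow> ('v \<Rightarrow> 'v) \<Rightarrow> ('r, 'v) module \<Rightarrow>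
   ('r, ('v \<Rightarrow> 'r) set) module" where
  "transpose_module R P1 f P0 = quotient_module (star_module R P1)
     ((\<lambda>h. compose (carrier P1) h f) ` carrier (star_module R P0))"

text \<open>
  \<open>D V = Hom\<^sub>K(V, K)\<close> for a right module \<open>V\<close> over the \<open>K\<close>-algebra \<open>A\<close>, with the left action
  \<open>(a \<cdot> \<phi>)(x) = \<phi>(x \<cdot> a)\<close>.  The scalar \<open>c\<close> of \<open>K\<close> acts on \<open>V\<close> as the element \<open>c \<cdot> 1\<close> of \<open>A\<close>.
\<close>

definition dual_module ::
  "('k, 'm) ring_scheme \<Rightarrow> ('k, 'r) module \<Rightarrow> ('r, 'x) module \<Rightarrow> ('r, 'x \<Rightarrow> 'k) module" where
  "dual_module K A V = \<lparr>carrier = {\<phi> \<in> carrier V \<rightarrow>\<^sub>E carrier K.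
       (\<forall>x\<in>carrier V. \<forall>y\<in>carrier V. \<phi> (x \<oplus>\<^bsub>V\<^esub> y) = \<phi> x \<oplus>\<^bsub>K\<^esub> \<phi> y) \<and>
       (\<forall>c\<in>carrier K. \<forall>x\<in>carrier V. \<phi> ((c \<odot>\<^bsub>A\<^esub> \<one>\<^bsub>A\<^esub>) \<odot>\<^bsub>V\<^esub> x) = c \<otimes>\<^bsub>K\<^esub> \<phi> x)},
     monoid.mult = undefined, one = undefined,
     zero = (\<lambda>x\<in>carrier V. \<zero>\<^bsub>K\<^esub>),
     add = (\<lambda>\<phi> \<psi>. \<lambda>x\<in>carrier V. \<phi> x \<oplus>\<^bsub>K\<^esub> \<psi> x),
     smult = (\<lambda>a \<phi>. \<lambda>x\<in>carrier V. \<phi> (a \<odot>\<^bsub>V\<^esub> x))\<rparr>"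

definition AR_translate ::
  "('k, 'm) ring_scheme \<Rightarrow> ('k, 'r) module \<Rightarrow> ('r, 'v) module \<Rightarrow>
   ('r, ('v \<Rightarrow> 'r) set \<Rightarrow> 'k) module" where
  "AR_translate K A M =
     (case (SOME p. min_proj_presentation A M p) of
        (P1, f, P0, g) \<Rightarrow> dual_module K A (transpose_module A P1 f P0))"


section \<open>\<open>\<tau>\<close>-tilting and support \<open>\<tau>\<close>-tilting modules\<close>

definition tau_rigid :: "('k, 'm) ring_scheme \<Rightarrow> ('k, 'r) module \<Rightarrow> ('r, 'v) module \<Rightarrow> bool" where
  "tau_rigid K A M \<longleftrightarrow> fg_module A M \<and>
     module_Hom A M (AR_translate K A M) = {\<lambda>x\<in>carrier M. \<zero>\<^bsub>AR_translate K A M\<^esub>}"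

definition tau_tilting :: "('k, 'm) ring_scheme \<Rightarrow> ('k, 'r) module \<Rightarrow> ('r, 'v) module \<Rightarrow> bool" where
  "tau_tilting K A M \<longleftrightarrow> tau_rigid K A M \<and>
     num_summands A M = num_summands A (regular_module A)"

definition quotient_algebra :: "('k, 'r) module \<Rightarrow> 'r set \<Rightarrow> ('k, 'r set) module" where
  "quotient_algebra A I = ring.extend (A Quot I)
     (module.fields (\<lambda>c C. \<Union>x\<in>C. I +>\<^bsub>A\<^esub> (c \<odot>\<^bsub>A\<^esub> x)))"

text \<open>A module annihilated by the ideal \<open>I\<close>, viewed as a module over the quotient by \<open>I\<close>:
  a coset acts through any of its representatives.\<close>

definition descend_module :: "('r, 'v) module \<Rightarrow> ('r set, 'v) module" where
  "descend_module M = ring.extend (ring.truncate M)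
     (module.fields (\<lambda>C x. (SOME a. a \<in> C) \<odot>\<^bsub>M\<^esub> x))"

definition support_tau_tilting ::
  "('k, 'm) ring_scheme \<Rightarrow> ('k, 'r) module \<Rightarrow> ('r, 'v) module \<Rightarrow> bool" where
  "support_tau_tilting K A M \<longleftrightarrow> fg_module A M \<and>
     (\<exists>e\<in>carrier A. e \<otimes>\<^bsub>A\<^esub> e = e \<and>
        (\<forall>a\<in>Idl\<^bsub>A\<^esub> {e}. \<forall>x\<in>carrier M. a \<odot>\<^bsub>M\<^esub> x = \<zero>\<^bsub>M\<^esub>) \<and>
        tau_tilting K (quotient_algebra A (Idl\<^bsub>A\<^esub> {e})) (descend_module M))"

text \<open>
  Isomorphism classes are taken among the modules with elements in \<^typ>\<open>nat \<Rightarrow> 'k\<close>.  This type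
  contains a copy of \<open>K\<^sup>d\<close> for every \<open>d\<close>, hence an isomorphic copy of every finitely generated
  module over a finite-dimensional \<open>K\<close>-algebra.
\<close>

definition tau_tilt ::
  "('k, 'm) ring_scheme \<Rightarrow> ('k, 'r) module \<Rightarrow> ('r, nat \<Rightarrow> 'k) module set set" where
  "tau_tilt K A = iso_classes A {M. tau_tilting K A M \<and> basic_module A M}"

definition stau_tilt ::
  "('k, 'm) ring_scheme \<Rightarrow> ('k, 'r) module \<Rightarrow> ('r, nat \<Rightarrow> 'k) module set set" where
  "stau_tilt K A = iso_classes A {M. support_tau_tilting K A M \<and> basic_module A M}"


section \<open>Path algebras and their radicals\<close>

text \<open>
  A quiver is a \<^typ>\<open>('v, 'e) pre_digraph\<close>; a path is a triple consisting of its source, its list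
  of arrows and its target.
\<close>

type_synonym ('v, 'e) path = "'v \<times> 'e list \<times> 'v"

definition quiver_paths :: "('v, 'e) pre_digraph \<Rightarrow> ('v, 'e) path set" where
  "quiver_paths Q = {(u, p, v). pre_digraph.awalk Q u p v}"

text \<open>
  The pairs of paths with product \<open>p\<close>.  A product \<open>q \<cdot> r\<close> means first \<open>r\<close>, then \<open>q\<close>; with this
  convention left modules are the representations of the quiver, and an arrow from \<open>x\<close> to \<open>y\<close>
  gives \<open>Ext\<^sup>1(S\<^sub>x, S\<^sub>y) \<noteq> 0\<close>.
\<close>

definition path_factorizations ::
  "('v, 'e) pre_digraph \<Rightarrow> ('v, 'e) path \<Rightarrow> (('v, 'e) path \<times> ('v, 'e) path) set" where
  "path_factorizations Q p = {((v, b, w), (u, a, v)) | u a v b w.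
     pre_digraph.awalk Q u a v \<and> pre_digraph.awalk Q v b w \<and> p = (u, a @ b, w)}"

definition path_algebra ::
  "('k, 'm) ring_scheme \<Rightarrow> ('v, 'e) pre_digraph \<Rightarrow> ('k, ('v, 'e) path \<Rightarrow> 'k) module" where
  "path_algebra K Q = \<lparr>
     carrier = {f. range f \<subseteq> carrier K \<and> finite {p. f p \<noteq> \<zero>\<^bsub>K\<^esub>} \<and>
                   {p. f p \<noteq> \<zero>\<^bsub>K\<^esub>} \<subseteq> quiver_paths Q},
     monoid.mult = (\<lambda>f g p. \<Oplus>\<^bsub>K\<^esub>qr\<in>path_factorizations Q p. f (fst qr) \<otimes>\<^bsub>K\<^esub> g (snd qr)),
     one = (\<lambda>(u, p, v). if u \<in> verts Q \<and> p = [] \<and> u = v then \<one>\<^bsub>K\<^esub> else \<zero>\<^bsub>K\<^esub>),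
     zero = (\<lambda>p. \<zero>\<^bsub>K\<^esub>),
     add = (\<lambda>f g p. f p \<oplus>\<^bsub>K\<^esub> g p),
     smult = (\<lambda>c f p. c \<otimes>\<^bsub>K\<^esub> f p)\<rparr>"

definition maximal_left_ideal :: "('r, 'p) ring_scheme \<Rightarrow> 'r set \<Rightarrow> bool" where
  "maximal_left_ideal R I \<longleftrightarrow> submodule I R (regular_module R) \<and> I \<noteq> carrier R \<and>
     (\<forall>J. submodule J R (regular_module R) \<and> I \<subseteq> J \<longrightarrow> J = I \<or> J = carrier R)"

definition jacobson_radical :: "('r, 'p) ring_scheme \<Rightarrow> 'r set" where
  "jacobson_radical R = {x \<in> carrier R. \<forall>I. maximal_left_ideal R I \<longrightarrow> x \<in> I}"

definition mod_rad_square :: "('k, 'r) module \<Rightarrow> ('k, 'r set) module" where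
  "mod_rad_square A = quotient_algebra A (jacobson_radical A \<cdot>\<^bsub>A\<^esub> jacobson_radical A)"


section \<open>The quivers of type A and D\<close>

datatype quiver_type = TypeA | TypeD

text \<open>Type A is \<open>n \<rightarrow> n-1 \<rightarrow> \<dots> \<rightarrow> 1\<close>; type D is \<open>n \<rightarrow> n-1 \<rightarrow> \<dots> \<rightarrow> 3\<close> with \<open>3 \<rightarrow> 1\<close> and \<open>3 \<rightarrow> 2\<close>.
  An arrow is the pair of its source and its target.\<close>

fun quiver_arrows :: "quiver_type \<Rightarrow> nat \<Rightarrow> (nat \<times> nat) set" where
  "quiver_arrows TypeA n = {(i + 1, i) | i. 1 \<le> i \<and> i + 1 \<le> n}"
| "quiver_arrows TypeD n = {(i + 1, i) | i. 3 \<le> i \<and> i + 1 \<le> n} \<union>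
     (if n \<ge> 3 then {(3, 1), (3, 2)} else {})"

definition linear_quiver :: "quiver_type \<Rightarrow> nat \<Rightarrow> (nat, nat \<times> nat) pre_digraph" where
  "linear_quiver T n = \<lparr>verts = {1..n}, arcs = quiver_arrows T n, tail = fst, head = snd\<rparr>"

definition Lambda2 ::
  "('k, 'm) ring_scheme \<Rightarrow> quiver_type \<Rightarrow> nat \<Rightarrow>
   ('k, ((nat, nat \<times> nat) path \<Rightarrow> 'k) set) module" where
  "Lambda2 K T n = mod_rad_square (path_algebra K (linear_quiver T n))"

end

theory Submission
  imports Defs
begin

text \<open>
  Every point of the quivers is the target of at most one arrow and the source of at most two.
  Over the quotient by the squared radical, an indecomposable module is therefore generated by a
  vector \<open>u\<close> at one point \<open>i\<close>, and it is determined by \<open>i\<close> and the set \<open>W\<close> of those children \<open>j\<close> of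
  \<open>i\<close> (targets of arrows from \<open>i\<close>) for which the arrow \<open>i \<rightarrow> j\<close> does not annihilate \<open>u\<close>.  A homomorphism
  \<open>M \<rightarrow> \<tau> M\<close> is a bilinear pairing of \<open>M\<close> with \<open>Hom(P\<^sub>1, A)\<close> that vanishes on the image of
  \<open>Hom(P\<^sub>0, A)\<close>, and the explicit minimal presentation shows that \<open>M\<close> is \<open>\<tau>\<close>-rigid if and only if,
  for any two summands \<open>(i, W)\<close> and \<open>(k, Y)\<close>, the point \<open>k\<close> is not a child of \<open>i\<close> outside \<open>W\<close>, and
  \<open>|Y - W| \<le> 1\<close> if \<open>k = i\<close>.  What remains is to count sets of such pairs: the pairs at the
  topmost point \<open>n\<close>, which has one child \<open>c\<close>, are \<open>{(n, {c})}\<close>, with an arbitrary maximal set on the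
  other points, or \<open>{(n, {}), (n, {c})}\<close>, with a maximal set on the points other than \<open>n\<close> and \<open>c\<close>.
  Support \<open>\<tau>\<close>-tilting modules are the \<open>\<tau>\<close>-tilting modules of the subquivers on all sets of points.
\<close>

section \<open>Left modules and linear maps\<close>

text \<open>Rigidity is a lifting problem. A summand \<open>(i, W)\<close> has one relation for each
  child \<open>j\<close> of \<open>i\<close> outside \<open>W\<close>, and \<open>M\<close> is rigid
  if any family of vectors of \<open>M\<close> at these \<open>j\<close> comes, through the arrows,
  from one vector of \<open>M\<close> at \<open>i\<close>. A generator that itself sits at such a
  \<open>j\<close> is not reached by an arrow, which gives the first condition. A summand
  \<open>(i, Y)\<close> offers at \<open>i\<close> only the multiples of one vector, so it can serve
  at most one of the points in \<open>Y - W\<close>, which gives the second. Compatible sets of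
  pairs over a set of points have at most as many elements as there are points; the \<tau>-tilting
  modules are those that reach this bound. Two obstacles shape the rest. The translate is defined
  through an arbitrarily chosen minimal presentation, so the explicit one has to be compared with it
  by the uniqueness of projective covers. And an indecomposable summand is not known in advance to
  be finite-dimensional, so strings are split off with hyperplanes obtained from Zorn's lemma
  instead of with bases; the invariant \<open>retract\<close> then takes the place of the
  Krull-Schmidt theorem.\<close>

definition lin ::
  "('r, 'p) ring_scheme \<Rightarrow> ('r, 'v) module \<Rightarrow> ('r, 'w) module \<Rightarrow> ('v \<Rightarrow> 'w) \<Rightarrow> bool" where
  "lin R M N h \<longleftrightarrow> h ` carrier M \<subseteq> carrier N \<and>
     (\<forall>x\<in>carrier M. \<forall>y\<in>carrier M. h (x \<oplus>\<^bsub>M\<^esub> y) = h x \<oplus>\<^bsub>N\<^esub> h y) \<and>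
     (\<forall>a\<in>carrier R. \<forall>x\<in>carrier M. h (a \<odot>\<^bsub>M\<^esub> x) = a \<odot>\<^bsub>N\<^esub> h x)"

lemma linI:
  assumes "\<And>x. x \<in> carrier M \<Longrightarrow> h x \<in> carrier N"
    and "\<And>x y. \<lbrakk>x \<in> carrier M; y \<in> carrier M\<rbrakk> \<Longrightarrow> h (x \<oplus>\<^bsub>M\<^esub> y) = h x \<oplus>\<^bsub>N\<^esub> h y"
    and "\<And>a x. \<lbrakk>a \<in> carrier R; x \<in> carrier M\<rbrakk> \<Longrightarrow> h (a \<odot>\<^bsub>M\<^esub> x) = a \<odot>\<^bsub>N\<^esub> h x"
  shows "lin R M N h"
  using assms unfolding lin_def by blast

lemma lin_closed: "\<lbrakk>lin R M N h; x \<in> carrier M\<rbrakk> \<Longrightarrow> h x \<in> carrier N"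
  and lin_add: "\<lbrakk>lin R M N h; x \<in> carrier M; y \<in> carrier M\<rbrakk> \<Longrightarrow> h (x \<oplus>\<^bsub>M\<^esub> y) = h x \<oplus>\<^bsub>N\<^esub> h y"
  and lin_smult: "\<lbrakk>lin R M N h; a \<in> carrier R; x \<in> carrier M\<rbrakk> \<Longrightarrow> h (a \<odot>\<^bsub>M\<^esub> x) = a \<odot>\<^bsub>N\<^esub> h x"
  unfolding lin_def by blast+

lemma lin_id: "lin R M M (\<lambda>x. x)"
  by (rule linI) auto

lemma lin_comp: "\<lbrakk>lin R M N h; lin R N L k\<rbrakk> \<Longrightarrow> lin R M L (\<lambda>x. k (h x))"
  by (rule linI) (simp_all add: lin_closed lin_add lin_smult)

text \<open>Extensionality is kept apart from linearity, because composites and explicit lambda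
  terms are linear but seldom extensional; \<open>lin_restrict\<close> leads back to
  \<open>module_Hom\<close>.\<close>

lemma module_Hom_iff: "h \<in> module_Hom R M N \<longleftrightarrow> lin R M N h \<and> h \<in> extensional (carrier M)"
  by (auto simp: module_Hom_def lin_def PiE_def)

lemma module_Hom_lin: "h \<in> module_Hom R M N \<Longrightarrow> lin R M N h"
  by (simp add: module_Hom_iff)

context left_module
begin

lemma lin_cong:
  assumes "lin R M N h" "\<And>x. x \<in> carrier M \<Longrightarrow> h x = k x" shows "lin R M N k"
proof (rule linI)
  fix x y assume xy: "x \<in> carrier M" "y \<in> carrier M"
  then show "k (x \<oplus>\<^bsub>M\<^esub> y) = k x \<oplus>\<^bsub>N\<^esub> k y"
    using lin_add[OF assms(1) xy] assms(2) by (metis M.add.m_closed)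
next
  fix a x assume "a \<in> carrier R" "x \<in> carrier M"
  then show "k (a \<odot>\<^bsub>M\<^esub> x) = a \<odot>\<^bsub>N\<^esub> k x"
    using lin_smult[OF assms(1)] assms(2) smult_closed by metis
next
  fix x assume "x \<in> carrier M" then show "k x \<in> carrier N"
    using lin_closed[OF assms(1)] assms(2) by metis
qed

lemma lin_restrict: "lin R M N h \<Longrightarrow> restrict h (carrier M) \<in> module_Hom R M N"
  by (simp add: module_Hom_iff) (erule lin_cong, simp)

lemma smult_l_null [simp]: assumes "x \<in> carrier M" shows "\<zero>\<^bsub>R\<^esub> \<odot>\<^bsub>M\<^esub> x = \<zero>\<^bsub>M\<^esub>"
proof -
  have "\<zero>\<^bsub>R\<^esub> \<odot>\<^bsub>M\<^esub> x \<oplus>\<^bsub>M\<^esub> \<zero>\<^bsub>R\<^esub> \<odot>\<^bsub>M\<^esub> x = \<zero>\<^bsub>R\<^esub> \<odot>\<^bsub>M\<^esub> x"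
    using smult_l_distr[of "\<zero>\<^bsub>R\<^esub>" "\<zero>\<^bsub>R\<^esub>" x] assms by simp
  then show ?thesis
    using assms smult_closed[of "\<zero>\<^bsub>R\<^esub>" x] M.add.l_cancel_one'[of "\<zero>\<^bsub>R\<^esub> \<odot>\<^bsub>M\<^esub> x" "\<zero>\<^bsub>R\<^esub> \<odot>\<^bsub>M\<^esub> x"]
    by (metis M.add.l_cancel_one R.zero_closed)
qed

lemma smult_r_null [simp]: assumes "a \<in> carrier R" shows "a \<odot>\<^bsub>M\<^esub> \<zero>\<^bsub>M\<^esub> = \<zero>\<^bsub>M\<^esub>"
proof -
  have "a \<odot>\<^bsub>M\<^esub> \<zero>\<^bsub>M\<^esub> \<oplus>\<^bsub>M\<^esub> a \<odot>\<^bsub>M\<^esub> \<zero>\<^bsub>M\<^esub> = a \<odot>\<^bsub>M\<^esub> \<zero>\<^bsub>M\<^esub>"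
    using smult_r_distr[of a "\<zero>\<^bsub>M\<^esub>" "\<zero>\<^bsub>M\<^esub>"] assms by simp
  then show ?thesis
    using assms smult_closed[of a "\<zero>\<^bsub>M\<^esub>"] by (metis M.add.l_cancel_one M.zero_closed)
qed

lemma smult_r_minus: assumes "a \<in> carrier R" "x \<in> carrier M"
  shows "a \<odot>\<^bsub>M\<^esub> (\<ominus>\<^bsub>M\<^esub> x) = \<ominus>\<^bsub>M\<^esub> (a \<odot>\<^bsub>M\<^esub> x)"
proof -
  have "a \<odot>\<^bsub>M\<^esub> (\<ominus>\<^bsub>M\<^esub> x) \<oplus>\<^bsub>M\<^esub> a \<odot>\<^bsub>M\<^esub> x = \<zero>\<^bsub>M\<^esub>"
    using assms by (simp add: smult_r_distr[symmetric] M.l_neg)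
  then show ?thesis using assms by (metis M.add.inv_equality M.add.inv_closed smult_closed a_inv_def)
qed

lemma smult_l_minus: assumes "a \<in> carrier R" "x \<in> carrier M"
  shows "(\<ominus>\<^bsub>R\<^esub> a) \<odot>\<^bsub>M\<^esub> x = \<ominus>\<^bsub>M\<^esub> (a \<odot>\<^bsub>M\<^esub> x)"
proof -
  have "(\<ominus>\<^bsub>R\<^esub> a) \<odot>\<^bsub>M\<^esub> x \<oplus>\<^bsub>M\<^esub> a \<odot>\<^bsub>M\<^esub> x = \<zero>\<^bsub>M\<^esub>"
    using assms by (simp add: smult_l_distr[symmetric] R.l_neg)
  then show ?thesis using assms by (metis M.add.inv_equality R.add.inv_closed smult_closed a_inv_def)
qed

lemma smult_finsum:
  assumes "a \<in> carrier R" "f \<in> S \<rightarrow> carrier M" "finite S"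
  shows "a \<odot>\<^bsub>M\<^esub> finsum M f S = finsum M (\<lambda>s. a \<odot>\<^bsub>M\<^esub> f s) S"
  using assms(3,2)
proof (induct S rule: finite_induct)
  case (insert x F)
  then have "f x \<in> carrier M" "f \<in> F \<rightarrow> carrier M" "finsum M f F \<in> carrier M"
      "(\<lambda>s. a \<odot>\<^bsub>M\<^esub> f s) \<in> F \<rightarrow> carrier M"
    using assms(1) smult_closed by (auto intro!: M.finsum_closed)
  then show ?case using insert assms(1) by (simp add: smult_r_distr smult_closed)
qed (use assms in simp)

lemma finsum_smult:
  assumes "f \<in> S \<rightarrow> carrier R" "x \<in> carrier M" "finite S"
  shows "finsum R f S \<odot>\<^bsub>M\<^esub> x = finsum M (\<lambda>s. f s \<odot>\<^bsub>M\<^esub> x) S"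
  using assms(3,1)
proof (induct S rule: finite_induct)
  case (insert y F)
  then have "f y \<in> carrier R" "f \<in> F \<rightarrow> carrier R" "finsum R f F \<in> carrier R"
      "(\<lambda>s. f s \<odot>\<^bsub>M\<^esub> x) \<in> F \<rightarrow> carrier M"
    using assms(2) smult_closed by (auto intro!: R.finsum_closed)
  then show ?case using insert assms(2) by (simp add: smult_l_distr smult_closed)
qed (use assms in simp)

lemma lin_zero: assumes "lin R M N h" "left_module R N" shows "h \<zero>\<^bsub>M\<^esub> = \<zero>\<^bsub>N\<^esub>"
proof -
  interpret N: left_module R N by fact
  show ?thesis
    using lin_smult[OF assms(1) R.zero_closed M.zero_closed] lin_closed[OF assms(1) M.zero_closed]
    by simp
qed

lemma lin_minus: assumes "lin R M N h" "left_module R N" "x \<in> carrier M"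
  shows "h (\<ominus>\<^bsub>M\<^esub> x) = \<ominus>\<^bsub>N\<^esub> h x"
proof -
  interpret N: left_module R N by fact
  have "h (\<ominus>\<^bsub>M\<^esub> x) \<oplus>\<^bsub>N\<^esub> h x = \<zero>\<^bsub>N\<^esub>"
    using assms by (simp add: lin_add[symmetric] M.l_neg lin_zero)
  then show ?thesis
    using assms lin_closed[OF assms(1)] by (metis N.M.add.inv_equality M.add.inv_closed a_inv_def)
qed

lemma lin_finsum: assumes "lin R M N h" "left_module R N" "f \<in> S \<rightarrow> carrier M" "finite S"
  shows "h (finsum M f S) = finsum N (\<lambda>s. h (f s)) S"
proof -
  interpret N: left_module R N by fact
  show ?thesis using assms(4,3)
  proof (induct S rule: finite_induct)
    case empty then show ?case using lin_zero[OF assms(1,2)] by simp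
  next
    case (insert y F)
    then have "f y \<in> carrier M" "f \<in> F \<rightarrow> carrier M" "finsum M f F \<in> carrier M"
        "(\<lambda>s. h (f s)) \<in> F \<rightarrow> carrier N"
      using assms(1) by (auto intro!: M.finsum_closed lin_closed[OF assms(1)])
    then show ?case using insert assms(1) by (simp add: lin_add lin_closed)
  qed
qed

section \<open>Submodules, images and preimages\<close>

lemma submoduleI:
  assumes "H \<subseteq> carrier M" "H \<noteq> {}" "\<And>x y. \<lbrakk>x \<in> H; y \<in> H\<rbrakk> \<Longrightarrow> x \<oplus>\<^bsub>M\<^esub> y \<in> H"
    "\<And>a x. \<lbrakk>a \<in> carrier R; x \<in> H\<rbrakk> \<Longrightarrow> a \<odot>\<^bsub>M\<^esub> x \<in> H"
  shows "submodule H R M"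
proof -
  \<comment> \<open>Negatives come from the action of the element -1 of the ring.\<close>
  have *: "\<ominus>\<^bsub>M\<^esub> x \<in> H" if "x \<in> H" for x
    using assms(4)[of "\<ominus>\<^bsub>R\<^esub> \<one>\<^bsub>R\<^esub>" x] that assms(1) by (auto simp: smult_l_minus smult_one subset_iff)
  show ?thesis
    by (intro submodule.intro submodule_axioms.intro M.add.subgroupI) (use assms * in \<open>auto simp: a_inv_def\<close>)
qed

lemma
  assumes "submodule H R M"
  shows submodule_carr: "x \<in> H \<Longrightarrow> x \<in> carrier M"
    and submodule_zero: "\<zero>\<^bsub>M\<^esub> \<in> H"
    and submodule_add: "\<lbrakk>x \<in> H; y \<in> H\<rbrakk> \<Longrightarrow> x \<oplus>\<^bsub>M\<^esub> y \<in> H"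
    and submodule_smult: "\<lbrakk>a \<in> carrier R; x \<in> H\<rbrakk> \<Longrightarrow> a \<odot>\<^bsub>M\<^esub> x \<in> H"
    and submodule_minus: "x \<in> H \<Longrightarrow> \<ominus>\<^bsub>M\<^esub> x \<in> H"
  using assms subgroup.subset[OF submodule.axioms(1)[OF assms]]
    subgroup.one_closed[OF submodule.axioms(1)[OF assms]]
    subgroup.m_closed[OF submodule.axioms(1)[OF assms]]
    subgroup.m_inv_closed[OF submodule.axioms(1)[OF assms]]
    submodule.smult_closed[OF assms] by (auto simp: a_inv_def)

lemma submodule_finsum:
  assumes "submodule H R M" "f \<in> S \<rightarrow> H" "finite S" shows "finsum M f S \<in> H"
  using assms(3,2)
proof (induct S rule: finite_induct)
  case empty then show ?case using submodule_zero[OF assms(1)] by simp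
next
  case (insert y F)
  then have "f y \<in> H" "f \<in> F \<rightarrow> H" by auto
  moreover then have "f \<in> F \<rightarrow> carrier M" using submodule_carr[OF assms(1)] by auto
  ultimately show ?case
    using insert submodule_add[OF assms(1)] submodule_carr[OF assms(1)] by auto
qed

lemma submodule_module: assumes "submodule H R M" shows "left_module R (M\<lparr>carrier := H\<rparr>)"
proof -
  interpret S: submodule H R M by fact
  have "comm_group (add_monoid (M\<lparr>carrier := H\<rparr>))"
    using M.add.subgroup_imp_group[OF S.subgroup_axioms]
    by (intro group.group_comm_groupI)
      (auto intro!: M.a_comm dest: submodule_carr[OF assms])
  then have "abelian_group (M\<lparr>carrier := H\<rparr>)"
    by (simp add: abelian_group_def abelian_group_axioms_def abelian_monoid_def comm_group_def)
  moreover have "ring R" by unfold_locales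
  moreover note c = submodule_carr[OF assms]
  have "left_module_axioms R (M\<lparr>carrier := H\<rparr>)"
    by (rule left_module_axioms.intro)
      (simp_all add: smult_l_distr smult_r_distr smult_assoc smult_one c submodule_smult[OF assms])
  ultimately show ?thesis by (intro left_module.intro)
qed

lemma submodule_all: "submodule (carrier M) R M"
  by (rule submoduleI) (auto intro: smult_closed)

lemma submodule_triv: "submodule {\<zero>\<^bsub>M\<^esub>} R M"
  by (rule submoduleI) auto

lemma submodule_image:
  assumes "lin R M N h" "left_module R N" "submodule H R M" shows "submodule (h ` H) R N"
proof -
  interpret N: left_module R N by fact
  note s = submodule_carr[OF assms(3)] submodule_zero[OF assms(3)] submodule_add[OF assms(3)]
    submodule_smult[OF assms(3)]
  show ?thesis
  proof (rule N.submoduleI)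
    show "h ` H \<subseteq> carrier N" using s lin_closed[OF assms(1)] by auto
    show "h ` H \<noteq> {}" using s by auto
    fix x y assume "x \<in> h ` H" "y \<in> h ` H"
    then obtain x' y' where "x' \<in> H" "y' \<in> H" "x = h x'" "y = h y'" by blast
    then show "x \<oplus>\<^bsub>N\<^esub> y \<in> h ` H" using s lin_add[OF assms(1), of x' y'] by (metis image_eqI)
  next
    fix a x assume "a \<in> carrier R" "x \<in> h ` H"
    then obtain x' where "x' \<in> H" "x = h x'" by blast
    then show "a \<odot>\<^bsub>N\<^esub> x \<in> h ` H"
      using s \<open>a \<in> carrier R\<close> lin_smult[OF assms(1), of a x'] by (metis image_eqI)
  qed
qed

lemma submodule_vimage:
  assumes "lin R M N h" "left_module R N" "submodule H R N"
  shows "submodule {x \<in> carrier M. h x \<in> H} R M"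
proof -
  interpret N: left_module R N by fact
  note s = N.submodule_zero[OF assms(3)] N.submodule_add[OF assms(3)] N.submodule_smult[OF assms(3)]
  show ?thesis
    by (rule submoduleI)
      (use s lin_zero[OF assms(1,2)] lin_add[OF assms(1)] lin_smult[OF assms(1)] smult_closed in auto)
qed

lemma a_kernel_eq: "a_kernel M N h = {x \<in> carrier M. h x = \<zero>\<^bsub>N\<^esub>}"
  by (simp add: a_kernel_def kernel_def)

lemma submodule_kernel:
  assumes "lin R M N h" "left_module R N" shows "submodule (a_kernel M N h) R M"
  using submodule_vimage[OF assms left_module.submodule_triv[OF assms(2)]] by (simp add: a_kernel_eq)

section \<open>Isomorphisms of modules\<close>

lemma lin_inv_into:
  assumes "lin R M N h" "bij_betw h (carrier M) (carrier N)"
  shows "lin R N M (inv_into (carrier M) h)"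
proof (rule linI)
  let ?k = "inv_into (carrier M) h"
  have k: "?k y \<in> carrier M" "h (?k y) = y" if "y \<in> carrier N" for y
    using assms(2) that by (auto simp: bij_betw_def f_inv_into_f intro!: inv_into_into)
  have hk: "?k (h x) = x" if "x \<in> carrier M" for x
    using assms(2) that by (auto simp: bij_betw_def)
  fix y assume y: "y \<in> carrier N" then show "?k y \<in> carrier M" by (rule k)
  show "?k (y \<oplus>\<^bsub>N\<^esub> z) = ?k y \<oplus>\<^bsub>M\<^esub> ?k z" if "z \<in> carrier N" for z
    using hk[of "?k y \<oplus>\<^bsub>M\<^esub> ?k z"] k[OF y] k[OF that] lin_add[OF assms(1), of "?k y" "?k z"] by simp
  show "?k (a \<odot>\<^bsub>N\<^esub> y) = a \<odot>\<^bsub>M\<^esub> ?k y" if "a \<in> carrier R" for a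
    using hk[of "a \<odot>\<^bsub>M\<^esub> ?k y"] k[OF y] that lin_smult[OF assms(1), of a "?k y"] smult_closed by simp
qed

lemma module_isoI:
  assumes "lin R M N h" "bij_betw h (carrier M) (carrier N)" shows "module_iso R M N"
  unfolding module_iso_def using lin_restrict[OF assms(1)] assms(2)
  by (intro bexI[of _ "restrict h (carrier M)"]) simp_all

lemma module_isoI':
  assumes "lin R M N h" "lin R N M k" "\<And>x. x \<in> carrier M \<Longrightarrow> k (h x) = x"
    "\<And>y. y \<in> carrier N \<Longrightarrow> h (k y) = y"
  shows "module_iso R M N"
  by (rule module_isoI[OF assms(1)], rule bij_betw_byWitness[of _ k])
    (use assms lin_closed[OF assms(1)] lin_closed[OF assms(2)] in auto)

lemma module_iso_refl: "module_iso R M M"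
  by (rule module_isoI[OF lin_id]) (simp add: bij_betw_def)

lemma module_iso_sym: assumes "module_iso R M N" "left_module R N" shows "module_iso R N M"
proof -
  obtain h where h: "lin R M N h" "bij_betw h (carrier M) (carrier N)"
    using assms by (auto simp: module_iso_def module_Hom_iff)
  then show ?thesis
    using left_module.module_isoI[OF assms(2) lin_inv_into[OF h] bij_betw_inv_into[OF h(2)]] by simp
qed

lemma module_iso_trans:
  assumes "module_iso R M N" "module_iso R N L" shows "module_iso R M L"
proof -
  obtain h k where h: "lin R M N h" "bij_betw h (carrier M) (carrier N)"
    and k: "lin R N L k" "bij_betw k (carrier N) (carrier L)"
    using assms by (auto simp: module_iso_def module_Hom_iff)
  show ?thesis
    using module_isoI[OF lin_comp[OF h(1) k(1)]] bij_betw_trans[OF h(2) k(2)]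
    by (simp add: comp_def)
qed

end

text \<open>The preimage of a submodule that contains the images of the generators contains the
  generators and is everything. This supplies the finite generation of the target that
  \<open>projective_module\<close> asks for.\<close>

lemma fg_module_surj:
  assumes fg: "fg_module R M" and N: "left_module R N" and h: "lin R M N h" "h ` carrier M = carrier N"
  shows "fg_module R N"
proof -
  interpret M: left_module R M using fg by (simp add: fg_module_def)
  interpret N: left_module R N by fact
  obtain S where S: "finite S" "S \<subseteq> carrier M"
      "\<And>H. submodule H R M \<Longrightarrow> S \<subseteq> H \<Longrightarrow> H = carrier M"
    using fg by (auto simp: fg_module_def)
  show ?thesis unfolding fg_module_def
  proof (intro conjI N exI[of _ "h ` S"] allI impI)
    show "finite (h ` S)" "h ` S \<subseteq> carrier N" using S lin_closed[OF h(1)] by auto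
    fix H assume H: "submodule H R N \<and> h ` S \<subseteq> H"
    then have "{x \<in> carrier M. h x \<in> H} = carrier M"
      using S by (intro S(3) M.submodule_vimage[OF h(1) N]) auto
    then have "h x \<in> H" if "x \<in> carrier M" for x using that by blast
    then have "carrier N \<subseteq> H" unfolding h(2)[symmetric] by (rule image_subsetI)
    moreover have "H \<subseteq> carrier N" using N.submodule_carr[of H] H by blast
    ultimately show "H = carrier N" by (rule equalityI[rotated])
  qed
qed

section \<open>The regular left module\<close>

context ring
begin

lemma regular_simps:
  "carrier (regular_module R) = carrier R" "zero (regular_module R) = zero R" "add (regular_module R) = add R"
  "smult (regular_module R) = monoid.mult R"
  by (auto simp: regular_module_def ring.defs module.defs fun_eq_iff)

lemma regular_left_module: "left_module R (regular_module R)"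
proof -
  have "abelian_group (regular_module R)"
    by (rule abelian_groupI) (auto simp: regular_simps a_ac intro: add.l_inv_ex)
  then show ?thesis
    by (intro left_module.intro left_module_axioms.intro ring_axioms)
      (simp_all add: regular_simps l_distr r_distr m_assoc)
qed

end

section \<open>Radical square zero algebras of forests\<close>

text \<open>
  The points are the elements of \<open>V\<close>; every point \<open>j\<close> receives at most one arrow, and that arrow
  starts at \<open>par j\<close>.  An element of the algebra is given by its coordinates \<open>ev i\<close> at the
  idempotents and \<open>om j\<close> at the arrows \<open>par j \<rightarrow> j\<close>.  In \<open>pre_rsz\<close> the coordinates need not
  determine the element: this covers the path algebra itself, whose quotient by the common kernel
  of the coordinates is the algebra of radical square zero.
\<close>

locale pre_rsz = K: field K + ring A for K :: "('k, 'm) ring_scheme" and A :: "('k, 'r) module" (structure) +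
  fixes V :: "nat set" and par :: "nat \<Rightarrow> nat" and ev om :: "nat \<Rightarrow> 'r \<Rightarrow> 'k"
  assumes finV: "finite V" and par_gt: "j \<in> V \<Longrightarrow> j < par j" and par_two: "card {j \<in> V. par j = i} \<le> 2"
    and ev_closed: "\<lbrakk>a \<in> carrier A; i \<in> V\<rbrakk> \<Longrightarrow> ev i a \<in> carrier K"
    and om_closed: "\<lbrakk>a \<in> carrier A; j \<in> V; par j \<in> V\<rbrakk> \<Longrightarrow> om j a \<in> carrier K"
    and coord_ex: "\<lbrakk>\<And>i. i \<in> V \<Longrightarrow> C i \<in> carrier K; \<And>j. \<lbrakk>j \<in> V; par j \<in> V\<rbrakk> \<Longrightarrow> D j \<in> carrier K\<rbrakk> \<Longrightarrow>
      \<exists>a\<in>carrier A. (\<forall>i\<in>V. ev i a = C i) \<and> (\<forall>j\<in>V. par j \<in> V \<longrightarrow> om j a = D j)"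
    and ev_add: "\<lbrakk>a \<in> carrier A; b \<in> carrier A; i \<in> V\<rbrakk> \<Longrightarrow> ev i (a \<oplus> b) = ev i a \<oplus>\<^bsub>K\<^esub> ev i b"
    and om_add: "\<lbrakk>a \<in> carrier A; b \<in> carrier A; j \<in> V; par j \<in> V\<rbrakk> \<Longrightarrow> om j (a \<oplus> b) = om j a \<oplus>\<^bsub>K\<^esub> om j b"
    and ev_mult: "\<lbrakk>a \<in> carrier A; b \<in> carrier A; i \<in> V\<rbrakk> \<Longrightarrow> ev i (a \<otimes> b) = ev i a \<otimes>\<^bsub>K\<^esub> ev i b"
    and om_mult: "\<lbrakk>a \<in> carrier A; b \<in> carrier A; j \<in> V; par j \<in> V\<rbrakk> \<Longrightarrow>
      om j (a \<otimes> b) = ev j a \<otimes>\<^bsub>K\<^esub> om j b \<oplus>\<^bsub>K\<^esub> om j a \<otimes>\<^bsub>K\<^esub> ev (par j) b"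
    and ev_one: "i \<in> V \<Longrightarrow> ev i \<one> = \<one>\<^bsub>K\<^esub>"
    and om_one: "\<lbrakk>j \<in> V; par j \<in> V\<rbrakk> \<Longrightarrow> om j \<one> = \<zero>\<^bsub>K\<^esub>"
    and scal_closed: "c \<in> carrier K \<Longrightarrow> c \<odot> \<one> \<in> carrier A"
    and ev_scal: "\<lbrakk>c \<in> carrier K; i \<in> V\<rbrakk> \<Longrightarrow> ev i (c \<odot> \<one>) = c"
    and om_scal: "\<lbrakk>c \<in> carrier K; j \<in> V; par j \<in> V\<rbrakk> \<Longrightarrow> om j (c \<odot> \<one>) = \<zero>\<^bsub>K\<^esub>"
    and scal_mult: "\<lbrakk>c \<in> carrier K; a \<in> carrier A\<rbrakk> \<Longrightarrow> c \<odot> a = (c \<odot> \<one>) \<otimes> a"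
begin

text \<open>Modules over \<open>A\<close> carry no scalar action of their own; the field acts on
  them through these elements.\<close>

definition sc :: "'k \<Rightarrow> 'r" where "sc c = c \<odot> \<one>"

lemma sc_closed [simp]: "c \<in> carrier K \<Longrightarrow> sc c \<in> carrier A"
  and ev_sc [simp]: "\<lbrakk>c \<in> carrier K; i \<in> V\<rbrakk> \<Longrightarrow> ev i (sc c) = c"
  and om_sc [simp]: "\<lbrakk>c \<in> carrier K; j \<in> V; par j \<in> V\<rbrakk> \<Longrightarrow> om j (sc c) = \<zero>\<^bsub>K\<^esub>"
  by (simp_all add: sc_def scal_closed ev_scal om_scal)

lemmas coords [simp] = ev_closed om_closed ev_add om_add ev_mult om_mult ev_one om_one

lemma ev_zero [simp]: assumes "i \<in> V" shows "ev i \<zero> = \<zero>\<^bsub>K\<^esub>"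
proof -
  have "ev i \<zero> \<oplus>\<^bsub>K\<^esub> ev i \<zero> = ev i \<zero>" using ev_add[of \<zero> \<zero> i] assms by simp
  then show ?thesis using assms by (metis K.add.l_cancel_one ev_closed zero_closed)
qed

lemma om_zero [simp]: assumes "j \<in> V" "par j \<in> V" shows "om j \<zero> = \<zero>\<^bsub>K\<^esub>"
proof -
  have "om j \<zero> \<oplus>\<^bsub>K\<^esub> om j \<zero> = om j \<zero>" using om_add[of \<zero> \<zero> j] assms by simp
  then show ?thesis using assms by (metis K.add.l_cancel_one om_closed zero_closed)
qed

lemma ev_minus [simp]: assumes "a \<in> carrier A" "i \<in> V" shows "ev i (\<ominus> a) = \<ominus>\<^bsub>K\<^esub> ev i a"
proof -
  have "ev i (\<ominus> a) \<oplus>\<^bsub>K\<^esub> ev i a = \<zero>\<^bsub>K\<^esub>" using assms by (simp add: ev_add[symmetric] l_neg del: ev_add)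
  then show ?thesis using assms by (intro K.minus_equality[symmetric]) auto
qed

lemma om_minus [simp]: assumes "a \<in> carrier A" "j \<in> V" "par j \<in> V" shows "om j (\<ominus> a) = \<ominus>\<^bsub>K\<^esub> om j a"
proof -
  have "om j (\<ominus> a) \<oplus>\<^bsub>K\<^esub> om j a = \<zero>\<^bsub>K\<^esub>" using assms by (simp add: om_add[symmetric] l_neg del: om_add)
  then show ?thesis using assms by (intro K.minus_equality[symmetric]) auto
qed

end

text \<open>Now the coordinates determine the element, so identities in \<open>A\<close> can be
  checked coordinate by coordinate.\<close>

locale rsz = pre_rsz K A V par ev om
  for K :: "('k, 'm) ring_scheme" and A :: "('k, 'r) module" (structure) and V par ev om +
  assumes coord_eqI: "\<lbrakk>a \<in> carrier A; b \<in> carrier A; \<And>i. i \<in> V \<Longrightarrow> ev i a = ev i b;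
      \<And>j. \<lbrakk>j \<in> V; par j \<in> V\<rbrakk> \<Longrightarrow> om j a = om j b\<rbrakk> \<Longrightarrow> a = b"
begin

definition mk :: "(nat \<Rightarrow> 'k) \<Rightarrow> (nat \<Rightarrow> 'k) \<Rightarrow> 'r" where
  "mk c d = (SOME a. a \<in> carrier A \<and> (\<forall>i\<in>V. ev i a = c i) \<and> (\<forall>j\<in>V. par j \<in> V \<longrightarrow> om j a = d j))"

definition E :: "nat \<Rightarrow> 'r" where
  "E i = mk (\<lambda>k. if k = i then \<one>\<^bsub>K\<^esub> else \<zero>\<^bsub>K\<^esub>) (\<lambda>_. \<zero>\<^bsub>K\<^esub>)"

text \<open>An arrow is named by its target, which determines it. If \<open>par j\<close> is not in
  \<open>V\<close>, no coordinate sees \<open>j\<close> and \<open>Ar j\<close> is zero.\<close>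

definition Ar :: "nat \<Rightarrow> 'r" where
  "Ar j = mk (\<lambda>_. \<zero>\<^bsub>K\<^esub>) (\<lambda>k. if k = j then \<one>\<^bsub>K\<^esub> else \<zero>\<^bsub>K\<^esub>)"

definition ch :: "nat \<Rightarrow> nat set" where "ch i = {j \<in> V. par j = i}"

lemma mk:
  assumes "\<And>i. i \<in> V \<Longrightarrow> c i \<in> carrier K" "\<And>j. \<lbrakk>j \<in> V; par j \<in> V\<rbrakk> \<Longrightarrow> d j \<in> carrier K"
  shows mk_closed: "mk c d \<in> carrier A" and ev_mk: "i \<in> V \<Longrightarrow> ev i (mk c d) = c i"
    and om_mk: "\<lbrakk>j \<in> V; par j \<in> V\<rbrakk> \<Longrightarrow> om j (mk c d) = d j"
proof -
  have "\<exists>a. a \<in> carrier A \<and> (\<forall>i\<in>V. ev i a = c i) \<and> (\<forall>j\<in>V. par j \<in> V \<longrightarrow> om j a = d j)"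
    using coord_ex[of c d] assms by blast
  from someI_ex[OF this] show "mk c d \<in> carrier A" "i \<in> V \<Longrightarrow> ev i (mk c d) = c i"
    "\<lbrakk>j \<in> V; par j \<in> V\<rbrakk> \<Longrightarrow> om j (mk c d) = d j" by (auto simp: mk_def)
qed

lemma ch_finite [simp]: "finite (ch i)" and ch_card: "card (ch i) \<le> 2" and ch_sub: "j \<in> ch i \<Longrightarrow> j \<in> V"
  and ch_par: "j \<in> ch i \<Longrightarrow> par j = i"
  using finV par_two by (simp_all add: ch_def)

lemma ch_irrefl: "i \<notin> ch i"
  using par_gt by (force simp: ch_def)

lemma E_closed [simp]: "E i \<in> carrier A"
  and ev_E [simp]: "k \<in> V \<Longrightarrow> ev k (E i) = (if k = i then \<one>\<^bsub>K\<^esub> else \<zero>\<^bsub>K\<^esub>)"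
  and om_E [simp]: "\<lbrakk>j \<in> V; par j \<in> V\<rbrakk> \<Longrightarrow> om j (E i) = \<zero>\<^bsub>K\<^esub>"
  unfolding E_def by (simp_all add: mk)

lemma Ar_closed [simp]: "Ar j \<in> carrier A"
  and ev_Ar [simp]: "k \<in> V \<Longrightarrow> ev k (Ar j) = \<zero>\<^bsub>K\<^esub>"
  and om_Ar [simp]: "\<lbrakk>k \<in> V; par k \<in> V\<rbrakk> \<Longrightarrow> om k (Ar j) = (if k = j then \<one>\<^bsub>K\<^esub> else \<zero>\<^bsub>K\<^esub>)"
  unfolding Ar_def by (simp_all add: mk)

lemma ev_finsum:
  assumes "f \<in> S \<rightarrow> carrier A" "finite S" "i \<in> V"
  shows "ev i (finsum A f S) = finsum K (\<lambda>s. ev i (f s)) S"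
  using assms(2,1)
proof (induct S rule: finite_induct)
  case (insert y F)
  then have "f y \<in> carrier A" "f \<in> F \<rightarrow> carrier A" "(\<lambda>s. ev i (f s)) \<in> F \<rightarrow> carrier K"
    using assms(3) by (auto simp: Pi_iff)
  then show ?case using insert assms(3) by simp
qed (use assms in simp)

lemma om_finsum:
  assumes "f \<in> S \<rightarrow> carrier A" "finite S" "j \<in> V" "par j \<in> V"
  shows "om j (finsum A f S) = finsum K (\<lambda>s. om j (f s)) S"
  using assms(2,1)
proof (induct S rule: finite_induct)
  case (insert y F)
  then have "f y \<in> carrier A" "f \<in> F \<rightarrow> carrier A" "(\<lambda>s. om j (f s)) \<in> F \<rightarrow> carrier K"
    using assms(3,4) by (auto simp: Pi_iff)
  then show ?case using insert assms(3,4) by simp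
qed (use assms in simp)

lemma sc_one: "sc \<one>\<^bsub>K\<^esub> = \<one>" and sc_zero: "sc \<zero>\<^bsub>K\<^esub> = \<zero>"
  by (rule coord_eqI; simp)+

lemma sc_central: "\<lbrakk>c \<in> carrier K; a \<in> carrier A\<rbrakk> \<Longrightarrow> sc c \<otimes> a = a \<otimes> sc c"
  by (rule coord_eqI) (simp_all add: K.m_comm)

lemma sc_add: "\<lbrakk>c \<in> carrier K; d \<in> carrier K\<rbrakk> \<Longrightarrow> sc (c \<oplus>\<^bsub>K\<^esub> d) = sc c \<oplus> sc d"
  and sc_mult: "\<lbrakk>c \<in> carrier K; d \<in> carrier K\<rbrakk> \<Longrightarrow> sc (c \<otimes>\<^bsub>K\<^esub> d) = sc c \<otimes> sc d"
  by (rule coord_eqI; simp)+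

lemma E_E: "E i \<otimes> E k = (if i = k then E i else \<zero>)"
  by (rule coord_eqI) auto

lemma E_Ar: "j \<in> V \<Longrightarrow> E k \<otimes> Ar j = (if k = j then Ar j else \<zero>)"
  by (rule coord_eqI) auto

lemma Ar_E: "\<lbrakk>j \<in> V; par j \<in> V\<rbrakk> \<Longrightarrow> Ar j \<otimes> E k = (if k = par j then Ar j else \<zero>)"
  by (rule coord_eqI) auto

text \<open>On the left, \<open>E k\<close> keeps the idempotent at \<open>k\<close> and the single
  arrow into \<open>k\<close>. If \<open>par k\<close> is outside \<open>V\<close>, there is no such
  arrow and \<open>om k\<close> carries no information.\<close>

lemma E_mult:
  assumes "a \<in> carrier A" "k \<in> V"
  shows "E k \<otimes> a = (if par k \<in> V then sc (ev k a) \<otimes> E k \<oplus> sc (om k a) \<otimes> Ar k else sc (ev k a) \<otimes> E k)"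
  by (rule coord_eqI) (use assms in auto)

lemma E_mult_E_off:
  assumes "a \<in> carrier A" "k \<in> V" "i \<in> V" "k \<noteq> i"
  shows "E k \<otimes> a \<otimes> E i = (if par k = i then sc (om k a) \<otimes> Ar k else \<zero>)"
  by (rule coord_eqI) (use assms in auto)

lemma E_mult_E_diag: "\<lbrakk>a \<in> carrier A; i \<in> V\<rbrakk> \<Longrightarrow> E i \<otimes> a \<otimes> E i = sc (ev i a) \<otimes> E i"
  using par_gt[of i] by (intro coord_eqI) auto

text \<open>The radical has square zero, so of \<open>a\<close> only the idempotent coordinate at
  the source of the arrow survives.\<close>

lemma Ar_mult: "\<lbrakk>a \<in> carrier A; j \<in> V; par j \<in> V\<rbrakk> \<Longrightarrow> Ar j \<otimes> a = sc (ev (par j) a) \<otimes> Ar j"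
  by (rule coord_eqI) (auto simp: K.m_comm)

lemma sum_E: "finsum A E V = \<one>"
proof (rule coord_eqI)
  fix i assume i: "i \<in> V"
  have "ev i (finsum A E V) = finsum K (\<lambda>s. ev i (E s)) V" using i finV by (intro ev_finsum) auto
  also have "\<dots> = finsum K (\<lambda>s. if i = s then \<one>\<^bsub>K\<^esub> else \<zero>\<^bsub>K\<^esub>) V"
    using i by (intro K.finsum_cong') auto
  also have "\<dots> = \<one>\<^bsub>K\<^esub>" using i finV K.finsum_singleton[of i V "\<lambda>_. \<one>\<^bsub>K\<^esub>"] by simp
  finally show "ev i (finsum A E V) = ev i \<one>" using i by simp
next
  fix j assume j: "j \<in> V" "par j \<in> V"
  have "om j (finsum A E V) = finsum K (\<lambda>s. om j (E s)) V" using j finV by (intro om_finsum) auto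
  also have "\<dots> = finsum K (\<lambda>s. \<zero>\<^bsub>K\<^esub>) V" using j by (intro K.finsum_cong') auto
  finally show "om j (finsum A E V) = om j \<one>" using j by simp
qed (auto intro: finsum_closed)

text \<open>The space at the point \<open>i\<close> of the representation that corresponds to
  \<open>M\<close>.\<close>

definition vs :: "('r, 'v) module \<Rightarrow> nat \<Rightarrow> 'v set" where
  "vs M i = {x \<in> carrier M. E i \<odot>\<^bsub>M\<^esub> x = x}"

end

section \<open>Modules as representations of the quiver\<close>

locale rsz_mod = rsz K A V par ev om + left_module A M
  for K :: "('k, 'm) ring_scheme" and A :: "('k, 'r) module" (structure) and V par ev om
    and M :: "('r, 'v) module"
begin

lemmas [simp] = smult_closed

lemma smult_mult: "\<lbrakk>a \<in> carrier A; b \<in> carrier A; x \<in> carrier M\<rbrakk> \<Longrightarrow> a \<odot>\<^bsub>M\<^esub> (b \<odot>\<^bsub>M\<^esub> x) = (a \<otimes> b) \<odot>\<^bsub>M\<^esub> x"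
  by (simp add: smult_assoc)

lemma decomp: assumes "x \<in> carrier M" shows "x = finsum M (\<lambda>i. E i \<odot>\<^bsub>M\<^esub> x) V"
  using finsum_smult[of E V x] assms finV by (simp add: sum_E smult_one)

lemma vertex_eqI:
  assumes "x \<in> carrier M" "y \<in> carrier M" "\<And>k. k \<in> V \<Longrightarrow> E k \<odot>\<^bsub>M\<^esub> x = E k \<odot>\<^bsub>M\<^esub> y" shows "x = y"
proof -
  have "finsum M (\<lambda>i. E i \<odot>\<^bsub>M\<^esub> x) V = finsum M (\<lambda>i. E i \<odot>\<^bsub>M\<^esub> y) V"
    using assms by (intro M.finsum_cong') auto
  then show ?thesis using decomp assms by metis
qed

lemma vs_carr: "x \<in> vs M i \<Longrightarrow> x \<in> carrier M" and vs_E: "x \<in> vs M i \<Longrightarrow> E i \<odot>\<^bsub>M\<^esub> x = x"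
  by (simp_all add: vs_def)

lemma E_in_vs: "x \<in> carrier M \<Longrightarrow> E i \<odot>\<^bsub>M\<^esub> x \<in> vs M i"
  by (simp add: vs_def smult_mult E_E)

lemma zero_in_vs: "\<zero>\<^bsub>M\<^esub> \<in> vs M i"
  by (simp add: vs_def)

lemma Ar_in_vs: "\<lbrakk>x \<in> carrier M; j \<in> V\<rbrakk> \<Longrightarrow> Ar j \<odot>\<^bsub>M\<^esub> x \<in> vs M j"
  by (simp add: vs_def smult_mult E_Ar)

lemma sc_in_vs: "\<lbrakk>x \<in> vs M i; c \<in> carrier K\<rbrakk> \<Longrightarrow> sc c \<odot>\<^bsub>M\<^esub> x \<in> vs M i"
  by (simp add: vs_def smult_mult sc_central[symmetric]) (simp add: smult_mult[symmetric])

lemma add_in_vs: "\<lbrakk>x \<in> vs M i; y \<in> vs M i\<rbrakk> \<Longrightarrow> x \<oplus>\<^bsub>M\<^esub> y \<in> vs M i"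
  by (simp add: vs_def smult_r_distr)

lemma E_smult:
  assumes "a \<in> carrier A" "k \<in> V" "x \<in> carrier M"
  shows "E k \<odot>\<^bsub>M\<^esub> (a \<odot>\<^bsub>M\<^esub> x) = (if par k \<in> V
    then sc (ev k a) \<odot>\<^bsub>M\<^esub> (E k \<odot>\<^bsub>M\<^esub> x) \<oplus>\<^bsub>M\<^esub> sc (om k a) \<odot>\<^bsub>M\<^esub> (Ar k \<odot>\<^bsub>M\<^esub> x)
    else sc (ev k a) \<odot>\<^bsub>M\<^esub> (E k \<odot>\<^bsub>M\<^esub> x))"
  using assms by (simp add: smult_mult E_mult smult_l_distr)

lemma E_smult_diag:
  assumes "a \<in> carrier A" "i \<in> V" "x \<in> vs M i"
  shows "E i \<odot>\<^bsub>M\<^esub> (a \<odot>\<^bsub>M\<^esub> x) = sc (ev i a) \<odot>\<^bsub>M\<^esub> x"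
proof -
  have "E i \<odot>\<^bsub>M\<^esub> (a \<odot>\<^bsub>M\<^esub> x) = (E i \<otimes> a \<otimes> E i) \<odot>\<^bsub>M\<^esub> x"
    using assms by (simp add: smult_assoc vs_def)
  then show ?thesis using assms by (simp add: E_mult_E_diag smult_assoc vs_def)
qed

lemma E_smult_off:
  assumes "a \<in> carrier A" "i \<in> V" "k \<in> V" "k \<noteq> i" "x \<in> vs M i"
  shows "E k \<odot>\<^bsub>M\<^esub> (a \<odot>\<^bsub>M\<^esub> x) = (if par k = i then sc (om k a) \<odot>\<^bsub>M\<^esub> (Ar k \<odot>\<^bsub>M\<^esub> x) else \<zero>\<^bsub>M\<^esub>)"
proof -
  have "E k \<odot>\<^bsub>M\<^esub> (a \<odot>\<^bsub>M\<^esub> x) = (E k \<otimes> a \<otimes> E i) \<odot>\<^bsub>M\<^esub> x"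
    using assms by (simp add: smult_assoc vs_def)
  then show ?thesis using assms by (auto simp: E_mult_E_off smult_assoc vs_def)
qed

lemma Ar_smult:
  assumes "a \<in> carrier A" "j \<in> V" "par j \<in> V" "x \<in> carrier M"
  shows "Ar j \<odot>\<^bsub>M\<^esub> (a \<odot>\<^bsub>M\<^esub> x) = sc (ev (par j) a) \<odot>\<^bsub>M\<^esub> (Ar j \<odot>\<^bsub>M\<^esub> x)"
  using assms by (simp add: smult_mult Ar_mult)

lemma Ar_vs_off:
  assumes "j \<in> V" "par j \<in> V" "x \<in> vs M i" "par j \<noteq> i" shows "Ar j \<odot>\<^bsub>M\<^esub> x = \<zero>\<^bsub>M\<^esub>"
proof -
  have "Ar j \<odot>\<^bsub>M\<^esub> (E i \<odot>\<^bsub>M\<^esub> x) = (Ar j \<otimes> E i) \<odot>\<^bsub>M\<^esub> x" using assms by (simp add: smult_mult vs_carr)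
  then show ?thesis using assms by (auto simp: Ar_E vs_def)
qed

lemma Ar_E_smult:
  assumes "j \<in> V" "par j \<in> V" "x \<in> carrier M" shows "Ar j \<odot>\<^bsub>M\<^esub> (E (par j) \<odot>\<^bsub>M\<^esub> x) = Ar j \<odot>\<^bsub>M\<^esub> x"
  using assms by (simp add: smult_mult Ar_E)

lemma sc_smult_eq_zero:
  assumes "c \<in> carrier K" "x \<in> carrier M" "sc c \<odot>\<^bsub>M\<^esub> x = \<zero>\<^bsub>M\<^esub>" "x \<noteq> \<zero>\<^bsub>M\<^esub>" shows "c = \<zero>\<^bsub>K\<^esub>"
proof (rule ccontr)
  assume c: "c \<noteq> \<zero>\<^bsub>K\<^esub>"
  then have i: "inv\<^bsub>K\<^esub> c \<in> carrier K" "inv\<^bsub>K\<^esub> c \<otimes>\<^bsub>K\<^esub> c = \<one>\<^bsub>K\<^esub>"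
    using assms K.field_Units by auto
  have "sc (inv\<^bsub>K\<^esub> c) \<odot>\<^bsub>M\<^esub> (sc c \<odot>\<^bsub>M\<^esub> x) = x"
    using assms(1,2) i by (simp add: smult_mult sc_mult[symmetric] sc_one smult_one)
  then show False unfolding assms(3) using assms(4) i by simp
qed

text \<open>Scalars, idempotents and arrows suffice: by \<open>E_smult\<close> the component at
  \<open>k\<close> of a multiple of \<open>x\<close> is a combination of \<open>E k\<close> and
  \<open>Ar k\<close> applied to \<open>x\<close>, and the components add up to the element.\<close>

lemma submoduleI_coords:
  assumes "H \<subseteq> carrier M" "H \<noteq> {}" "\<And>x y. \<lbrakk>x \<in> H; y \<in> H\<rbrakk> \<Longrightarrow> x \<oplus>\<^bsub>M\<^esub> y \<in> H"
    and "\<And>c x. \<lbrakk>c \<in> carrier K; x \<in> H\<rbrakk> \<Longrightarrow> sc c \<odot>\<^bsub>M\<^esub> x \<in> H"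
    and "\<And>i x. \<lbrakk>i \<in> V; x \<in> H\<rbrakk> \<Longrightarrow> E i \<odot>\<^bsub>M\<^esub> x \<in> H"
    and "\<And>j x. \<lbrakk>j \<in> V; par j \<in> V; x \<in> H\<rbrakk> \<Longrightarrow> Ar j \<odot>\<^bsub>M\<^esub> x \<in> H"
  shows "submodule H A M"
proof (rule submoduleI[OF assms(1-3)])
  fix a x assume ax: "a \<in> carrier A" "x \<in> H"
  have z: "\<zero>\<^bsub>M\<^esub> \<in> H"
    using assms(4)[of "\<zero>\<^bsub>K\<^esub>" x] ax assms(1) by (auto simp: sc_zero subset_iff)
  \<comment> \<open>\<open>submodule_finsum\<close> cannot be used, as it presupposes the
    conclusion.\<close>
  have fin: "finsum M f S \<in> H" if "finite S" "f \<in> S \<rightarrow> H" for f :: "nat \<Rightarrow> 'v" and S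
    using that
  proof (induct S rule: finite_induct)
    case (insert y F)
    then have "f y \<in> H" "f \<in> F \<rightarrow> H" by auto
    moreover have "f \<in> F \<rightarrow> carrier M" "f y \<in> carrier M" using insert.prems assms(1) by auto
    ultimately show ?case using insert assms(3) by simp
  qed (use z in simp)
  have "E k \<odot>\<^bsub>M\<^esub> (a \<odot>\<^bsub>M\<^esub> x) \<in> H" if "k \<in> V" for k
    using that ax assms by (simp add: E_smult subset_iff)
  then have "finsum M (\<lambda>k. E k \<odot>\<^bsub>M\<^esub> (a \<odot>\<^bsub>M\<^esub> x)) V \<in> H" by (intro fin finV) auto
  then show "a \<odot>\<^bsub>M\<^esub> x \<in> H" using decomp[of "a \<odot>\<^bsub>M\<^esub> x"] ax assms(1) by auto
qed

end

section \<open>String modules and decompositions into strings\<close>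

context rsz
begin

definition orb :: "('r, 'v) module \<Rightarrow> 'v \<Rightarrow> 'v set" where
  "orb M u = (\<lambda>a. a \<odot>\<^bsub>M\<^esub> u) ` carrier A"

text \<open>\<open>u\<close> determines \<open>W\<close>; the pair of \<open>i\<close> and
  \<open>W\<close> is recorded because it serves as the type of the string.\<close>

definition gen :: "('r, 'v) module \<Rightarrow> nat \<Rightarrow> nat set \<Rightarrow> 'v \<Rightarrow> bool" where
  "gen M i W u \<longleftrightarrow> i \<in> V \<and> u \<in> vs M i \<and> u \<noteq> \<zero>\<^bsub>M\<^esub> \<and> W = {j \<in> ch i. Ar j \<odot>\<^bsub>M\<^esub> u \<noteq> \<zero>\<^bsub>M\<^esub>}"

text \<open>\<open>\<pi> s\<close> is the projection onto the summand generated by \<open>u s\<close>, a string of type \<open>(v s, W s)\<close>.\<close>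

definition strings ::
  "('r, 'v) module \<Rightarrow> 'i set \<Rightarrow> ('i \<Rightarrow> nat) \<Rightarrow> ('i \<Rightarrow> nat set) \<Rightarrow> ('i \<Rightarrow> 'v) \<Rightarrow> ('i \<Rightarrow> 'v \<Rightarrow> 'v) \<Rightarrow> bool" where
  "strings M I v W u \<pi> \<longleftrightarrow> finite I \<and>
     (\<forall>s\<in>I. gen M (v s) (W s) (u s) \<and> lin A M M (\<pi> s) \<and> \<pi> s ` carrier M \<subseteq> orb M (u s) \<and>
       \<pi> s (u s) = u s \<and> (\<forall>t\<in>I. t \<noteq> s \<longrightarrow> \<pi> s (u t) = \<zero>\<^bsub>M\<^esub>)) \<and>
     (\<forall>x\<in>carrier M. x = finsum M (\<lambda>s. \<pi> s x) I)"

lemma stringsD: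
  assumes "strings M I v W u \<pi>"
  shows strings_finite: "finite I"
    and strings_gen: "s \<in> I \<Longrightarrow> gen M (v s) (W s) (u s)"
    and strings_lin: "s \<in> I \<Longrightarrow> lin A M M (\<pi> s)"
    and strings_orb: "\<lbrakk>s \<in> I; x \<in> carrier M\<rbrakk> \<Longrightarrow> \<pi> s x \<in> orb M (u s)"
    and strings_same: "s \<in> I \<Longrightarrow> \<pi> s (u s) = u s"
    and strings_other: "\<lbrakk>s \<in> I; t \<in> I; t \<noteq> s\<rbrakk> \<Longrightarrow> \<pi> s (u t) = \<zero>\<^bsub>M\<^esub>"
    and strings_sum: "x \<in> carrier M \<Longrightarrow> finsum M (\<lambda>s. \<pi> s x) I = x"
  using assms unfolding strings_def by (blast, blast, blast, blast, blast, blast, metis)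

lemma gen_point: "gen M i W u \<Longrightarrow> i \<in> V" and gen_sub: "gen M i W u \<Longrightarrow> W \<subseteq> ch i"
  and gen_vs: "gen M i W u \<Longrightarrow> u \<in> vs M i" and gen_nz: "gen M i W u \<Longrightarrow> u \<noteq> \<zero>\<^bsub>M\<^esub>"
  and gen_in: "\<lbrakk>gen M i W u; j \<in> W\<rbrakk> \<Longrightarrow> Ar j \<odot>\<^bsub>M\<^esub> u \<noteq> \<zero>\<^bsub>M\<^esub>"
  and gen_out: "\<lbrakk>gen M i W u; j \<in> ch i; j \<notin> W\<rbrakk> \<Longrightarrow> Ar j \<odot>\<^bsub>M\<^esub> u = \<zero>\<^bsub>M\<^esub>"
  by (auto simp: gen_def)

lemma gen_carr: "gen M i W u \<Longrightarrow> u \<in> carrier M"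
  by (auto simp: gen_def vs_def)

end

context rsz_mod
begin

lemma rsz_modI: "left_module A N \<Longrightarrow> rsz_mod K A V par ev om N"
  by (intro rsz_mod.intro rsz_axioms)

lemma orbI: "a \<in> carrier A \<Longrightarrow> a \<odot>\<^bsub>M\<^esub> u \<in> orb M u"
  by (simp add: orb_def)

lemma orb_self: "u \<in> carrier M \<Longrightarrow> u \<in> orb M u"
  using orbI[of "\<one>" u] by (simp add: smult_one)

lemma orb_submodule: assumes "u \<in> carrier M" shows "submodule (orb M u) A M"
proof (rule submoduleI)
  show "orb M u \<subseteq> carrier M" "orb M u \<noteq> {}" using assms by (auto simp: orb_def)
  fix x y assume "x \<in> orb M u" "y \<in> orb M u"
  then obtain a b where ab: "a \<in> carrier A" "b \<in> carrier A" "x = a \<odot>\<^bsub>M\<^esub> u" "y = b \<odot>\<^bsub>M\<^esub> u"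
    by (auto simp: orb_def)
  then have "x \<oplus>\<^bsub>M\<^esub> y = (a \<oplus> b) \<odot>\<^bsub>M\<^esub> u" using assms by (simp add: smult_l_distr)
  then show "x \<oplus>\<^bsub>M\<^esub> y \<in> orb M u" using ab by (simp add: orbI)
next
  fix a x assume "a \<in> carrier A" "x \<in> orb M u"
  then show "a \<odot>\<^bsub>M\<^esub> x \<in> orb M u" using assms by (auto simp: orb_def smult_mult)
qed

lemma orb_sub: "u \<in> carrier M \<Longrightarrow> orb M u \<subseteq> carrier M"
  by (auto simp: orb_def)

text \<open>The multiple of \<open>u\<close> by \<open>a\<close> has the component
  \<open>ev i a\<close> times \<open>u\<close> at \<open>i\<close>, the component
  \<open>om j a\<close> times \<open>Ar j\<close> of \<open>u\<close> at a child \<open>j\<close>,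
  and none elsewhere.\<close>

lemma smult_gen_vanish:
  assumes "i \<in> V" "u \<in> vs M i" "a \<in> carrier A" "ev i a = \<zero>\<^bsub>K\<^esub>"
    "\<And>j. \<lbrakk>j \<in> ch i; Ar j \<odot>\<^bsub>M\<^esub> u \<noteq> \<zero>\<^bsub>M\<^esub>\<rbrakk> \<Longrightarrow> om j a = \<zero>\<^bsub>K\<^esub>"
  shows "a \<odot>\<^bsub>M\<^esub> u = \<zero>\<^bsub>M\<^esub>"
proof (rule vertex_eqI)
  fix k assume k: "k \<in> V"
  have "sc (om k a) \<odot>\<^bsub>M\<^esub> (Ar k \<odot>\<^bsub>M\<^esub> u) = \<zero>\<^bsub>M\<^esub>" if "par k = i"
    using assms(5)[of k] k that assms vs_carr[OF assms(2)]
    by (cases "Ar k \<odot>\<^bsub>M\<^esub> u = \<zero>\<^bsub>M\<^esub>") (auto simp: ch_def sc_zero)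
  then show "E k \<odot>\<^bsub>M\<^esub> (a \<odot>\<^bsub>M\<^esub> u) = E k \<odot>\<^bsub>M\<^esub> \<zero>\<^bsub>M\<^esub>"
    using assms k vs_carr[OF assms(2)]
    by (cases "k = i") (simp_all add: E_smult_diag E_smult_off sc_zero)
qed (use assms vs_carr in auto)

text \<open>The annihilator of a generator depends only on its type. This is why strings of the same
  type are isomorphic.\<close>

lemma smult_gen_zero_iff:
  assumes g: "gen M i W u" and a: "a \<in> carrier A"
  shows "a \<odot>\<^bsub>M\<^esub> u = \<zero>\<^bsub>M\<^esub> \<longleftrightarrow> ev i a = \<zero>\<^bsub>K\<^esub> \<and> (\<forall>j\<in>W. om j a = \<zero>\<^bsub>K\<^esub>)"
proof
  note u = gen_point[OF g] gen_vs[OF g] gen_carr[OF g]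
  assume z: "a \<odot>\<^bsub>M\<^esub> u = \<zero>\<^bsub>M\<^esub>"
  have "sc (ev i a) \<odot>\<^bsub>M\<^esub> u = \<zero>\<^bsub>M\<^esub>" using E_smult_diag[OF a u(1,2)] z by simp
  then have "ev i a = \<zero>\<^bsub>K\<^esub>" using sc_smult_eq_zero[of "ev i a" u] gen_nz[OF g] u a by auto
  moreover have "om j a = \<zero>\<^bsub>K\<^esub>" if j: "j \<in> W" for j
  proof -
    have jc: "j \<in> V" "par j = i" "j \<noteq> i" using gen_sub[OF g] j ch_irrefl by (auto simp: ch_def)
    have "sc (om j a) \<odot>\<^bsub>M\<^esub> (Ar j \<odot>\<^bsub>M\<^esub> u) = \<zero>\<^bsub>M\<^esub>" using E_smult_off[OF a u(1) jc(1,3) u(2)] z jc by simp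
    then show ?thesis
      using sc_smult_eq_zero[of "om j a" "Ar j \<odot>\<^bsub>M\<^esub> u"] gen_in[OF g j] u a jc by auto
  qed
  ultimately show "ev i a = \<zero>\<^bsub>K\<^esub> \<and> (\<forall>j\<in>W. om j a = \<zero>\<^bsub>K\<^esub>)" by blast
next
  assume "ev i a = \<zero>\<^bsub>K\<^esub> \<and> (\<forall>j\<in>W. om j a = \<zero>\<^bsub>K\<^esub>)"
  then show "a \<odot>\<^bsub>M\<^esub> u = \<zero>\<^bsub>M\<^esub>" using smult_gen_vanish[OF gen_point[OF g] gen_vs[OF g] a] g
    by (auto simp: gen_def)
qed

lemma minus_zero_iff:
  assumes "x \<in> carrier M" "y \<in> carrier M" shows "x \<ominus>\<^bsub>M\<^esub> y = \<zero>\<^bsub>M\<^esub> \<longleftrightarrow> x = y"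
  using assms M.minus_equality[of x "\<ominus>\<^bsub>M\<^esub> y"] by (auto simp: a_minus_def M.r_neg)

lemma smult_eq_iff:
  assumes "a \<in> carrier A" "b \<in> carrier A" "u \<in> carrier M"
  shows "a \<odot>\<^bsub>M\<^esub> u = b \<odot>\<^bsub>M\<^esub> u \<longleftrightarrow> (a \<ominus> b) \<odot>\<^bsub>M\<^esub> u = \<zero>\<^bsub>M\<^esub>"
proof -
  have "(a \<ominus> b) \<odot>\<^bsub>M\<^esub> u = a \<odot>\<^bsub>M\<^esub> u \<ominus>\<^bsub>M\<^esub> b \<odot>\<^bsub>M\<^esub> u"
    using assms by (simp add: a_minus_def smult_l_distr smult_l_minus)
  then show ?thesis using assms by (simp add: minus_zero_iff)
qed

text \<open>What annihilates \<open>u\<close> annihilates \<open>m\<close>, since the arrows outside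
  \<open>W\<close> kill \<open>m\<close>; so sending a multiple of \<open>u\<close> to the same
  multiple of \<open>m\<close> is well defined.\<close>

lemma gen_wd:
  assumes g: "gen M i W u" and N: "left_module A N" and m: "m \<in> vs N i"
    and mz: "\<And>j. \<lbrakk>j \<in> ch i; j \<notin> W\<rbrakk> \<Longrightarrow> Ar j \<odot>\<^bsub>N\<^esub> m = \<zero>\<^bsub>N\<^esub>"
    and ab: "a \<in> carrier A" "b \<in> carrier A" "a \<odot>\<^bsub>M\<^esub> u = b \<odot>\<^bsub>M\<^esub> u"
  shows "a \<odot>\<^bsub>N\<^esub> m = b \<odot>\<^bsub>N\<^esub> m"
proof -
  interpret N: rsz_mod K A V par ev om N by (rule rsz_modI) fact
  have "(a \<ominus> b) \<odot>\<^bsub>M\<^esub> u = \<zero>\<^bsub>M\<^esub>" using ab gen_carr[OF g] by (simp add: smult_eq_iff)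
  then have "ev i (a \<ominus> b) = \<zero>\<^bsub>K\<^esub> \<and> (\<forall>j\<in>W. om j (a \<ominus> b) = \<zero>\<^bsub>K\<^esub>)"
    using smult_gen_zero_iff[OF g] ab by simp
  then have "(a \<ominus> b) \<odot>\<^bsub>N\<^esub> m = \<zero>\<^bsub>N\<^esub>"
    using ab mz by (intro N.smult_gen_vanish[OF gen_point[OF g] m]) auto
  then show ?thesis using ab N.vs_carr[OF m] by (simp add: N.smult_eq_iff)
qed

lemma lin_agree:
  assumes st: "strings M I v W u \<pi>" and N: "left_module A N" and h: "lin A M N h" and k: "lin A M N k"
    and eq: "\<And>s. s \<in> I \<Longrightarrow> h (u s) = k (u s)" and x: "x \<in> carrier M"
  shows "h x = k x"
proof -
  interpret N: rsz_mod K A V par ev om N by (rule rsz_modI) fact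
  have "h (\<pi> s x) = k (\<pi> s x)" if s: "s \<in> I" for s
  proof -
    obtain a where a: "a \<in> carrier A" "\<pi> s x = a \<odot>\<^bsub>M\<^esub> u s"
      using strings_orb[OF st s x] by (auto simp: orb_def)
    then show ?thesis
      using lin_smult[OF h, of a "u s"] lin_smult[OF k, of a "u s"] eq[OF s]
        gen_carr[OF strings_gen[OF st s]] by simp
  qed
  moreover have p: "(\<lambda>s. \<pi> s x) \<in> I \<rightarrow> carrier M" using strings_lin[OF st] x by (auto intro: lin_closed)
  ultimately have "finsum N (\<lambda>s. h (\<pi> s x)) I = finsum N (\<lambda>s. k (\<pi> s x)) I"
    using lin_closed[OF k] by (intro N.M.finsum_cong') auto
  then show ?thesis
    using lin_finsum[OF h N p strings_finite[OF st]] lin_finsum[OF k N p strings_finite[OF st]]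
      strings_sum[OF st x] by simp
qed

lemma lin_finsum_maps:
  assumes N: "left_module A N" and "finite I" and h: "\<And>s. s \<in> I \<Longrightarrow> lin A M N (h s)"
  shows "lin A M N (\<lambda>x. finsum N (\<lambda>s. h s x) I)"
proof (rule linI)
  interpret N: rsz_mod K A V par ev om N by (rule rsz_modI) fact
  have c: "(\<lambda>s. h s x) \<in> I \<rightarrow> carrier N" if "x \<in> carrier M" for x
    using that lin_closed[OF h] by auto
  fix x assume x: "x \<in> carrier M"
  show "finsum N (\<lambda>s. h s x) I \<in> carrier N" using c[OF x] by (rule N.M.finsum_closed)
  show "finsum N (\<lambda>s. h s (x \<oplus>\<^bsub>M\<^esub> y)) I = finsum N (\<lambda>s. h s x) I \<oplus>\<^bsub>N\<^esub> finsum N (\<lambda>s. h s y) I"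
    if y: "y \<in> carrier M" for y
  proof -
    have "finsum N (\<lambda>s. h s (x \<oplus>\<^bsub>M\<^esub> y)) I = finsum N (\<lambda>s. h s x \<oplus>\<^bsub>N\<^esub> h s y) I"
      using x y c by (intro N.M.finsum_cong') (auto simp: lin_add[OF h] lin_closed[OF h])
    then show ?thesis using N.M.finsum_addf[OF c[OF x] c[OF y]] by simp
  qed
  show "finsum N (\<lambda>s. h s (a \<odot>\<^bsub>M\<^esub> x)) I = a \<odot>\<^bsub>N\<^esub> finsum N (\<lambda>s. h s x) I" if a: "a \<in> carrier A" for a
  proof -
    have "finsum N (\<lambda>s. h s (a \<odot>\<^bsub>M\<^esub> x)) I = finsum N (\<lambda>s. a \<odot>\<^bsub>N\<^esub> h s x) I"
      using x a by (intro N.M.finsum_cong') (auto simp: lin_smult[OF h] lin_closed[OF h])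
    then show ?thesis using N.smult_finsum[OF a c[OF x] assms(2)] by simp
  qed
qed

lemma finsum_single:
  assumes "finite I" "t \<in> I" "f t \<in> carrier M" "\<And>s. \<lbrakk>s \<in> I; s \<noteq> t\<rbrakk> \<Longrightarrow> f s = \<zero>\<^bsub>M\<^esub>"
  shows "finsum M f I = f t"
proof -
  have "finsum M f I = finsum M (\<lambda>s. if t = s then f t else \<zero>\<^bsub>M\<^esub>) I"
    using assms by (intro M.finsum_cong') auto
  then show ?thesis using assms M.finsum_singleton[of t I "\<lambda>_. f t"] by auto
qed

text \<open>The universal property of a sum of strings: a generator may be sent to any vector at the
  same point that is killed by the arrows outside \<open>W s\<close>. A coefficient of each
  component is chosen, and \<open>gen_wd\<close> makes the value independent of the choice.\<close>

lemma strings_extend: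
  assumes st: "strings M I v W u \<pi>" and N: "left_module A N"
    and m: "\<And>s. s \<in> I \<Longrightarrow> m s \<in> vs N (v s)"
    and mz: "\<And>s j. \<lbrakk>s \<in> I; j \<in> ch (v s); j \<notin> W s\<rbrakk> \<Longrightarrow> Ar j \<odot>\<^bsub>N\<^esub> m s = \<zero>\<^bsub>N\<^esub>"
  shows "\<exists>h. lin A M N h \<and> (\<forall>s\<in>I. h (u s) = m s)"
proof -
  interpret N: rsz_mod K A V par ev om N by (rule rsz_modI) fact
  define co where "co s x = (SOME a. a \<in> carrier A \<and> \<pi> s x = a \<odot>\<^bsub>M\<^esub> u s)" for s x
  have co: "co s x \<in> carrier A \<and> \<pi> s x = co s x \<odot>\<^bsub>M\<^esub> u s" if "s \<in> I" "x \<in> carrier M" for s x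
  proof -
    have "\<exists>a. a \<in> carrier A \<and> \<pi> s x = a \<odot>\<^bsub>M\<^esub> u s"
      using strings_orb[OF st that] by (auto simp: orb_def)
    then show ?thesis unfolding co_def by (rule someI_ex)
  qed
  define hs where "hs s x = co s x \<odot>\<^bsub>N\<^esub> m s" for s x
  have hs: "hs s x = a \<odot>\<^bsub>N\<^esub> m s" if "s \<in> I" "x \<in> carrier M" "a \<in> carrier A" "\<pi> s x = a \<odot>\<^bsub>M\<^esub> u s" for s x a
    unfolding hs_def using gen_wd[OF strings_gen[OF st that(1)] N m[OF that(1)] mz[OF that(1)]] co that
    by metis
  have lin_hs: "lin A M N (hs s)" if s: "s \<in> I" for s
  proof (rule linI)
    note mc = N.vs_carr[OF m[OF s]] and uc = gen_carr[OF strings_gen[OF st s]]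
    fix x assume x: "x \<in> carrier M"
    show "hs s x \<in> carrier N" using co[OF s x] mc by (simp add: hs_def)
    show "hs s (x \<oplus>\<^bsub>M\<^esub> y) = hs s x \<oplus>\<^bsub>N\<^esub> hs s y" if y: "y \<in> carrier M" for y
    proof -
      have "\<pi> s (x \<oplus>\<^bsub>M\<^esub> y) = (co s x \<oplus> co s y) \<odot>\<^bsub>M\<^esub> u s"
        using co[OF s x] co[OF s y] uc lin_add[OF strings_lin[OF st s] x y] by (simp add: smult_l_distr)
      then have "hs s (x \<oplus>\<^bsub>M\<^esub> y) = (co s x \<oplus> co s y) \<odot>\<^bsub>N\<^esub> m s"
        using s x y co[OF s x] co[OF s y] by (intro hs) auto
      then show ?thesis using co[OF s x] co[OF s y] mc by (simp add: hs_def N.smult_l_distr)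
    qed
    show "hs s (a \<odot>\<^bsub>M\<^esub> x) = a \<odot>\<^bsub>N\<^esub> hs s x" if a: "a \<in> carrier A" for a
    proof -
      have "\<pi> s (a \<odot>\<^bsub>M\<^esub> x) = (a \<otimes> co s x) \<odot>\<^bsub>M\<^esub> u s"
        using co[OF s x] a uc lin_smult[OF strings_lin[OF st s] a x] by (simp add: smult_assoc)
      then have "hs s (a \<odot>\<^bsub>M\<^esub> x) = (a \<otimes> co s x) \<odot>\<^bsub>N\<^esub> m s"
        using s x a co[OF s x] by (intro hs) auto
      then show ?thesis using co[OF s x] a mc by (simp add: hs_def N.smult_assoc)
    qed
  qed
  let ?h = "\<lambda>x. finsum N (\<lambda>s. hs s x) I"
  have "?h (u t) = m t" if t: "t \<in> I" for t
  proof -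
    note uc = gen_carr[OF strings_gen[OF st t]]
    have "hs t (u t) = m t"
      using hs[OF t uc, of \<one>] strings_same[OF st t] uc N.vs_carr[OF m[OF t]]
      by (simp add: smult_one N.smult_one)
    moreover have "hs s (u t) = \<zero>\<^bsub>N\<^esub>" if s: "s \<in> I" "s \<noteq> t" for s
      using hs[OF s(1) uc, of \<zero>] strings_other[OF st s(1) t] s uc N.vs_carr[OF m[OF s(1)]]
        gen_carr[OF strings_gen[OF st s(1)]] by simp
    ultimately show ?thesis
      using N.finsum_single[OF strings_finite[OF st] t, of "\<lambda>s. hs s (u t)"] N.vs_carr[OF m[OF t]] by simp
  qed
  then show ?thesis using lin_finsum_maps[OF N strings_finite[OF st] lin_hs] by (intro exI[of _ ?h] conjI ballI)
qed

text \<open>The generators extend to maps in both directions, and the two composites fix the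
  generators.\<close>

lemma strings_iso:
  assumes st: "strings M I v W u \<pi>" and N: "left_module A N" and st': "strings N I v W u' \<pi>'"
  shows "module_iso A M N"
proof -
  interpret N: rsz_mod K A V par ev om N by (rule rsz_modI) fact
  obtain h where h: "lin A M N h" "\<And>s. s \<in> I \<Longrightarrow> h (u s) = u' s"
    using strings_extend[OF st N, of u'] gen_vs[OF strings_gen[OF st']] gen_out[OF strings_gen[OF st']]
    by blast
  obtain k where k: "lin A N M k" "\<And>s. s \<in> I \<Longrightarrow> k (u' s) = u s"
    using N.strings_extend[OF st' left_module_axioms, of u] gen_vs[OF strings_gen[OF st]]
      gen_out[OF strings_gen[OF st]] by blast
  show ?thesis
  proof (rule module_isoI'[OF h(1) k(1)])
    show "k (h x) = x" if "x \<in> carrier M" for x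
      using lin_agree[OF st left_module_axioms lin_comp[OF h(1) k(1)] lin_id _ that] h k by simp
    show "h (k y) = y" if "y \<in> carrier N" for y
      using N.lin_agree[OF st' N lin_comp[OF k(1) h(1)] lin_id _ that] h k by simp
  qed
qed

lemma strings_reindex:
  assumes st: "strings M I v W u \<pi>" and b: "bij_betw b J I"
  shows "strings M J (v \<circ> b) (W \<circ> b) (u \<circ> b) (\<pi> \<circ> b)"
proof -
  have J: "\<And>s. s \<in> J \<Longrightarrow> b s \<in> I" "inj_on b J" "b ` J = I" using b by (auto simp: bij_betw_def)
  have "finsum M (\<lambda>s. \<pi> (b s) x) J = x" if x: "x \<in> carrier M" for x
    using M.finsum_reindex[of "\<lambda>s. \<pi> s x" b J] J strings_sum[OF st x] lin_closed[OF strings_lin[OF st] x]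
    by auto
  moreover have "finite J" using b strings_finite[OF st] bij_betw_finite by blast
  moreover have "b t \<noteq> b s" if "s \<in> J" "t \<in> J" "t \<noteq> s" for s t using that J by (auto simp: inj_on_def)
  ultimately show ?thesis unfolding strings_def
    using J(1) stringsD[OF st] by auto
qed

lemma strings_fg:
  assumes st: "strings M I v W u \<pi>" shows "fg_module A M"
  unfolding fg_module_def
proof (intro conjI left_module_axioms exI[of _ "u ` I"] allI impI)
  show "finite (u ` I)" "u ` I \<subseteq> carrier M"
    using strings_finite[OF st] gen_carr[OF strings_gen[OF st]] by auto
  fix H assume H: "submodule H A M \<and> u ` I \<subseteq> H"
  have "x \<in> H" if x: "x \<in> carrier M" for x
  proof -
    have "\<pi> s x \<in> H" if "s \<in> I" for s
      using strings_orb[OF st that x] H that by (auto simp: orb_def intro!: submodule_smult)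
    then have "finsum M (\<lambda>s. \<pi> s x) I \<in> H" using H strings_finite[OF st] by (intro submodule_finsum) auto
    then show ?thesis using strings_sum[OF st x] by simp
  qed
  then show "H = carrier M" using H submodule_carr[of H] by blast
qed

lemma gen_sub_iff:
  assumes "submodule H A M" shows "gen (M\<lparr>carrier := H\<rparr>) i W u \<longleftrightarrow> gen M i W u \<and> u \<in> H"
  using submodule_carr[OF assms] by (auto simp: gen_def vs_def)

lemma orb_upd: "orb (M\<lparr>carrier := H\<rparr>) u = orb M u"
  by (simp add: orb_def)

text \<open>One string is a decomposition with one term, its projection being the identity; so the
  results on decompositions apply to it.\<close>

lemma strings_single:
  assumes g: "gen M i W u" shows "strings (M\<lparr>carrier := orb M u\<rparr>) {s} (\<lambda>_. i) (\<lambda>_. W) (\<lambda>_. u) (\<lambda>_ x. x)"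
proof -
  have so: "submodule (orb M u) A M" using orb_submodule[OF gen_carr[OF g]] .
  interpret O: left_module A "M\<lparr>carrier := orb M u\<rparr>" by (rule submodule_module[OF so])
  show ?thesis
    using g orb_self[OF gen_carr[OF g]] gen_sub_iff[OF so] lin_id O.M.finsum_insert[of "{}" s]
      submodule_carr[OF so]
    by (auto simp: strings_def orb_upd)
qed

lemma gen_iso:
  assumes "gen M i W u" "left_module A N" "gen N i W u'"
  shows "module_iso A (M\<lparr>carrier := orb M u\<rparr>) (N\<lparr>carrier := orb N u'\<rparr>)"
proof -
  interpret N: rsz_mod K A V par ev om N by (rule rsz_modI) fact
  interpret O: rsz_mod K A V par ev om "M\<lparr>carrier := orb M u\<rparr>"
    by (intro rsz_modI submodule_module orb_submodule gen_carr[OF assms(1)])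
  show ?thesis
    by (rule O.strings_iso[OF strings_single[OF assms(1), of "()"] _ N.strings_single[OF assms(3)]])
      (intro N.submodule_module N.orb_submodule gen_carr[OF assms(3)])
qed

end

section \<open>Indecomposable modules are strings\<close>

lemma quotient_image_classes:
  fixes \<tau> :: "'a \<Rightarrow> 't"
  assumes "\<And>x y. \<lbrakk>x \<in> S; y \<in> S\<rbrakk> \<Longrightarrow> R x y \<longleftrightarrow> \<tau> x = \<tau> y"
  shows "bij_betw (\<lambda>t. {y \<in> S. \<tau> y = t}) (\<tau> ` S) (S // {(x, y) \<in> S \<times> S. R x y})"
proof -
  have "{(x, y) \<in> S \<times> S. R x y} `` {x} = {y \<in> S. \<tau> y = \<tau> x}" if "x \<in> S" for x
    using assms that by auto
  then have "S // {(x, y) \<in> S \<times> S. R x y} = (\<lambda>t. {y \<in> S. \<tau> y = t}) ` \<tau> ` S"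
    by (auto simp: quotient_def image_image)
  moreover have "inj_on (\<lambda>t. {y \<in> S. \<tau> y = t}) (\<tau> ` S)" by (rule inj_onI) blast
  ultimately show ?thesis by (simp add: bij_betw_def)
qed

text \<open>A complete invariant replaces isomorphism classes by its values. Finiteness is carried
  along, because \<open>card\<close> is 0 on infinite sets.\<close>

lemma iso_classes_count:
  assumes "\<And>M N. \<lbrakk>M \<in> S; N \<in> S\<rbrakk> \<Longrightarrow> module_iso R M N \<longleftrightarrow> \<tau> M = \<tau> N"
  shows "card (iso_classes R S) = card (\<tau> ` S)" "finite (iso_classes R S) \<longleftrightarrow> finite (\<tau> ` S)"
  using quotient_image_classes[of S "module_iso R" \<tau>, OF assms] unfolding iso_classes_def
  by (simp_all add: bij_betw_same_card bij_betw_finite)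

lemma set_add_mem: "x \<in> A <+>\<^bsub>M\<^esub> B \<longleftrightarrow> (\<exists>a\<in>A. \<exists>b\<in>B. x = a \<oplus>\<^bsub>M\<^esub> b)"
  by (auto simp: set_add_def set_mult_def)

section \<open>Splitting off a string\<close>

context rsz
begin

text \<open>A subspace over the field, in general not stable under \<open>A\<close>.\<close>

definition subsp :: "('r, 'v) module \<Rightarrow> 'v set \<Rightarrow> bool" where
  "subsp M H \<longleftrightarrow> H \<subseteq> carrier M \<and> \<zero>\<^bsub>M\<^esub> \<in> H \<and> (\<forall>x\<in>H. \<forall>y\<in>H. x \<oplus>\<^bsub>M\<^esub> y \<in> H) \<and>
     (\<forall>c\<in>carrier K. \<forall>x\<in>H. sc c \<odot>\<^bsub>M\<^esub> x \<in> H)"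

text \<open>The map \<open>p\<close> fixes \<open>u\<close>, hence all of \<open>orb M u\<close>,
  and is a projection onto it. No complement is named, which makes the notion easy to transport
  along isomorphisms.\<close>

definition retract :: "('r, 'v) module \<Rightarrow> nat \<Rightarrow> nat set \<Rightarrow> bool" where
  "retract M i W \<longleftrightarrow> (\<exists>u p. gen M i W u \<and> lin A M M p \<and> p u = u \<and> p ` carrier M \<subseteq> orb M u)"

end

context rsz_mod
begin

lemma
  assumes "subsp M H"
  shows subsp_carr: "x \<in> H \<Longrightarrow> x \<in> carrier M" and subsp_zero: "\<zero>\<^bsub>M\<^esub> \<in> H"
    and subsp_add: "\<lbrakk>x \<in> H; y \<in> H\<rbrakk> \<Longrightarrow> x \<oplus>\<^bsub>M\<^esub> y \<in> H"
    and subsp_sc: "\<lbrakk>c \<in> carrier K; x \<in> H\<rbrakk> \<Longrightarrow> sc c \<odot>\<^bsub>M\<^esub> x \<in> H"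
  using assms by (auto simp: subsp_def)

lemma minus_zero: "\<ominus>\<^bsub>M\<^esub> \<zero>\<^bsub>M\<^esub> = \<zero>\<^bsub>M\<^esub>"
  using M.minus_equality[of "\<zero>\<^bsub>M\<^esub>" "\<zero>\<^bsub>M\<^esub>"] by simp

lemma sc_minus_one: "x \<in> carrier M \<Longrightarrow> sc (\<ominus>\<^bsub>K\<^esub> \<one>\<^bsub>K\<^esub>) \<odot>\<^bsub>M\<^esub> x = \<ominus>\<^bsub>M\<^esub> x"
proof -
  assume x: "x \<in> carrier M"
  have "sc (\<ominus>\<^bsub>K\<^esub> \<one>\<^bsub>K\<^esub>) = \<ominus> \<one>" by (rule coord_eqI) auto
  then show ?thesis using x by (simp add: smult_l_minus smult_one)
qed

lemma subsp_minus: assumes "subsp M H" "x \<in> H" shows "\<ominus>\<^bsub>M\<^esub> x \<in> H"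
  using subsp_sc[OF assms(1), of "\<ominus>\<^bsub>K\<^esub> \<one>\<^bsub>K\<^esub>" x] assms sc_minus_one subsp_carr[OF assms] by simp

lemma subsp_sc_cancel:
  assumes "subsp M H" "sc c \<odot>\<^bsub>M\<^esub> x \<in> H" "c \<in> carrier K" "c \<noteq> \<zero>\<^bsub>K\<^esub>" "x \<in> carrier M" shows "x \<in> H"
proof -
  have i: "inv\<^bsub>K\<^esub> c \<in> carrier K" "inv\<^bsub>K\<^esub> c \<otimes>\<^bsub>K\<^esub> c = \<one>\<^bsub>K\<^esub>" using assms K.field_Units by auto
  then have "sc (inv\<^bsub>K\<^esub> c) \<odot>\<^bsub>M\<^esub> (sc c \<odot>\<^bsub>M\<^esub> x) = x"
    using assms(3,5) by (simp add: smult_mult sc_mult[symmetric] sc_one smult_one)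
  then show ?thesis using subsp_sc[OF assms(1) i(1) assms(2)] by simp
qed

text \<open>A subspace that is maximal among those that contain \<open>Y\<close> and avoid
  \<open>u\<close> is a complement of the line through \<open>u\<close>: adding any further vector
  to it brings in \<open>u\<close>.\<close>

lemma hyperplane:
  assumes Y: "subsp M Y" and u: "u \<in> carrier M" "u \<notin> Y"
  obtains H where "subsp M H" "Y \<subseteq> H" "u \<notin> H"
    "\<And>x. x \<in> carrier M \<Longrightarrow> \<exists>c\<in>carrier K. x \<ominus>\<^bsub>M\<^esub> sc c \<odot>\<^bsub>M\<^esub> u \<in> H"
proof -
  let ?F = "{H. subsp M H \<and> Y \<subseteq> H \<and> u \<notin> H}"
  have chain: "(\<Union>C) \<in> ?F" if C: "C \<noteq> {}" "subset.chain ?F C" for C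
  proof -
    have CF: "\<And>Q. Q \<in> C \<Longrightarrow> subsp M Q \<and> Y \<subseteq> Q \<and> u \<notin> Q"
      and lin: "\<And>Q Q'. \<lbrakk>Q \<in> C; Q' \<in> C\<rbrakk> \<Longrightarrow> Q \<subseteq> Q' \<or> Q' \<subseteq> Q"
      using C(2) by (auto simp: subset_chain_def)
    have "x \<oplus>\<^bsub>M\<^esub> y \<in> \<Union>C" if xy: "x \<in> \<Union>C" "y \<in> \<Union>C" for x y
    proof -
      obtain Q Q' where "Q \<in> C" "Q' \<in> C" "x \<in> Q" "y \<in> Q'" using xy by blast
      then obtain Z where "Z \<in> C" "x \<in> Z" "y \<in> Z" using lin by blast
      then show ?thesis using subsp_add[of Z x y] CF by blast
    qed
    moreover have "sc c \<odot>\<^bsub>M\<^esub> x \<in> \<Union>C" if "c \<in> carrier K" "x \<in> \<Union>C" for c x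
      using that subsp_sc[of _ c x] CF by blast
    moreover have "\<zero>\<^bsub>M\<^esub> \<in> \<Union>C" "\<Union>C \<subseteq> carrier M" "Y \<subseteq> \<Union>C" "u \<notin> \<Union>C"
      using C(1) CF subsp_zero subsp_carr by blast+
    ultimately show ?thesis by (auto simp: subsp_def)
  qed
  have ne: "?F \<noteq> {}" using Y u by blast
  have "\<exists>H\<in>?F. \<forall>Q\<in>?F. H \<subseteq> Q \<longrightarrow> Q = H"
    by (rule subset_Zorn_nonempty[OF ne]) (rule chain)
  then obtain H where H: "H \<in> ?F" and max: "\<forall>Q\<in>?F. H \<subseteq> Q \<longrightarrow> Q = H" by (elim bexE)
  have Hs: "subsp M H" "Y \<subseteq> H" "u \<notin> H" using H by auto
  have "\<exists>c\<in>carrier K. x \<ominus>\<^bsub>M\<^esub> sc c \<odot>\<^bsub>M\<^esub> u \<in> H" if x: "x \<in> carrier M" for x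
  proof (cases "x \<in> H")
    case True
    then show ?thesis using u x by (intro bexI[of _ "\<zero>\<^bsub>K\<^esub>"]) (simp_all add: sc_zero a_minus_def minus_zero)
  next
    case False
    let ?H' = "{h \<oplus>\<^bsub>M\<^esub> sc c \<odot>\<^bsub>M\<^esub> x | h c. h \<in> H \<and> c \<in> carrier K}"
    note hc = subsp_carr[OF Hs(1)]
    have HH': "H \<subseteq> ?H'"
    proof
      fix h assume h: "h \<in> H"
      then have "h = h \<oplus>\<^bsub>M\<^esub> sc \<zero>\<^bsub>K\<^esub> \<odot>\<^bsub>M\<^esub> x" using x hc by (simp add: sc_zero)
      then show "h \<in> ?H'" using h K.zero_closed by blast
    qed
    have xH': "x \<in> ?H'"
    proof -
      have "x = \<zero>\<^bsub>M\<^esub> \<oplus>\<^bsub>M\<^esub> sc \<one>\<^bsub>K\<^esub> \<odot>\<^bsub>M\<^esub> x" using x by (simp add: sc_one smult_one)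
      then show ?thesis using subsp_zero[OF Hs(1)] by blast
    qed
    have "subsp M ?H'" unfolding subsp_def
    proof (intro conjI ballI)
      show "?H' \<subseteq> carrier M" using hc x by auto
      show "\<zero>\<^bsub>M\<^esub> \<in> ?H'" using HH' subsp_zero[OF Hs(1)] by blast
      fix y z assume "y \<in> ?H'" "z \<in> ?H'"
      then obtain h c k d where y: "y = h \<oplus>\<^bsub>M\<^esub> sc c \<odot>\<^bsub>M\<^esub> x" "z = k \<oplus>\<^bsub>M\<^esub> sc d \<odot>\<^bsub>M\<^esub> x"
        and h: "h \<in> H" "k \<in> H" "c \<in> carrier K" "d \<in> carrier K" by blast
      have "y \<oplus>\<^bsub>M\<^esub> z = (h \<oplus>\<^bsub>M\<^esub> k) \<oplus>\<^bsub>M\<^esub> sc (c \<oplus>\<^bsub>K\<^esub> d) \<odot>\<^bsub>M\<^esub> x"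
        using y h hc x by (simp add: sc_add smult_l_distr M.a_ac)
      moreover have "h \<oplus>\<^bsub>M\<^esub> k \<in> H" "c \<oplus>\<^bsub>K\<^esub> d \<in> carrier K" using h subsp_add[OF Hs(1)] by auto
      ultimately show "y \<oplus>\<^bsub>M\<^esub> z \<in> ?H'" by blast
    next
      fix e y assume e: "e \<in> carrier K" and "y \<in> ?H'"
      then obtain h c where y: "y = h \<oplus>\<^bsub>M\<^esub> sc c \<odot>\<^bsub>M\<^esub> x" and h: "h \<in> H" "c \<in> carrier K" by blast
      have "sc e \<odot>\<^bsub>M\<^esub> y = sc e \<odot>\<^bsub>M\<^esub> h \<oplus>\<^bsub>M\<^esub> sc (e \<otimes>\<^bsub>K\<^esub> c) \<odot>\<^bsub>M\<^esub> x"
        using y h hc x e by (simp add: sc_mult smult_r_distr smult_assoc)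
      moreover have "sc e \<odot>\<^bsub>M\<^esub> h \<in> H" "e \<otimes>\<^bsub>K\<^esub> c \<in> carrier K" using h e subsp_sc[OF Hs(1)] by auto
      ultimately show "sc e \<odot>\<^bsub>M\<^esub> y \<in> ?H'" by blast
    qed
    moreover have "?H' \<noteq> H" using False xH' by blast
    ultimately have "u \<in> ?H'" using bspec[OF max, of ?H'] HH' Hs(2) by auto
    then obtain h c where uh: "u = h \<oplus>\<^bsub>M\<^esub> sc c \<odot>\<^bsub>M\<^esub> x" and h: "h \<in> H" "c \<in> carrier K" by blast
    \<comment> \<open>Otherwise \<open>u\<close> would be the vector \<open>h\<close> of
      \<open>H\<close>.\<close>
    have c0: "c \<noteq> \<zero>\<^bsub>K\<^esub>" using uh h hc x Hs(3) by (auto simp: sc_zero)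
    then have i: "inv\<^bsub>K\<^esub> c \<in> carrier K" "inv\<^bsub>K\<^esub> c \<otimes>\<^bsub>K\<^esub> c = \<one>\<^bsub>K\<^esub>" using h K.field_Units by auto
    have hcar: "h \<in> carrier M" using h hc by blast
    have "sc (inv\<^bsub>K\<^esub> c) \<odot>\<^bsub>M\<^esub> u = sc (inv\<^bsub>K\<^esub> c) \<odot>\<^bsub>M\<^esub> h \<oplus>\<^bsub>M\<^esub> x"
      using uh h hcar x i by (simp add: smult_r_distr smult_mult sc_mult[symmetric] sc_one smult_one)
    then have "x \<ominus>\<^bsub>M\<^esub> sc (inv\<^bsub>K\<^esub> c) \<odot>\<^bsub>M\<^esub> u = \<ominus>\<^bsub>M\<^esub> (sc (inv\<^bsub>K\<^esub> c) \<odot>\<^bsub>M\<^esub> h)"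
      using x hcar i u by (simp add: a_minus_def M.minus_add M.a_comm M.a_lcomm M.r_neg1 M.r_neg2)
    then show ?thesis using i h subsp_minus[OF Hs(1) subsp_sc[OF Hs(1)]] by (intro bexI[of _ "inv\<^bsub>K\<^esub> c"]) simp_all
  qed
  then show thesis using that[OF Hs] by blast
qed

lemma kernel_subsp:
  assumes "i \<in> V" "j \<in> V" shows "subsp M {x \<in> vs M i. Ar j \<odot>\<^bsub>M\<^esub> x = \<zero>\<^bsub>M\<^esub>}"
  unfolding subsp_def
  using zero_in_vs add_in_vs sc_in_vs
  by (auto simp: vs_carr smult_r_distr smult_mult sc_central[symmetric])
    (simp add: smult_mult[symmetric] vs_carr)

lemma sum_subsp:
  assumes "subsp M Q" "subsp M Y" shows "subsp M (Q <+>\<^bsub>M\<^esub> Y)"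
  unfolding subsp_def
proof (intro conjI ballI)
  note c = subsp_carr[OF assms(1)] subsp_carr[OF assms(2)]
  show "Q <+>\<^bsub>M\<^esub> Y \<subseteq> carrier M" using c by (auto simp: set_add_mem)
  show "\<zero>\<^bsub>M\<^esub> \<in> Q <+>\<^bsub>M\<^esub> Y" using subsp_zero assms unfolding set_add_mem by force
  fix x y assume "x \<in> Q <+>\<^bsub>M\<^esub> Y" "y \<in> Q <+>\<^bsub>M\<^esub> Y"
  then obtain a b a' b' where ab: "a \<in> Q" "b \<in> Y" "x = a \<oplus>\<^bsub>M\<^esub> b" "a' \<in> Q" "b' \<in> Y" "y = a' \<oplus>\<^bsub>M\<^esub> b'"
    by (auto simp: set_add_mem)
  have "x \<oplus>\<^bsub>M\<^esub> y = (a \<oplus>\<^bsub>M\<^esub> a') \<oplus>\<^bsub>M\<^esub> (b \<oplus>\<^bsub>M\<^esub> b')" using ab c by (simp add: M.a_ac)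
  then show "x \<oplus>\<^bsub>M\<^esub> y \<in> Q <+>\<^bsub>M\<^esub> Y" using ab subsp_add assms unfolding set_add_mem by blast
next
  note c = subsp_carr[OF assms(1)] subsp_carr[OF assms(2)]
  fix e x assume e: "e \<in> carrier K" "x \<in> Q <+>\<^bsub>M\<^esub> Y"
  then obtain a b where ab: "a \<in> Q" "b \<in> Y" "x = a \<oplus>\<^bsub>M\<^esub> b" by (auto simp: set_add_mem)
  then have "sc e \<odot>\<^bsub>M\<^esub> x = sc e \<odot>\<^bsub>M\<^esub> a \<oplus>\<^bsub>M\<^esub> sc e \<odot>\<^bsub>M\<^esub> b" using e c by (simp add: smult_r_distr)
  then show "sc e \<odot>\<^bsub>M\<^esub> x \<in> Q <+>\<^bsub>M\<^esub> Y" using e ab subsp_sc assms unfolding set_add_mem by blast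
qed

text \<open>
  This fails if three arrows start at \<open>i\<close>: their kernels can be three different lines in a plane,
  and the module is then indecomposable without being a string.
\<close>

lemma string_vector_exists:
  assumes i: "i \<in> V" and nz: "x0 \<in> vs M i" "x0 \<noteq> \<zero>\<^bsub>M\<^esub>"
  shows "\<exists>W u Y. W \<subseteq> ch i \<and> u \<in> vs M i \<and> subsp M Y \<and> u \<notin> Y \<and>
    (\<forall>j\<in>W. {x \<in> vs M i. Ar j \<odot>\<^bsub>M\<^esub> x = \<zero>\<^bsub>M\<^esub>} \<subseteq> Y) \<and> (\<forall>j\<in>ch i - W. Ar j \<odot>\<^bsub>M\<^esub> u = \<zero>\<^bsub>M\<^esub>)"
proof -
  define kr where "kr j = {x \<in> vs M i. Ar j \<odot>\<^bsub>M\<^esub> x = \<zero>\<^bsub>M\<^esub>}" for j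
  have ks: "subsp M (kr j)" if "j \<in> ch i" for j
    using kernel_subsp[OF i] ch_sub[OF that] by (simp add: kr_def)
  have z: "subsp M {\<zero>\<^bsub>M\<^esub>}" by (auto simp: subsp_def)
  have goal: ?thesis if "W \<subseteq> ch i" "u \<in> vs M i" "subsp M Y" "u \<notin> Y" "\<And>j. j \<in> W \<Longrightarrow> kr j \<subseteq> Y"
      "\<And>j. \<lbrakk>j \<in> ch i; j \<notin> W\<rbrakk> \<Longrightarrow> u \<in> kr j" for W u Y
    using that unfolding kr_def by blast
  \<comment> \<open>If every arrow is zero on the space at \<open>i\<close>, any nonzero vector
    there generates a simple module.\<close>
  have all: ?thesis if "\<And>j. j \<in> ch i \<Longrightarrow> vs M i \<subseteq> kr j"
    using goal[of "{}" x0 "{\<zero>\<^bsub>M\<^esub>}"] nz z that by blast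
  \<comment> \<open>A vector on which exactly one arrow is nonzero: the kernel of that arrow is
    \<open>Y\<close>.\<close>
  have one: ?thesis if a: "a \<in> ch i" "u \<in> vs M i" "u \<notin> kr a" "\<And>j. \<lbrakk>j \<in> ch i; j \<noteq> a\<rbrakk> \<Longrightarrow> u \<in> kr j" for a u
    using goal[of "{a}" u "kr a"] ks[OF a(1)] a by blast
  consider "ch i = {}" | a where "ch i = {a}" | a b where "ch i = {a, b}" "a \<noteq> b"
  proof -
    have "card (ch i) = 0 \<or> card (ch i) = 1 \<or> card (ch i) = 2" using ch_card[of i] by linarith
    then show thesis using that by (auto simp: card_1_singleton_iff card_2_iff)
  qed
  then show ?thesis
  proof cases
    case 1 then show ?thesis using all by simp
  next
    case (2 a)
    show ?thesis
    proof (cases "vs M i \<subseteq> kr a")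
      case True then show ?thesis using all 2 by simp
    next
      case False
      then obtain u where "u \<in> vs M i" "u \<notin> kr a" by (meson subsetI)
      then show ?thesis using one[of a u] 2 by simp
    qed
  next
    case (3 a b)
    show ?thesis
    proof (cases "vs M i \<subseteq> kr a <+>\<^bsub>M\<^esub> kr b")
      case False
      \<comment> \<open>Outside the sum of the two kernels both arrows are nonzero, and the sum
        itself can be taken as \<open>Y\<close>.\<close>
      then obtain u where u: "u \<in> vs M i" "u \<notin> kr a <+>\<^bsub>M\<^esub> kr b" by (meson subsetI)
      have abch: "a \<in> ch i" "b \<in> ch i" using 3 by auto
      have k0: "x \<oplus>\<^bsub>M\<^esub> \<zero>\<^bsub>M\<^esub> = x" "\<zero>\<^bsub>M\<^esub> \<oplus>\<^bsub>M\<^esub> x = x" if "x \<in> kr j" "j \<in> ch i" for x j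
        using subsp_carr[OF ks[OF that(2)] that(1)] by simp_all
      have "kr a \<subseteq> kr a <+>\<^bsub>M\<^esub> kr b"
      proof
        fix x assume "x \<in> kr a"
        then show "x \<in> kr a <+>\<^bsub>M\<^esub> kr b"
          using k0[OF _ abch(1)] subsp_zero[OF ks[OF abch(2)]] unfolding set_add_mem by metis
      qed
      moreover have "kr b \<subseteq> kr a <+>\<^bsub>M\<^esub> kr b"
      proof
        fix x assume "x \<in> kr b"
        then show "x \<in> kr a <+>\<^bsub>M\<^esub> kr b"
          using k0[OF _ abch(2)] subsp_zero[OF ks[OF abch(1)]] unfolding set_add_mem by metis
      qed
      ultimately show ?thesis
        using goal[of "{a, b}" u "kr a <+>\<^bsub>M\<^esub> kr b"] u sum_subsp[OF ks[OF abch(1)] ks[OF abch(2)]] 3 by blast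
    next
      case True
      have split: "\<exists>y\<in>kr a. \<exists>z\<in>kr b. x = y \<oplus>\<^bsub>M\<^esub> z" if "x \<in> vs M i" for x
        using True that by (auto simp: set_add_mem)
      show ?thesis
      proof (cases "vs M i \<subseteq> kr a \<and> vs M i \<subseteq> kr b")
        case True
        then show ?thesis using 3(1) by (intro all) auto
      next
        case F: False
        have "\<exists>x c d. x \<in> vs M i \<and> x \<notin> kr c \<and> {c, d} = {a, b} \<and> c \<noteq> d"
        proof (cases "vs M i \<subseteq> kr a")
          case False
          then obtain x where "x \<in> vs M i" "x \<notin> kr a" by (meson subsetI)
          then show ?thesis using 3(2) by (intro exI[of _ x] exI[of _ a] exI[of _ b]) simp
        next
          case True
          then have "\<not> vs M i \<subseteq> kr b" using F by simp
          then obtain x where "x \<in> vs M i" "x \<notin> kr b" by (meson subsetI)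
          then show ?thesis using 3(2) by (intro exI[of _ x] exI[of _ b] exI[of _ a]) auto
        qed
        then obtain x c d where x: "x \<in> vs M i" "x \<notin> kr c" and cd: "{c, d} = {a, b}" "c \<noteq> d"
          by (elim exE conjE)
        have cc: "c \<in> ch i" "d \<in> ch i" using cd 3 by auto
        obtain y z where yz: "y \<in> kr c" "z \<in> kr d" "x = y \<oplus>\<^bsub>M\<^esub> z"
        proof -
          obtain y z where yz: "y \<in> kr a" "z \<in> kr b" "x = y \<oplus>\<^bsub>M\<^esub> z" using split[OF x(1)] by blast
          moreover have "x = z \<oplus>\<^bsub>M\<^esub> y"
            using yz subsp_carr[OF ks] 3 by (auto intro: M.a_comm)
          ultimately show thesis using that cd by (auto simp: doubleton_eq_iff)
        qed
        \<comment> \<open>Dropping the part \<open>y\<close> in the kernel of \<open>Ar c\<close>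
          leaves a vector on which \<open>Ar c\<close> is still nonzero and which
          \<open>Ar d\<close> kills.\<close>
        have "z \<notin> kr c" using x yz subsp_add[OF ks[OF cc(1)]] by blast
        moreover have "z \<in> vs M i" using yz by (simp add: kr_def)
        ultimately show ?thesis using one[of c z] cc yz cd 3 by blast
      qed
    qed
  qed
qed

text \<open>The complement consists of the vectors whose component at \<open>i\<close> lies in a
  hyperplane \<open>H\<close> and whose component at each \<open>j\<close> in \<open>W\<close> lies
  in a hyperplane \<open>Hj j\<close>, chosen so that the arrow to \<open>j\<close> respects these
  conditions.\<close>

lemma string_summand_exists:
  assumes "carrier M \<noteq> {\<zero>\<^bsub>M\<^esub>}"
  shows "\<exists>i W u N'. gen M i W u \<and> complementary A M (orb M u) N'"
proof -
  have "\<exists>i\<in>V. \<exists>x\<in>vs M i. x \<noteq> \<zero>\<^bsub>M\<^esub>"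
  proof (rule ccontr)
    assume *: "\<not> ?thesis"
    have "x = \<zero>\<^bsub>M\<^esub>" if x: "x \<in> carrier M" for x
    proof (rule vertex_eqI[OF x M.zero_closed])
      fix k assume "k \<in> V"
      then have "E k \<odot>\<^bsub>M\<^esub> x = \<zero>\<^bsub>M\<^esub>" using * E_in_vs[OF x, of k] by blast
      then show "E k \<odot>\<^bsub>M\<^esub> x = E k \<odot>\<^bsub>M\<^esub> \<zero>\<^bsub>M\<^esub>" by simp
    qed
    then have "carrier M = {\<zero>\<^bsub>M\<^esub>}" using M.zero_closed by blast
    then show False using assms by simp
  qed
  then have ne: "{i \<in> V. \<exists>x\<in>vs M i. x \<noteq> \<zero>\<^bsub>M\<^esub>} \<noteq> {}" (is "?T \<noteq> {}") by blast
  \<comment> \<open>At the topmost point of the support no nonzero arrow arrives, so the complement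
    has to respect only the arrows that leave \<open>i\<close>.\<close>
  define i where "i = Max ?T"
  have "finite ?T" using finV by simp
  then have iT: "i \<in> ?T" and imax: "\<And>k. k \<in> ?T \<Longrightarrow> k \<le> i"
    unfolding i_def by (rule Max_in[OF _ ne], rule Max_ge)
  then obtain x0 where i: "i \<in> V" "x0 \<in> vs M i" "x0 \<noteq> \<zero>\<^bsub>M\<^esub>" by blast
  have top: "x = \<zero>\<^bsub>M\<^esub>" if "par i \<in> V" "x \<in> vs M (par i)" for x
    using imax[of "par i"] par_gt[OF i(1)] that by force
  obtain W u Y where W: "W \<subseteq> ch i" "u \<in> vs M i" "subsp M Y" "u \<notin> Y"
      "\<And>j x. \<lbrakk>j \<in> W; x \<in> vs M i; Ar j \<odot>\<^bsub>M\<^esub> x = \<zero>\<^bsub>M\<^esub>\<rbrakk> \<Longrightarrow> x \<in> Y"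
      "\<And>j. \<lbrakk>j \<in> ch i; j \<notin> W\<rbrakk> \<Longrightarrow> Ar j \<odot>\<^bsub>M\<^esub> u = \<zero>\<^bsub>M\<^esub>"
    using string_vector_exists[OF i] by blast
  have uc: "u \<in> carrier M" using vs_carr[OF W(2)] .
  obtain H where H: "subsp M H" "Y \<subseteq> H" "u \<notin> H"
      "\<And>x. x \<in> carrier M \<Longrightarrow> \<exists>c\<in>carrier K. x \<ominus>\<^bsub>M\<^esub> sc c \<odot>\<^bsub>M\<^esub> u \<in> H"
    using hyperplane[OF W(3) uc W(4)] by blast
  have nz: "Ar j \<odot>\<^bsub>M\<^esub> u \<noteq> \<zero>\<^bsub>M\<^esub>" if "j \<in> W" for j using W(5)[OF that W(2)] W(4) by blast
  have g: "gen M i W u" using i W nz subsp_zero[OF W(3)] by (auto simp: gen_def)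
  have Wc: "j \<in> V" "par j = i" "j \<noteq> i" "par j \<in> V" if "j \<in> W" for j
    using that W(1) i ch_irrefl by (auto simp: ch_def)
  \<comment> \<open>The hyperplane at \<open>j\<close> has to contain the image of \<open>H\<close>
    and to avoid the image of \<open>u\<close>. Both are possible together because the kernel of the
    arrow lies in \<open>Y\<close> and hence in \<open>H\<close>.\<close>
  let ?P = "\<lambda>j Hj. subsp M Hj \<and> (\<lambda>x. Ar j \<odot>\<^bsub>M\<^esub> x) ` (H \<inter> vs M i) \<subseteq> Hj \<and> Ar j \<odot>\<^bsub>M\<^esub> u \<notin> Hj \<and>
      (\<forall>x\<in>carrier M. \<exists>c\<in>carrier K. x \<ominus>\<^bsub>M\<^esub> sc c \<odot>\<^bsub>M\<^esub> (Ar j \<odot>\<^bsub>M\<^esub> u) \<in> Hj)"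
  have ex: "\<exists>Hj. ?P j Hj" if j: "j \<in> W" for j
  proof -
    let ?Y = "(\<lambda>x. Ar j \<odot>\<^bsub>M\<^esub> x) ` (H \<inter> vs M i)"
    have "subsp M ?Y" unfolding subsp_def
    proof (intro conjI ballI)
      show "?Y \<subseteq> carrier M" using vs_carr by auto
      show "\<zero>\<^bsub>M\<^esub> \<in> ?Y" using subsp_zero[OF H(1)] zero_in_vs by (intro image_eqI[of _ _ "\<zero>\<^bsub>M\<^esub>"]) auto
      fix x y assume "x \<in> ?Y" "y \<in> ?Y"
      then obtain x' y' where x: "x = Ar j \<odot>\<^bsub>M\<^esub> x'" "y = Ar j \<odot>\<^bsub>M\<^esub> y'" "x' \<in> H" "y' \<in> H" "x' \<in> vs M i" "y' \<in> vs M i"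
        by blast
      then have "x \<oplus>\<^bsub>M\<^esub> y = Ar j \<odot>\<^bsub>M\<^esub> (x' \<oplus>\<^bsub>M\<^esub> y')" by (simp add: smult_r_distr vs_carr)
      then show "x \<oplus>\<^bsub>M\<^esub> y \<in> ?Y" using x subsp_add[OF H(1)] add_in_vs by blast
    next
      fix c x assume c: "c \<in> carrier K" and "x \<in> ?Y"
      then obtain x' where x: "x = Ar j \<odot>\<^bsub>M\<^esub> x'" "x' \<in> H" "x' \<in> vs M i" by blast
      then have "sc c \<odot>\<^bsub>M\<^esub> x = Ar j \<odot>\<^bsub>M\<^esub> (sc c \<odot>\<^bsub>M\<^esub> x')"
        using c by (simp add: smult_mult vs_carr sc_central)
      then show "sc c \<odot>\<^bsub>M\<^esub> x \<in> ?Y" using x c subsp_sc[OF H(1)] sc_in_vs by blast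
    qed
    moreover have "Ar j \<odot>\<^bsub>M\<^esub> u \<in> carrier M" using uc by simp
    moreover have "Ar j \<odot>\<^bsub>M\<^esub> u \<notin> ?Y"
    proof
      assume "Ar j \<odot>\<^bsub>M\<^esub> u \<in> ?Y"
      then obtain x where x: "Ar j \<odot>\<^bsub>M\<^esub> u = Ar j \<odot>\<^bsub>M\<^esub> x" "x \<in> H" "x \<in> vs M i" by blast
      have d: "u \<ominus>\<^bsub>M\<^esub> x \<in> vs M i"
        using x W(2) sc_in_vs[of x i "\<ominus>\<^bsub>K\<^esub> \<one>\<^bsub>K\<^esub>"] sc_minus_one[of x]
        by (simp add: a_minus_def add_in_vs vs_carr)
      have "Ar j \<odot>\<^bsub>M\<^esub> (u \<ominus>\<^bsub>M\<^esub> x) = \<zero>\<^bsub>M\<^esub>"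
        using x uc by (simp add: a_minus_def smult_r_distr smult_r_minus vs_carr M.r_neg)
      then have "u \<ominus>\<^bsub>M\<^esub> x \<in> H" using W(5)[OF j d] H(2) by blast
      then have "(u \<ominus>\<^bsub>M\<^esub> x) \<oplus>\<^bsub>M\<^esub> x \<in> H" using subsp_add[OF H(1)] x by blast
      then show False using H(3) uc vs_carr[OF x(3)] by (simp add: a_minus_def M.a_assoc M.l_neg)
    qed
    ultimately show ?thesis
    proof (rule hyperplane)
      fix Hj assume "subsp M Hj" "?Y \<subseteq> Hj" "Ar j \<odot>\<^bsub>M\<^esub> u \<notin> Hj"
        "\<And>x. x \<in> carrier M \<Longrightarrow> \<exists>c\<in>carrier K. x \<ominus>\<^bsub>M\<^esub> sc c \<odot>\<^bsub>M\<^esub> (Ar j \<odot>\<^bsub>M\<^esub> u) \<in> Hj"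
      then show "\<exists>Hj. ?P j Hj" by (intro exI[of _ Hj] conjI ballI)
    qed
  qed
  have "\<exists>Hj. \<forall>j\<in>W. ?P j (Hj j)" by (rule bchoice) (use ex in blast)
  then obtain Hj where Hj': "\<forall>j\<in>W. ?P j (Hj j)" ..
  have Hj: "\<And>j. j \<in> W \<Longrightarrow> subsp M (Hj j)"
      "\<And>j x. \<lbrakk>j \<in> W; x \<in> H; x \<in> vs M i\<rbrakk> \<Longrightarrow> Ar j \<odot>\<^bsub>M\<^esub> x \<in> Hj j"
      "\<And>j. j \<in> W \<Longrightarrow> Ar j \<odot>\<^bsub>M\<^esub> u \<notin> Hj j"
      "\<And>j x. \<lbrakk>j \<in> W; x \<in> carrier M\<rbrakk> \<Longrightarrow> \<exists>c\<in>carrier K. x \<ominus>\<^bsub>M\<^esub> sc c \<odot>\<^bsub>M\<^esub> (Ar j \<odot>\<^bsub>M\<^esub> u) \<in> Hj j"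
    subgoal using Hj' by blast
    subgoal using Hj' by (simp add: image_subset_iff)
    subgoal using Hj' by blast
    subgoal using Hj' by blast
    done
  let ?N = "{x \<in> carrier M. E i \<odot>\<^bsub>M\<^esub> x \<in> H \<and> (\<forall>j\<in>W. E j \<odot>\<^bsub>M\<^esub> x \<in> Hj j)}"
  have sN: "submodule ?N A M"
  proof (rule submoduleI_coords)
    show "?N \<subseteq> carrier M" by blast
    show "?N \<noteq> {}" using subsp_zero[OF H(1)] subsp_zero[OF Hj(1)] by force
    show "x \<oplus>\<^bsub>M\<^esub> y \<in> ?N" if "x \<in> ?N" "y \<in> ?N" for x y
      using that subsp_add[OF H(1)] subsp_add[OF Hj(1)] by (simp add: smult_r_distr)
    show "sc c \<odot>\<^bsub>M\<^esub> x \<in> ?N" if "c \<in> carrier K" "x \<in> ?N" for c x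
      using that subsp_sc[OF H(1)] subsp_sc[OF Hj(1)]
      by (simp add: smult_mult sc_central[symmetric]) (simp add: smult_mult[symmetric])
    show "E k \<odot>\<^bsub>M\<^esub> x \<in> ?N" if "k \<in> V" "x \<in> ?N" for k x
      using that subsp_zero[OF H(1)] subsp_zero[OF Hj(1)] by (auto simp: smult_mult E_E)
    show "Ar k \<odot>\<^bsub>M\<^esub> x \<in> ?N" if k: "k \<in> V" "par k \<in> V" and x: "x \<in> ?N" for k x
    proof -
      have xc: "x \<in> carrier M" using x by blast
      have "Ar i \<odot>\<^bsub>M\<^esub> x = \<zero>\<^bsub>M\<^esub>" if "par i \<in> V"
        using Ar_E_smult[OF i(1) that xc] top[OF that E_in_vs[OF xc]] by simp
      then have "E i \<odot>\<^bsub>M\<^esub> (Ar k \<odot>\<^bsub>M\<^esub> x) \<in> H"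
        using xc k i subsp_zero[OF H(1)] by (cases "k = i") (simp_all add: smult_mult E_Ar)
      moreover have "E j \<odot>\<^bsub>M\<^esub> (Ar k \<odot>\<^bsub>M\<^esub> x) \<in> Hj j" if j: "j \<in> W" for j
      proof (cases "k = j")
        case True
        have "Ar j \<odot>\<^bsub>M\<^esub> (E i \<odot>\<^bsub>M\<^esub> x) \<in> Hj j" using Hj(2)[OF j _ E_in_vs[OF xc]] x by blast
        then show ?thesis using Ar_E_smult[OF _ _ xc, of j] Wc[OF j] xc True by (simp add: smult_mult E_Ar)
      next
        case False
        then show ?thesis using xc k subsp_zero[OF Hj(1)[OF j]] by (simp add: smult_mult E_Ar)
      qed
      ultimately show ?thesis using xc by simp
    qed
  qed
  have "orb M u \<inter> ?N = {\<zero>\<^bsub>M\<^esub>}"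
  proof (rule equalityI; rule subsetI)
    fix x assume x: "x \<in> orb M u \<inter> ?N"
    then obtain a where a: "a \<in> carrier A" "x = a \<odot>\<^bsub>M\<^esub> u" by (auto simp: orb_def)
    have "sc (ev i a) \<odot>\<^bsub>M\<^esub> u \<in> H" using x a E_smult_diag[OF a(1) i(1) W(2)] by simp
    then have "ev i a = \<zero>\<^bsub>K\<^esub>" using subsp_sc_cancel[OF H(1), of "ev i a" u] ev_closed[OF a(1) i(1)] H(3) uc by blast
    moreover have "om j a = \<zero>\<^bsub>K\<^esub>" if j: "j \<in> W" for j
    proof -
      have "sc (om j a) \<odot>\<^bsub>M\<^esub> (Ar j \<odot>\<^bsub>M\<^esub> u) \<in> Hj j"
        using x a j E_smult_off[OF a(1) i(1) Wc(1,3)[OF j] W(2)] Wc[OF j] by auto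
      then show ?thesis 
        using subsp_sc_cancel[OF Hj(1)[OF j], of "om j a" "Ar j \<odot>\<^bsub>M\<^esub> u"] om_closed[OF a(1) Wc(1,4)[OF j]]
          Hj(3)[OF j] smult_closed[OF Ar_closed uc, of j] by blast
    qed
    ultimately show "x \<in> {\<zero>\<^bsub>M\<^esub>}" using smult_gen_zero_iff[OF g a(1)] a by blast
  next
    fix x assume "x \<in> {\<zero>\<^bsub>M\<^esub>}"
    then show "x \<in> orb M u \<inter> ?N"
      using submodule_zero[OF sN] submodule_zero[OF orb_submodule[OF uc]] by blast
  qed
  moreover have "orb M u <+>\<^bsub>M\<^esub> ?N = carrier M"
  proof (rule equalityI; rule subsetI)
    fix x assume "x \<in> orb M u <+>\<^bsub>M\<^esub> ?N"
    then show "x \<in> carrier M" using orb_sub[OF uc] by (auto simp: set_add_mem)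
  next
    fix x assume x: "x \<in> carrier M"
    obtain c where c: "c \<in> carrier K" "E i \<odot>\<^bsub>M\<^esub> x \<ominus>\<^bsub>M\<^esub> sc c \<odot>\<^bsub>M\<^esub> u \<in> H" using H(4)[of "E i \<odot>\<^bsub>M\<^esub> x"] x by auto
    have "\<exists>d. d \<in> carrier K \<and> E j \<odot>\<^bsub>M\<^esub> x \<ominus>\<^bsub>M\<^esub> sc d \<odot>\<^bsub>M\<^esub> (Ar j \<odot>\<^bsub>M\<^esub> u) \<in> Hj j" if "j \<in> W" for j
      using Hj(4)[OF that, of "E j \<odot>\<^bsub>M\<^esub> x"] x by auto
    then obtain d where d: "\<And>j. j \<in> W \<Longrightarrow> d j \<in> carrier K \<and> E j \<odot>\<^bsub>M\<^esub> x \<ominus>\<^bsub>M\<^esub> sc (d j) \<odot>\<^bsub>M\<^esub> (Ar j \<odot>\<^bsub>M\<^esub> u) \<in> Hj j"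
      by metis
    \<comment> \<open>One element of \<open>A\<close> collects the multiples that have to be
      subtracted at \<open>i\<close> and at the points of \<open>W\<close>.\<close>
    define a where "a = mk (\<lambda>_. c) (\<lambda>j. if j \<in> W then d j else \<zero>\<^bsub>K\<^esub>)"
    have a: "a \<in> carrier A" "ev i a = c" "\<And>j. j \<in> W \<Longrightarrow> om j a = d j"
      unfolding a_def using c d i Wc by (simp_all add: mk)
    let ?y = "x \<ominus>\<^bsub>M\<^esub> a \<odot>\<^bsub>M\<^esub> u"
    have yc: "?y \<in> carrier M" using x a uc by simp
    have "E i \<odot>\<^bsub>M\<^esub> ?y = E i \<odot>\<^bsub>M\<^esub> x \<ominus>\<^bsub>M\<^esub> sc c \<odot>\<^bsub>M\<^esub> u"
      using x a uc E_smult_diag[OF a(1) i(1) W(2)] by (simp add: a_minus_def smult_r_distr smult_r_minus)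
    moreover have "E j \<odot>\<^bsub>M\<^esub> ?y = E j \<odot>\<^bsub>M\<^esub> x \<ominus>\<^bsub>M\<^esub> sc (d j) \<odot>\<^bsub>M\<^esub> (Ar j \<odot>\<^bsub>M\<^esub> u)" if j: "j \<in> W" for j
      using x a uc j E_smult_off[OF a(1) i(1) Wc(1,3)[OF j] W(2)] Wc[OF j]
      by (simp add: a_minus_def smult_r_distr smult_r_minus)
    ultimately have "?y \<in> ?N" using yc c d by auto
    moreover have "x = a \<odot>\<^bsub>M\<^esub> u \<oplus>\<^bsub>M\<^esub> ?y"
      using x a uc by (simp add: a_minus_def M.a_comm M.a_lcomm M.r_neg M.r_neg1 M.r_neg2)
    moreover have "a \<odot>\<^bsub>M\<^esub> u \<in> orb M u" using a by (simp add: orbI)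
    ultimately show "x \<in> orb M u <+>\<^bsub>M\<^esub> ?N" unfolding set_add_mem by blast
  qed
  ultimately have "complementary A M (orb M u) ?N"
    using sN orb_submodule[OF uc] by (simp add: complementary_def)
  then show ?thesis using g by blast
qed

lemma indecomposable_string:
  assumes "indecomposable A M" shows "\<exists>i W u. gen M i W u \<and> carrier M = orb M u"
proof -
  obtain i W u N' where g: "gen M i W u" and c: "complementary A M (orb M u) N'"
    using string_summand_exists assms by (auto simp: indecomposable_def)
  have "orb M u \<noteq> {\<zero>\<^bsub>M\<^esub>}" using orb_self[OF gen_carr[OF g]] gen_nz[OF g] by auto
  then have "N' = {\<zero>\<^bsub>M\<^esub>}" using assms c by (auto simp: indecomposable_def)
  have "x \<in> orb M u" if x: "x \<in> carrier M" for x
  proof -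
    have "x \<in> orb M u <+>\<^bsub>M\<^esub> N'" using c x by (simp add: complementary_def)
    then obtain y where "y \<in> orb M u" "x = y \<oplus>\<^bsub>M\<^esub> \<zero>\<^bsub>M\<^esub>" using \<open>N' = {\<zero>\<^bsub>M\<^esub>}\<close> by (auto simp: set_add_mem)
    then show ?thesis using orb_sub[OF gen_carr[OF g]] by (simp add: subset_iff)
  qed
  then have "carrier M = orb M u" using orb_sub[OF gen_carr[OF g]] by blast
  then show ?thesis using g by blast
qed

text \<open>If \<open>u\<close> is the sum of \<open>x\<close> in \<open>N\<close> and
  \<open>y\<close> in \<open>N'\<close>, the component of \<open>x\<close> at \<open>i\<close> is a
  multiple of \<open>u\<close>. A nonzero multiple puts \<open>u\<close> into \<open>N\<close>; for
  a zero multiple the component of \<open>y\<close> at \<open>i\<close> is \<open>u\<close>, which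
  puts it into \<open>N'\<close>.\<close>

lemma string_indecomposable:
  assumes g: "gen M i W u" and M: "carrier M = orb M u" shows "indecomposable A M"
  unfolding indecomposable_def
proof (intro conjI allI impI)
  show "carrier M \<noteq> {\<zero>\<^bsub>M\<^esub>}" using gen_nz[OF g] gen_carr[OF g] by auto
  fix N N' assume c: "complementary A M N N'"
  have sub: "submodule N A M" "submodule N' A M" "N \<inter> N' = {\<zero>\<^bsub>M\<^esub>}" using c by (auto simp: complementary_def)
  have uc: "u \<in> carrier M" using gen_carr[OF g] .
  have *: "N1 = {\<zero>\<^bsub>M\<^esub>}" if "u \<in> N0" "N0 \<inter> N1 = {\<zero>\<^bsub>M\<^esub>}" "submodule N0 A M" "submodule N1 A M" for N0 N1
  proof -
    have "orb M u \<subseteq> N0" using that submodule_smult[OF that(3)] by (auto simp: orb_def)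
    then show ?thesis using that M submodule_carr[OF that(4)] by blast
  qed
  obtain x y where xy: "x \<in> N" "y \<in> N'" "u = x \<oplus>\<^bsub>M\<^esub> y"
  proof -
    have "u \<in> N <+>\<^bsub>M\<^esub> N'" using uc c by (simp add: complementary_def)
    then show thesis using that by (auto simp: set_add_mem)
  qed
  have xc: "x \<in> carrier M" "y \<in> carrier M" using xy sub submodule_carr by blast+
  obtain a where a: "a \<in> carrier A" "x = a \<odot>\<^bsub>M\<^esub> u" using xc M by (auto simp: orb_def)
  have ex: "E i \<odot>\<^bsub>M\<^esub> x = sc (ev i a) \<odot>\<^bsub>M\<^esub> u" using E_smult_diag[OF a(1) gen_point[OF g] gen_vs[OF g]] a by simp
  have ss: "subsp M N" using sub(1) submodule_carr[OF sub(1)] submodule_zero[OF sub(1)] submodule_add[OF sub(1)] submodule_smult[OF sub(1)]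
    by (auto simp: subsp_def)
  show "N = {\<zero>\<^bsub>M\<^esub>} \<or> N' = {\<zero>\<^bsub>M\<^esub>}"
  proof (cases "ev i a = \<zero>\<^bsub>K\<^esub>")
    case False
    have "sc (ev i a) \<odot>\<^bsub>M\<^esub> u \<in> N" using submodule_smult[OF sub(1) E_closed xy(1), of i] unfolding ex .
    moreover have "ev i a \<in> carrier K" using a(1) gen_point[OF g] by simp
    ultimately have "u \<in> N" using False uc by (rule subsp_sc_cancel[OF ss])
    then show ?thesis using *[of N N'] sub by blast
  next
    case True
    have "E i \<odot>\<^bsub>M\<^esub> u = E i \<odot>\<^bsub>M\<^esub> x \<oplus>\<^bsub>M\<^esub> E i \<odot>\<^bsub>M\<^esub> y" using xc xy by (simp add: smult_r_distr)
    then have "u = E i \<odot>\<^bsub>M\<^esub> y" using True ex xc uc vs_E[OF gen_vs[OF g]] by (simp add: sc_zero)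
    then have "u \<in> N'" using submodule_smult[OF sub(2), of "E i" y] xy by simp
    then show ?thesis using *[of N' N] sub by blast
  qed
qed

end

section \<open>Uniqueness of decompositions and basic modules\<close>

context rsz_mod
begin

lemma lin_vs: assumes "left_module A N" "lin A M N h" "x \<in> vs M i" shows "h x \<in> vs N i"
  using assms lin_smult[OF assms(2) E_closed, of x i] lin_closed[OF assms(2)] by (simp add: vs_def)

lemma retract_iso:
  assumes "retract M i W" "module_iso A M N" "left_module A N" shows "retract N i W"
proof -
  interpret N: rsz_mod K A V par ev om N by (rule rsz_modI) fact
  obtain h where h: "lin A M N h" "bij_betw h (carrier M) (carrier N)"
    using assms(2) by (auto simp: module_iso_def module_Hom_iff)
  define k where "k = inv_into (carrier M) h"
  have k: "lin A N M k" unfolding k_def by (rule lin_inv_into[OF h])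
  have kh: "k (h x) = x" if "x \<in> carrier M" for x
    using h(2) that by (simp add: k_def bij_betw_def)
  obtain u p where g: "gen M i W u" and p: "lin A M M p" "p u = u" "p ` carrier M \<subseteq> orb M u"
    using assms(1) by (auto simp: retract_def)
  have uc: "u \<in> carrier M" using gen_carr[OF g] .
  have z: "h x = \<zero>\<^bsub>N\<^esub> \<longleftrightarrow> x = \<zero>\<^bsub>M\<^esub>" if "x \<in> carrier M" for x
    using kh[OF that] kh[OF M.zero_closed] lin_zero[OF h(1) assms(3)] by metis
  have "Ar j \<odot>\<^bsub>N\<^esub> h u = h (Ar j \<odot>\<^bsub>M\<^esub> u)" for j using lin_smult[OF h(1) Ar_closed uc] by simp
  then have g': "gen N i W (h u)"
    using g lin_vs[OF assms(3) h(1) gen_vs[OF g]] z uc by (simp add: gen_def)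
  have "h (p (k y)) \<in> orb N (h u)" if y: "y \<in> carrier N" for y
  proof -
    obtain a where a: "a \<in> carrier A" "p (k y) = a \<odot>\<^bsub>M\<^esub> u"
      using p(3) lin_closed[OF k y] by (auto simp: orb_def)
    then show ?thesis using lin_smult[OF h(1) a(1) uc] N.orbI[OF a(1)] by simp
  qed
  then show ?thesis unfolding retract_def
    using g' lin_comp[OF k lin_comp[OF p(1) h(1)]] kh[OF uc] p(2)
    by (intro exI[of _ "h u"] exI[of _ "\<lambda>y. h (p (k y))"]) auto
qed

lemma strings_retract: "\<lbrakk>strings M I v W u \<pi>; s \<in> I\<rbrakk> \<Longrightarrow> retract M (v s) (W s)"
  unfolding retract_def
  by (intro exI[of _ "u s"] exI[of _ "\<pi> s"]) (auto simp: stringsD)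

text \<open>
  Some component of \<open>w\<close> is mapped by \<open>p\<close> to a nonzero multiple of \<open>w\<close>; that component lies in a
  string which starts at the same point, because \<open>w\<close> is not in the radical of \<open>orb M w\<close>.
\<close>

lemma retract_strings:
  assumes st: "strings M I v W u \<pi>" and r: "retract M i U"
  shows "\<exists>s\<in>I. v s = i \<and> W s = U"
proof -
  obtain w p where g: "gen M i U w" and p: "lin A M M p" "p w = w" "p ` carrier M \<subseteq> orb M w"
    using r by (auto simp: retract_def)
  have w: "w \<in> carrier M" "w \<in> vs M i" "w \<noteq> \<zero>\<^bsub>M\<^esub>" "i \<in> V"
    using gen_carr[OF g] gen_vs[OF g] gen_nz[OF g] gen_point[OF g] by auto
  have fi: "finite I" by (rule strings_finite[OF st])
  have pc: "\<pi> s w \<in> carrier M" if "s \<in> I" for s using lin_closed[OF strings_lin[OF st that] w(1)] .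
  \<comment> \<open>The images of the components of \<open>w\<close> under \<open>p\<close> add up
    to \<open>w\<close>.\<close>
  have "\<exists>s\<in>I. p (\<pi> s w) \<noteq> \<zero>\<^bsub>M\<^esub>"
  proof (rule ccontr)
    assume "\<not> ?thesis"
    then have "finsum M (\<lambda>s. p (\<pi> s w)) I = finsum M (\<lambda>s. \<zero>\<^bsub>M\<^esub>) I" by (intro M.finsum_cong') auto
    then have "p (finsum M (\<lambda>s. \<pi> s w) I) = \<zero>\<^bsub>M\<^esub>"
      using lin_finsum[OF p(1) left_module_axioms _ fi, of "\<lambda>s. \<pi> s w"] pc by simp
    then show False using strings_sum[OF st w(1)] p(2) w(3) by simp
  qed
  then obtain s where s: "s \<in> I" and nz: "p (\<pi> s w) \<noteq> \<zero>\<^bsub>M\<^esub>" by blast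
  define x where "x = \<pi> s w"
  have xv: "x \<in> vs M i" unfolding x_def by (rule lin_vs[OF left_module_axioms strings_lin[OF st s] w(2)])
  note xc = vs_carr[OF xv] and us = strings_gen[OF st s]
  have uc: "u s \<in> carrier M" using gen_carr[OF us] .
  obtain c where c: "c \<in> carrier K" "p x = sc c \<odot>\<^bsub>M\<^esub> w"
  proof -
    obtain a where a: "a \<in> carrier A" "p x = a \<odot>\<^bsub>M\<^esub> w" using p(3) xc by (auto simp: orb_def)
    have "p x = E i \<odot>\<^bsub>M\<^esub> p x" using vs_E[OF lin_vs[OF left_module_axioms p(1) xv]] by simp
    then show thesis using that[of "ev i a"] a E_smult_diag[OF a(1) w(4,2)] w(4) by simp
  qed
  have c0: "c \<noteq> \<zero>\<^bsub>K\<^esub>" using nz c w by (auto simp: x_def[symmetric] sc_zero)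
  obtain a where a: "a \<in> carrier A" "x = a \<odot>\<^bsub>M\<^esub> u s" using strings_orb[OF st s w(1)] by (auto simp: orb_def x_def)
  show ?thesis
  proof (cases "v s = i")
    case True
    have usv: "u s \<in> vs M i" using gen_vs[OF us] True by simp
    have xd: "x = sc (ev i a) \<odot>\<^bsub>M\<^esub> u s" using E_smult_diag[OF a(1) w(4) usv] vs_E[OF xv] a by simp
    have ek: "ev i a \<in> carrier K" using a w by simp
    have e0: "ev i a \<noteq> \<zero>\<^bsub>K\<^esub>" using xd uc nz lin_zero[OF p(1) left_module_axioms] by (auto simp: x_def[symmetric] sc_zero)
    have comm: "Ar j \<odot>\<^bsub>M\<^esub> (sc d \<odot>\<^bsub>M\<^esub> y) = sc d \<odot>\<^bsub>M\<^esub> (Ar j \<odot>\<^bsub>M\<^esub> y)" if "d \<in> carrier K" "y \<in> carrier M" for j d y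
      using that by (simp add: smult_mult sc_central)
    \<comment> \<open>Up to nonzero scalars, \<open>\<pi> s\<close> maps \<open>w\<close> to
      \<open>u s\<close> and \<open>p\<close> maps \<open>u s\<close> back to \<open>w\<close>, so
      the same arrows kill both.\<close>
    have "Ar j \<odot>\<^bsub>M\<^esub> u s = \<zero>\<^bsub>M\<^esub> \<longleftrightarrow> Ar j \<odot>\<^bsub>M\<^esub> w = \<zero>\<^bsub>M\<^esub>" for j
    proof
      assume "Ar j \<odot>\<^bsub>M\<^esub> u s = \<zero>\<^bsub>M\<^esub>"
      then have "Ar j \<odot>\<^bsub>M\<^esub> x = \<zero>\<^bsub>M\<^esub>" using xd comm[OF ek uc] ek by simp
      then have "Ar j \<odot>\<^bsub>M\<^esub> p x = \<zero>\<^bsub>M\<^esub>"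
        using lin_smult[OF p(1) Ar_closed xc, of j] lin_zero[OF p(1) left_module_axioms] by simp
      then have "sc c \<odot>\<^bsub>M\<^esub> (Ar j \<odot>\<^bsub>M\<^esub> w) = \<zero>\<^bsub>M\<^esub>" using c comm[OF c(1) w(1)] by simp
      then show "Ar j \<odot>\<^bsub>M\<^esub> w = \<zero>\<^bsub>M\<^esub>" using sc_smult_eq_zero[OF c(1), of "Ar j \<odot>\<^bsub>M\<^esub> w"] w c0 by auto
    next
      assume "Ar j \<odot>\<^bsub>M\<^esub> w = \<zero>\<^bsub>M\<^esub>"
      then have "Ar j \<odot>\<^bsub>M\<^esub> x = \<zero>\<^bsub>M\<^esub>" unfolding x_def
        using lin_smult[OF strings_lin[OF st s] Ar_closed w(1), of j]
          lin_zero[OF strings_lin[OF st s] left_module_axioms] by simp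
      then have "sc (ev i a) \<odot>\<^bsub>M\<^esub> (Ar j \<odot>\<^bsub>M\<^esub> u s) = \<zero>\<^bsub>M\<^esub>" using xd comm[OF ek uc] by simp
      then show "Ar j \<odot>\<^bsub>M\<^esub> u s = \<zero>\<^bsub>M\<^esub>" using sc_smult_eq_zero[OF ek, of "Ar j \<odot>\<^bsub>M\<^esub> u s"] uc e0 by auto
    qed
    then have "W s = U" using us g True by (auto simp: gen_def)
    then show ?thesis using s True by blast
  next
    \<comment> \<open>Then \<open>x\<close> is reached by the arrow into \<open>i\<close>, so
      \<open>p x\<close> is obtained by that arrow from an element of \<open>orb M w\<close>. But
      \<open>w\<close> lives at \<open>i\<close>, and the arrow starts at
      \<open>par i\<close>.\<close>
    case False
    have "x = (if par i = v s then sc (om i a) \<odot>\<^bsub>M\<^esub> (Ar i \<odot>\<^bsub>M\<^esub> u s) else \<zero>\<^bsub>M\<^esub>)"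
      using E_smult_off[OF a(1) gen_point[OF us] w(4) _ gen_vs[OF us]] False vs_E[OF xv] a by auto
    then have pi: "par i = v s" and xe: "x = sc (om i a) \<odot>\<^bsub>M\<^esub> (Ar i \<odot>\<^bsub>M\<^esub> u s)"
      using nz lin_zero[OF p(1) left_module_axioms] by (auto simp: x_def[symmetric] split: if_splits)
    have pV: "par i \<in> V" using pi gen_point[OF us] by simp
    have oc: "om i a \<in> carrier K" using a w pV by simp
    obtain b where b: "b \<in> carrier A" "p (u s) = b \<odot>\<^bsub>M\<^esub> w" using p(3) uc by (auto simp: orb_def)
    have "Ar i \<odot>\<^bsub>M\<^esub> w = \<zero>\<^bsub>M\<^esub>" using Ar_vs_off[OF w(4) pV w(2)] par_gt[OF w(4)] by simp
    then have "Ar i \<odot>\<^bsub>M\<^esub> p (u s) = \<zero>\<^bsub>M\<^esub>" using Ar_smult[OF b(1) w(4) pV w(1)] b w pV by simp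
    then have "p x = \<zero>\<^bsub>M\<^esub>"
      using xe lin_smult[OF p(1), of "sc (om i a)" "Ar i \<odot>\<^bsub>M\<^esub> u s"] lin_smult[OF p(1) Ar_closed uc, of i] oc uc
      by simp
    then show ?thesis using nz by (simp add: x_def)
  qed
qed

text \<open>\<open>retract\<close> is invariant under isomorphism, and the only type of which a
  single string has a retract is its own.\<close>

lemma gen_type_unique:
  assumes "gen M i W u" "left_module A N" "gen N i' W' u'"
    "module_iso A (M\<lparr>carrier := orb M u\<rparr>) (N\<lparr>carrier := orb N u'\<rparr>)"
  shows "i = i' \<and> W = W'"
proof -
  interpret N: rsz_mod K A V par ev om N by (rule rsz_modI) fact
  interpret O: rsz_mod K A V par ev om "M\<lparr>carrier := orb M u\<rparr>"
    by (intro rsz_modI submodule_module orb_submodule gen_carr[OF assms(1)])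
  interpret O': rsz_mod K A V par ev om "N\<lparr>carrier := orb N u'\<rparr>"
    by (intro rsz_modI N.submodule_module N.orb_submodule gen_carr[OF assms(3)])
  have "retract (M\<lparr>carrier := orb M u\<rparr>) i W"
    using O.strings_retract[OF strings_single[OF assms(1), of "()"]] by simp
  then have "retract (N\<lparr>carrier := orb N u'\<rparr>) i W"
    using O.retract_iso[OF _ assms(4) O'.left_module_axioms] by blast
  then show ?thesis using O'.retract_strings[OF N.strings_single[OF assms(3), of "()"]] by auto
qed

text \<open>The kernel of the projection is a complement.\<close>

lemma strings_summand:
  assumes st: "strings M I v W u \<pi>" and s: "s \<in> I"
  shows "orb M (u s) \<in> indec_summands A M"
proof -
  note g = strings_gen[OF st s]
  note uc = gen_carr[OF g] and l = strings_lin[OF st s]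
  interpret O: rsz_mod K A V par ev om "M\<lparr>carrier := orb M (u s)\<rparr>"
    by (intro rsz_modI submodule_module orb_submodule uc)
  have po: "\<pi> s (a \<odot>\<^bsub>M\<^esub> u s) = a \<odot>\<^bsub>M\<^esub> u s" if "a \<in> carrier A" for a
    using lin_smult[OF l that uc] strings_same[OF st s] by simp
  let ?N = "a_kernel M M (\<pi> s)"
  have sN: "submodule ?N A M" by (rule submodule_kernel[OF l left_module_axioms])
  have "orb M (u s) \<inter> ?N = {\<zero>\<^bsub>M\<^esub>}"
    using po submodule_zero[OF sN] submodule_zero[OF orb_submodule[OF uc]]
    by (auto simp: orb_def a_kernel_eq)
  moreover have "orb M (u s) <+>\<^bsub>M\<^esub> ?N = carrier M"
  proof (rule equalityI; rule subsetI)
    fix x assume "x \<in> orb M (u s) <+>\<^bsub>M\<^esub> ?N"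
    then show "x \<in> carrier M" using orb_sub[OF uc] by (auto simp: set_add_mem a_kernel_eq)
  next
    fix x assume x: "x \<in> carrier M"
    have p: "\<pi> s x \<in> orb M (u s)" "\<pi> s x \<in> carrier M"
      using strings_orb[OF st s x] lin_closed[OF l x] by auto
    have "\<pi> s (\<pi> s x) = \<pi> s x" using p po by (auto simp: orb_def)
    then have "x \<ominus>\<^bsub>M\<^esub> \<pi> s x \<in> ?N"
      using x p by (simp add: a_kernel_eq a_minus_def lin_add[OF l] lin_minus[OF l left_module_axioms] M.r_neg)
    moreover have "x = \<pi> s x \<oplus>\<^bsub>M\<^esub> (x \<ominus>\<^bsub>M\<^esub> \<pi> s x)"
      using x p by (simp add: a_minus_def M.a_comm M.a_lcomm M.r_neg M.r_neg1 M.r_neg2)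
    ultimately show "x \<in> orb M (u s) <+>\<^bsub>M\<^esub> ?N" using p unfolding set_add_mem by blast
  qed
  ultimately have "direct_summand A M (orb M (u s))"
    unfolding direct_summand_def complementary_def using sN orb_submodule[OF uc] by blast
  moreover have "indecomposable A (M\<lparr>carrier := orb M (u s)\<rparr>)"
    by (rule O.string_indecomposable[of "v s" "W s" "u s"])
      (use g orb_self[OF uc] gen_sub_iff[OF orb_submodule[OF uc]] in \<open>auto simp: orb_upd\<close>)
  ultimately show ?thesis by (simp add: indec_summands_def)
qed

lemma indec_submodule_string:
  assumes N: "submodule N A M" and ind: "indecomposable A (M\<lparr>carrier := N\<rparr>)"
  shows "\<exists>i W u. gen M i W u \<and> N = orb M u"
proof -
  interpret N: rsz_mod K A V par ev om "M\<lparr>carrier := N\<rparr>" by (intro rsz_modI submodule_module N)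
  obtain i W u where "gen (M\<lparr>carrier := N\<rparr>) i W u" "N = orb (M\<lparr>carrier := N\<rparr>) u"
    using N.indecomposable_string[OF ind] by auto
  then show ?thesis using gen_sub_iff[OF N] by (auto simp: orb_upd)
qed

text \<open>A complement of \<open>N\<close> defines a projection onto \<open>N\<close>. So the
  string \<open>N\<close> is a retract, and \<open>retract_strings\<close> finds its type in every
  decomposition of the module.\<close>

lemma summand_string:
  assumes "N \<in> indec_summands A M"
  shows "\<exists>i W u. gen M i W u \<and> N = orb M u \<and> retract M i W"
proof -
  obtain N' where c: "complementary A M N N'" and ind: "indecomposable A (M\<lparr>carrier := N\<rparr>)"
    using assms by (auto simp: indec_summands_def direct_summand_def)
  have sub: "submodule N A M" "submodule N' A M" "N \<inter> N' = {\<zero>\<^bsub>M\<^esub>}" and sum: "N <+>\<^bsub>M\<^esub> N' = carrier M"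
    using c by (auto simp: complementary_def)
  obtain i W u where g: "gen M i W u" and N: "N = orb M u"
    using indec_submodule_string[OF sub(1) ind] by blast
  have uN: "u \<in> N" using orb_self[OF gen_carr[OF g]] N by simp
  note cr = submodule_carr[OF sub(1)] submodule_carr[OF sub(2)]
  have uniq: "n = m" if "n \<in> N" "m \<in> N" "n' \<in> N'" "m' \<in> N'" "n \<oplus>\<^bsub>M\<^esub> n' = m \<oplus>\<^bsub>M\<^esub> m'" for n m n' m'
  proof -
    have "n \<ominus>\<^bsub>M\<^esub> m = m' \<ominus>\<^bsub>M\<^esub> n'"
    proof -
      have c: "n \<in> carrier M" "m \<in> carrier M" "n' \<in> carrier M" "m' \<in> carrier M" using that cr by auto
      have "n = (n \<oplus>\<^bsub>M\<^esub> n') \<oplus>\<^bsub>M\<^esub> \<ominus>\<^bsub>M\<^esub> n'" using c by (simp add: M.a_assoc M.r_neg)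
      also have "\<dots> = m \<oplus>\<^bsub>M\<^esub> (m' \<oplus>\<^bsub>M\<^esub> \<ominus>\<^bsub>M\<^esub> n')" using that(5) c by (simp add: M.a_assoc)
      finally have "n \<ominus>\<^bsub>M\<^esub> m = (m \<oplus>\<^bsub>M\<^esub> (m' \<oplus>\<^bsub>M\<^esub> \<ominus>\<^bsub>M\<^esub> n')) \<oplus>\<^bsub>M\<^esub> \<ominus>\<^bsub>M\<^esub> m" by (simp add: a_minus_def)
      also have "\<dots> = (m' \<oplus>\<^bsub>M\<^esub> \<ominus>\<^bsub>M\<^esub> n') \<oplus>\<^bsub>M\<^esub> (m \<oplus>\<^bsub>M\<^esub> \<ominus>\<^bsub>M\<^esub> m)" using c by (simp add: M.a_ac)
      also have "\<dots> = m' \<ominus>\<^bsub>M\<^esub> n'" using c by (simp add: a_minus_def M.r_neg)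
      finally show ?thesis .
    qed
    moreover have "n \<ominus>\<^bsub>M\<^esub> m \<in> N" "m' \<ominus>\<^bsub>M\<^esub> n' \<in> N'"
      using that sub by (auto simp: a_minus_def intro: submodule_add submodule_minus)
    ultimately have "n \<ominus>\<^bsub>M\<^esub> m = \<zero>\<^bsub>M\<^esub>" using sub(3) by auto
    then show ?thesis using that cr by (simp add: minus_zero_iff)
  qed
  have "\<exists>p. p \<in> N \<and> (\<exists>n'\<in>N'. x = p \<oplus>\<^bsub>M\<^esub> n')" if "x \<in> carrier M" for x
  proof -
    have "x \<in> N <+>\<^bsub>M\<^esub> N'" using that sum by simp
    then show ?thesis by (auto simp: set_add_mem)
  qed
  then obtain p where p: "\<And>x. x \<in> carrier M \<Longrightarrow> p x \<in> N \<and> (\<exists>n'\<in>N'. x = p x \<oplus>\<^bsub>M\<^esub> n')" by metis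
  have pI: "p x = n" if "x = n \<oplus>\<^bsub>M\<^esub> n'" "n \<in> N" "n' \<in> N'" for x n n'
  proof -
    have "x \<in> carrier M" using that cr by simp
    then obtain m' where "m' \<in> N'" "x = p x \<oplus>\<^bsub>M\<^esub> m'" "p x \<in> N" using p by blast
    then show ?thesis using uniq[of "p x" n m' n'] that by simp
  qed
  have "lin A M M p"
  proof (rule linI)
    fix x assume x: "x \<in> carrier M"
    then obtain n' where n': "n' \<in> N'" "x = p x \<oplus>\<^bsub>M\<^esub> n'" "p x \<in> N" using p by blast
    show "p x \<in> carrier M" using n' cr by blast
    show "p (x \<oplus>\<^bsub>M\<^esub> y) = p x \<oplus>\<^bsub>M\<^esub> p y" if y: "y \<in> carrier M" for y
    proof -
      obtain m' where m': "m' \<in> N'" "y = p y \<oplus>\<^bsub>M\<^esub> m'" "p y \<in> N" using p[OF y] by blast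
      have "(p x \<oplus>\<^bsub>M\<^esub> n') \<oplus>\<^bsub>M\<^esub> (p y \<oplus>\<^bsub>M\<^esub> m') = (p x \<oplus>\<^bsub>M\<^esub> p y) \<oplus>\<^bsub>M\<^esub> (n' \<oplus>\<^bsub>M\<^esub> m')"
      proof -
        have "p x \<in> carrier M" "n' \<in> carrier M" "p y \<in> carrier M" "m' \<in> carrier M"
          using n' m' cr by blast+
        then show ?thesis by (simp add: M.a_ac)
      qed
      then have "x \<oplus>\<^bsub>M\<^esub> y = (p x \<oplus>\<^bsub>M\<^esub> p y) \<oplus>\<^bsub>M\<^esub> (n' \<oplus>\<^bsub>M\<^esub> m')" using n'(2) m'(2) by simp
      then show ?thesis
        by (rule pI) (use n' m' sub in \<open>simp_all add: submodule_add\<close>)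
    qed
    show "p (a \<odot>\<^bsub>M\<^esub> x) = a \<odot>\<^bsub>M\<^esub> p x" if a: "a \<in> carrier A" for a
    proof -
      have "a \<odot>\<^bsub>M\<^esub> x = a \<odot>\<^bsub>M\<^esub> p x \<oplus>\<^bsub>M\<^esub> a \<odot>\<^bsub>M\<^esub> n'"
        using smult_r_distr[OF a cr(1)[OF n'(3)] cr(2)[OF n'(1)]] unfolding n'(2)[symmetric] .
      then show ?thesis by (rule pI) (use n' a sub in \<open>simp_all add: submodule_smult\<close>)
    qed
  qed
  moreover have "p u = u"
    using pI[of u u "\<zero>\<^bsub>M\<^esub>"] uN cr(1)[OF uN] submodule_zero[OF sub(2)] by simp
  ultimately have "retract M i W" unfolding retract_def using g p N by (intro exI[of _ u] exI[of _ p]) auto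
  then show ?thesis using g N by blast
qed

text \<open>There can be many more indecomposable summands than the listed ones, but the type is a
  complete invariant for them, and every type that occurs is one of the given decomposition.\<close>

lemma num_summands_strings:
  assumes st: "strings M I v W u \<pi>" shows "num_summands A M = card ((\<lambda>s. (v s, W s)) ` I)"
proof -
  \<comment> \<open>The type of a string; \<open>gen_type_unique\<close> makes the choice
    unambiguous.\<close>
  define \<tau> where "\<tau> L = (SOME t. \<exists>w. gen L (fst t) (snd t) w \<and> carrier L = orb L w)" for L :: "('r, 'v) module"
  have \<tau>: "\<tau> (M\<lparr>carrier := orb M w\<rparr>) = (i, U)" if g: "gen M i U w" for i U w
  proof -
    let ?L = "M\<lparr>carrier := orb M w\<rparr>"
    have so: "submodule (orb M w) A M" by (rule orb_submodule[OF gen_carr[OF g]])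
    have iff: "gen ?L i' U' w' \<and> carrier ?L = orb ?L w' \<longleftrightarrow> gen M i' U' w' \<and> orb M w = orb M w'" for i' U' w'
      using gen_sub_iff[OF so, of i' U' w'] orb_self[of w'] gen_carr[of M i' U' w'] by (auto simp: orb_upd)
    have "\<tau> ?L = (SOME t. \<exists>w'. gen M (fst t) (snd t) w' \<and> orb M w = orb M w')"
      unfolding \<tau>_def iff ..
    also have "\<dots> = (i, U)"
    proof (rule some_equality)
      show "\<exists>w'. gen M (fst (i, U)) (snd (i, U)) w' \<and> orb M w = orb M w'" using g by auto
      fix t assume "\<exists>w'. gen M (fst t) (snd t) w' \<and> orb M w = orb M w'"
      then obtain w' where w': "gen M (fst t) (snd t) w'" "orb M w = orb M w'" by blast
      then have "fst t = i \<and> snd t = U"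
        using gen_type_unique[OF w'(1) left_module_axioms g] left_module.module_iso_refl[OF submodule_module[OF so]]
        by simp
      then show "t = (i, U)" by (simp add: prod_eq_iff)
    qed
    finally show ?thesis .
  qed
  let ?S = "(\<lambda>N. M\<lparr>carrier := N\<rparr>) ` indec_summands A M"
  have iso: "module_iso A L L' \<longleftrightarrow> \<tau> L = \<tau> L'" if LL: "L \<in> ?S" "L' \<in> ?S" for L L'
  proof -
    obtain i U w where L: "gen M i U w" "L = M\<lparr>carrier := orb M w\<rparr>" using LL(1) summand_string by blast
    obtain i' U' w' where L': "gen M i' U' w'" "L' = M\<lparr>carrier := orb M w'\<rparr>" using LL(2) summand_string by blast
    show ?thesis unfolding L(2) L'(2) \<tau>[OF L(1)] \<tau>[OF L'(1)]
    proof
      show "(i, U) = (i', U')"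
        if "module_iso A (M\<lparr>carrier := orb M w\<rparr>) (M\<lparr>carrier := orb M w'\<rparr>)"
        using gen_type_unique[OF L(1) left_module_axioms L'(1) that] by simp
      show "module_iso A (M\<lparr>carrier := orb M w\<rparr>) (M\<lparr>carrier := orb M w'\<rparr>)" if "(i, U) = (i', U')"
        using gen_iso[OF L(1) left_module_axioms] L'(1) that by simp
    qed
  qed
  have "\<tau> ` ?S = (\<lambda>s. (v s, W s)) ` I"
  proof (rule equalityI; rule subsetI)
    fix t assume "t \<in> \<tau> ` ?S"
    then obtain N where N: "N \<in> indec_summands A M" "t = \<tau> (M\<lparr>carrier := N\<rparr>)" by blast
    then obtain i U w where w: "gen M i U w" "N = orb M w" "retract M i U" using summand_string by blast
    then show "t \<in> (\<lambda>s. (v s, W s)) ` I" using retract_strings[OF st w(3)] \<tau>[OF w(1)] N by force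
  next
    fix t assume "t \<in> (\<lambda>s. (v s, W s)) ` I"
    then obtain s where s: "s \<in> I" "t = (v s, W s)" by blast
    then have "t = \<tau> (M\<lparr>carrier := orb M (u s)\<rparr>)" using \<tau>[OF strings_gen[OF st s(1)]] by simp
    then show "t \<in> \<tau> ` ?S" using strings_summand[OF st s(1)] by blast
  qed
  then show ?thesis using iso_classes_count(1)[of ?S A \<tau>, OF iso] by (simp add: num_summands_def)
qed

text \<open>In an internal direct sum the components are unique, hence depend linearly on the
  vector. Pairwise nonisomorphic strings have different types.\<close>

lemma basic_imp_strings:
  assumes "basic_module A M"
  shows "\<exists>(I :: nat set) v W u \<pi>. strings M I v W u \<pi> \<and> inj_on (\<lambda>s. (v s, W s)) I"
proof -
  obtain S where S: "internal_direct_sum A M S" "\<And>N. N \<in> S \<Longrightarrow> indecomposable A (M\<lparr>carrier := N\<rparr>)"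
    "\<And>N N'. \<lbrakk>N \<in> S; N' \<in> S; N \<noteq> N'\<rbrakk> \<Longrightarrow> \<not> module_iso A (M\<lparr>carrier := N\<rparr>) (M\<lparr>carrier := N'\<rparr>)"
    using assms by (auto simp: basic_module_def)
  have fin: "finite S" and sub: "\<And>N. N \<in> S \<Longrightarrow> submodule N A M"
    and ex: "\<And>x. x \<in> carrier M \<Longrightarrow> \<exists>!f. f \<in> (\<Pi>\<^sub>E N\<in>S. N) \<and> x = finsum M f S"
    using S(1) by (auto simp: internal_direct_sum_def)
  have "\<exists>i W u. gen M i W u \<and> N = orb M u" if "N \<in> S" for N
    using indec_submodule_string[OF sub S(2)] that by blast
  then obtain v W u where g: "\<And>N. N \<in> S \<Longrightarrow> gen M (v N) (W N) (u N) \<and> orb M (u N) = N" by metis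
  define F where "F x = (THE f. f \<in> (\<Pi>\<^sub>E N\<in>S. N) \<and> x = finsum M f S)" for x
  have F: "F x \<in> (\<Pi>\<^sub>E N\<in>S. N) \<and> x = finsum M (F x) S" if "x \<in> carrier M" for x
    unfolding F_def by (rule theI'[OF ex[OF that]])
  have FI: "F (finsum M f S) N = f N" if f: "f \<in> (\<Pi> N\<in>S. N)" and N: "N \<in> S" for f N
  proof -
    have fc: "f \<in> S \<rightarrow> carrier M" using f submodule_carr[OF sub] by (auto simp: Pi_iff)
    have "restrict f S \<in> (\<Pi>\<^sub>E N\<in>S. N)" using f by auto
    moreover have "finsum M f S = finsum M (restrict f S) S" using fc by (intro M.finsum_cong') auto
    ultimately have "F (finsum M f S) = restrict f S"
      using ex[OF M.finsum_closed[OF fc]] F[OF M.finsum_closed[OF fc]] by blast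
    then show ?thesis using N by simp
  qed
  have Fm: "F x N \<in> N" "F x N \<in> carrier M" if "x \<in> carrier M" "N \<in> S" for x N
    using F[OF that(1)] that(2) submodule_carr[OF sub[OF that(2)]] by (auto simp: PiE_iff)
  have Fc: "F x \<in> S \<rightarrow> carrier M" if "x \<in> carrier M" for x using Fm[OF that] by auto
  have lin: "lin A M M (\<lambda>x. F x N)" if N: "N \<in> S" for N
  proof (rule linI)
    fix x assume x: "x \<in> carrier M"
    show "F x N \<in> carrier M" using Fm x N by blast
    show "F (x \<oplus>\<^bsub>M\<^esub> y) N = F x N \<oplus>\<^bsub>M\<^esub> F y N" if y: "y \<in> carrier M" for y
    proof -
      have "x \<oplus>\<^bsub>M\<^esub> y = finsum M (\<lambda>N. F x N \<oplus>\<^bsub>M\<^esub> F y N) S"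
        using M.finsum_addf[OF Fc[OF x] Fc[OF y]] F[OF x] F[OF y] by simp
      then show ?thesis
        using FI[of "\<lambda>N. F x N \<oplus>\<^bsub>M\<^esub> F y N", OF _ N] Fm(1)[OF x] Fm(1)[OF y] submodule_add[OF sub]
        by (simp add: Pi_iff)
    qed
    show "F (a \<odot>\<^bsub>M\<^esub> x) N = a \<odot>\<^bsub>M\<^esub> F x N" if a: "a \<in> carrier A" for a
    proof -
      have "a \<odot>\<^bsub>M\<^esub> x = finsum M (\<lambda>N. a \<odot>\<^bsub>M\<^esub> F x N) S"
        using smult_finsum[OF a Fc[OF x] fin] F[OF x] by simp
      then show ?thesis
        using FI[of "\<lambda>N. a \<odot>\<^bsub>M\<^esub> F x N", OF _ N] Fm(1)[OF x] submodule_smult[OF sub] a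
        by (simp add: Pi_iff)
    qed
  qed
  have Fu: "F (u N) N' = (if N' = N then u N else \<zero>\<^bsub>M\<^esub>)" if N: "N \<in> S" "N' \<in> S" for N N'
  proof -
    have uN: "u N \<in> N" "u N \<in> carrier M" 
      using g[OF N(1)] gen_carr[of M "v N" "W N" "u N"] orb_self[of "u N"] by auto
    let ?f = "\<lambda>N'. if N' = N then u N else \<zero>\<^bsub>M\<^esub>"
    have "?f \<in> (\<Pi> N\<in>S. N)" using uN submodule_zero[OF sub] by auto
    moreover have "finsum M ?f S = u N"
      using finsum_single[OF fin N(1), of ?f] uN by simp
    ultimately show ?thesis using FI[of ?f N'] N by simp
  qed
  have st: "strings M S v W u (\<lambda>N x. F x N)" unfolding strings_def
    using fin g lin Fu F Fm(1) by (auto simp: image_subset_iff) 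
  have inj: "inj_on (\<lambda>N. (v N, W N)) S"
  proof (rule inj_onI, rule ccontr)
    fix N N' assume *: "N \<in> S" "N' \<in> S" "(v N, W N) = (v N', W N')" "N \<noteq> N'"
    then have "module_iso A (M\<lparr>carrier := orb M (u N)\<rparr>) (M\<lparr>carrier := orb M (u N')\<rparr>)"
      using g[OF *(1)] g[OF *(2)] by (intro gen_iso[OF _ left_module_axioms, of "v N" "W N"]) auto
    then show False using S(3)[OF *(1,2,4)] g[OF *(1)] g[OF *(2)] by simp
  qed
  \<comment> \<open>Indices in \<open>nat\<close> are the ones that \<open>Model\<close> and
    \<open>has_types\<close> work with.\<close>
  obtain b where b: "bij_betw b {0..<card S} S" using ex_bij_betw_nat_finite[OF fin] by blast
  have "inj_on ((\<lambda>N. (v N, W N)) \<circ> b) {0..<card S}"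
    using b inj by (intro comp_inj_on) (auto simp: bij_betw_def)
  then show ?thesis using strings_reindex[OF st b] by (force simp: comp_def)
qed

text \<open>Applying \<open>\<pi> s\<close> to any expression of \<open>x\<close> as a sum over the
  summands recovers the term in the summand of \<open>s\<close>, so the expression is
  unique.\<close>

lemma strings_imp_basic:
  assumes st: "strings M I v W u \<pi>" and inj: "inj_on (\<lambda>s. (v s, W s)) I"
  shows "basic_module A M"
  unfolding basic_module_def
proof (intro exI[of _ "(\<lambda>s. orb M (u s)) ` I"] conjI ballI impI)
  let ?o = "\<lambda>s. orb M (u s)"
  note g = strings_gen[OF st]
  note uc = gen_carr[OF g]
  show "indecomposable A (M\<lparr>carrier := N\<rparr>)" if "N \<in> ?o ` I" for N
    using that strings_summand[OF st] by (auto simp: indec_summands_def)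
  show "\<not> module_iso A (M\<lparr>carrier := N\<rparr>) (M\<lparr>carrier := N'\<rparr>)" if NN: "N \<in> ?o ` I" "N' \<in> ?o ` I" "N \<noteq> N'" for N N'
  proof
    assume iso: "module_iso A (M\<lparr>carrier := N\<rparr>) (M\<lparr>carrier := N'\<rparr>)"
    obtain s t where st': "s \<in> I" "t \<in> I" "N = ?o s" "N' = ?o t" using NN(1,2) by blast
    have "(v s, W s) = (v t, W t)"
      using gen_type_unique[OF g[OF st'(1)] left_module_axioms g[OF st'(2)]] iso st'(3,4) by simp
    then have "s = t" by (rule inj_onD[OF inj _ st'(1,2)])
    then show False using NN(3) st'(3,4) by simp
  qed
  have po: "\<pi> s y = (if s = t then y else \<zero>\<^bsub>M\<^esub>)" if st': "s \<in> I" "t \<in> I" "y \<in> ?o t" for s t y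
  proof -
    obtain a where a: "a \<in> carrier A" "y = a \<odot>\<^bsub>M\<^esub> u t" using st' by (auto simp: orb_def)
    then show ?thesis
      using lin_smult[OF strings_lin[OF st st'(1)] a(1) uc[OF st'(2)]] strings_same[OF st st'(1)]
        strings_other[OF st st'(1,2)] by auto
  qed
  have oi: "inj_on ?o I"
  proof (rule inj_onI, rule ccontr)
    fix s t assume "s \<in> I" "t \<in> I" "?o s = ?o t" "s \<noteq> t"
    then show False using po[of s t "u s"] orb_self[OF uc[of s]] strings_same[OF st, of s] gen_nz[OF g[of s]] by simp
  qed
  show "internal_direct_sum A M (?o ` I)" unfolding internal_direct_sum_def
  proof (intro conjI ballI)
    show "finite (?o ` I)" using strings_finite[OF st] by simp
    show "submodule N A M" if "N \<in> ?o ` I" for N using that orb_submodule uc by auto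
    fix x assume x: "x \<in> carrier M"
    have pc: "\<pi> s x \<in> ?o s" "\<pi> s x \<in> carrier M" if "s \<in> I" for s
      using strings_orb[OF st that x] lin_closed[OF strings_lin[OF st that] x] by auto
    let ?f = "\<lambda>N\<in>?o ` I. \<pi> (inv_into I ?o N) x"
    have fo: "?f (?o s) = \<pi> s x" if "s \<in> I" for s
      using that inv_into_f_f[OF oi that] by simp
    show "\<exists>!f. f \<in> (\<Pi>\<^sub>E N\<in>?o ` I. N) \<and> x = finsum M f (?o ` I)"
    proof (rule ex1I[of _ ?f])
      have "finsum M ?f (?o ` I) = finsum M (\<lambda>s. ?f (?o s)) I"
        using M.finsum_reindex[of ?f ?o I] oi fo pc by (auto simp: Pi_iff)
      also have "\<dots> = finsum M (\<lambda>s. \<pi> s x) I" using pc fo by (intro M.finsum_cong') auto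
      finally show "?f \<in> (\<Pi>\<^sub>E N\<in>?o ` I. N) \<and> x = finsum M ?f (?o ` I)"
        using strings_sum[OF st x] fo pc by (auto simp: PiE_iff)
    next
      fix f assume f: "f \<in> (\<Pi>\<^sub>E N\<in>?o ` I. N) \<and> x = finsum M f (?o ` I)"
      have fm: "f (?o s) \<in> ?o s" "f (?o s) \<in> carrier M" if "s \<in> I" for s
        using f that orb_sub[OF uc[OF that]] by (auto simp: PiE_iff)
      have xs: "x = finsum M (\<lambda>s. f (?o s)) I"
        using M.finsum_reindex[of f ?o I] oi fm f by (auto simp: Pi_iff)
      have "f (?o s) = \<pi> s x" if s: "s \<in> I" for s
      proof -
        have "\<pi> s x = finsum M (\<lambda>t. \<pi> s (f (?o t))) I"
          unfolding xs by (rule lin_finsum[OF strings_lin[OF st s] left_module_axioms _ strings_finite[OF st]])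
            (use fm in auto)
        also have "\<dots> = \<pi> s (f (?o s))"
          using po[OF s _ fm(1)] fm s by (intro finsum_single strings_finite[OF st]) auto
        also have "\<dots> = f (?o s)" using po[OF s s fm(1)[OF s]] by simp
        finally show ?thesis by simp
      qed
      then show "f = ?f" using f fo by (intro extensionalityI[of _ "?o ` I"]) (auto simp: PiE_iff)
    qed
  qed
qed

end

section \<open>Model modules, dual bases and projective covers\<close>

context rsz
begin

text \<open>Pairs of an index and a point are coded as numbers, because the modules to be counted
  have elements of type \<open>nat \<Rightarrow> 'k\<close>.\<close>

definition codes :: "nat set \<Rightarrow> (nat \<Rightarrow> nat) \<Rightarrow> (nat \<Rightarrow> nat set) \<Rightarrow> nat set" where
  "codes I v W = {z. fst (prod_decode z) \<in> I \<and>
     (snd (prod_decode z) = v (fst (prod_decode z)) \<or> snd (prod_decode z) \<in> W (fst (prod_decode z)))}"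

text \<open>The coordinate at \<open>prod_encode (s, j)\<close> belongs to the string with index \<open>s\<close> and to the point \<open>j\<close>.\<close>

definition Model :: "nat set \<Rightarrow> (nat \<Rightarrow> nat) \<Rightarrow> (nat \<Rightarrow> nat set) \<Rightarrow> ('r, nat \<Rightarrow> 'k) module" where
  "Model I v W = \<lparr>carrier = {\<phi>. \<forall>z. \<phi> z \<in> carrier K \<and> (z \<notin> codes I v W \<longrightarrow> \<phi> z = \<zero>\<^bsub>K\<^esub>)},
     monoid.mult = undefined, one = undefined, zero = (\<lambda>_. \<zero>\<^bsub>K\<^esub>), add = (\<lambda>\<phi> \<psi> z. \<phi> z \<oplus>\<^bsub>K\<^esub> \<psi> z),
     smult = (\<lambda>a \<phi> z. if z \<in> codes I v W then
       (if snd (prod_decode z) = v (fst (prod_decode z)) then ev (snd (prod_decode z)) a \<otimes>\<^bsub>K\<^esub> \<phi> z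
        else ev (snd (prod_decode z)) a \<otimes>\<^bsub>K\<^esub> \<phi> z \<oplus>\<^bsub>K\<^esub>
          om (snd (prod_decode z)) a \<otimes>\<^bsub>K\<^esub> \<phi> (prod_encode (fst (prod_decode z), v (fst (prod_decode z)))))
       else \<zero>\<^bsub>K\<^esub>)\<rparr>"

lemma codes_enc [simp]: "prod_encode (s, j) \<in> codes I v W \<longleftrightarrow> s \<in> I \<and> (j = v s \<or> j \<in> W s)"
  by (simp add: codes_def)

lemma enc_ext: "(\<And>s j. f (prod_encode (s, j)) = g (prod_encode (s, j))) \<Longrightarrow> f = g"
  by (rule ext) (metis prod_decode_inverse surj_pair)

lemma Mod_carrier: "\<phi> \<in> carrier (Model I v W) \<longleftrightarrow>
    (\<forall>s j. \<phi> (prod_encode (s, j)) \<in> carrier K \<and> (\<not> (s \<in> I \<and> (j = v s \<or> j \<in> W s)) \<longrightarrow> \<phi> (prod_encode (s, j)) = \<zero>\<^bsub>K\<^esub>))"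
proof
  assume *: "\<forall>s j. \<phi> (prod_encode (s, j)) \<in> carrier K \<and>
    (\<not> (s \<in> I \<and> (j = v s \<or> j \<in> W s)) \<longrightarrow> \<phi> (prod_encode (s, j)) = \<zero>\<^bsub>K\<^esub>)"
  have "\<phi> z \<in> carrier K \<and> (z \<notin> codes I v W \<longrightarrow> \<phi> z = \<zero>\<^bsub>K\<^esub>)" for z
    using *[rule_format, of "fst (prod_decode z)" "snd (prod_decode z)"] by (auto simp: codes_def)
  then show "\<phi> \<in> carrier (Model I v W)" by (simp add: Model_def)
next
  assume "\<phi> \<in> carrier (Model I v W)"
  then have "\<phi> z \<in> carrier K \<and> (z \<notin> codes I v W \<longrightarrow> \<phi> z = \<zero>\<^bsub>K\<^esub>)" for z by (simp add: Model_def)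
  from this[of "prod_encode (_, _)"] show "\<forall>s j. \<phi> (prod_encode (s, j)) \<in> carrier K \<and>
      (\<not> (s \<in> I \<and> (j = v s \<or> j \<in> W s)) \<longrightarrow> \<phi> (prod_encode (s, j)) = \<zero>\<^bsub>K\<^esub>)"
    unfolding codes_enc by blast
qed

lemma Mod_simps:
  "zero (Model I v W) = (\<lambda>_. \<zero>\<^bsub>K\<^esub>)"
  "(\<phi> \<oplus>\<^bsub>Model I v W\<^esub> \<psi>) = (\<lambda>z. \<phi> z \<oplus>\<^bsub>K\<^esub> \<psi> z)"
  "(a \<odot>\<^bsub>Model I v W\<^esub> \<phi>) (prod_encode (s, j)) = (if s \<in> I \<and> (j = v s \<or> j \<in> W s) then
       (if j = v s then ev j a \<otimes>\<^bsub>K\<^esub> \<phi> (prod_encode (s, j))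
        else ev j a \<otimes>\<^bsub>K\<^esub> \<phi> (prod_encode (s, j)) \<oplus>\<^bsub>K\<^esub> om j a \<otimes>\<^bsub>K\<^esub> \<phi> (prod_encode (s, v s)))
       else \<zero>\<^bsub>K\<^esub>)"
  by (simp_all add: Model_def)

definition ugen :: "(nat \<Rightarrow> nat) \<Rightarrow> nat \<Rightarrow> nat \<Rightarrow> 'k" where
  "ugen v s = (\<lambda>z. if z = prod_encode (s, v s) then \<one>\<^bsub>K\<^esub> else \<zero>\<^bsub>K\<^esub>)"

definition upr :: "nat \<Rightarrow> (nat \<Rightarrow> 'k) \<Rightarrow> nat \<Rightarrow> 'k" where
  "upr s \<phi> = (\<lambda>z. if fst (prod_decode z) = s then \<phi> z else \<zero>\<^bsub>K\<^esub>)"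

context
  fixes I :: "nat set" and v :: "nat \<Rightarrow> nat" and W :: "nat \<Rightarrow> nat set"
  assumes fin: "finite I" and vV: "\<And>s. s \<in> I \<Longrightarrow> v s \<in> V" and Wch: "\<And>s. s \<in> I \<Longrightarrow> W s \<subseteq> ch (v s)"
begin

lemma Mod_points:
  assumes "s \<in> I" "j \<in> W s" shows "j \<in> V" "par j = v s" "j \<noteq> v s" "v s \<in> V"
  using Wch[OF assms(1)] assms vV ch_irrefl by (auto simp: ch_def)

lemma Mod_eqI:
  assumes "\<And>s. \<lbrakk>s \<in> I; v s \<in> V\<rbrakk> \<Longrightarrow> f (prod_encode (s, v s)) = g (prod_encode (s, v s))"
    and "\<And>s j. \<lbrakk>s \<in> I; j \<in> W s; j \<in> V; par j = v s; j \<noteq> v s; v s \<in> V\<rbrakk> \<Longrightarrow>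
      f (prod_encode (s, j)) = g (prod_encode (s, j))"
    and "\<And>s j. \<not> (s \<in> I \<and> (j = v s \<or> j \<in> W s)) \<Longrightarrow> f (prod_encode (s, j)) = g (prod_encode (s, j))"
  shows "f = g"
proof (rule enc_ext)
  fix s j
  consider "s \<in> I" "j = v s" | "s \<in> I" "j \<in> W s" "j \<noteq> v s" | "\<not> (s \<in> I \<and> (j = v s \<or> j \<in> W s))" by blast
  then show "f (prod_encode (s, j)) = g (prod_encode (s, j))"
  proof cases
    case 1 then show ?thesis using assms(1) vV by simp
  next
    case 2 then show ?thesis using assms(2) Mod_points by simp
  next
    case 3 then show ?thesis by (rule assms(3))
  qed
qed

lemma Mod_memI:
  assumes "\<And>s. \<lbrakk>s \<in> I; v s \<in> V\<rbrakk> \<Longrightarrow> f (prod_encode (s, v s)) \<in> carrier K"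
    and "\<And>s j. \<lbrakk>s \<in> I; j \<in> W s; j \<in> V; par j = v s; j \<noteq> v s; v s \<in> V\<rbrakk> \<Longrightarrow> f (prod_encode (s, j)) \<in> carrier K"
    and "\<And>s j. \<not> (s \<in> I \<and> (j = v s \<or> j \<in> W s)) \<Longrightarrow> f (prod_encode (s, j)) = \<zero>\<^bsub>K\<^esub>"
  shows "f \<in> carrier (Model I v W)"
  unfolding Mod_carrier
proof (intro allI)
  fix s j
  consider "s \<in> I" "j = v s" | "s \<in> I" "j \<in> W s" "j \<noteq> v s" | "\<not> (s \<in> I \<and> (j = v s \<or> j \<in> W s))" by blast
  then show "f (prod_encode (s, j)) \<in> carrier K \<and>
      (\<not> (s \<in> I \<and> (j = v s \<or> j \<in> W s)) \<longrightarrow> f (prod_encode (s, j)) = \<zero>\<^bsub>K\<^esub>)"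
  proof cases
    case 1 then show ?thesis using assms(1) vV by simp
  next
    case 2 then show ?thesis using assms(2) Mod_points by simp
  next
    case 3 then show ?thesis using assms(3) by simp
  qed
qed

lemma Mod_module: "left_module A (Model I v W)"
proof (intro left_module.intro left_module_axioms.intro)
  show "ring A" by (rule ring_axioms)
  let ?M = "Model I v W"
  have mem: "\<phi> (prod_encode (s, j)) \<in> carrier K" if "\<phi> \<in> carrier ?M" for \<phi> s j
    using that by (simp add: Mod_carrier)
  show "abelian_group ?M"
  proof (rule abelian_groupI)
    fix \<phi> assume "\<phi> \<in> carrier ?M"
    then show "\<exists>\<psi>\<in>carrier ?M. \<psi> \<oplus>\<^bsub>?M\<^esub> \<phi> = \<zero>\<^bsub>?M\<^esub>"
      by (intro bexI[of _ "\<lambda>z. \<ominus>\<^bsub>K\<^esub> \<phi> z"]) (auto simp: Model_def K.l_neg)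
  qed (auto simp: Model_def K.a_ac)
  fix a \<phi> assume a: "a \<in> carrier A" and \<phi>: "\<phi> \<in> carrier ?M"
  show "a \<odot>\<^bsub>?M\<^esub> \<phi> \<in> carrier ?M"
    using a mem[OF \<phi>] by (intro Mod_memI) (auto simp: Mod_simps)
  show "a \<odot>\<^bsub>?M\<^esub> (\<phi> \<oplus>\<^bsub>?M\<^esub> \<psi>) = a \<odot>\<^bsub>?M\<^esub> \<phi> \<oplus>\<^bsub>?M\<^esub> a \<odot>\<^bsub>?M\<^esub> \<psi>" if "\<psi> \<in> carrier ?M" for \<psi>
    using a mem[OF \<phi>] mem[OF that]
    by (intro Mod_eqI) (auto simp: Mod_simps K.r_distr K.a_ac)
  show "(a \<oplus> b) \<odot>\<^bsub>?M\<^esub> \<phi> = a \<odot>\<^bsub>?M\<^esub> \<phi> \<oplus>\<^bsub>?M\<^esub> b \<odot>\<^bsub>?M\<^esub> \<phi>" if "b \<in> carrier A" for b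
    using a that mem[OF \<phi>]
    by (intro Mod_eqI) (auto simp: Mod_simps K.l_distr K.a_ac)
  show "(a \<otimes> b) \<odot>\<^bsub>?M\<^esub> \<phi> = a \<odot>\<^bsub>?M\<^esub> (b \<odot>\<^bsub>?M\<^esub> \<phi>)" if "b \<in> carrier A" for b
    using a that mem[OF \<phi>]
    by (intro Mod_eqI) (auto simp: Mod_simps K.l_distr K.r_distr K.a_assoc K.m_assoc)
next
  fix \<phi> assume \<phi>: "\<phi> \<in> carrier (Model I v W)"
  then show "\<one> \<odot>\<^bsub>Model I v W\<^esub> \<phi> = \<phi>"
    using \<phi> by (intro Mod_eqI) (auto simp: Mod_simps Mod_carrier)
qed

lemma Mod_strings: "strings (Model I v W) I v W (ugen v) upr"
proof -
  let ?M = "Model I v W"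
  interpret M: rsz_mod K A V par ev om ?M by (intro rsz_mod.intro rsz_axioms Mod_module)
  note mem = Mod_carrier[THEN iffD1, rule_format]
  have uc: "ugen v s \<in> carrier ?M" if "s \<in> I" for s
    using that by (auto simp: Mod_carrier ugen_def)
  have gen: "gen ?M (v s) (W s) (ugen v s)" if s: "s \<in> I" for s
  proof -
    have "E (v s) \<odot>\<^bsub>?M\<^esub> ugen v s = ugen v s"
      using s by (intro Mod_eqI) (auto simp: Mod_simps ugen_def)
    moreover have "ugen v s \<noteq> \<zero>\<^bsub>?M\<^esub>"
      by (auto simp: ugen_def Mod_simps fun_eq_iff intro!: exI[of _ "prod_encode (s, v s)"])
    moreover have "Ar j \<odot>\<^bsub>?M\<^esub> ugen v s \<noteq> \<zero>\<^bsub>?M\<^esub> \<longleftrightarrow> j \<in> W s" if j: "j \<in> ch (v s)" for j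
    proof
      assume "j \<in> W s"
      then have "(Ar j \<odot>\<^bsub>?M\<^esub> ugen v s) (prod_encode (s, j)) = \<one>\<^bsub>K\<^esub>"
        using Mod_points[OF s] vV s by (auto simp: Mod_simps ugen_def)
      moreover have "(\<zero>\<^bsub>?M\<^esub>) (prod_encode (s, j)) = \<zero>\<^bsub>K\<^esub>" by (simp add: Mod_simps)
      ultimately show "Ar j \<odot>\<^bsub>?M\<^esub> ugen v s \<noteq> \<zero>\<^bsub>?M\<^esub>" using K.one_not_zero by metis
    next
      assume *: "Ar j \<odot>\<^bsub>?M\<^esub> ugen v s \<noteq> \<zero>\<^bsub>?M\<^esub>"
      show "j \<in> W s"
      proof (rule ccontr)
        assume "j \<notin> W s"
        then have "Ar j \<odot>\<^bsub>?M\<^esub> ugen v s = \<zero>\<^bsub>?M\<^esub>"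
          using s by (intro Mod_eqI) (auto simp: Mod_simps ugen_def)
        then show False using * by blast
      qed
    qed
    ultimately show ?thesis using s vV uc[OF s] Wch[OF s] by (auto simp: gen_def vs_def)
  qed
  have lin: "lin A ?M ?M (upr s)" if s: "s \<in> I" for s
  proof (rule linI)
    fix \<phi> assume \<phi>: "\<phi> \<in> carrier ?M"
    show "upr s \<phi> \<in> carrier ?M" using mem[OF \<phi>] by (auto simp: Mod_carrier upr_def)
    show "upr s (\<phi> \<oplus>\<^bsub>?M\<^esub> \<psi>) = upr s \<phi> \<oplus>\<^bsub>?M\<^esub> upr s \<psi>" for \<psi>
      by (intro enc_ext) (auto simp: Mod_simps upr_def)
    show "upr s (a \<odot>\<^bsub>?M\<^esub> \<phi>) = a \<odot>\<^bsub>?M\<^esub> upr s \<phi>" if "a \<in> carrier A" for a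
      using that by (intro Mod_eqI) (auto simp: Mod_simps upr_def)
  qed
  have orb: "upr s \<phi> \<in> orb ?M (ugen v s)" if s: "s \<in> I" and \<phi>: "\<phi> \<in> carrier ?M" for s \<phi>
  proof -
    \<comment> \<open>The coordinates of the component, read as those of an algebra element that
      carries the generator to it.\<close>
    define a where "a = mk (\<lambda>i. if i = v s then \<phi> (prod_encode (s, i)) else \<zero>\<^bsub>K\<^esub>) (\<lambda>j. \<phi> (prod_encode (s, j)))"
    have a: "a \<in> carrier A" "\<And>i. i \<in> V \<Longrightarrow> ev i a = (if i = v s then \<phi> (prod_encode (s, i)) else \<zero>\<^bsub>K\<^esub>)"
      "\<And>j. \<lbrakk>j \<in> V; par j \<in> V\<rbrakk> \<Longrightarrow> om j a = \<phi> (prod_encode (s, j))"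
      unfolding a_def using mem[OF \<phi>] by (simp_all add: mk)
    have "upr s \<phi> = a \<odot>\<^bsub>?M\<^esub> ugen v s"
      using mem[OF \<phi>] s by (intro Mod_eqI) (auto simp: Mod_simps upr_def ugen_def a)
    then show ?thesis using a(1) by (simp add: orb_def)
  qed
  have sum: "finsum ?M (\<lambda>s. upr s \<phi>) J = (\<lambda>z. if fst (prod_decode z) \<in> J then \<phi> z else \<zero>\<^bsub>K\<^esub>)"
    if \<phi>: "\<phi> \<in> carrier ?M" and J: "finite J" "J \<subseteq> I" for \<phi> J
    using J
  proof (induct J rule: finite_induct)
    case (insert s J)
    then have "finsum ?M (\<lambda>s. upr s \<phi>) (insert s J) = upr s \<phi> \<oplus>\<^bsub>?M\<^esub> finsum ?M (\<lambda>s. upr s \<phi>) J"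
      using lin_closed[OF lin \<phi>] by (intro M.M.finsum_insert) auto
    then show ?case using insert mem[OF \<phi>] by (intro enc_ext) (auto simp: Mod_simps upr_def)
  qed (simp add: Mod_simps)
  have "finsum ?M (\<lambda>s. upr s \<phi>) I = \<phi>" if \<phi>: "\<phi> \<in> carrier ?M" for \<phi>
    using sum[OF \<phi> fin subset_refl] mem[OF \<phi>] by (intro enc_ext) auto
  moreover have "upr s (ugen v s) = ugen v s" for s by (intro enc_ext) (auto simp: upr_def ugen_def)
  moreover have "upr s (ugen v t) = \<zero>\<^bsub>?M\<^esub>" if "t \<noteq> s" for s t
    using that by (intro enc_ext) (auto simp: upr_def ugen_def Mod_simps)
  ultimately show ?thesis unfolding strings_def using fin gen lin orb by (auto simp: image_subset_iff)
qed

end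

text \<open>A dual basis of a finitely generated projective module: \<open>P\<close> is isomorphic
  to the sum of the left ideals generated by the idempotents \<open>E (v s)\<close>, the vectors
  \<open>p s\<close> are its generators, and \<open>q s\<close> is the coordinate map into the left
  ideal of \<open>E (v s)\<close>.\<close>

definition dual :: "('r, 'v) module \<Rightarrow> 'i set \<Rightarrow> ('i \<Rightarrow> nat) \<Rightarrow> ('i \<Rightarrow> 'v) \<Rightarrow> ('i \<Rightarrow> 'v \<Rightarrow> 'r) \<Rightarrow> bool" where
  "dual P I v p q \<longleftrightarrow> finite I \<and>
     (\<forall>s\<in>I. v s \<in> V \<and> p s \<in> vs P (v s) \<and> lin A P (regular_module A) (q s) \<and>
       (\<forall>x\<in>carrier P. q s x \<otimes> E (v s) = q s x) \<and> (\<forall>t\<in>I. q s (p t) = (if s = t then E (v s) else \<zero>))) \<and>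
     (\<forall>x\<in>carrier P. x = finsum P (\<lambda>s. q s x \<odot>\<^bsub>P\<^esub> p s) I)"

lemma dualD:
  assumes "dual P I v p q"
  shows dual_finite: "finite I" and dual_point: "s \<in> I \<Longrightarrow> v s \<in> V" and dual_vs: "s \<in> I \<Longrightarrow> p s \<in> vs P (v s)"
    and dual_lin: "s \<in> I \<Longrightarrow> lin A P (regular_module A) (q s)"
    and dual_right: "\<lbrakk>s \<in> I; x \<in> carrier P\<rbrakk> \<Longrightarrow> q s x \<otimes> E (v s) = q s x"
    and dual_delta: "\<lbrakk>s \<in> I; t \<in> I\<rbrakk> \<Longrightarrow> q s (p t) = (if s = t then E (v s) else \<zero>)"
    and dual_sum: "x \<in> carrier P \<Longrightarrow> finsum P (\<lambda>s. q s x \<odot>\<^bsub>P\<^esub> p s) I = x"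
  using assms unfolding dual_def by (blast, blast, blast, blast, blast, blast, metis)

lemma dual_closed: "\<lbrakk>dual P I v p q; s \<in> I; x \<in> carrier P\<rbrakk> \<Longrightarrow> q s x \<in> carrier A"
  using lin_closed[OF dual_lin, of P I v p q s x] by (simp add: regular_simps)

lemma dual_carr: "\<lbrakk>dual P I v p q; s \<in> I\<rbrakk> \<Longrightarrow> p s \<in> carrier P"
  using dual_vs[of P I v p q s] by (simp add: vs_def)

lemma regular_lin_simps:
  assumes "lin A P (regular_module A) h"
  shows "x \<in> carrier P \<Longrightarrow> h x \<in> carrier A" "\<lbrakk>x \<in> carrier P; y \<in> carrier P\<rbrakk> \<Longrightarrow> h (x \<oplus>\<^bsub>P\<^esub> y) = h x \<oplus> h y"
    "\<lbrakk>a \<in> carrier A; x \<in> carrier P\<rbrakk> \<Longrightarrow> h (a \<odot>\<^bsub>P\<^esub> x) = a \<otimes> h x"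
  using lin_closed[OF assms] lin_add[OF assms] lin_smult[OF assms] by (simp_all add: regular_simps)

end

section \<open>Projectivity through dual bases\<close>

context rsz_mod
begin

lemma lin_right_mult:
  assumes N: "left_module A N" and h: "lin A M (regular_module A) h" and m: "m \<in> carrier N"
  shows "lin A M N (\<lambda>x. h x \<odot>\<^bsub>N\<^esub> m)"
proof -
  interpret N: rsz_mod K A V par ev om N by (rule rsz_modI) fact
  note r = regular_lin_simps[OF h]
  show ?thesis
    by (rule linI) (use r m in \<open>simp_all add: N.smult_l_distr N.smult_assoc\<close>)
qed

text \<open>A string that keeps all children of its point is the indecomposable projective at that
  point; the coordinate maps come from \<open>strings_extend\<close>.\<close>

lemma free_dual:
  assumes st: "strings M I v (\<lambda>s. ch (v s)) p \<pi>" shows "\<exists>q. dual M I v p q"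
proof -
  interpret R: rsz_mod K A V par ev om "regular_module A" by (intro rsz_modI regular_left_module)
  have "\<exists>h. lin A M (regular_module A) h \<and> (\<forall>s\<in>I. h (p s) = (if s = t then E (v t) else \<zero>))" if "t \<in> I" for t
    by (rule strings_extend[OF st regular_left_module])
      (use R.zero_in_vs in \<open>auto simp: regular_simps vs_def E_E\<close>)
  then obtain q where q: "\<And>t. t \<in> I \<Longrightarrow> lin A M (regular_module A) (q t)"
    "\<And>s t. \<lbrakk>t \<in> I; s \<in> I\<rbrakk> \<Longrightarrow> q t (p s) = (if s = t then E (v t) else \<zero>)" by metis
  have pc: "p s \<in> carrier M" "E (v s) \<odot>\<^bsub>M\<^esub> p s = p s" if "s \<in> I" for s
    using gen_vs[OF strings_gen[OF st that]] by (auto simp: vs_def)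
  have "q t x \<otimes> E (v t) = q t x" if "t \<in> I" "x \<in> carrier M" for t x
    by (rule lin_agree[OF st regular_left_module _ q(1)[OF that(1)] _ that(2)])
      (use lin_right_mult[OF regular_left_module q(1)[OF that(1)], of "E (v t)"] q that
        in \<open>auto simp: regular_simps E_E\<close>)
  moreover have "x = finsum M (\<lambda>s. q s x \<odot>\<^bsub>M\<^esub> p s) I" if x: "x \<in> carrier M" for x
  proof -
    have e: "q t x \<odot>\<^bsub>M\<^esub> p t = \<pi> t x" if "t \<in> I" for t
      by (rule lin_agree[OF st left_module_axioms _ strings_lin[OF st that] _ x])
        (use lin_right_mult[OF left_module_axioms q(1)[OF that] pc(1)[OF that]] q that pc
          strings_same[OF st] strings_other[OF st] in auto)
    have "finsum M (\<lambda>s. q s x \<odot>\<^bsub>M\<^esub> p s) I = finsum M (\<lambda>s. \<pi> s x) I"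
      using e lin_closed[OF strings_lin[OF st] x] by (intro M.finsum_cong') auto
    then show ?thesis using strings_sum[OF st x] by simp
  qed
  ultimately have "dual M I v p q" unfolding dual_def
  proof (intro conjI ballI)
    show "finite I" by (rule strings_finite[OF st])
    fix s assume s: "s \<in> I"
    show "v s \<in> V" "p s \<in> vs M (v s)" using strings_gen[OF st s] by (auto simp: gen_def)
    show "lin A M (regular_module A) (q s)" by (rule q(1)[OF s])
    show "q s (p t) = (if s = t then E (v s) else \<zero>)" if "t \<in> I" for t using q(2)[OF s that] by auto
  qed
  then show ?thesis by blast
qed

lemma dual_extend:
  assumes d: "dual M I v p q" and N: "left_module A N" and m: "\<And>s. s \<in> I \<Longrightarrow> m s \<in> vs N (v s)"
  shows "\<exists>h. lin A M N h \<and> (\<forall>s\<in>I. h (p s) = m s)"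
proof -
  interpret N: rsz_mod K A V par ev om N by (rule rsz_modI) fact
  let ?h = "\<lambda>x. finsum N (\<lambda>s. q s x \<odot>\<^bsub>N\<^esub> m s) I"
  have mc: "m s \<in> carrier N" "E (v s) \<odot>\<^bsub>N\<^esub> m s = m s" if "s \<in> I" for s
    using m[OF that] by (auto simp: vs_def)
  have "lin A M N ?h"
    using lin_right_mult[OF N dual_lin[OF d]] mc by (intro lin_finsum_maps[OF N dual_finite[OF d]]) auto
  moreover have "?h (p t) = m t" if t: "t \<in> I" for t
    using N.finsum_single[OF dual_finite[OF d] t, of "\<lambda>s. q s (p t) \<odot>\<^bsub>N\<^esub> m s"] dual_delta[OF d _ t] mc t by simp
  ultimately show ?thesis by blast
qed

lemma dual_agree:
  assumes d: "dual M I v p q" and N: "left_module A N" and h: "lin A M N h" and k: "lin A M N k"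
    and eq: "\<And>s. s \<in> I \<Longrightarrow> h (p s) = k (p s)" and x: "x \<in> carrier M"
  shows "h x = k x"
proof -
  interpret N: rsz_mod K A V par ev om N by (rule rsz_modI) fact
  note c = dual_closed[OF d _ x] dual_carr[OF d]
  have "h x = finsum N (\<lambda>s. q s x \<odot>\<^bsub>N\<^esub> h (p s)) I" if h: "lin A M N h" for h
  proof -
    have "h (finsum M (\<lambda>s. q s x \<odot>\<^bsub>M\<^esub> p s) I) = finsum N (\<lambda>s. h (q s x \<odot>\<^bsub>M\<^esub> p s)) I"
      using c by (intro lin_finsum[OF h N _ dual_finite[OF d]]) auto
    also have "\<dots> = finsum N (\<lambda>s. q s x \<odot>\<^bsub>N\<^esub> h (p s)) I"
      using c lin_smult[OF h] lin_closed[OF h] by (intro N.M.finsum_cong') auto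
    finally show ?thesis using dual_sum[OF d x] by simp
  qed
  moreover have "finsum N (\<lambda>s. q s x \<odot>\<^bsub>N\<^esub> h (p s)) I = finsum N (\<lambda>s. q s x \<odot>\<^bsub>N\<^esub> k (p s)) I"
    using eq c lin_closed[OF k] by (intro N.M.finsum_cong') auto
  ultimately show ?thesis using h k by simp
qed

lemma dual_generate:
  assumes d: "dual M I v p q" and H: "submodule H A M" "\<And>s. s \<in> I \<Longrightarrow> p s \<in> H" shows "H = carrier M"
proof -
  have "x \<in> H" if x: "x \<in> carrier M" for x
  proof -
    have "finsum M (\<lambda>s. q s x \<odot>\<^bsub>M\<^esub> p s) I \<in> H"
      using H dual_closed[OF d _ x] submodule_smult[OF H(1)]
      by (intro submodule_finsum[OF H(1) _ dual_finite[OF d]]) auto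
    then show ?thesis using dual_sum[OF d x] by simp
  qed
  then show ?thesis using submodule_carr[OF H(1)] by blast
qed

lemma dual_projective:
  assumes d: "dual M I v p q" shows "projective_module A M"
  unfolding projective_module_def
proof (intro conjI allI ballI impI)
  show "fg_module A M" unfolding fg_module_def
    using dual_generate[OF d] dual_finite[OF d] dual_carr[OF d]
    by (intro conjI left_module_axioms exI[of _ "p ` I"]) auto
  fix L N :: "('r, 'v) module" and g h
  assume g: "g \<in> module_Hom A L N" and h: "h \<in> module_Hom A M N"
    and fg: "fg_module A L \<and> fg_module A N \<and> g ` carrier L = carrier N"
  interpret L: rsz_mod K A V par ev om L using fg by (intro rsz_modI) (simp add: fg_module_def)
  interpret N: rsz_mod K A V par ev om N using fg by (intro rsz_modI) (simp add: fg_module_def)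
  note gl = module_Hom_lin[OF g] and hl = module_Hom_lin[OF h]
  \<comment> \<open>Any preimage of \<open>h (p s)\<close> becomes one at the point
    \<open>v s\<close> after multiplication by \<open>E (v s)\<close>.\<close>
  have "\<exists>m. m \<in> vs L (v s) \<and> g m = h (p s)" if s: "s \<in> I" for s
  proof -
    have "h (p s) \<in> g ` carrier L" using lin_closed[OF hl dual_carr[OF d s]] fg by simp
    then obtain m where m: "m \<in> carrier L" "g m = h (p s)" by auto
    have "g (E (v s) \<odot>\<^bsub>L\<^esub> m) = h (p s)"
      using lin_smult[OF gl E_closed m(1)] m(2) N.vs_E[OF lin_vs[OF N.left_module_axioms hl dual_vs[OF d s]]] by simp
    then show ?thesis using L.E_in_vs[OF m(1)] by blast
  qed
  then obtain m where m: "\<And>s. s \<in> I \<Longrightarrow> m s \<in> vs L (v s)" "\<And>s. s \<in> I \<Longrightarrow> g (m s) = h (p s)" by metis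
  obtain k where k: "lin A M L k" "\<And>s. s \<in> I \<Longrightarrow> k (p s) = m s"
    using dual_extend[OF d L.left_module_axioms m(1)] by blast
  have "g (k x) = h x" if "x \<in> carrier M" for x
    using dual_agree[OF d N.left_module_axioms lin_comp[OF k(1) gl] hl _ that] k m by simp
  then show "\<exists>h'\<in>module_Hom A M L. \<forall>x\<in>carrier M. g (h' x) = h x"
    using lin_restrict[OF k(1)] by (intro bexI[of _ "restrict k (carrier M)"]) auto
qed

text \<open>Nakayama's lemma, in the form that applies to the kernels of the two covers below.\<close>

lemma dual_superfluous:
  assumes d: "dual M I v p q" and H: "submodule H A M"
    and rad: "\<And>x s. \<lbrakk>x \<in> H; s \<in> I\<rbrakk> \<Longrightarrow> ev (v s) (q s x) = \<zero>\<^bsub>K\<^esub>"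
  shows "superfluous A M H"
  unfolding superfluous_def
proof (intro conjI H allI impI)
  fix N assume N: "submodule N A M \<and> N <+>\<^bsub>M\<^esub> H = carrier M"
  note sN = conjunct1[OF N]
  \<comment> \<open>The coordinates of the vectors of \<open>H\<close> lie in the radical of
    \<open>A\<close>.\<close>
  have ra: "ev k (q s x) = \<zero>\<^bsub>K\<^esub>" if x: "x \<in> H" and s: "s \<in> I" and k: "k \<in> V" for x s k
  proof (cases "k = v s")
    case False
    have xc: "x \<in> carrier M" using submodule_carr[OF H x] .
    have "ev k (q s x \<otimes> E (v s)) = \<zero>\<^bsub>K\<^esub>" using dual_closed[OF d s xc] k False by simp
    then show ?thesis using dual_right[OF d s xc] by simp
  qed (use rad[OF x s] in simp)
  \<comment> \<open>The radical of \<open>A\<close> kills \<open>H\<close>, because its square is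
    zero.\<close>
  have kill: "b \<odot>\<^bsub>M\<^esub> y = \<zero>\<^bsub>M\<^esub>" if b: "b \<in> carrier A" "\<And>k. k \<in> V \<Longrightarrow> ev k b = \<zero>\<^bsub>K\<^esub>" and y: "y \<in> H" for b y
  proof -
    have yc: "y \<in> carrier M" using submodule_carr[OF H y] .
    have "b \<otimes> q s y = \<zero>" if "s \<in> I" for s
      using b ra[OF y that] dual_closed[OF d that yc] by (intro coord_eqI) auto
    then have z: "b \<odot>\<^bsub>M\<^esub> (q s y \<odot>\<^bsub>M\<^esub> p s) = \<zero>\<^bsub>M\<^esub>" if "s \<in> I" for s
      using that b dual_closed[OF d that yc] dual_carr[OF d that] by (simp add: smult_mult)
    have "b \<odot>\<^bsub>M\<^esub> finsum M (\<lambda>s. q s y \<odot>\<^bsub>M\<^esub> p s) I = finsum M (\<lambda>s. b \<odot>\<^bsub>M\<^esub> (q s y \<odot>\<^bsub>M\<^esub> p s)) I"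
      using dual_closed[OF d _ yc] dual_carr[OF d] by (intro smult_finsum b dual_finite[OF d]) auto
    also have "\<dots> = finsum M (\<lambda>s. \<zero>\<^bsub>M\<^esub>) I" using z by (intro M.finsum_cong') auto
    finally show ?thesis using dual_sum[OF d yc] by simp
  qed
  have split: "\<exists>n\<in>N. \<exists>h\<in>H. x = n \<oplus>\<^bsub>M\<^esub> h" if "x \<in> carrier M" for x
  proof -
    have "x \<in> N <+>\<^bsub>M\<^esub> H" using N that by simp
    then show ?thesis by (auto simp: set_add_mem)
  qed
  \<comment> \<open>Hence the radical maps \<open>M\<close>, the sum of \<open>N\<close> and
    \<open>H\<close>, into \<open>N\<close>; applied to the generators this puts \<open>H\<close>
    into \<open>N\<close>.\<close>
  have bp: "b \<odot>\<^bsub>M\<^esub> x \<in> N" if b: "b \<in> carrier A" "\<And>k. k \<in> V \<Longrightarrow> ev k b = \<zero>\<^bsub>K\<^esub>" and x: "x \<in> carrier M" for b x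
  proof -
    obtain n h where nh: "n \<in> N" "h \<in> H" "x = n \<oplus>\<^bsub>M\<^esub> h" using split[OF x] by blast
    have "b \<odot>\<^bsub>M\<^esub> x = b \<odot>\<^bsub>M\<^esub> n"
      using nh b kill[OF b nh(2)] submodule_carr[OF sN nh(1)] submodule_carr[OF H nh(2)]
      by (simp add: smult_r_distr)
    then show ?thesis using submodule_smult[OF sN b(1) nh(1)] by simp
  qed
  have HN: "h \<in> N" if h: "h \<in> H" for h
  proof -
    have hc: "h \<in> carrier M" using submodule_carr[OF H h] .
    have "finsum M (\<lambda>s. q s h \<odot>\<^bsub>M\<^esub> p s) I \<in> N"
      using bp[OF dual_closed[OF d _ hc] ra[OF h] dual_carr[OF d]]
      by (intro submodule_finsum[OF sN _ dual_finite[OF d]]) auto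
    then show ?thesis using dual_sum[OF d hc] by simp
  qed
  have "p s \<in> N" if s: "s \<in> I" for s
  proof -
    obtain n h where "n \<in> N" "h \<in> H" "p s = n \<oplus>\<^bsub>M\<^esub> h" using split[OF dual_carr[OF d s]] by blast
    then show ?thesis using HN submodule_add[OF sN] by simp
  qed
  then show "N = carrier M" by (rule dual_generate[OF d sN])
qed

end

section \<open>Uniqueness of projective covers\<close>

lemma projective_lift:
  fixes P L N :: "('r, 'v) module"
  assumes P: "projective_module R P" and fg: "fg_module R L" and N: "left_module R N"
    and g: "lin R L N g" "g ` carrier L = carrier N" and h: "lin R P N h"
  shows "\<exists>k. lin R P L k \<and> (\<forall>x\<in>carrier P. g (k x) = h x)"
proof -
  have fgP: "fg_module R P" using P by (simp add: projective_module_def)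
  interpret P: left_module R P using fgP by (simp add: fg_module_def)
  interpret L: left_module R L using fg by (simp add: fg_module_def)
  have fN: "fg_module R N" by (rule fg_module_surj[OF fg N g])
  let ?g = "restrict g (carrier L)" and ?h = "restrict h (carrier P)"
  have *: "\<exists>h'\<in>module_Hom R P V. \<forall>x\<in>carrier P. p (h' x) = h x"
    if "p \<in> module_Hom R V W" "h \<in> module_Hom R P W" "fg_module R V" "fg_module R W" "p ` carrier V = carrier W"
    for V W :: "('r, 'v) module" and p h
    using P that unfolding projective_module_def by blast
  have "\<exists>k\<in>module_Hom R P L. \<forall>x\<in>carrier P. ?g (k x) = ?h x"
    by (rule *[OF L.lin_restrict[OF g(1)] P.lin_restrict[OF h] fg fN]) (use g(2) in simp)
  then obtain k where k: "lin R P L k" "\<And>x. x \<in> carrier P \<Longrightarrow> ?g (k x) = ?h x"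
    by (auto simp: module_Hom_iff)
  have "g (k x) = h x" if "x \<in> carrier P" for x
    using k(2)[OF that] lin_closed[OF k(1) that] that by simp
  then show ?thesis using k(1) by blast
qed

lemma projective_cover_unique:
  fixes P P' M :: "('r, 'v) module"
  assumes M: "left_module R M" and P: "projective_cover R P p M" and P': "projective_cover R P' p' M"
  shows "\<exists>\<phi>. lin R P' P \<phi> \<and> bij_betw \<phi> (carrier P') (carrier P) \<and> (\<forall>x\<in>carrier P'. p (\<phi> x) = p' x)"
proof -
  have pr: "projective_module R P" "projective_module R P'"
    and p: "lin R P M p" "p ` carrier P = carrier M" and p': "lin R P' M p'" "p' ` carrier P' = carrier M"
    and sf: "superfluous R P (a_kernel P M p)" "superfluous R P' (a_kernel P' M p')"
    using P P' by (auto simp: projective_cover_def module_Hom_iff)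
  have fg: "fg_module R P" "fg_module R P'" using pr by (auto simp: projective_module_def)
  interpret P: left_module R P using fg by (simp add: fg_module_def)
  interpret P': left_module R P' using fg by (simp add: fg_module_def)
  interpret M: left_module R M by fact
  obtain \<phi> where \<phi>: "lin R P' P \<phi>" "\<And>x. x \<in> carrier P' \<Longrightarrow> p (\<phi> x) = p' x"
    using projective_lift[OF pr(2) fg(1) M p p'(1)] by blast
  \<comment> \<open>Stated for arbitrary modules over \<open>M\<close>, because it is applied to
    \<phi> and to \<sigma>.\<close>
  have surj: "\<psi> ` carrier L' = carrier L"
    if L: "left_module R L" "left_module R L'" and \<psi>: "lin R L' L \<psi>" and l: "lin R L M l"
      and l': "l' ` carrier L' = carrier M" and c: "\<And>x. x \<in> carrier L' \<Longrightarrow> l (\<psi> x) = l' x"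
      and s: "superfluous R L (a_kernel L M l)" for L L' :: "('r, 'v) module" and \<psi> l l'
  proof -
    interpret L: left_module R L by (rule L(1))
    interpret L': left_module R L' by (rule L(2))
    have sub: "submodule (\<psi> ` carrier L') R L" by (rule L'.submodule_image[OF \<psi> L(1) L'.submodule_all])
    have "carrier L \<subseteq> \<psi> ` carrier L' <+>\<^bsub>L\<^esub> a_kernel L M l"
    proof
      fix x assume x: "x \<in> carrier L"
      have "l x \<in> l' ` carrier L'" using lin_closed[OF l x] l' by simp
      then obtain y where y: "y \<in> carrier L'" "l x = l' y" by auto
      have ly: "l' y \<in> carrier M" using y(2) lin_closed[OF l x] by simp
      have py: "\<psi> y \<in> carrier L" using lin_closed[OF \<psi> y(1)] .
      have "l (x \<ominus>\<^bsub>L\<^esub> \<psi> y) = \<zero>\<^bsub>M\<^esub>"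
        using x py y ly c[OF y(1)] lin_closed[OF l]
        by (simp add: a_minus_def lin_add[OF l] L.lin_minus[OF l M] M.M.r_neg)
      moreover have "x = \<psi> y \<oplus>\<^bsub>L\<^esub> (x \<ominus>\<^bsub>L\<^esub> \<psi> y)"
        using x py by (simp add: a_minus_def L.M.a_lcomm L.M.r_neg)
      moreover have "x \<ominus>\<^bsub>L\<^esub> \<psi> y \<in> carrier L" using x py by simp
      ultimately show "x \<in> \<psi> ` carrier L' <+>\<^bsub>L\<^esub> a_kernel L M l"
        using y(1) unfolding set_add_mem L.a_kernel_eq by blast
    qed
    moreover have "\<psi> ` carrier L' <+>\<^bsub>L\<^esub> a_kernel L M l \<subseteq> carrier L"
      using L.submodule_carr[OF sub] by (auto simp: set_add_mem L.a_kernel_eq)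
    ultimately show ?thesis using s sub unfolding superfluous_def by blast
  qed
  have \<phi>s: "\<phi> ` carrier P' = carrier P"
    by (rule surj[OF P.left_module_axioms P'.left_module_axioms \<phi>(1) p(1) p'(2) \<phi>(2) sf(1)])
  obtain \<sigma> where \<sigma>: "lin R P P' \<sigma>" "\<And>x. x \<in> carrier P \<Longrightarrow> \<phi> (\<sigma> x) = x"
    using projective_lift[OF pr(1) fg(2) P.left_module_axioms \<phi>(1) \<phi>s lin_id] by blast
  have "p' (\<sigma> x) = p x" if "x \<in> carrier P" for x
    using \<phi>(2)[OF lin_closed[OF \<sigma>(1) that]] \<sigma>(2)[OF that] by simp
  then have \<sigma>s: "\<sigma> ` carrier P = carrier P'"
    by (rule surj[OF P'.left_module_axioms P.left_module_axioms \<sigma>(1) p'(1) p(2) _ sf(2)])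
  have "inj_on \<phi> (carrier P')" unfolding \<sigma>s[symmetric] using \<sigma>(2) by (auto intro!: inj_onI)
  then show ?thesis using \<phi> \<phi>s by (intro exI[of _ \<phi>]) (simp add: bij_betw_def)
qed

section \<open>Minimal projective presentations\<close>

context rsz
begin

lemma K_finsum_single:
  assumes "finite I" "t \<in> I" "f t \<in> carrier K" "\<And>s. \<lbrakk>s \<in> I; s \<noteq> t\<rbrakk> \<Longrightarrow> f s = \<zero>\<^bsub>K\<^esub>"
  shows "finsum K f I = f t"
proof -
  have "finsum K f I = finsum K (\<lambda>s. if t = s then f t else \<zero>\<^bsub>K\<^esub>) I"
    using assms by (intro K.finsum_cong') auto
  then show ?thesis using assms K.finsum_singleton[of t I "\<lambda>_. f t"] by auto
qed

lemma finsum_regular: "finsum (regular_module A) f S = finsum A f S"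
  by (simp add: finsum_def finprod_def regular_simps)

text \<open>
  The kernel of \<open>\<Oplus> P(v s) \<rightarrow> M\<close> is the sum of the simple modules at the children of \<open>v s\<close> outside
  \<open>W s\<close>, so the second projective is the sum of the projectives at these children.
\<close>

definition rels :: "nat set \<Rightarrow> (nat \<Rightarrow> nat) \<Rightarrow> (nat \<Rightarrow> nat set) \<Rightarrow> (nat \<times> nat) set" where
  "rels I v W = (SIGMA s:I. ch (v s) - W s)"

text \<open>A presentation with coordinates. The map onto the module is left out, since the
  transpose depends on \<open>f\<close> only.\<close>

definition nice ::
  "nat set \<Rightarrow> (nat \<Rightarrow> nat) \<Rightarrow> (nat \<Rightarrow> nat set) \<Rightarrow> ('r, 'v) module \<Rightarrow> ('v \<Rightarrow> 'v) \<Rightarrow> ('r, 'v) module \<Rightarrow>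
   (nat \<Rightarrow> 'v) \<Rightarrow> (nat \<Rightarrow> 'v \<Rightarrow> 'r) \<Rightarrow> (nat \<times> nat \<Rightarrow> 'v) \<Rightarrow> (nat \<times> nat \<Rightarrow> 'v \<Rightarrow> 'r) \<Rightarrow> bool" where
  "nice I v W P1 f P0 q qs p ps \<longleftrightarrow> left_module A P0 \<and> left_module A P1 \<and>
     dual P0 I v q qs \<and> dual P1 (rels I v W) snd p ps \<and> lin A P1 P0 f \<and>
     (\<forall>(s, j)\<in>rels I v W. f (p (s, j)) = Ar j \<odot>\<^bsub>P0\<^esub> q s)"

text \<open>The dual of \<open>f\<close> in coordinates: the coordinate map \<open>qs s\<close> is
  pulled back to the sum of the maps \<open>ps (s, j)\<close> followed by right multiplication with
  \<open>Ar j\<close>. Both sides are linear in \<open>y\<close> and agree on the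
  generators.\<close>

lemma nice_qs_f:
  assumes n: "nice I v W P1 f P0 q qs p ps" and s: "s \<in> I" and y: "y \<in> carrier P1"
  shows "qs s (f y) = finsum A (\<lambda>j. ps (s, j) y \<otimes> Ar j) (ch (v s) - W s)"
proof -
  have d0: "dual P0 I v q qs" and d1: "dual P1 (rels I v W) snd p ps" and f: "lin A P1 P0 f"
    and fp: "\<And>s j. (s, j) \<in> rels I v W \<Longrightarrow> f (p (s, j)) = Ar j \<odot>\<^bsub>P0\<^esub> q s"
    using n by (auto simp: nice_def)
  interpret P0: rsz_mod K A V par ev om P0 using n by (intro rsz_mod.intro rsz_axioms) (simp add: nice_def)
  interpret P1: rsz_mod K A V par ev om P1 using n by (intro rsz_mod.intro rsz_axioms) (simp add: nice_def)
  interpret R: rsz_mod K A V par ev om "regular_module A" by (intro rsz_mod.intro rsz_axioms regular_left_module)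
  let ?C = "ch (v s) - W s"
  have rl: "(s, j) \<in> rels I v W" if "j \<in> ?C" for j using s that by (simp add: rels_def)
  have "qs s (f y) = finsum (regular_module A) (\<lambda>j. ps (s, j) y \<otimes> Ar j) ?C"
  proof (rule P1.dual_agree[OF d1 regular_left_module _ _ _ y])
    show "lin A P1 (regular_module A) (\<lambda>y. qs s (f y))" by (rule lin_comp[OF f dual_lin[OF d0 s]])
    show "lin A P1 (regular_module A) (\<lambda>y. finsum (regular_module A) (\<lambda>j. ps (s, j) y \<otimes> Ar j) ?C)"
      using P1.lin_right_mult[OF regular_left_module dual_lin[OF d1 rl]]
      by (intro P1.lin_finsum_maps[OF regular_left_module]) (auto simp: regular_simps)
    fix r assume r: "r \<in> rels I v W"
    obtain s' k where rk: "r = (s', k)" by fastforce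
    have s': "s' \<in> I" "k \<in> ch (v s') - W s'" using r rk by (auto simp: rels_def)
    have kV: "k \<in> V" "par k \<in> V" "par k = v s'" using s' dual_point[OF d0 s'(1)] by (auto simp: ch_def)
    have "qs s (f (p r)) = Ar k \<otimes> (if s = s' then E (v s) else \<zero>)"
      using fp r rk regular_lin_simps(3)[OF dual_lin[OF d0 s] Ar_closed dual_carr[OF d0 s'(1)]] dual_delta[OF d0 s s'(1)]
      by simp
    also have "\<dots> = (if s = s' then Ar k else \<zero>)" using kV by (simp add: Ar_E)
    finally have l: "qs s (f (p r)) = (if s = s' then Ar k else \<zero>)" .
    have t: "ps (s, j) (p r) \<otimes> Ar j = (if (s, j) = r then Ar k else \<zero>)" if "j \<in> ?C" for j
      using dual_delta[OF d1 rl[OF that] r] kV rk by (auto simp: E_Ar)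
    show "qs s (f (p r)) = finsum (regular_module A) (\<lambda>j. ps (s, j) (p r) \<otimes> Ar j) ?C"
    proof (cases "s = s'")
      case True
      have "finsum (regular_module A) (\<lambda>j. ps (s, j) (p r) \<otimes> Ar j) ?C = ps (s, k) (p r) \<otimes> Ar k"
        by (rule R.finsum_single) (use t s' True rk in \<open>auto simp: regular_simps\<close>)
      then show ?thesis using l t[of k] s' True rk by simp
    next
      case False
      have "finsum (regular_module A) (\<lambda>j. ps (s, j) (p r) \<otimes> Ar j) ?C = finsum (regular_module A) (\<lambda>j. \<zero>\<^bsub>regular_module A\<^esub>) ?C"
        using t False rk by (intro R.M.finsum_cong') (auto simp: regular_simps)
      also have "\<dots> = \<zero>\<^bsub>regular_module A\<^esub>" by simp
      finally show ?thesis using l False by (simp add: regular_simps(2))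
    qed
  qed
  then show ?thesis by (simp add: finsum_regular)
qed

lemma dual_reindex:
  assumes d: "dual P I v p q" and b: "bij_betw b J I" and P: "left_module A P"
  shows "dual P J (v \<circ> b) (p \<circ> b) (q \<circ> b)"
proof -
  interpret P: rsz_mod K A V par ev om P by (intro rsz_mod.intro rsz_axioms P)
  have J: "\<And>s. s \<in> J \<Longrightarrow> b s \<in> I" "inj_on b J" "b ` J = I" using b by (auto simp: bij_betw_def)
  have "finsum P (\<lambda>s. q (b s) x \<odot>\<^bsub>P\<^esub> p (b s)) J = x" if x: "x \<in> carrier P" for x
    using P.M.finsum_reindex[of "\<lambda>s. q s x \<odot>\<^bsub>P\<^esub> p s" b J] J dual_sum[OF d x] dual_closed[OF d _ x] dual_carr[OF d]
    by auto
  moreover have "finite J" using b dual_finite[OF d] bij_betw_finite by blast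
  moreover have "(b s = b t) = (s = t)" if "s \<in> J" "t \<in> J" for s t using that J by (auto simp: inj_on_def)
  ultimately show ?thesis unfolding dual_def
    using J(1) dualD[OF d] by auto
qed

lemma dual_transport:
  assumes d: "dual P I v p q" and P: "left_module A P" and N: "left_module A N"
    and \<phi>: "lin A P N \<phi>" "bij_betw \<phi> (carrier P) (carrier N)"
  shows "dual N I v (\<lambda>s. \<phi> (p s)) (\<lambda>s x. q s (inv_into (carrier P) \<phi> x))"
proof -
  interpret P: rsz_mod K A V par ev om P by (intro rsz_mod.intro rsz_axioms P)
  interpret N: rsz_mod K A V par ev om N by (intro rsz_mod.intro rsz_axioms N)
  let ?k = "inv_into (carrier P) \<phi>"
  have k: "lin A N P ?k" by (rule P.lin_inv_into[OF \<phi>])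
  have k\<phi>: "?k (\<phi> x) = x" if "x \<in> carrier P" for x using \<phi>(2) that by (simp add: bij_betw_def)
  have \<phi>k: "\<phi> (?k y) = y" if "y \<in> carrier N" for y using \<phi>(2) that by (simp add: bij_betw_def f_inv_into_f)
  have "finsum N (\<lambda>s. q s (?k x) \<odot>\<^bsub>N\<^esub> \<phi> (p s)) I = x" if x: "x \<in> carrier N" for x
  proof -
    have kx: "?k x \<in> carrier P" using lin_closed[OF k x] .
    have "\<phi> (finsum P (\<lambda>s. q s (?k x) \<odot>\<^bsub>P\<^esub> p s) I) = finsum N (\<lambda>s. \<phi> (q s (?k x) \<odot>\<^bsub>P\<^esub> p s)) I"
      using dual_closed[OF d _ kx] dual_carr[OF d] by (intro P.lin_finsum[OF \<phi>(1) N _ dual_finite[OF d]]) auto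
    also have "\<dots> = finsum N (\<lambda>s. q s (?k x) \<odot>\<^bsub>N\<^esub> \<phi> (p s)) I"
      using dual_closed[OF d _ kx] dual_carr[OF d] lin_smult[OF \<phi>(1)] lin_closed[OF \<phi>(1)]
      by (intro N.M.finsum_cong') auto
    finally show ?thesis using dual_sum[OF d kx] \<phi>k[OF x] by simp
  qed
  moreover have "lin A N (regular_module A) (\<lambda>x. q s (?k x))" if "s \<in> I" for s
    by (rule lin_comp[OF k dual_lin[OF d that]])
  ultimately show ?thesis unfolding dual_def
    using dual_finite[OF d] dual_point[OF d] dual_vs[OF d] dual_right[OF d] dual_delta[OF d] dual_carr[OF d]
      P.lin_vs[OF N \<phi>(1)] k\<phi> lin_closed[OF k] by simp
qed

end

section \<open>The two covers of the explicit presentation\<close>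

context rsz_mod
begin

context
  fixes I :: "nat set" and v W u \<pi> and P0 :: "('r, 'v) module" and g q qs
  assumes st: "strings M I v W u \<pi>" and P0: "left_module A P0" and d0: "dual P0 I v q qs"
    and g: "lin A P0 M g" "\<And>s. s \<in> I \<Longrightarrow> g (q s) = u s"
begin

interpretation P: rsz_mod K A V par ev om P0 by (rule rsz_modI[OF P0])

text \<open>The component of \<open>g x\<close> in the string \<open>s\<close> is
  \<open>qs s x\<close> times \<open>u s\<close>, so for a vector \<open>x\<close> in the kernel the
  coordinate \<open>qs s x\<close> annihilates \<open>u s\<close>.\<close>

lemma kernel_coords:
  assumes x: "x \<in> carrier P0" "g x = \<zero>\<^bsub>M\<^esub>" and s: "s \<in> I"
  shows "ev (v s) (qs s x) = \<zero>\<^bsub>K\<^esub>" "j \<in> W s \<Longrightarrow> om j (qs s x) = \<zero>\<^bsub>K\<^esub>"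
proof -
  have uc: "u t \<in> carrier M" if "t \<in> I" for t using gen_carr[OF strings_gen[OF st that]] .
  have uE: "E (v s) \<odot>\<^bsub>M\<^esub> u s = u s" using vs_E[OF gen_vs[OF strings_gen[OF st s]]] .
  have "\<pi> s (g x) = qs s x \<odot>\<^bsub>M\<^esub> u s"
    by (rule P.dual_agree[OF d0 left_module_axioms lin_comp[OF g(1) strings_lin[OF st s]]
          P.lin_right_mult[OF left_module_axioms dual_lin[OF d0 s] uc[OF s]] _ x(1)])
      (use s g(2) dual_delta[OF d0 s] uE uc strings_same[OF st s] strings_other[OF st s] in auto)
  then have "qs s x \<odot>\<^bsub>M\<^esub> u s = \<zero>\<^bsub>M\<^esub>" using x lin_zero[OF strings_lin[OF st s] left_module_axioms] by simp
  then show "ev (v s) (qs s x) = \<zero>\<^bsub>K\<^esub>" "j \<in> W s \<Longrightarrow> om j (qs s x) = \<zero>\<^bsub>K\<^esub>"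
    using smult_gen_zero_iff[OF strings_gen[OF st s] dual_closed[OF d0 s x(1)]] by auto
qed

lemma first_cover: "projective_cover A P0 (restrict g (carrier P0)) M"
  unfolding projective_cover_def
proof (intro conjI)
  show "projective_module A P0" by (rule P.dual_projective[OF d0])
  show "restrict g (carrier P0) \<in> module_Hom A P0 M" by (rule P.lin_restrict[OF g(1)])
  have im: "submodule (g ` carrier P0) A M" by (rule P.submodule_image[OF g(1) left_module_axioms P.submodule_all])
  have us: "u s \<in> g ` carrier P0" if "s \<in> I" for s
    using g(2)[OF that] dual_carr[OF d0 that] by (metis image_eqI)
  have "x \<in> g ` carrier P0" if x: "x \<in> carrier M" for x
  proof -
    have "\<pi> s x \<in> g ` carrier P0" if "s \<in> I" for s
      using strings_orb[OF st that x] us[OF that] submodule_smult[OF im] by (auto simp: orb_def)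
    then have "finsum M (\<lambda>s. \<pi> s x) I \<in> g ` carrier P0"
      by (intro submodule_finsum[OF im _ strings_finite[OF st]]) auto
    then show ?thesis using strings_sum[OF st x] by simp
  qed
  then have "g ` carrier P0 = carrier M" using submodule_carr[OF im] by blast
  then show "restrict g (carrier P0) ` carrier P0 = carrier M" by simp
  have "a_kernel P0 M (restrict g (carrier P0)) = a_kernel P0 M g" by (auto simp: P.a_kernel_eq)
  moreover have "superfluous A P0 (a_kernel P0 M g)"
    by (rule P.dual_superfluous[OF d0 P.submodule_kernel[OF g(1) left_module_axioms]])
      (auto simp: P.a_kernel_eq kernel_coords)
  ultimately show "superfluous A P0 (a_kernel P0 M (restrict g (carrier P0)))" by simp
qed

lemma second_cover:
  assumes n: "nice I v W P1 f P0 q qs p ps" and fe: "f \<in> extensional (carrier P1)"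
  shows "projective_cover A P1 f (P0\<lparr>carrier := a_kernel P0 M g\<rparr>)"
proof -
  have d1: "dual P1 (rels I v W) snd p ps" and f: "lin A P1 P0 f" and P1: "left_module A P1"
    and fp: "\<And>s j. (s, j) \<in> rels I v W \<Longrightarrow> f (p (s, j)) = Ar j \<odot>\<^bsub>P0\<^esub> q s"
    using n by (auto simp: nice_def)
  interpret P1: rsz_mod K A V par ev om P1 by (rule rsz_modI[OF P1])
  let ?k = "a_kernel P0 M g"
  have sk: "submodule ?k A P0" by (rule P.submodule_kernel[OF g(1) left_module_axioms])
  have zl: "lin A P1 M (\<lambda>_. \<zero>\<^bsub>M\<^esub>)" by (rule linI) auto
  have "g (f y) = \<zero>\<^bsub>M\<^esub>" if y: "y \<in> carrier P1" for y
  proof (rule P1.dual_agree[OF d1 left_module_axioms lin_comp[OF f g(1)] zl _ y])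
    fix r assume r: "r \<in> rels I v W"
    then obtain s j where rs: "r = (s, j)" "s \<in> I" "j \<in> ch (v s)" "j \<notin> W s" by (auto simp: rels_def)
    have "g (f (p r)) = Ar j \<odot>\<^bsub>M\<^esub> u s"
      using fp r rs lin_smult[OF g(1) Ar_closed dual_carr[OF d0 rs(2)]] g(2)[OF rs(2)] by simp
    then show "g (f (p r)) = \<zero>\<^bsub>M\<^esub>" using gen_out[OF strings_gen[OF st rs(2)] rs(3,4)] by simp
  qed
  then have fk: "f y \<in> ?k" if "y \<in> carrier P1" for y
    using that lin_closed[OF f] by (simp add: P.a_kernel_eq)
  have flin: "lin A P1 (P0\<lparr>carrier := ?k\<rparr>) f"
    using fk lin_add[OF f] lin_smult[OF f] by (intro linI) auto
  have im: "submodule (f ` carrier P1) A P0" by (rule P1.submodule_image[OF f P0 P1.submodule_all])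
  have ap: "Ar j \<odot>\<^bsub>P0\<^esub> q s \<in> f ` carrier P1" if "s \<in> I" "j \<in> ch (v s)" "j \<notin> W s" for s j
  proof -
    have "(s, j) \<in> rels I v W" using that by (simp add: rels_def)
    then show ?thesis using fp[of s j] dual_carr[OF d1, of "(s, j)"] by (metis image_eqI)
  qed
  have "x \<in> f ` carrier P1" if x: "x \<in> ?k" for x
  proof -
    have xc: "x \<in> carrier P0" "g x = \<zero>\<^bsub>M\<^esub>" using x by (auto simp: P.a_kernel_eq)
    have "qs s x \<odot>\<^bsub>P0\<^esub> q s \<in> f ` carrier P1" if s: "s \<in> I" for s
    proof -
      note a = dual_closed[OF d0 s xc(1)] and qv = dual_vs[OF d0 s] and vV = dual_point[OF d0 s]
      note qc = P.vs_carr[OF qv]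
      have "E k \<odot>\<^bsub>P0\<^esub> (qs s x \<odot>\<^bsub>P0\<^esub> q s) \<in> f ` carrier P1" if k: "k \<in> V" for k
      proof (cases "k = v s")
        case True
        then have "E k \<odot>\<^bsub>P0\<^esub> (qs s x \<odot>\<^bsub>P0\<^esub> q s) = \<zero>\<^bsub>P0\<^esub>"
          using P.E_smult_diag[OF a vV qv] kernel_coords(1)[OF xc s] qc by (simp add: sc_zero)
        then show ?thesis using P.submodule_zero[OF im] by simp
      next
        case False
        show ?thesis
        proof (cases "par k = v s \<and> k \<notin> W s")
          case True
          then have "k \<in> ch (v s)" using k by (simp add: ch_def)
          moreover have "om k (qs s x) \<in> carrier K" using a k True vV by simp
          ultimately show ?thesis
            using P.E_smult_off[OF a vV k False qv] True P.submodule_smult[OF im _ ap[OF s]] by simp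
        next
          case F: False
          then have "E k \<odot>\<^bsub>P0\<^esub> (qs s x \<odot>\<^bsub>P0\<^esub> q s) = \<zero>\<^bsub>P0\<^esub>"
            using P.E_smult_off[OF a vV k False qv] kernel_coords(2)[OF xc s, of k] qc by (auto simp: sc_zero)
          then show ?thesis using P.submodule_zero[OF im] by simp
        qed
      qed
      then have "finsum P0 (\<lambda>k. E k \<odot>\<^bsub>P0\<^esub> (qs s x \<odot>\<^bsub>P0\<^esub> q s)) V \<in> f ` carrier P1"
        by (intro P.submodule_finsum[OF im _ finV]) auto
      then show ?thesis using P.decomp[of "qs s x \<odot>\<^bsub>P0\<^esub> q s"] a qc by simp
    qed
    then have "finsum P0 (\<lambda>s. qs s x \<odot>\<^bsub>P0\<^esub> q s) I \<in> f ` carrier P1"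
      by (intro P.submodule_finsum[OF im _ dual_finite[OF d0]]) auto
    then show ?thesis using dual_sum[OF d0 xc(1)] by simp
  qed
  then have onto: "f ` carrier P1 = ?k" using fk by blast
  have "superfluous A P1 (a_kernel P1 P0 f)"
  proof (rule P1.dual_superfluous[OF d1 P1.submodule_kernel[OF f P0]])
    fix y r assume y: "y \<in> a_kernel P1 P0 f" and r: "r \<in> rels I v W"
    obtain s j where rs: "r = (s, j)" "s \<in> I" "j \<in> ch (v s) - W s" using r by (auto simp: rels_def)
    have yc: "y \<in> carrier P1" "f y = \<zero>\<^bsub>P0\<^esub>" using y by (auto simp: P1.a_kernel_eq)
    have jV: "j \<in> V" "par j \<in> V" using rs dual_point[OF d0 rs(2)] by (auto simp: ch_def)
    have pc: "ps (s, k) y \<in> carrier A" if "k \<in> ch (v s) - W s" for k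
      using dual_closed[OF d1 _ yc(1), of "(s, k)"] rs that by (simp add: rels_def)
    have "finsum A (\<lambda>k. ps (s, k) y \<otimes> Ar k) (ch (v s) - W s) = \<zero>"
      using nice_qs_f[OF n rs(2) yc(1)] P.lin_zero[OF dual_lin[OF d0 rs(2)] regular_left_module] yc
      by (simp add: regular_simps)
    then have "om j (finsum A (\<lambda>k. ps (s, k) y \<otimes> Ar k) (ch (v s) - W s)) = \<zero>\<^bsub>K\<^esub>" using jV by simp
    moreover have "om j (finsum A (\<lambda>k. ps (s, k) y \<otimes> Ar k) (ch (v s) - W s)) =
        finsum K (\<lambda>k. om j (ps (s, k) y \<otimes> Ar k)) (ch (v s) - W s)"
      using pc jV by (intro om_finsum) auto
    moreover have "\<dots> = om j (ps (s, j) y \<otimes> Ar j)"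
      by (rule K_finsum_single) (use rs pc jV in auto)
    moreover have "\<dots> = ev j (ps (s, j) y)" using pc[OF rs(3)] jV by simp
    ultimately show "ev (snd r) (ps r y) = \<zero>\<^bsub>K\<^esub>" using rs by simp
  qed
  then have "superfluous A P1 (a_kernel P1 (P0\<lparr>carrier := ?k\<rparr>) f)" by (simp add: P1.a_kernel_eq)
  then show ?thesis unfolding projective_cover_def
    using P1.dual_projective[OF d1] flin fe onto by (simp add: module_Hom_iff)
qed

end

lemma cover_transport:
  assumes c: "projective_cover A P f N" and N: "left_module A N" and N': "left_module A N'"
    and \<phi>: "lin A N N' \<phi>" "bij_betw \<phi> (carrier N) (carrier N')"
  shows "projective_cover A P (restrict (\<lambda>x. \<phi> (f x)) (carrier P)) N'"
proof -
  have pr: "projective_module A P" and f: "lin A P N f" "f ` carrier P = carrier N"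
    and sf: "superfluous A P (a_kernel P N f)"
    using c by (auto simp: projective_cover_def module_Hom_iff)
  interpret P: rsz_mod K A V par ev om P using pr
    by (intro rsz_modI) (simp add: projective_module_def fg_module_def)
  interpret N: rsz_mod K A V par ev om N by (rule rsz_modI[OF N])
  have "\<phi> y = \<zero>\<^bsub>N'\<^esub> \<longleftrightarrow> y = \<zero>\<^bsub>N\<^esub>" if "y \<in> carrier N" for y
    using \<phi>(2) that N.lin_zero[OF \<phi>(1) N'] N.M.zero_closed unfolding bij_betw_def inj_on_def by metis
  then have "a_kernel P N' (restrict (\<lambda>x. \<phi> (f x)) (carrier P)) = a_kernel P N f"
    using lin_closed[OF f(1)] by (auto simp: P.a_kernel_eq)
  moreover have "(\<lambda>x. \<phi> (f x)) ` carrier P = carrier N'"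
    using f(2) \<phi>(2) by (metis bij_betw_def image_image)
  ultimately show ?thesis
    unfolding projective_cover_def using pr sf P.lin_restrict[OF lin_comp[OF f(1) \<phi>(1)]] by simp
qed

end

context rsz
begin

text \<open>Both projectives are models. As \<open>Model\<close> takes numbers as indices, the
  relations are coded for its construction and decoded by \<open>dual_reindex\<close>.\<close>

lemma nice_presentation_exists:
  fixes M :: "('r, nat \<Rightarrow> 'k) module"
  assumes M: "left_module A M" and st: "strings M I v W u \<pi>"
  shows "\<exists>P1 f P0 g q qs p ps. min_proj_presentation A M (P1, f, P0, g) \<and> nice I v W P1 f P0 q qs p ps"
proof -
  interpret rsz_mod K A V par ev om M by (intro rsz_mod.intro rsz_axioms M)
  have fin: "finite I" by (rule strings_finite[OF st])
  have vV: "v s \<in> V" if "s \<in> I" for s by (rule gen_point[OF strings_gen[OF st that]])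
  let ?P0 = "Model I v (\<lambda>s. ch (v s))"
  have P0: "left_module A ?P0" by (rule Mod_module[OF fin vV]) auto
  interpret P0: rsz_mod K A V par ev om ?P0 by (rule rsz_modI[OF P0])
  obtain q qs where d0: "dual ?P0 I v q qs"
    using P0.free_dual[OF Mod_strings[OF fin vV]] by blast
  obtain g where g: "lin A ?P0 M g" "\<And>s. s \<in> I \<Longrightarrow> g (q s) = u s"
    using P0.dual_extend[OF d0 M, of u] gen_vs[OF strings_gen[OF st]] by blast
  let ?g = "restrict g (carrier ?P0)"
  have gr: "lin A ?P0 M ?g" using P0.lin_restrict[OF g(1)] by (rule module_Hom_lin)
  have grq: "?g (q s) = u s" if "s \<in> I" for s using g(2)[OF that] dual_carr[OF d0 that] by simp
  let ?J = "prod_encode ` rels I v W" and ?w = "\<lambda>z. snd (prod_decode z)"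
  have fr: "finite (rels I v W)" using fin by (auto simp: rels_def)
  have wV: "?w z \<in> V" if "z \<in> ?J" for z using that by (auto simp: rels_def ch_def)
  let ?P1 = "Model ?J ?w (\<lambda>s. ch (?w s))"
  have fJ: "finite ?J" using fr by simp
  have P1: "left_module A ?P1" by (rule Mod_module[OF fJ wV]) auto
  interpret P1: rsz_mod K A V par ev om ?P1 by (rule rsz_modI[OF P1])
  obtain p' ps' where d1': "dual ?P1 ?J ?w p' ps'"
    using P1.free_dual[OF Mod_strings[OF fJ wV]] by blast
  have "bij_betw prod_encode (rels I v W) ?J" by (simp add: bij_betw_def inj_prod_encode)
  from dual_reindex[OF d1' this P1]
  have d1: "dual ?P1 (rels I v W) snd (p' \<circ> prod_encode) (ps' \<circ> prod_encode)" by (simp add: comp_def)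
  have "Ar (snd r) \<odot>\<^bsub>?P0\<^esub> q (fst r) \<in> vs ?P0 (snd r)" if "r \<in> rels I v W" for r
    using that dual_carr[OF d0] by (intro P0.Ar_in_vs) (auto simp: rels_def ch_def)
  then obtain f where f: "lin A ?P1 ?P0 f"
      "\<And>r. r \<in> rels I v W \<Longrightarrow> f ((p' \<circ> prod_encode) r) = Ar (snd r) \<odot>\<^bsub>?P0\<^esub> q (fst r)"
    using P1.dual_extend[OF d1 P0, of "\<lambda>r. Ar (snd r) \<odot>\<^bsub>?P0\<^esub> q (fst r)"] by blast
  let ?f = "restrict f (carrier ?P1)"
  have fr': "lin A ?P1 ?P0 ?f" using P1.lin_restrict[OF f(1)] by (rule module_Hom_lin)
  have n: "nice I v W ?P1 ?f ?P0 q qs (p' \<circ> prod_encode) (ps' \<circ> prod_encode)"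
    unfolding nice_def using P0 P1 d0 d1 fr' f(2) dual_carr[OF d1] by auto
  have gg: "restrict ?g (carrier ?P0) = ?g" by (rule ext) (simp add: restrict_def)
  have "projective_cover A ?P0 ?g M" using first_cover[OF st P0 d0 gr grq] unfolding gg .
  then have "min_proj_presentation A M (?P1, ?f, ?P0, ?g)"
    unfolding min_proj_presentation_def prod.case
    using second_cover[OF st P0 d0 gr grq n restrict_extensional] by (rule conjI)
  then show ?thesis using n by blast
qed

text \<open>\<open>AR_translate\<close> uses a presentation picked by \<open>SOME\<close>, so
  coordinates are needed on every minimal presentation. They are carried over from the explicit one
  along isomorphisms of the covers.\<close>

lemma presentation_nice:
  fixes M :: "('r, nat \<Rightarrow> 'k) module"
  assumes M: "left_module A M" and st: "strings M I v W u \<pi>"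
    and mp: "min_proj_presentation A M (P1, f, P0, g)"
  shows "\<exists>q qs p ps. nice I v W P1 f P0 q qs p ps"
proof -
  interpret rsz_mod K A V par ev om M by (intro rsz_mod.intro rsz_axioms M)
  obtain P1' f' P0' g' q qs p ps where mp': "min_proj_presentation A M (P1', f', P0', g')"
    and n: "nice I v W P1' f' P0' q qs p ps"
    using nice_presentation_exists[OF M st] by blast
  have c: "projective_cover A P0 g M" "projective_cover A P1 f (P0\<lparr>carrier := a_kernel P0 M g\<rparr>)"
    using mp by (auto simp: min_proj_presentation_def)
  have c': "projective_cover A P0' g' M" "projective_cover A P1' f' (P0'\<lparr>carrier := a_kernel P0' M g'\<rparr>)"
    using mp' by (auto simp: min_proj_presentation_def)
  have lm: "left_module A P" if "projective_cover A P h N" for P h and N :: "('r, nat \<Rightarrow> 'k) module"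
    using that by (simp add: projective_cover_def projective_module_def fg_module_def)
  have hl: "lin A P N h" if "projective_cover A P h N" for P h and N :: "('r, nat \<Rightarrow> 'k) module"
    using that by (simp add: projective_cover_def module_Hom_iff)
  note L0 = lm[OF c(1)] and L1 = lm[OF c(2)] and L0' = lm[OF c'(1)] and L1' = lm[OF c'(2)]
  interpret P0: rsz_mod K A V par ev om P0 by (rule rsz_modI[OF L0])
  interpret P0': rsz_mod K A V par ev om P0' by (rule rsz_modI[OF L0'])
  let ?k = "a_kernel P0 M g" and ?k' = "a_kernel P0' M g'"
  have sk: "submodule ?k A P0" "submodule ?k' A P0'"
    by (rule P0.submodule_kernel[OF hl[OF c(1)] M], rule P0'.submodule_kernel[OF hl[OF c'(1)] M])
  obtain \<phi> where \<phi>: "lin A P0' P0 \<phi>" "bij_betw \<phi> (carrier P0') (carrier P0)"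
      "\<And>x. x \<in> carrier P0' \<Longrightarrow> g (\<phi> x) = g' x"
    using projective_cover_unique[OF M c(1) c'(1)] by blast
  \<comment> \<open>\<phi> identifies the kernels of the two first covers, so that
    \<open>P1'\<close> also covers the kernel inside \<open>P0\<close>.\<close>
  have "\<phi> ` ?k' = ?k"
  proof (rule equalityI; rule subsetI)
    fix x assume "x \<in> \<phi> ` ?k'"
    then show "x \<in> ?k" using \<phi>(3) lin_closed[OF \<phi>(1)] by (auto simp: P0.a_kernel_eq P0'.a_kernel_eq)
  next
    fix x assume x: "x \<in> ?k"
    then have "x \<in> \<phi> ` carrier P0'" using \<phi>(2) by (simp add: bij_betw_def P0.a_kernel_eq)
    then obtain y where "y \<in> carrier P0'" "x = \<phi> y" by blast
    then show "x \<in> \<phi> ` ?k'" using x \<phi>(3) by (auto simp: P0.a_kernel_eq P0'.a_kernel_eq)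
  qed
  moreover have "inj_on \<phi> ?k'" using \<phi>(2) by (rule inj_on_subset[OF bij_betw_imp_inj_on]) (auto simp: P0'.a_kernel_eq)
  ultimately have bk: "bij_betw \<phi> (carrier (P0'\<lparr>carrier := ?k'\<rparr>)) (carrier (P0\<lparr>carrier := ?k\<rparr>))"
    by (simp add: bij_betw_def)
  have lk: "lin A (P0'\<lparr>carrier := ?k'\<rparr>) (P0\<lparr>carrier := ?k\<rparr>) \<phi>"
    using bk lin_add[OF \<phi>(1)] lin_smult[OF \<phi>(1)] P0'.submodule_carr[OF sk(2)]
    by (intro linI) (auto simp: bij_betw_def)
  have "projective_cover A P1' (restrict (\<lambda>x. \<phi> (f' x)) (carrier P1')) (P0\<lparr>carrier := ?k\<rparr>)"
    by (rule cover_transport[OF c'(2) P0'.submodule_module[OF sk(2)] P0.submodule_module[OF sk(1)] lk bk])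
  from projective_cover_unique[OF P0.submodule_module[OF sk(1)] c(2) this]
  obtain \<psi> where \<psi>: "lin A P1' P1 \<psi>" "bij_betw \<psi> (carrier P1') (carrier P1)"
      "\<And>x. x \<in> carrier P1' \<Longrightarrow> f (\<psi> x) = \<phi> (f' x)"
    by auto
  have nn: "dual P0' I v q qs" "dual P1' (rels I v W) snd p ps"
     "\<And>s j. (s, j) \<in> rels I v W \<Longrightarrow> f' (p (s, j)) = Ar j \<odot>\<^bsub>P0'\<^esub> q s"
    using n by (auto simp: nice_def)
  have f0: "lin A P1 P0 f" using hl[OF c(2)] P0.submodule_carr[OF sk(1)] by (auto simp: lin_def)
  have "f (\<psi> (p (s, j))) = Ar j \<odot>\<^bsub>P0\<^esub> \<phi> (q s)" if r: "(s, j) \<in> rels I v W" for s j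
    using \<psi>(3)[OF dual_carr[OF nn(2) r]] nn(3)[OF r] lin_smult[OF \<phi>(1) Ar_closed dual_carr[OF nn(1)], of s] r
    by (simp add: rels_def)
  then have "nice I v W P1 f P0 (\<lambda>s. \<phi> (q s)) (\<lambda>s x. qs s (inv_into (carrier P0') \<phi> x))
      (\<lambda>r. \<psi> (p r)) (\<lambda>r x. ps r (inv_into (carrier P1') \<psi> x))"
    unfolding nice_def
    using L0 L1 f0 dual_transport[OF nn(1) L0' L0 \<phi>(1,2)] dual_transport[OF nn(2) L1' L1 \<psi>(1,2)] by auto
  then show ?thesis by blast
qed

end

section \<open>Homomorphisms into the Auslander--Reiten translate\<close>

text \<open>Needed for pairings and for evaluation of functions, which are additive without being
  module homomorphisms.\<close>

lemma additive_finsum: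
  assumes "abelian_monoid G" "abelian_monoid H"
    and "\<And>x. x \<in> carrier G \<Longrightarrow> h x \<in> carrier H"
    and "\<And>x y. \<lbrakk>x \<in> carrier G; y \<in> carrier G\<rbrakk> \<Longrightarrow> h (x \<oplus>\<^bsub>G\<^esub> y) = h x \<oplus>\<^bsub>H\<^esub> h y"
    and "h \<zero>\<^bsub>G\<^esub> = \<zero>\<^bsub>H\<^esub>" "finite S" "f \<in> S \<rightarrow> carrier G"
  shows "h (finsum G f S) = finsum H (\<lambda>s. h (f s)) S"
proof -
  interpret G: abelian_monoid G by fact
  interpret H: abelian_monoid H by fact
  show ?thesis using assms(6,7)
  proof (induct S rule: finite_induct)
    case (insert y F)
    then have *: "f y \<in> carrier G" "f \<in> F \<rightarrow> carrier G" by auto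
    then have "(\<lambda>s. h (f s)) \<in> F \<rightarrow> carrier H" "finsum G f F \<in> carrier G"
      using assms(3) by (auto simp: Pi_iff intro!: G.finsum_closed)
    then show ?case using insert * assms(3,4) by simp
  qed (use assms(5) in simp)
qed

section \<open>The right module of maps into the algebra\<close>

context rsz
begin

lemma star_simps:
  "carrier (star_module A P) = module_Hom A P (regular_module A)"
  "zero (star_module A P) = (\<lambda>x\<in>carrier P. \<zero>)"
  "add (star_module A P) = (\<lambda>h h'. \<lambda>x\<in>carrier P. h x \<oplus> h' x)"
  "smult (star_module A P) = (\<lambda>a h. \<lambda>x\<in>carrier P. h x \<otimes> a)"
  by (simp_all add: star_module_def)

lemma star_mem: "h \<in> carrier (star_module A P) \<longleftrightarrow> lin A P (regular_module A) h \<and> h \<in> extensional (carrier P)"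
  by (simp add: star_simps module_Hom_iff)

lemma star_app: "\<lbrakk>h \<in> carrier (star_module A P); x \<in> carrier P\<rbrakk> \<Longrightarrow> h x \<in> carrier A"
  by (auto simp: star_mem dest: regular_lin_simps(1))

lemma star_ext:
  assumes "h \<in> carrier (star_module A P)" "h' \<in> carrier (star_module A P)" "\<And>x. x \<in> carrier P \<Longrightarrow> h x = h' x"
  shows "h = h'"
  using assms by (intro extensionalityI[of h "carrier P" h']) (auto simp: star_mem)

context
  fixes P :: "('r, 'w) module"
  assumes P: "left_module A P"
begin

interpretation P: rsz_mod K A V par ev om P by (intro rsz_mod.intro rsz_axioms P)

lemma star_memI: "lin A P (regular_module A) h \<Longrightarrow> (\<lambda>x\<in>carrier P. h x) \<in> carrier (star_module A P)"
  using P.lin_restrict by (simp add: star_simps)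

lemma star_smult: "\<lbrakk>h \<in> carrier (star_module A P); a \<in> carrier A\<rbrakk> \<Longrightarrow> a \<odot>\<^bsub>star_module A P\<^esub> h \<in> carrier (star_module A P)"
  using P.lin_right_mult[OF regular_left_module, of h a] star_memI[of "\<lambda>x. h x \<otimes> a"]
  by (simp add: star_mem regular_simps) (simp add: star_simps)

lemma star_abelian: "abelian_group (star_module A P)"
proof (rule abelian_groupI)
  let ?S = "star_module A P"
  note app = star_app
  have l: "lin A P (regular_module A) h" if "h \<in> carrier ?S" for h using that by (simp add: star_mem)
  show add: "h \<oplus>\<^bsub>?S\<^esub> h' \<in> carrier ?S" if "h \<in> carrier ?S" "h' \<in> carrier ?S" for h h'
  proof -
    have "lin A P (regular_module A) (\<lambda>x. h x \<oplus> h' x)"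
      using regular_lin_simps[OF l[OF that(1)]] regular_lin_simps[OF l[OF that(2)]]
      by (intro linI) (simp_all add: regular_simps a_ac r_distr)
    then show ?thesis using star_memI by (simp add: star_simps)
  qed
  show z: "\<zero>\<^bsub>?S\<^esub> \<in> carrier ?S"
    using star_memI[of "\<lambda>_. \<zero>"] by (auto simp: star_simps lin_def regular_simps)
  show "(x \<oplus>\<^bsub>?S\<^esub> y) \<oplus>\<^bsub>?S\<^esub> z = x \<oplus>\<^bsub>?S\<^esub> (y \<oplus>\<^bsub>?S\<^esub> z)"
    if "x \<in> carrier ?S" "y \<in> carrier ?S" "z \<in> carrier ?S" for x y z
    using that by (intro star_ext[of _ P] add) (simp_all add: star_simps(3) app a_assoc)
  show "x \<oplus>\<^bsub>?S\<^esub> y = y \<oplus>\<^bsub>?S\<^esub> x" if "x \<in> carrier ?S" "y \<in> carrier ?S" for x y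
    using that by (intro star_ext[of _ P] add) (simp_all add: star_simps(3) app a_comm)
  show "\<zero>\<^bsub>?S\<^esub> \<oplus>\<^bsub>?S\<^esub> x = x" if "x \<in> carrier ?S" for x
    using that z by (intro star_ext[of _ P] add) (simp_all add: star_simps(2,3) app)
  show "\<exists>y\<in>carrier ?S. y \<oplus>\<^bsub>?S\<^esub> x = \<zero>\<^bsub>?S\<^esub>" if x: "x \<in> carrier ?S" for x
  proof (rule bexI[of _ "(\<ominus> \<one>) \<odot>\<^bsub>?S\<^esub> x"])
    show "(\<ominus> \<one>) \<odot>\<^bsub>?S\<^esub> x \<in> carrier ?S" using x by (intro star_smult) auto
    then show "(\<ominus> \<one>) \<odot>\<^bsub>?S\<^esub> x \<oplus>\<^bsub>?S\<^esub> x = \<zero>\<^bsub>?S\<^esub>"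
      using x z by (intro star_ext[of _ P] add) (simp_all add: star_simps(2,3,4) app r_minus l_neg)
  qed
qed

end

text \<open>The form is balanced: the left action on \<open>x\<close> may be traded for the right
  action on \<open>h\<close>. It is thus a linear functional on the tensor product over
  \<open>A\<close> of Hom(P1, A) and \<open>M\<close>, and by the last clause it factors through the
  transpose.\<close>

definition pairing ::
  "('r, 'v) module \<Rightarrow> ('r, 'w) module \<Rightarrow> ('w \<Rightarrow> 'w) \<Rightarrow> ('r, 'w) module \<Rightarrow> ('v \<Rightarrow> ('w \<Rightarrow> 'r) \<Rightarrow> 'k) \<Rightarrow> bool" where
  "pairing M P1 f P0 B \<longleftrightarrow> (\<forall>x\<in>carrier M. \<forall>h\<in>carrier (star_module A P1).
     B x h \<in> carrier K \<and>
     (\<forall>y\<in>carrier M. B (x \<oplus>\<^bsub>M\<^esub> y) h = B x h \<oplus>\<^bsub>K\<^esub> B y h) \<and>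
     (\<forall>h'\<in>carrier (star_module A P1). B x (h \<oplus>\<^bsub>star_module A P1\<^esub> h') = B x h \<oplus>\<^bsub>K\<^esub> B x h') \<and>
     (\<forall>a\<in>carrier A. B (a \<odot>\<^bsub>M\<^esub> x) h = B x (a \<odot>\<^bsub>star_module A P1\<^esub> h)) \<and>
     (\<forall>c\<in>carrier K. B x (sc c \<odot>\<^bsub>star_module A P1\<^esub> h) = c \<otimes>\<^bsub>K\<^esub> B x h)) \<and>
     (\<forall>x\<in>carrier M. \<forall>h\<in>carrier (star_module A P0). B x (compose (carrier P1) h f) = \<zero>\<^bsub>K\<^esub>)"

text \<open>\<open>Hom(M, D Tr M)\<close> consists of the pairings of \<open>M\<close> and \<open>Hom(P1, A)\<close> that vanish on the image of \<open>Hom(P0, A)\<close>.\<close>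

lemma Hom_AR_iff:
  fixes M :: "('r, 'v) module" and P0 P1 :: "('r, 'w) module"
  assumes M: "left_module A M" and P0: "left_module A P0" and P1: "left_module A P1" and f: "lin A P1 P0 f"
  defines "D \<equiv> dual_module K A (transpose_module A P1 f P0)"
  shows "module_Hom A M D = {\<lambda>x\<in>carrier M. \<zero>\<^bsub>D\<^esub>} \<longleftrightarrow>
    (\<forall>B. pairing M P1 f P0 B \<longrightarrow> (\<forall>x\<in>carrier M. \<forall>h\<in>carrier (star_module A P1). B x h = \<zero>\<^bsub>K\<^esub>))"
proof -
  interpret M: rsz_mod K A V par ev om M by (intro rsz_mod.intro rsz_axioms M)
  interpret P0: rsz_mod K A V par ev om P0 by (intro rsz_mod.intro rsz_axioms P0)
  interpret P1: rsz_mod K A V par ev om P1 by (intro rsz_mod.intro rsz_axioms P1)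
  let ?S = "star_module A P1" and ?SP = "star_module A P0"
  define H where "H = (\<lambda>h. compose (carrier P1) h f) ` carrier ?SP"
  define T where "T = quotient_module ?S H"
  have DT: "D = dual_module K A T" by (simp add: D_def T_def H_def transpose_module_def)
  interpret S: abelian_group ?S by (rule star_abelian[OF P1])
  interpret S0: abelian_group ?SP by (rule star_abelian[OF P0])
  have cm: "compose (carrier P1) h f \<in> carrier ?S" if "h \<in> carrier ?SP" for h
    using that star_memI[OF P1, OF lin_comp[OF f, of "regular_module A" h]] by (simp add: star_mem compose_def)
  have cadd: "compose (carrier P1) h f \<oplus>\<^bsub>?S\<^esub> compose (carrier P1) h' f = compose (carrier P1) (h \<oplus>\<^bsub>?SP\<^esub> h') f"
    if "h \<in> carrier ?SP" "h' \<in> carrier ?SP" for h h'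
    using lin_closed[OF f] by (intro ext) (auto simp: star_simps compose_def)
  have csm: "a \<odot>\<^bsub>?S\<^esub> compose (carrier P1) h f = compose (carrier P1) (a \<odot>\<^bsub>?SP\<^esub> h) f" for h a
    using lin_closed[OF f] by (intro ext) (auto simp: star_simps compose_def)
  have cz: "compose (carrier P1) \<zero>\<^bsub>?SP\<^esub> f = \<zero>\<^bsub>?S\<^esub>"
    using lin_closed[OF f] by (intro ext) (auto simp: star_simps compose_def)
  have Hc: "n \<in> carrier ?S" if "n \<in> H" for n using that cm by (auto simp: H_def)
  have Hadd: "n \<oplus>\<^bsub>?S\<^esub> n' \<in> H" if "n \<in> H" "n' \<in> H" for n n'
    using that cadd by (auto simp: H_def)
  have Hsm: "a \<odot>\<^bsub>?S\<^esub> n \<in> H" if "n \<in> H" "a \<in> carrier A" for n a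
    using that csm star_smult[OF P0] by (auto simp: H_def)
  have "subgroup H (add_monoid ?S)"
  proof (rule S.add.subgroupI)
    show "H \<subseteq> carrier ?S" "H \<noteq> {}" using Hc S0.zero_closed by (auto simp: H_def)
    show "n \<oplus>\<^bsub>?S\<^esub> n' \<in> H" if "n \<in> H" "n' \<in> H" for n n' using that by (rule Hadd)
    show "\<ominus>\<^bsub>?S\<^esub> n \<in> H" if nH: "n \<in> H" for n
    proof -
      obtain h where h: "h \<in> carrier ?SP" "n = compose (carrier P1) h f" using nH by (auto simp: H_def)
      have "compose (carrier P1) (\<ominus>\<^bsub>?SP\<^esub> h) f \<oplus>\<^bsub>?S\<^esub> n = \<zero>\<^bsub>?S\<^esub>"
        using h cadd[of "\<ominus>\<^bsub>?SP\<^esub> h" h] cz by (simp add: S0.l_neg)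
      then have "\<ominus>\<^bsub>?S\<^esub> n = compose (carrier P1) (\<ominus>\<^bsub>?SP\<^esub> h) f"
        using S.minus_equality[of "compose (carrier P1) (\<ominus>\<^bsub>?SP\<^esub> h) f" n] cm h by simp
      then show ?thesis using h by (simp add: H_def)
    qed
  qed
  then have "additive_subgroup H ?S" by (rule additive_subgroup.intro)
  then interpret H: abelian_subgroup H ?S by (rule abelian_subgroupI3[OF _ star_abelian[OF P1]])
  define cl where "cl h = H +>\<^bsub>?S\<^esub> h" for h
  have T_simps: "zero T = H" "add T = set_add ?S" "carrier T = a_rcosets\<^bsub>?S\<^esub> H"
    "smult T = (\<lambda>a C. \<Union>x\<in>C. H +>\<^bsub>?S\<^esub> (a \<odot>\<^bsub>?S\<^esub> x))"
    by (simp_all add: T_def quotient_module_def)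
  have clT: "cl h \<in> carrier T" if "h \<in> carrier ?S" for h
    using that by (auto simp: T_simps cl_def A_RCOSETS_def')
  have Tcl: "\<exists>h\<in>carrier ?S. C = cl h" if "C \<in> carrier T" for C
    using that by (auto simp: T_simps cl_def A_RCOSETS_def')
  have cl_add: "cl h \<oplus>\<^bsub>T\<^esub> cl h' = cl (h \<oplus>\<^bsub>?S\<^esub> h')" if "h \<in> carrier ?S" "h' \<in> carrier ?S" for h h'
    using H.a_rcos_sum[OF that] by (simp add: T_simps cl_def)
  have clH: "cl n = H" if "n \<in> H" for n using H.a_rcos_const[OF that] by (simp add: cl_def)
  have cl_self: "h \<in> cl h" if "h \<in> carrier ?S" for h using H.a_rcos_self[OF that] by (simp add: cl_def)
  have cl_mem: "\<exists>n\<in>H. y = n \<oplus>\<^bsub>?S\<^esub> h" if "y \<in> cl h" for y h using that by (auto simp: cl_def a_r_coset_def')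
  have cl_absorb: "cl (n \<oplus>\<^bsub>?S\<^esub> h) = cl h" if "n \<in> H" "h \<in> carrier ?S" for n h
    using H.a_repr_independence'[of "n \<oplus>\<^bsub>?S\<^esub> h" h] that by (auto simp: cl_def a_r_coset_def')
  have sadd: "a \<odot>\<^bsub>?S\<^esub> (h \<oplus>\<^bsub>?S\<^esub> h') = a \<odot>\<^bsub>?S\<^esub> h \<oplus>\<^bsub>?S\<^esub> a \<odot>\<^bsub>?S\<^esub> h'"
    if "a \<in> carrier A" "h \<in> carrier ?S" "h' \<in> carrier ?S" for a h h'
    using that by (intro ext) (auto simp: star_simps(3,4) star_app l_distr)
  have cl_sm: "a \<odot>\<^bsub>T\<^esub> cl h = cl (a \<odot>\<^bsub>?S\<^esub> h)" if a: "a \<in> carrier A" and h: "h \<in> carrier ?S" for a h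
  proof -
    have "H +>\<^bsub>?S\<^esub> (a \<odot>\<^bsub>?S\<^esub> y) = cl (a \<odot>\<^bsub>?S\<^esub> h)" if y: "y \<in> cl h" for y
    proof -
      obtain n where n: "n \<in> H" "y = n \<oplus>\<^bsub>?S\<^esub> h" using cl_mem[OF y] by blast
      then have "a \<odot>\<^bsub>?S\<^esub> y = a \<odot>\<^bsub>?S\<^esub> n \<oplus>\<^bsub>?S\<^esub> a \<odot>\<^bsub>?S\<^esub> h" using sadd[OF a Hc[OF n(1)] h] by simp
      then show ?thesis using cl_absorb[OF Hsm[OF n(1) a] star_smult[OF P1 h a]] by (simp add: cl_def)
    qed
    then show ?thesis using cl_self[OF h] by (auto simp: T_simps)
  qed
  have D_simps: "zero D = (\<lambda>x\<in>carrier T. \<zero>\<^bsub>K\<^esub>)" "add D = (\<lambda>\<phi> \<psi>. \<lambda>x\<in>carrier T. \<phi> x \<oplus>\<^bsub>K\<^esub> \<psi> x)"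
    "smult D = (\<lambda>a \<phi>. \<lambda>x\<in>carrier T. \<phi> (a \<odot>\<^bsub>T\<^esub> x))"
    by (simp_all add: DT dual_module_def)
  have D_mem: "\<phi> \<in> carrier D \<longleftrightarrow> \<phi> \<in> extensional (carrier T) \<and> (\<forall>C\<in>carrier T. \<phi> C \<in> carrier K) \<and>
      (\<forall>C\<in>carrier T. \<forall>C'\<in>carrier T. \<phi> (C \<oplus>\<^bsub>T\<^esub> C') = \<phi> C \<oplus>\<^bsub>K\<^esub> \<phi> C') \<and>
      (\<forall>c\<in>carrier K. \<forall>C\<in>carrier T. \<phi> (sc c \<odot>\<^bsub>T\<^esub> C) = c \<otimes>\<^bsub>K\<^esub> \<phi> C)" for \<phi>
    by (auto simp: DT dual_module_def sc_def PiE_iff)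
  have Tadd: "C \<oplus>\<^bsub>T\<^esub> C' \<in> carrier T" if "C \<in> carrier T" "C' \<in> carrier T" for C C'
    using Tcl[OF that(1)] Tcl[OF that(2)] cl_add clT by fastforce
  have Tsm: "a \<odot>\<^bsub>T\<^esub> C \<in> carrier T" if "a \<in> carrier A" "C \<in> carrier T" for a C
    using Tcl[OF that(2)] cl_sm[OF that(1)] clT star_smult[OF P1 _ that(1)] by fastforce
  have zD: "\<zero>\<^bsub>D\<^esub> \<in> carrier D" unfolding D_mem using Tadd Tsm by (auto simp: D_simps)
  have zHom: "(\<lambda>x\<in>carrier M. \<zero>\<^bsub>D\<^esub>) \<in> module_Hom A M D"
    unfolding module_Hom_iff using zD Tsm by (auto simp: lin_def D_simps intro!: ext)
  show ?thesis
  proof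
    assume hom: "module_Hom A M D = {\<lambda>x\<in>carrier M. \<zero>\<^bsub>D\<^esub>}"
    show "\<forall>B. pairing M P1 f P0 B \<longrightarrow> (\<forall>x\<in>carrier M. \<forall>h\<in>carrier ?S. B x h = \<zero>\<^bsub>K\<^esub>)"
    proof (intro allI impI ballI)
      fix B x h assume B: "pairing M P1 f P0 B" and x: "x \<in> carrier M" and h: "h \<in> carrier ?S"
      note BD = conjunct1[OF B[unfolded pairing_def], rule_format]
      have BH: "B x n = \<zero>\<^bsub>K\<^esub>" if "x \<in> carrier M" "n \<in> H" for x n
        using B that by (auto simp: pairing_def H_def)
      \<comment> \<open>A coset is evaluated at a chosen representative; \<open>wd\<close> removes
        the choice, since \<open>B\<close> vanishes on \<open>H\<close>.\<close>
      define rp where "rp C = (SOME h. h \<in> carrier ?S \<and> C = cl h)" for C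
      have rp: "rp C \<in> carrier ?S \<and> C = cl (rp C)" if "C \<in> carrier T" for C
      proof -
        have "\<exists>h. h \<in> carrier ?S \<and> C = cl h" using Tcl[OF that] by blast
        then show ?thesis unfolding rp_def by (rule someI_ex)
      qed
      have wd: "B x (rp (cl h)) = B x h" if x: "x \<in> carrier M" and h: "h \<in> carrier ?S" for x h
      proof -
        note r = rp[OF clT[OF h]]
        have "rp (cl h) \<in> cl h" using cl_self[of "rp (cl h)"] r by simp
        then obtain n where n: "n \<in> H" "rp (cl h) = n \<oplus>\<^bsub>?S\<^esub> h" using cl_mem by blast
        then show ?thesis using BD[OF x Hc[OF n(1)]] BD[OF x h] h BH[OF x n(1)] by simp
      qed
      let ?\<psi> = "\<lambda>x\<in>carrier M. \<lambda>C\<in>carrier T. B x (rp C)"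
      have "?\<psi> y \<in> carrier D" if y: "y \<in> carrier M" for y
      proof -
        have "B y (rp (C \<oplus>\<^bsub>T\<^esub> C')) = B y (rp C) \<oplus>\<^bsub>K\<^esub> B y (rp C')" if C: "C \<in> carrier T" "C' \<in> carrier T" for C C'
        proof -
          have "C \<oplus>\<^bsub>T\<^esub> C' = cl (rp C \<oplus>\<^bsub>?S\<^esub> rp C')" using cl_add[of "rp C" "rp C'"] rp[OF C(1)] rp[OF C(2)] by simp
          then have "B y (rp (C \<oplus>\<^bsub>T\<^esub> C')) = B y (rp C \<oplus>\<^bsub>?S\<^esub> rp C')"
            using wd[OF y, of "rp C \<oplus>\<^bsub>?S\<^esub> rp C'"] rp[OF C(1)] rp[OF C(2)] by simp
          then show ?thesis using BD[OF y, of "rp C"] rp[OF C(1)] rp[OF C(2)] by simp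
        qed
        moreover have "B y (rp (sc c \<odot>\<^bsub>T\<^esub> C)) = c \<otimes>\<^bsub>K\<^esub> B y (rp C)" if c: "c \<in> carrier K" and C: "C \<in> carrier T" for c C
        proof -
          have "sc c \<odot>\<^bsub>T\<^esub> C = cl (sc c \<odot>\<^bsub>?S\<^esub> rp C)" using cl_sm[of "sc c" "rp C"] rp[OF C] c by simp
          then have "B y (rp (sc c \<odot>\<^bsub>T\<^esub> C)) = B y (sc c \<odot>\<^bsub>?S\<^esub> rp C)"
            using wd[OF y star_smult[OF P1]] rp[OF C] c by simp
          then show ?thesis using BD[OF y, of "rp C"] rp[OF C] c by simp
        qed
        ultimately show ?thesis unfolding D_mem using y Tadd Tsm BD rp by simp
      qed
      moreover have "?\<psi> (y \<oplus>\<^bsub>M\<^esub> z) = ?\<psi> y \<oplus>\<^bsub>D\<^esub> ?\<psi> z" if "y \<in> carrier M" "z \<in> carrier M" for y z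
        using that BD rp by (intro ext) (simp add: D_simps)
      moreover have "?\<psi> (a \<odot>\<^bsub>M\<^esub> y) = a \<odot>\<^bsub>D\<^esub> ?\<psi> y" if a: "a \<in> carrier A" and y: "y \<in> carrier M" for a y
      proof (rule ext)
        fix C
        show "?\<psi> (a \<odot>\<^bsub>M\<^esub> y) C = (a \<odot>\<^bsub>D\<^esub> ?\<psi> y) C"
        proof (cases "C \<in> carrier T")
          case True
          have "a \<odot>\<^bsub>T\<^esub> C = cl (a \<odot>\<^bsub>?S\<^esub> rp C)" using cl_sm[of a "rp C"] rp[OF True] a by simp
          then have "B y (rp (a \<odot>\<^bsub>T\<^esub> C)) = B y (a \<odot>\<^bsub>?S\<^esub> rp C)"
            using wd[OF y star_smult[OF P1]] rp[OF True] a by simp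
          then show ?thesis using BD[OF y, of "rp C"] rp[OF True] a y True Tsm by (simp add: D_simps)
        qed (use a y in \<open>simp add: D_simps\<close>)
      qed
      ultimately have "?\<psi> \<in> module_Hom A M D" unfolding module_Hom_iff lin_def by auto
      then have "?\<psi> x = (\<lambda>C\<in>carrier T. \<zero>\<^bsub>K\<^esub>)" using hom x by (simp add: D_simps)
      then have "?\<psi> x (cl h) = \<zero>\<^bsub>K\<^esub>" using clT[OF h] by simp
      then show "B x h = \<zero>\<^bsub>K\<^esub>" using wd[OF x h] clT[OF h] x by simp
    qed
  next
    assume B0: "\<forall>B. pairing M P1 f P0 B \<longrightarrow> (\<forall>x\<in>carrier M. \<forall>h\<in>carrier ?S. B x h = \<zero>\<^bsub>K\<^esub>)"
    have "\<psi> = (\<lambda>x\<in>carrier M. \<zero>\<^bsub>D\<^esub>)" if psi: "\<psi> \<in> module_Hom A M D" for \<psi>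
    proof -
      have l: "lin A M D \<psi>" and e: "\<psi> \<in> extensional (carrier M)" using psi by (auto simp: module_Hom_iff)
      note pD = D_mem[THEN iffD1, OF lin_closed[OF l]]
      \<comment> \<open>\<open>H\<close> is the zero coset, and \<open>\<psi> x\<close> is
        additive.\<close>
      have pz: "\<psi> x H = \<zero>\<^bsub>K\<^esub>" if x: "x \<in> carrier M" for x
      proof -
        have H: "H \<in> carrier T" "H \<oplus>\<^bsub>T\<^esub> H = H"
          using clT[OF S.zero_closed] clH[OF H.zero_closed] cl_add[OF S.zero_closed S.zero_closed] by auto
        then have "\<psi> x H \<oplus>\<^bsub>K\<^esub> \<psi> x H = \<psi> x H" "\<psi> x H \<in> carrier K" using pD[OF x] by metis+
        then show ?thesis by (metis K.add.l_cancel_one K.zero_closed)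
      qed
      have "pairing M P1 f P0 (\<lambda>x h. \<psi> x (cl h))" unfolding pairing_def
      proof (intro conjI ballI)
        fix x h assume x: "x \<in> carrier M" and h: "h \<in> carrier ?S"
        show "\<psi> x (cl h) \<in> carrier K" using pD[OF x] clT[OF h] by blast
        show "\<psi> (x \<oplus>\<^bsub>M\<^esub> y) (cl h) = \<psi> x (cl h) \<oplus>\<^bsub>K\<^esub> \<psi> y (cl h)" if "y \<in> carrier M" for y
          using lin_add[OF l x that] clT[OF h] by (simp add: D_simps)
        show "\<psi> x (cl (h \<oplus>\<^bsub>?S\<^esub> h')) = \<psi> x (cl h) \<oplus>\<^bsub>K\<^esub> \<psi> x (cl h')" if "h' \<in> carrier ?S" for h'
          using pD[OF x] clT[OF h] clT[OF that] cl_add[OF h that] by metis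
        show "\<psi> (a \<odot>\<^bsub>M\<^esub> x) (cl h) = \<psi> x (cl (a \<odot>\<^bsub>?S\<^esub> h))" if "a \<in> carrier A" for a
          using lin_smult[OF l that x] clT[OF h] cl_sm[OF that h] by (simp add: D_simps)
        show "\<psi> x (cl (sc c \<odot>\<^bsub>?S\<^esub> h)) = c \<otimes>\<^bsub>K\<^esub> \<psi> x (cl h)" if "c \<in> carrier K" for c
          using pD[OF x] that clT[OF h] cl_sm[OF sc_closed[OF that] h] by metis
      next
        fix x h assume x: "x \<in> carrier M" and h: "h \<in> carrier ?SP"
        have "compose (carrier P1) h f \<in> H" using h by (simp add: H_def)
        then show "\<psi> x (cl (compose (carrier P1) h f)) = \<zero>\<^bsub>K\<^esub>" using clH pz[OF x] by simp
      qed
      then have z: "\<psi> x (cl h) = \<zero>\<^bsub>K\<^esub>" if "x \<in> carrier M" "h \<in> carrier ?S" for x h using B0 that by blast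
      have "\<psi> x = \<zero>\<^bsub>D\<^esub>" if x: "x \<in> carrier M" for x
      proof (rule extensionalityI[of _ "carrier T"])
        show "\<psi> x \<in> extensional (carrier T)" using pD[OF x] by blast
        show "\<zero>\<^bsub>D\<^esub> \<in> extensional (carrier T)" by (simp add: D_simps)
        show "\<psi> x C = \<zero>\<^bsub>D\<^esub> C" if "C \<in> carrier T" for C using Tcl[OF that] z[OF x] that by (auto simp: D_simps)
      qed
      then show ?thesis using e by (intro extensionalityI[of _ "carrier M"]) auto
    qed
    then show "module_Hom A M D = {\<lambda>x\<in>carrier M. \<zero>\<^bsub>D\<^esub>}" using zHom by blast
  qed
qed

end

section \<open>Combinatorial description of tau-rigidity\<close>

context rsz
begin

lemmas A_finsum_cong = finsum_cong'

text \<open>The relations are those of the string \<open>s\<close>, and the vectors to be lifted lie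
  in the string \<open>t\<close>; the two roles differ, so both orders are tested.\<close>

definition compat :: "'i set \<Rightarrow> ('i \<Rightarrow> nat) \<Rightarrow> ('i \<Rightarrow> nat set) \<Rightarrow> bool" where
  "compat I v W \<longleftrightarrow> (\<forall>s\<in>I. \<forall>t\<in>I. v t \<notin> ch (v s) - W s \<and> (v t = v s \<longrightarrow> card (W t - W s) \<le> 1))"

end

context rsz_mod
begin

lemma vs_finsum:
  assumes "finite I" "\<And>t. t \<in> I \<Longrightarrow> m t \<in> vs M i" shows "finsum M m I \<in> vs M i"
proof -
  have c: "m \<in> I \<rightarrow> carrier M" using assms(2) vs_carr by blast
  have "E i \<odot>\<^bsub>M\<^esub> finsum M m I = finsum M (\<lambda>t. E i \<odot>\<^bsub>M\<^esub> m t) I" by (rule smult_finsum[OF E_closed c assms(1)])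
  also have "\<dots> = finsum M m I" using c assms(2) vs_E by (intro M.finsum_cong') auto
  finally show ?thesis using c by (simp add: vs_def)
qed

text \<open>
  This is the surjectivity of \<open>Hom(P0, M) \<rightarrow> Hom(P1, M)\<close>: the arrows \<open>v s \<rightarrow> j\<close> with \<open>j \<notin> W s\<close>
  induce a surjection onto the product of the spaces of \<open>M\<close> at the points \<open>j\<close>.
\<close>

lemma compat_lift:
  assumes st: "strings M I v W u \<pi>" and cp: "compat I v W" and s: "s \<in> I"
    and j0: "j0 \<in> ch (v s)" "j0 \<notin> W s" and x: "x \<in> vs M j0"
  shows "\<exists>m\<in>vs M (v s). Ar j0 \<odot>\<^bsub>M\<^esub> m = x \<and> (\<forall>j\<in>ch (v s) - W s - {j0}. Ar j \<odot>\<^bsub>M\<^esub> m = \<zero>\<^bsub>M\<^esub>)"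
proof -
  have xc: "x \<in> carrier M" by (rule vs_carr[OF x])
  have jV: "j0 \<in> V" "par j0 = v s" using j0 by (auto simp: ch_def)
  have vV: "v s \<in> V" by (rule gen_point[OF strings_gen[OF st s]])
  have "\<exists>m. m \<in> vs M (v s) \<and> Ar j0 \<odot>\<^bsub>M\<^esub> m = \<pi> t x \<and> (\<forall>j\<in>ch (v s) - W s - {j0}. Ar j \<odot>\<^bsub>M\<^esub> m = \<zero>\<^bsub>M\<^esub>)"
    if t: "t \<in> I" for t
  proof -
    note g = strings_gen[OF st t]
    note uv = gen_vs[OF g] and uc = gen_carr[OF g] and tV = gen_point[OF g]
    have c1: "v t \<noteq> j0" and c2: "v t = v s \<Longrightarrow> card (W t - W s) \<le> 1"
      using cp s t j0 by (auto simp: compat_def)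
    have px: "\<pi> t x \<in> vs M j0" by (rule lin_vs[OF left_module_axioms strings_lin[OF st t] x])
    obtain a where a: "a \<in> carrier A" "\<pi> t x = a \<odot>\<^bsub>M\<^esub> u t"
      using strings_orb[OF st t xc] by (auto simp: orb_def)
    \<comment> \<open>As the generator of \<open>t\<close> does not sit at \<open>j0\<close>, the
      string has a component at \<open>j0\<close> only through the arrow from
      \<open>v s\<close>.\<close>
    have pe: "\<pi> t x = (if v t = v s then sc (om j0 a) \<odot>\<^bsub>M\<^esub> (Ar j0 \<odot>\<^bsub>M\<^esub> u t) else \<zero>\<^bsub>M\<^esub>)"
      using E_smult_off[OF a(1) tV jV(1) c1[symmetric] uv] vs_E[OF px] a(2) jV by auto
    show ?thesis
    proof (cases "v t = v s \<and> j0 \<in> W t")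
      case False
      then have "\<pi> t x = \<zero>\<^bsub>M\<^esub>" using pe gen_out[OF g, of j0] j0 a jV vV by auto
      then show ?thesis using zero_in_vs by (intro exI[of _ "\<zero>\<^bsub>M\<^esub>"]) auto
    next
      case True
      then have vt: "v t = v s" and jt: "j0 \<in> W t" by auto
      have ok: "om j0 a \<in> carrier K" using a jV vV by simp
      have comm: "Ar j \<odot>\<^bsub>M\<^esub> (sc (om j0 a) \<odot>\<^bsub>M\<^esub> u t) = sc (om j0 a) \<odot>\<^bsub>M\<^esub> (Ar j \<odot>\<^bsub>M\<^esub> u t)" for j
        using ok uc by (simp add: smult_mult sc_central)
      \<comment> \<open>\<open>W t - W s\<close> contains \<open>j0\<close> and has at most one
        element, so every other arrow outside \<open>W s\<close> kills \<open>u t\<close>.\<close>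
      have z: "Ar j \<odot>\<^bsub>M\<^esub> (sc (om j0 a) \<odot>\<^bsub>M\<^esub> u t) = \<zero>\<^bsub>M\<^esub>" if j: "j \<in> ch (v s) - W s - {j0}" for j
      proof -
        have "j \<notin> W t"
        proof
          assume "j \<in> W t"
          then have "{j0, j} \<subseteq> W t - W s" using j jt j0 by auto
          moreover have "finite (W t - W s)" using finite_subset[OF gen_sub[OF g]] by simp
          ultimately have "card {j0, j} \<le> card (W t - W s)" by (intro card_mono) auto
          then show False using c2[OF vt] j by simp
        qed
        then have "Ar j \<odot>\<^bsub>M\<^esub> u t = \<zero>\<^bsub>M\<^esub>" using gen_out[OF g, of j] j vt by auto
        then show ?thesis using comm ok by simp
      qed
      show ?thesis
        using sc_in_vs[OF uv ok] vt pe comm z by (intro exI[of _ "sc (om j0 a) \<odot>\<^bsub>M\<^esub> u t"]) auto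
    qed
  qed
  then obtain m where m: "\<And>t. t \<in> I \<Longrightarrow> m t \<in> vs M (v s)" "\<And>t. t \<in> I \<Longrightarrow> Ar j0 \<odot>\<^bsub>M\<^esub> m t = \<pi> t x"
    "\<And>t j. \<lbrakk>t \<in> I; j \<in> ch (v s) - W s - {j0}\<rbrakk> \<Longrightarrow> Ar j \<odot>\<^bsub>M\<^esub> m t = \<zero>\<^bsub>M\<^esub>" by metis
  have mc: "m \<in> I \<rightarrow> carrier M" using m(1) vs_carr by blast
  have fi: "finite I" by (rule strings_finite[OF st])
  have A: "Ar j \<odot>\<^bsub>M\<^esub> finsum M m I = finsum M (\<lambda>t. Ar j \<odot>\<^bsub>M\<^esub> m t) I" for j
    by (rule smult_finsum[OF Ar_closed mc fi])
  have "finsum M (\<lambda>t. Ar j0 \<odot>\<^bsub>M\<^esub> m t) I = finsum M (\<lambda>t. \<pi> t x) I"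
    using m(2) lin_closed[OF strings_lin[OF st] xc] by (intro M.finsum_cong') auto
  moreover have "finsum M (\<lambda>t. Ar j \<odot>\<^bsub>M\<^esub> m t) I = \<zero>\<^bsub>M\<^esub>" if "j \<in> ch (v s) - W s - {j0}" for j
  proof -
    have "finsum M (\<lambda>t. Ar j \<odot>\<^bsub>M\<^esub> m t) I = finsum M (\<lambda>t. \<zero>\<^bsub>M\<^esub>) I"
      using m(3) that by (intro M.finsum_cong') auto
    then show ?thesis by simp
  qed
  ultimately show ?thesis
    using vs_finsum[OF fi m(1)] A strings_sum[OF st xc] by (intro bexI[of _ "finsum M m I"]) auto
qed

text \<open>Maps \<open>h\<close> are combinations of the coordinate maps of \<open>P1\<close>,
  which leaves the values of \<open>B\<close> at a vector \<open>y\<close> at \<open>j0\<close> and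
  the map \<open>ps (s, j0)\<close>. Such a \<open>y\<close> is lifted to \<open>m\<close> by
  \<open>compat_lift\<close>; pairing \<open>m\<close> with the pullback of \<open>qs s\<close>
  gives zero on the one hand and, by \<open>nice_qs_f\<close>, the wanted value on the
  other.\<close>

lemma compat_pairing_zero:
  fixes P0 P1 :: "('r, 'w) module"
  assumes st: "strings M I v W u \<pi>" and cp: "compat I v W" and n: "nice I v W P1 f P0 q qs p ps"
    and B: "pairing M P1 f P0 B" and x: "x \<in> carrier M" and h: "h \<in> carrier (star_module A P1)"
  shows "B x h = \<zero>\<^bsub>K\<^esub>"
proof -
  have d0: "dual P0 I v q qs" and d1: "dual P1 (rels I v W) snd p ps" and f: "lin A P1 P0 f"
    and P0: "left_module A P0" and P1: "left_module A P1"
    using n by (auto simp: nice_def)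
  interpret P0: rsz_mod K A V par ev om P0 by (rule rsz_modI[OF P0])
  interpret P1: rsz_mod K A V par ev om P1 by (rule rsz_modI[OF P1])
  let ?S = "star_module A P1"
  interpret S: abelian_group ?S by (rule star_abelian[OF P1])
  note BD = conjunct1[OF B[unfolded pairing_def], rule_format]
  note B0 = conjunct2[OF B[unfolded pairing_def], rule_format]
  have Bz: "B \<zero>\<^bsub>M\<^esub> h = \<zero>\<^bsub>K\<^esub>" if "h \<in> carrier ?S" for h
  proof -
    have "B \<zero>\<^bsub>M\<^esub> h \<oplus>\<^bsub>K\<^esub> B \<zero>\<^bsub>M\<^esub> h = B \<zero>\<^bsub>M\<^esub> h" "B \<zero>\<^bsub>M\<^esub> h \<in> carrier K"
      using BD[OF M.zero_closed that] by (metis M.l_zero M.zero_closed)+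
    then show ?thesis by (metis K.add.l_cancel_one K.zero_closed)
  qed
  have Bsum: "B y (finsum ?S g J) = finsum K (\<lambda>r. B y (g r)) J"
    if "y \<in> carrier M" "finite J" "g \<in> J \<rightarrow> carrier ?S" for y J and g :: "'j \<Rightarrow> 'w \<Rightarrow> 'r"
  proof (rule additive_finsum[where h = "B y"])
    show "abelian_monoid ?S" "abelian_monoid K" by unfold_locales
    have "B y \<zero>\<^bsub>?S\<^esub> \<oplus>\<^bsub>K\<^esub> B y \<zero>\<^bsub>?S\<^esub> = B y \<zero>\<^bsub>?S\<^esub>" "B y \<zero>\<^bsub>?S\<^esub> \<in> carrier K"
      using BD[OF that(1) S.zero_closed] by (metis S.l_zero S.zero_closed)+
    then show "B y \<zero>\<^bsub>?S\<^esub> = \<zero>\<^bsub>K\<^esub>" by (metis K.add.l_cancel_one K.zero_closed)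
  qed (use that BD in auto)
  have app: "finsum ?S g J z = finsum A (\<lambda>r. g r z) J"
    if "z \<in> carrier P1" "finite J" "g \<in> J \<rightarrow> carrier ?S" for z J and g :: "'j \<Rightarrow> 'w \<Rightarrow> 'r"
  proof (rule additive_finsum[where h = "\<lambda>h. h z"])
    show "abelian_monoid ?S" "abelian_monoid A" by unfold_locales
  qed (use that in \<open>auto simp: star_app\<close>, simp_all add: star_simps)
  have psr: "restrict (ps r) (carrier P1) \<in> carrier ?S" if "r \<in> rels I v W" for r
    by (rule star_memI[OF P1 dual_lin[OF d1 that]])
  let ?ps = "\<lambda>r. restrict (ps r) (carrier P1)"
  have key: "B y (?ps (s, j0)) = \<zero>\<^bsub>K\<^esub>" if r: "(s, j0) \<in> rels I v W" and y: "y \<in> vs M j0" for s j0 y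
  proof -
    have s: "s \<in> I" "j0 \<in> ch (v s)" "j0 \<notin> W s" using r by (auto simp: rels_def)
    let ?C = "ch (v s) - W s"
    have rC: "(s, j) \<in> rels I v W" if "j \<in> ?C" for j using that s by (simp add: rels_def)
    obtain m where m: "m \<in> vs M (v s)" "Ar j0 \<odot>\<^bsub>M\<^esub> m = y" "\<And>j. j \<in> ?C - {j0} \<Longrightarrow> Ar j \<odot>\<^bsub>M\<^esub> m = \<zero>\<^bsub>M\<^esub>"
      using compat_lift[OF st cp s y] by blast
    have mc: "m \<in> carrier M" by (rule vs_carr[OF m(1)])
    have Sm: "Ar j \<odot>\<^bsub>?S\<^esub> ?ps (s, j) \<in> carrier ?S" if "j \<in> ?C" for j
      by (rule star_smult[OF P1 psr[OF rC[OF that]] Ar_closed])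
    have qm: "restrict (qs s) (carrier P0) \<in> carrier (star_module A P0)"
      by (rule star_memI[OF P0 dual_lin[OF d0 s(1)]])
    have Bm: "B m (Ar j \<odot>\<^bsub>?S\<^esub> ?ps (s, j)) = B (Ar j \<odot>\<^bsub>M\<^esub> m) (?ps (s, j))" if "j \<in> ?C" for j
      using BD[OF mc psr[OF rC[OF that]]] Ar_closed by metis
    have Bc: "B (Ar j \<odot>\<^bsub>M\<^esub> m) (?ps (s, j)) \<in> carrier K" if "j \<in> ?C" for j
      using BD[OF smult_closed[OF Ar_closed mc] psr[OF rC[OF that]]] by blast
    have "finsum ?S (\<lambda>j. Ar j \<odot>\<^bsub>?S\<^esub> ?ps (s, j)) ?C = compose (carrier P1) (restrict (qs s) (carrier P0)) f"
    proof (rule extensionalityI[of _ "carrier P1"])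
      show "finsum ?S (\<lambda>j. Ar j \<odot>\<^bsub>?S\<^esub> ?ps (s, j)) ?C \<in> extensional (carrier P1)"
        using S.finsum_closed[of "\<lambda>j. Ar j \<odot>\<^bsub>?S\<^esub> ?ps (s, j)" ?C] Sm by (simp add: star_mem Pi_iff)
      fix z assume z: "z \<in> carrier P1"
      have "finsum ?S (\<lambda>j. Ar j \<odot>\<^bsub>?S\<^esub> ?ps (s, j)) ?C z = finsum A (\<lambda>j. (Ar j \<odot>\<^bsub>?S\<^esub> ?ps (s, j)) z) ?C"
        using Sm by (intro app z) auto
      also have "\<dots> = finsum A (\<lambda>j. ps (s, j) z \<otimes> Ar j) ?C"
        using z dual_closed[OF d1 rC z] by (intro A_finsum_cong) (auto simp: star_simps)
      also have "\<dots> = qs s (f z)" using nice_qs_f[OF n s(1) z] by simp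
      finally show "finsum ?S (\<lambda>j. Ar j \<odot>\<^bsub>?S\<^esub> ?ps (s, j)) ?C z = compose (carrier P1) (restrict (qs s) (carrier P0)) f z"
        using z lin_closed[OF f z] by (simp add: compose_def)
    qed (simp add: compose_def)
    then have "\<zero>\<^bsub>K\<^esub> = B m (finsum ?S (\<lambda>j. Ar j \<odot>\<^bsub>?S\<^esub> ?ps (s, j)) ?C)" using B0[OF mc qm] by simp
    also have "\<dots> = finsum K (\<lambda>j. B m (Ar j \<odot>\<^bsub>?S\<^esub> ?ps (s, j))) ?C"
      using Sm by (intro Bsum mc) auto
    also have "\<dots> = finsum K (\<lambda>j. B (Ar j \<odot>\<^bsub>M\<^esub> m) (?ps (s, j))) ?C"
      using Bm Bc by (intro K.finsum_cong') auto
    \<comment> \<open>The arrows of the other relations of \<open>s\<close> kill \<open>m\<close>,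
      which leaves one term.\<close>
    also have "\<dots> = B (Ar j0 \<odot>\<^bsub>M\<^esub> m) (?ps (s, j0))"
    proof (rule K_finsum_single)
      show "B (Ar j \<odot>\<^bsub>M\<^esub> m) (?ps (s, j)) = \<zero>\<^bsub>K\<^esub>" if "j \<in> ?C" "j \<noteq> j0" for j
        using m(3)[of j] Bz[OF psr[OF rC[OF that(1)]]] that by simp
    qed (use s Bc in auto)
    finally show ?thesis using m(2) by simp
  qed
  have hl: "lin A P1 (regular_module A) h" using h by (simp add: star_mem)
  note hr = regular_lin_simps[OF hl]
  have pc: "p r \<in> carrier P1" "E (snd r) \<odot>\<^bsub>P1\<^esub> p r = p r" if "r \<in> rels I v W" for r
    using dual_vs[OF d1 that] by (auto simp: vs_def)
  have hp: "h (p r) \<in> carrier A" "E (snd r) \<otimes> h (p r) = h (p r)" if "r \<in> rels I v W" for r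
    using hr(1)[OF pc(1)[OF that]] hr(3)[OF E_closed pc(1)[OF that], of "snd r"] pc(2)[OF that] by auto
  have Sm: "h (p r) \<odot>\<^bsub>?S\<^esub> ?ps r \<in> carrier ?S" if "r \<in> rels I v W" for r
    by (rule star_smult[OF P1 psr[OF that] hp(1)[OF that]])
  have fr: "finite (rels I v W)" by (rule dual_finite[OF d1])
  \<comment> \<open>Expansion of \<open>h\<close> in the dual basis: its coefficients are the values
    on the generators.\<close>
  have "h = finsum ?S (\<lambda>r. h (p r) \<odot>\<^bsub>?S\<^esub> ?ps r) (rels I v W)"
  proof (rule extensionalityI[of _ "carrier P1"])
    show "h \<in> extensional (carrier P1)" using h by (simp add: star_mem)
    show "finsum ?S (\<lambda>r. h (p r) \<odot>\<^bsub>?S\<^esub> ?ps r) (rels I v W) \<in> extensional (carrier P1)"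
      using S.finsum_closed[of "\<lambda>r. h (p r) \<odot>\<^bsub>?S\<^esub> ?ps r" "rels I v W"] Sm by (simp add: star_mem Pi_iff)
    fix z assume z: "z \<in> carrier P1"
    have "finsum ?S (\<lambda>r. h (p r) \<odot>\<^bsub>?S\<^esub> ?ps r) (rels I v W) z = finsum A (\<lambda>r. (h (p r) \<odot>\<^bsub>?S\<^esub> ?ps r) z) (rels I v W)"
      using Sm by (intro app z fr) auto
    also have "\<dots> = finsum A (\<lambda>r. ps r z \<otimes> h (p r)) (rels I v W)"
      using z dual_closed[OF d1 _ z] hp by (intro A_finsum_cong) (auto simp: star_simps)
    also have "\<dots> = finsum (regular_module A) (\<lambda>r. h (ps r z \<odot>\<^bsub>P1\<^esub> p r)) (rels I v W)"
      unfolding finsum_regular using dual_closed[OF d1 _ z] pc hp hr(3) by (intro A_finsum_cong) auto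
    also have "\<dots> = h (finsum P1 (\<lambda>r. ps r z \<odot>\<^bsub>P1\<^esub> p r) (rels I v W))"
      using dual_closed[OF d1 _ z] pc by (intro P1.lin_finsum[OF hl regular_left_module _ fr, symmetric]) auto
    finally show "h z = finsum ?S (\<lambda>r. h (p r) \<odot>\<^bsub>?S\<^esub> ?ps r) (rels I v W) z"
      using dual_sum[OF d1 z] by simp
  qed
  then have "B x h = B x (finsum ?S (\<lambda>r. h (p r) \<odot>\<^bsub>?S\<^esub> ?ps r) (rels I v W))" by simp
  also have "\<dots> = finsum K (\<lambda>r. B x (h (p r) \<odot>\<^bsub>?S\<^esub> ?ps r)) (rels I v W)"
    using Sm by (intro Bsum x fr) auto
  also have "\<dots> = finsum K (\<lambda>r. \<zero>\<^bsub>K\<^esub>) (rels I v W)"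
  proof (rule K.finsum_cong')
    fix r assume r: "r \<in> rels I v W"
    \<comment> \<open>The coefficient is moved to \<open>x\<close>, where it produces a vector at
      the point of the relation.\<close>
    have "h (p r) \<odot>\<^bsub>M\<^esub> x \<in> vs M (snd r)" using hp[OF r] x by (simp add: vs_def smult_mult)
    then have "B (h (p r) \<odot>\<^bsub>M\<^esub> x) (?ps r) = \<zero>\<^bsub>K\<^esub>" using key[of "fst r" "snd r"] r by simp
    then show "B x (h (p r) \<odot>\<^bsub>?S\<^esub> ?ps r) = \<zero>\<^bsub>K\<^esub>" using BD[OF x psr[OF r]] hp[OF r] by simp
  qed auto
  finally show ?thesis by simp
qed

lemma gen_coord_unique:
  assumes g: "gen M i W u" and ab: "a \<in> carrier A" "b \<in> carrier A" "a \<odot>\<^bsub>M\<^esub> u = b \<odot>\<^bsub>M\<^esub> u"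
  shows "ev i a = ev i b" "j \<in> W \<Longrightarrow> om j a = om j b"
proof -
  have iV: "i \<in> V" by (rule gen_point[OF g])
  have e: "a = b" if "a \<oplus>\<^bsub>K\<^esub> \<ominus>\<^bsub>K\<^esub> b = \<zero>\<^bsub>K\<^esub>" "a \<in> carrier K" "b \<in> carrier K" for a b
    using that K.minus_equality[of a "\<ominus>\<^bsub>K\<^esub> b"] by simp
  have "(a \<ominus> b) \<odot>\<^bsub>M\<^esub> u = \<zero>\<^bsub>M\<^esub>" using ab gen_carr[OF g] by (simp add: smult_eq_iff)
  then have *: "ev i (a \<ominus> b) = \<zero>\<^bsub>K\<^esub> \<and> (\<forall>j\<in>W. om j (a \<ominus> b) = \<zero>\<^bsub>K\<^esub>)"
    using smult_gen_zero_iff[OF g] ab by simp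
  show "ev i a = ev i b" by (rule e) (use * ab iV in \<open>simp_all add: a_minus_def\<close>)
  show "om j a = om j b" if "j \<in> W"
  proof (rule e)
    have j: "j \<in> V" "par j \<in> V" using that gen_sub[OF g] iV by (auto simp: ch_def)
    then show "om j a \<in> carrier K" "om j b \<in> carrier K" using ab by simp_all
    have "om j (a \<oplus> \<ominus> b) = \<zero>\<^bsub>K\<^esub>" using * that by (simp add: a_minus_def)
    then show "om j a \<oplus>\<^bsub>K\<^esub> \<ominus>\<^bsub>K\<^esub> om j b = \<zero>\<^bsub>K\<^esub>" using j ab by simp
  qed
qed

text \<open>\<kappa> is the coefficient of \<open>u t\<close>, and \<open>l j\<close> that of
  \<open>Ar j\<close> applied to \<open>u t\<close>, in the component of a vector in the string
  \<open>t\<close>. Both are well defined by \<open>gen_coord_unique\<close>.\<close>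

lemma coordinate_functionals:
  assumes st: "strings M I v W u \<pi>" and t: "t \<in> I"
  obtains \<kappa> l where "\<And>x. x \<in> carrier M \<Longrightarrow> \<kappa> x \<in> carrier K" "\<And>x j. \<lbrakk>x \<in> carrier M; j \<in> W t\<rbrakk> \<Longrightarrow> l j x \<in> carrier K"
    "\<And>x y. \<lbrakk>x \<in> carrier M; y \<in> carrier M\<rbrakk> \<Longrightarrow> \<kappa> (x \<oplus>\<^bsub>M\<^esub> y) = \<kappa> x \<oplus>\<^bsub>K\<^esub> \<kappa> y"
    "\<And>x y j. \<lbrakk>x \<in> carrier M; y \<in> carrier M; j \<in> W t\<rbrakk> \<Longrightarrow> l j (x \<oplus>\<^bsub>M\<^esub> y) = l j x \<oplus>\<^bsub>K\<^esub> l j y"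
    "\<And>a x. \<lbrakk>a \<in> carrier A; x \<in> carrier M\<rbrakk> \<Longrightarrow> \<kappa> (a \<odot>\<^bsub>M\<^esub> x) = ev (v t) a \<otimes>\<^bsub>K\<^esub> \<kappa> x"
    "\<And>a x j. \<lbrakk>a \<in> carrier A; x \<in> carrier M; j \<in> W t\<rbrakk> \<Longrightarrow> l j (a \<odot>\<^bsub>M\<^esub> x) = ev j a \<otimes>\<^bsub>K\<^esub> l j x \<oplus>\<^bsub>K\<^esub> om j a \<otimes>\<^bsub>K\<^esub> \<kappa> x"
    "\<kappa> (u t) = \<one>\<^bsub>K\<^esub>" "\<And>j. j \<in> W t \<Longrightarrow> l j (u t) = \<zero>\<^bsub>K\<^esub>"
proof -
  note g = strings_gen[OF st t] and pl = strings_lin[OF st t]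
  note uc = gen_carr[OF g] and tV = gen_point[OF g]
  have jV: "j \<in> V" "par j = v t" "par j \<in> V" if "j \<in> W t" for j
    using gen_sub[OF g] that tV by (auto simp: ch_def)
  have "\<exists>a. a \<in> carrier A \<and> \<pi> t x = a \<odot>\<^bsub>M\<^esub> u t" if "x \<in> carrier M" for x
    using strings_orb[OF st t that] by (auto simp: orb_def)
  then obtain co where co: "\<And>x. x \<in> carrier M \<Longrightarrow> co x \<in> carrier A" "\<And>x. x \<in> carrier M \<Longrightarrow> \<pi> t x = co x \<odot>\<^bsub>M\<^esub> u t"
    by metis
  have ce: "ev (v t) (co x) = ev (v t) a" "j \<in> W t \<Longrightarrow> om j (co x) = om j a"
    if "x \<in> carrier M" "a \<in> carrier A" "\<pi> t x = a \<odot>\<^bsub>M\<^esub> u t" for x a j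
    using gen_coord_unique[OF g co(1)[OF that(1)] that(2)] co(2)[OF that(1)] that(3) by auto
  have ad: "\<pi> t (x \<oplus>\<^bsub>M\<^esub> y) = (co x \<oplus> co y) \<odot>\<^bsub>M\<^esub> u t" if "x \<in> carrier M" "y \<in> carrier M" for x y
    using that co uc lin_add[OF pl] by (simp add: smult_l_distr)
  have sm: "\<pi> t (a \<odot>\<^bsub>M\<^esub> x) = (a \<otimes> co x) \<odot>\<^bsub>M\<^esub> u t" if "a \<in> carrier A" "x \<in> carrier M" for a x
    using that co uc lin_smult[OF pl] by (simp add: smult_assoc)
  have un: "\<pi> t (u t) = \<one> \<odot>\<^bsub>M\<^esub> u t" using strings_same[OF st t] uc by (simp add: smult_one)
  show thesis
    by (rule that[of "\<lambda>x. ev (v t) (co x)" "\<lambda>j x. om j (co x)"])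
      (use co(1) tV jV uc ce(1)[OF _ _ ad] ce(1)[OF _ _ sm] ce(1)[OF uc one_closed un]
        ce(2)[OF _ _ ad] ce(2)[OF _ _ sm] ce(2)[OF uc one_closed un] in auto)
qed

text \<open>A violated condition leaves a vector that cannot be lifted, and a functional that
  detects it on the string \<open>t\<close> gives the pairing. The pullback of a map
  \<open>h\<close> on \<open>P0\<close> takes the value \<open>Ar j\<close> times
  \<open>h (q s)\<close> at the generator \<open>p (s, j)\<close>, so the functional is chosen to
  vanish on such values.\<close>

lemma not_compat_pairing:
  fixes P0 P1 :: "('r, 'w) module"
  assumes st: "strings M I v W u \<pi>" and nc: "\<not> compat I v W" and n: "nice I v W P1 f P0 q qs p ps"
  shows "\<exists>B. pairing M P1 f P0 B \<and> (\<exists>x\<in>carrier M. \<exists>h\<in>carrier (star_module A P1). B x h \<noteq> \<zero>\<^bsub>K\<^esub>)"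
proof -
  have d0: "dual P0 I v q qs" and d1: "dual P1 (rels I v W) snd p ps" and f: "lin A P1 P0 f"
    and P0: "left_module A P0" and P1: "left_module A P1"
    and fp: "\<And>s j. (s, j) \<in> rels I v W \<Longrightarrow> f (p (s, j)) = Ar j \<odot>\<^bsub>P0\<^esub> q s"
    using n by (auto simp: nice_def)
  let ?S = "star_module A P1"
  have psr: "restrict (ps r) (carrier P1) \<in> carrier ?S" if "r \<in> rels I v W" for r
    by (rule star_memI[OF P1 dual_lin[OF d1 that]])
  have pc: "p r \<in> carrier P1" if "r \<in> rels I v W" for r using dual_carr[OF d1 that] .
  have hA: "h (p r) \<in> carrier A" if "h \<in> carrier ?S" "r \<in> rels I v W" for h r
    by (rule star_app[OF that(1) pc[OF that(2)]])
  have hadd: "(h \<oplus>\<^bsub>?S\<^esub> h') (p r) = h (p r) \<oplus> h' (p r)" if "r \<in> rels I v W" for h h' r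
    using pc[OF that] by (simp add: star_simps)
  have hsm: "(a \<odot>\<^bsub>?S\<^esub> h) (p r) = h (p r) \<otimes> a" if "r \<in> rels I v W" for h a r
    using pc[OF that] by (simp add: star_simps)
  have hcomp: "compose (carrier P1) h f (p (s, j)) = Ar j \<otimes> h (q s)" and hq: "h (q s) \<in> carrier A"
    if "h \<in> carrier (star_module A P0)" "(s, j) \<in> rels I v W" for h s j
  proof -
    have s: "s \<in> I" using that(2) by (simp add: rels_def)
    have hl: "lin A P0 (regular_module A) h" using that(1) by (simp add: star_mem)
    show "compose (carrier P1) h f (p (s, j)) = Ar j \<otimes> h (q s)"
      using pc[OF that(2)] fp[OF that(2)] regular_lin_simps(3)[OF hl Ar_closed dual_carr[OF d0 s]]
      by (simp add: compose_def)
    show "h (q s) \<in> carrier A" by (rule regular_lin_simps(1)[OF hl dual_carr[OF d0 s]])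
  qed
  obtain s t where s: "s \<in> I" and t: "t \<in> I"
    and dis: "v t \<in> ch (v s) - W s \<or> v t = v s \<and> 1 < card (W t - W s)"
    using nc by (auto simp: compat_def not_le)
  note gt = strings_gen[OF st t]
  have uc: "u t \<in> carrier M" by (rule gen_carr[OF gt])
  obtain \<kappa> l where \<kappa>c: "\<And>x. x \<in> carrier M \<Longrightarrow> \<kappa> x \<in> carrier K" and lc: "\<And>x j. \<lbrakk>x \<in> carrier M; j \<in> W t\<rbrakk> \<Longrightarrow> l j x \<in> carrier K"
    and \<kappa>a: "\<And>x y. \<lbrakk>x \<in> carrier M; y \<in> carrier M\<rbrakk> \<Longrightarrow> \<kappa> (x \<oplus>\<^bsub>M\<^esub> y) = \<kappa> x \<oplus>\<^bsub>K\<^esub> \<kappa> y"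
    and la: "\<And>x y j. \<lbrakk>x \<in> carrier M; y \<in> carrier M; j \<in> W t\<rbrakk> \<Longrightarrow> l j (x \<oplus>\<^bsub>M\<^esub> y) = l j x \<oplus>\<^bsub>K\<^esub> l j y"
    and \<kappa>s: "\<And>a x. \<lbrakk>a \<in> carrier A; x \<in> carrier M\<rbrakk> \<Longrightarrow> \<kappa> (a \<odot>\<^bsub>M\<^esub> x) = ev (v t) a \<otimes>\<^bsub>K\<^esub> \<kappa> x"
    and ls: "\<And>a x j. \<lbrakk>a \<in> carrier A; x \<in> carrier M; j \<in> W t\<rbrakk> \<Longrightarrow> l j (a \<odot>\<^bsub>M\<^esub> x) = ev j a \<otimes>\<^bsub>K\<^esub> l j x \<oplus>\<^bsub>K\<^esub> om j a \<otimes>\<^bsub>K\<^esub> \<kappa> x"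
    and \<kappa>u: "\<kappa> (u t) = \<one>\<^bsub>K\<^esub>" and lu: "\<And>j. j \<in> W t \<Longrightarrow> l j (u t) = \<zero>\<^bsub>K\<^esub>"
    using coordinate_functionals[OF st t] by blast
  show ?thesis
  proof (cases "v t \<in> ch (v s) - W s")
    case True
    define k where "k = v t"
    have r: "(s, k) \<in> rels I v W" using True s by (simp add: rels_def k_def)
    have kV: "k \<in> V" using gen_point[OF gt] by (simp add: k_def)
    \<comment> \<open>\<kappa> sees only the idempotent coordinate of the coefficient, which is zero
      for a right multiple of an arrow.\<close>
    let ?B = "\<lambda>x h. \<kappa> (h (p (s, k)) \<odot>\<^bsub>M\<^esub> x)"
    have "pairing M P1 f P0 ?B" unfolding pairing_def
    proof (intro conjI ballI)
      fix x h assume x: "x \<in> carrier M" and h: "h \<in> carrier ?S"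
      note hp = hA[OF h r]
      show "?B x h \<in> carrier K" using x hp \<kappa>c by simp
      show "?B (x \<oplus>\<^bsub>M\<^esub> y) h = ?B x h \<oplus>\<^bsub>K\<^esub> ?B y h" if "y \<in> carrier M" for y
        using x hp that \<kappa>a by (simp add: smult_r_distr)
      show "?B x (h \<oplus>\<^bsub>?S\<^esub> h') = ?B x h \<oplus>\<^bsub>K\<^esub> ?B x h'" if "h' \<in> carrier ?S" for h'
        using x hp hA[OF that r] \<kappa>a by (simp add: hadd[OF r] smult_l_distr)
      show "?B (a \<odot>\<^bsub>M\<^esub> x) h = ?B x (a \<odot>\<^bsub>?S\<^esub> h)" if "a \<in> carrier A" for a
        using x hp that by (simp add: hsm[OF r] smult_assoc)
      show "?B x (sc c \<odot>\<^bsub>?S\<^esub> h) = c \<otimes>\<^bsub>K\<^esub> ?B x h" if "c \<in> carrier K" for c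
        using x hp that kV \<kappa>s \<kappa>c by (simp add: hsm[OF r] sc_central[symmetric] smult_assoc k_def[symmetric])
    next
      fix x h assume x: "x \<in> carrier M" and h: "h \<in> carrier (star_module A P0)"
      show "?B x (compose (carrier P1) h f) = \<zero>\<^bsub>K\<^esub>"
        using x hcomp[OF h r] hq[OF h r] \<kappa>s \<kappa>c kV by (simp add: k_def[symmetric])
    qed
    moreover have "?B (u t) (restrict (ps (s, k)) (carrier P1)) = \<one>\<^bsub>K\<^esub>"
      using dual_delta[OF d1 r r] pc[OF r] \<kappa>s[OF _ uc] \<kappa>u kV uc by (simp add: k_def[symmetric])
    ultimately show ?thesis using uc psr[OF r] K.one_not_zero
      by (intro exI[of _ ?B] conjI bexI[of _ "u t"] bexI[of _ "restrict (ps (s, k)) (carrier P1)"]) simp_all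
  next
    case False
    then have vt: "v t = v s" and "\<not> card (W t - W s) \<le> Suc 0" using dis by auto
    moreover have "finite (W t - W s)" using finite_subset[OF gen_sub[OF gt]] by simp
    ultimately obtain a b where ab: "a \<in> W t" "a \<notin> W s" "b \<in> W t" "b \<notin> W s" "a \<noteq> b"
      using card_le_Suc0_iff_eq[of "W t - W s"] by blast
    have abc: "a \<in> ch (v s)" "b \<in> ch (v s)" using gen_sub[OF gt] ab vt by auto
    have ra: "(s, a) \<in> rels I v W" and rb: "(s, b) \<in> rels I v W" using s ab abc by (auto simp: rels_def)
    have V: "a \<in> V" "b \<in> V" "par a \<in> V" "par b \<in> V"
      using abc gen_point[OF strings_gen[OF st s]] by (auto simp: ch_def)
    \<comment> \<open>On a pullback both terms equal \<kappa> of \<open>h (q s)\<close> applied to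
      \<open>x\<close>, hence the difference. It is nonzero on \<open>Ar a\<close> applied to
      \<open>u t\<close>, which cannot be lifted inside this string without a contribution at
      \<open>b\<close>.\<close>
    let ?B = "\<lambda>x h. l a (h (p (s, a)) \<odot>\<^bsub>M\<^esub> x) \<oplus>\<^bsub>K\<^esub> \<ominus>\<^bsub>K\<^esub> l b (h (p (s, b)) \<odot>\<^bsub>M\<^esub> x)"
    have "pairing M P1 f P0 ?B" unfolding pairing_def
    proof (intro conjI ballI)
      fix x h assume x: "x \<in> carrier M" and h: "h \<in> carrier ?S"
      note hp = hA[OF h ra] hA[OF h rb]
      show "?B x h \<in> carrier K" using x hp lc ab by simp
      show "?B (x \<oplus>\<^bsub>M\<^esub> y) h = ?B x h \<oplus>\<^bsub>K\<^esub> ?B y h" if "y \<in> carrier M" for y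
        using x hp that la lc ab by (simp add: smult_r_distr K.minus_add K.a_ac)
      show "?B x (h \<oplus>\<^bsub>?S\<^esub> h') = ?B x h \<oplus>\<^bsub>K\<^esub> ?B x h'" if "h' \<in> carrier ?S" for h'
        using x hp hA[OF that ra] hA[OF that rb] la lc ab
        by (simp add: hadd[OF ra] hadd[OF rb] smult_l_distr K.minus_add K.a_ac)
      show "?B (e \<odot>\<^bsub>M\<^esub> x) h = ?B x (e \<odot>\<^bsub>?S\<^esub> h)" if "e \<in> carrier A" for e
        using x hp that by (simp add: hsm[OF ra] hsm[OF rb] smult_assoc)
      show "?B x (sc c \<odot>\<^bsub>?S\<^esub> h) = c \<otimes>\<^bsub>K\<^esub> ?B x h" if "c \<in> carrier K" for c
        using x hp that V ls lc \<kappa>c ab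
        by (simp add: hsm[OF ra] hsm[OF rb] sc_central[symmetric] smult_assoc K.r_distr K.r_minus)
    next
      fix x h assume x: "x \<in> carrier M" and h: "h \<in> carrier (star_module A P0)"
      show "?B x (compose (carrier P1) h f) = \<zero>\<^bsub>K\<^esub>"
        using x hcomp[OF h ra] hcomp[OF h rb] hq[OF h ra] ls lc \<kappa>c \<kappa>s V ab gen_point[OF gt]
        by (simp add: smult_assoc K.r_neg)
    qed
    moreover have "?B (Ar a \<odot>\<^bsub>M\<^esub> u t) (restrict (ps (s, a)) (carrier P1)) = \<one>\<^bsub>K\<^esub>"
    proof -
      have "l b \<zero>\<^bsub>M\<^esub> = \<zero>\<^bsub>K\<^esub>"
        using ls[of \<zero> "u t" b] uc ab V lc \<kappa>c by simp
      then show ?thesis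
        using dual_delta[OF d1 ra ra] dual_delta[OF d1 ra rb] pc[OF ra] pc[OF rb] ls lc \<kappa>c \<kappa>u lu uc ab V by simp
    qed
    moreover have "Ar a \<odot>\<^bsub>M\<^esub> u t \<in> carrier M" using uc by simp
    ultimately show ?thesis using psr[OF ra] K.one_not_zero
      by (intro exI[of _ ?B] conjI bexI[of _ "Ar a \<odot>\<^bsub>M\<^esub> u t"] bexI[of _ "restrict (ps (s, a)) (carrier P1)"]) simp_all
  qed
qed

end

context rsz
begin

lemma tau_rigid_iff:
  fixes M :: "('r, nat \<Rightarrow> 'k) module" and I :: "nat set"
  assumes M: "left_module A M" and st: "strings M I v W u \<pi>"
  shows "tau_rigid K A M \<longleftrightarrow> compat I v W"
proof -
  interpret rsz_mod K A V par ev om M by (intro rsz_mod.intro rsz_axioms M)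
  have "\<exists>p. min_proj_presentation A M p" using nice_presentation_exists[OF M st] by blast
  \<comment> \<open>The presentation inside \<open>AR_translate\<close> is minimal because some
    minimal presentation exists.\<close>
  then have mp: "min_proj_presentation A M (SOME p. min_proj_presentation A M p)" by (rule someI_ex)
  obtain P1 f P0 g where sp: "(SOME p. min_proj_presentation A M p) = (P1, f, P0, g)"
    using prod_cases4 by blast
  obtain q qs p ps where n: "nice I v W P1 f P0 q qs p ps"
    using presentation_nice[OF M st] mp sp by metis
  have nn: "left_module A P0" "left_module A P1" "lin A P1 P0 f" using n by (auto simp: nice_def)
  have ar: "AR_translate K A M = dual_module K A (transpose_module A P1 f P0)"
    by (simp add: AR_translate_def sp)
  show ?thesis unfolding tau_rigid_def ar Hom_AR_iff[OF M nn]
    using strings_fg[OF st] compat_pairing_zero[OF st _ n] not_compat_pairing[OF st _ n] by blast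
qed

end

section \<open>Counting compatible sets of strings\<close>

text \<open>Children are taken within \<open>U\<close>, because the supports to be counted are
  arbitrary subsets of the points.\<close>

definition kids :: "(nat \<Rightarrow> nat) \<Rightarrow> nat set \<Rightarrow> nat \<Rightarrow> nat set" where
  "kids par U i = {j \<in> U. par j = i}"

definition typs :: "(nat \<Rightarrow> nat) \<Rightarrow> nat set \<Rightarrow> (nat \<times> nat set) set" where
  "typs par U = (SIGMA i:U. Pow (kids par U i))"

definition cmp :: "(nat \<Rightarrow> nat) \<Rightarrow> nat set \<Rightarrow> (nat \<times> nat set) set \<Rightarrow> bool" where
  "cmp par U S \<longleftrightarrow> (\<forall>(i, W)\<in>S. \<forall>(k, Y)\<in>S. k \<notin> kids par U i - W \<and> (k = i \<longrightarrow> card (Y - W) \<le> 1))"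

text \<open>If no point has more than two children, \<open>cmp_bound\<close> shows that no
  compatible set over \<open>U\<close> is larger.\<close>

definition maxc :: "(nat \<Rightarrow> nat) \<Rightarrow> nat set \<Rightarrow> (nat \<times> nat set) set set" where
  "maxc par U = {S. S \<subseteq> typs par U \<and> cmp par U S \<and> card S = card U}"

text \<open>The set \<open>U\<close> is the support of the module; by \<open>maxc_disjoint\<close>
  it is determined by the set of pairs, so that the counts over all supports add up.\<close>

definition smaxc :: "(nat \<Rightarrow> nat) \<Rightarrow> nat set \<Rightarrow> (nat \<times> nat set) set set" where
  "smaxc par V = (\<Union>U\<in>Pow V. maxc par U)"

lemma typs_mem: "(i, W) \<in> typs par U \<longleftrightarrow> i \<in> U \<and> W \<subseteq> kids par U i"
  by (auto simp: typs_def)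

lemma typs_finite: "finite U \<Longrightarrow> finite (typs par U)"
  by (auto simp: typs_def kids_def)

lemma maxc_finite: "finite U \<Longrightarrow> finite (maxc par U)"
  by (rule finite_subset[of _ "Pow (typs par U)"]) (auto simp: maxc_def typs_finite)

lemma cmpD:
  assumes "cmp par U S" "(i, W) \<in> S" "(k, Y) \<in> S"
  shows "k \<in> kids par U i \<Longrightarrow> k \<in> W" "k = i \<Longrightarrow> card (Y - W) \<le> 1"
  using assms unfolding cmp_def by fastforce+

lemma cmpI:
  assumes "\<And>i W k Y. \<lbrakk>(i, W) \<in> S; (k, Y) \<in> S; k \<in> kids par U i\<rbrakk> \<Longrightarrow> k \<in> W"
    and "\<And>i W Y. \<lbrakk>(i, W) \<in> S; (i, Y) \<in> S\<rbrakk> \<Longrightarrow> card (Y - W) \<le> 1"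
  shows "cmp par U S"
  using assms unfolding cmp_def by fast

lemma cmp_mono: "\<lbrakk>cmp par U S; S' \<subseteq> S; U' \<subseteq> U\<rbrakk> \<Longrightarrow> cmp par U' S'"
proof (rule cmpI)
  assume a: "cmp par U S" "S' \<subseteq> S" "U' \<subseteq> U"
  show "k \<in> W" if "(i, W) \<in> S'" "(k, Y) \<in> S'" "k \<in> kids par U' i" for i W k Y
    using cmpD(1)[OF a(1), of i W k Y] a(2,3) that by (auto simp: kids_def)
  show "card (Y - W) \<le> 1" if "(i, W) \<in> S'" "(i, Y) \<in> S'" for i W Y
    using cmpD(2)[OF a(1), of i W i Y] a(2) that by auto
qed

text \<open>\<open>C\<close> stands for the children of a point and \<open>G\<close> for the strings that start there.\<close>

lemma star_bound:
  assumes C: "finite C" "card C \<le> 2" and G: "G \<subseteq> Pow C" "G \<noteq> {}"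
    and c: "\<And>W Y. \<lbrakk>W \<in> G; Y \<in> G\<rbrakk> \<Longrightarrow> card (Y - W) \<le> 1"
  shows "card G \<le> 1 + card (\<Union>W\<in>G. C - W)"
proof -
  let ?F = "\<Union>W\<in>G. C - W"
  have fF: "finite ?F" by (rule finite_subset[OF _ C(1)]) blast
  have F: "card S \<le> card ?F" if "S \<subseteq> ?F" for S using that fF by (rule card_mono[rotated])
  have Gle: "card G \<le> card L" if "G \<subseteq> L" "finite L" for L using that by (rule card_mono[rotated])
  consider "C = {}" | a where "C = {a}" | a b where "C = {a, b}" "a \<noteq> b"
  proof -
    have "card C = 0 \<or> card C = 1 \<or> card C = 2" using C(2) by linarith
    then show thesis using that C(1) by (auto simp: card_1_singleton_iff card_2_iff)
  qed
  then show ?thesis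
  proof cases
    case 1
    then show ?thesis using Gle[of "{{}}"] G by auto
  next
    case (2 a)
    have G2: "G \<subseteq> {{}, {a}}" using G 2 by auto
    show ?thesis
    proof (cases "{} \<in> G")
      case True
      then have "{a} \<subseteq> ?F" using 2 by auto
      from F[OF this] show ?thesis using Gle[OF G2] by simp
    next
      case False
      then have "G \<subseteq> {{a}}" using G2 by auto
      then show ?thesis using Gle[of "{{a}}"] by simp
    qed
  next
    case (3 a b)
    have G4: "W = {} \<or> W = {a} \<or> W = {b} \<or> W = {a, b}" if "W \<in> G" for W using G 3 that by auto
    show ?thesis
    proof (cases "{} \<in> G")
      case True
      \<comment> \<open>With the empty set in \<open>G\<close> the full set is excluded; at most
        three sets remain, and both children are missed by the empty one.\<close>
      have "{a, b} \<notin> G"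
      proof
        assume "{a, b} \<in> G"
        then have "card ({a, b} - {}) \<le> 1" using c True by blast
        then show False using 3 by simp
      qed
      then have "G \<subseteq> {{}, {a}, {b}}" using G4 by auto
      then have "card G \<le> 3" using Gle[of "{{}, {a}, {b}}"] card_length[of "[{}, {a}, {b}]"] by simp
      moreover have "{a, b} \<subseteq> ?F" using True 3 by auto
      ultimately show ?thesis using F[of "{a, b}"] 3 by simp
    next
      case N: False
      show ?thesis
      proof (cases "{a} \<in> G \<and> {b} \<in> G")
        case True
        \<comment> \<open>Each child is missed by the singleton of the other.\<close>
        have "G \<subseteq> {{a}, {b}, {a, b}}" using G4 N by blast
        then have "card G \<le> 3" using Gle[of "{{a}, {b}, {a, b}}"] card_length[of "[{a}, {b}, {a, b}]"] by simp
        moreover have "{a, b} \<subseteq> ?F" using True 3 by auto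
        ultimately show ?thesis using F[of "{a, b}"] 3 by simp
      next
        case False
        \<comment> \<open>With just one singleton in \<open>G\<close>, only the full set can join
          it, and one child is missed.\<close>
        have two: ?thesis if xy: "{x, y} = {a, b}" "x \<noteq> y" "{x} \<in> G" "{y} \<notin> G" for x y
        proof -
          have "G \<subseteq> {{x}, {x, y}}" using G4 N xy by (auto simp: doubleton_eq_iff)
          then have "card G \<le> 2" using Gle[of "{{x}, {x, y}}"] card_length[of "[{x}, {x, y}]"] by simp
          moreover have "y \<in> C" using xy 3 by auto
          then have "{y} \<subseteq> ?F" using xy by auto
          ultimately show ?thesis using F[of "{y}"] by simp
        qed
        show ?thesis
        proof (cases "{a} \<in> G \<or> {b} \<in> G")
          case True
          then show ?thesis using two[of a b] two[of b a] False 3 by (auto simp: insert_commute)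
        next
          case F: False
          then have "G \<subseteq> {{a, b}}" using G4 N by blast
          then show ?thesis using Gle[of "{{a, b}}"] by simp
        qed
      qed
    qed
  qed
qed

text \<open>A point \<open>i\<close> where strings start accounts, by \<open>star_bound\<close>, for
  itself and for the children \<open>F i\<close> that some string at \<open>i\<close> misses. No
  string starts at a missed child, and different points miss different children because a point has
  only one parent; so the total is at most the number of points.\<close>

lemma cmp_bound:
  assumes U: "finite U" "\<And>i. card (kids par U i) \<le> 2" and S: "S \<subseteq> typs par U" "cmp par U S"
  shows "card S \<le> card U"
proof -
  define G where "G i = {W. (i, W) \<in> S}" for i
  define N where "N = {i \<in> U. G i \<noteq> {}}"
  define F where "F i = (\<Union>W\<in>G i. kids par U i - W)" for i
  have kf: "finite (kids par U i)" for i using U(1) by (simp add: kids_def)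
  have GP: "G i \<subseteq> Pow (kids par U i)" for i using S(1) by (auto simp: G_def typs_def)
  have fG: "finite (G i)" for i by (rule finite_subset[OF GP]) (simp add: kf)
  have fN: "finite N" using U(1) by (simp add: N_def)
  have SS: "S = Sigma N G" using S(1) by (auto simp: N_def G_def typs_def)
  have Gc: "card (G i) \<le> 1 + card (F i)" if "i \<in> N" for i
    unfolding F_def using that cmpD(2)[OF S(2)]
    by (intro star_bound kf U(2) GP) (auto simp: N_def G_def)
  have FU: "F i \<subseteq> U - N" for i
    using cmpD(1)[OF S(2)] by (auto simp: F_def N_def G_def kids_def)
  have fF: "finite (F i)" for i using finite_subset[OF FU] U(1) by blast
  have Fk: "F i \<subseteq> kids par U i" for i by (auto simp: F_def)
  have disj: "F i \<inter> F j = {}" if "i \<noteq> j" for i j using Fk[of i] Fk[of j] that by (auto simp: kids_def)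
  have "card S = (\<Sum>i\<in>N. card (G i))" unfolding SS using fN fG by simp
  also have "\<dots> \<le> (\<Sum>i\<in>N. 1 + card (F i))" by (rule sum_mono) (rule Gc)
  also have "\<dots> = card N + (\<Sum>i\<in>N. card (F i))" by (simp only: sum.distrib card_eq_sum)
  also have "\<dots> = card N + card (\<Union>i\<in>N. F i)"
    using card_UN_disjoint[OF fN, of F] fF disj by simp
  also have "\<dots> \<le> card N + card (U - N)" using FU U(1) by (intro add_left_mono card_mono) auto
  also have "\<dots> = card U" using U(1) by (simp add: N_def card_Diff_subset card_mono)
  finally show ?thesis .
qed

text \<open>A common element lives over the intersection, where \<open>cmp_bound\<close> allows it
  no more elements than there are points.\<close>

lemma maxc_disjoint:
  assumes U: "finite U" "\<And>i. card (kids par U i) \<le> 2" and U': "finite U'"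
    and S: "S \<in> maxc par U" "S \<in> maxc par U'" shows "U = U'"
proof -
  have "S \<subseteq> typs par (U \<inter> U')" using S by (fastforce simp: maxc_def typs_def kids_def)
  moreover have "cmp par (U \<inter> U') S" using S(1) cmp_mono[of par U S S "U \<inter> U'"] by (simp add: maxc_def)
  moreover have "card (kids par (U \<inter> U') i) \<le> 2" for i
    using card_mono[of "kids par U i" "kids par (U \<inter> U') i"] U by (auto simp: kids_def intro: order_trans)
  ultimately have "card S \<le> card (U \<inter> U')" using U(1) by (intro cmp_bound) auto
  then have "card U \<le> card (U \<inter> U')" "card U' \<le> card (U \<inter> U')" using S by (auto simp: maxc_def)
  then show ?thesis using U(1) U' card_seteq[of U "U \<inter> U'"] card_seteq[of U' "U \<inter> U'"] by auto
qed

lemma smaxc_card: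
  assumes V: "finite V" "\<And>i. card (kids par V i) \<le> 2"
  shows "finite (smaxc par V)" "card (smaxc par V) = (\<Sum>U\<in>Pow V. card (maxc par U))"
proof -
  have fU: "finite U" if "U \<in> Pow V" for U using that V(1) finite_subset by auto
  have k: "card (kids par U i) \<le> 2" if "U \<in> Pow V" for U i
    using card_mono[of "kids par V i" "kids par U i"] V that by (auto simp: kids_def intro: order_trans)
  show "finite (smaxc par V)" unfolding smaxc_def using V(1) maxc_finite[OF fU] by blast
  have "maxc par U \<inter> maxc par U' = {}" if "U \<in> Pow V" "U' \<in> Pow V" "U \<noteq> U'" for U U'
    using maxc_disjoint[OF fU[OF that(1)] k[OF that(1)] fU[OF that(2)]] that(3) by blast
  then show "card (smaxc par V) = (\<Sum>U\<in>Pow V. card (maxc par U))"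
    unfolding smaxc_def using V(1) maxc_finite[OF fU] by (intro card_UN_disjoint) auto
qed

section \<open>Recursion at a point without a parent in the set\<close>

context
  fixes par :: "nat \<Rightarrow> nat" and U :: "nat set" and n :: nat
  assumes fU: "finite U" and k2: "\<And>i. card (kids par U i) \<le> 2" and nU: "n \<in> U" and top: "par n \<notin> U"
begin

lemma sub_bound:
  assumes "S \<subseteq> typs par U'" "cmp par U S" "U' \<subseteq> U" shows "card S \<le> card U'"
proof (rule cmp_bound)
  show "finite U'" using fU assms(3) finite_subset by blast
  show "card (kids par U' i) \<le> 2" for i
    using card_mono[of "kids par U i" "kids par U' i"] fU k2[of i] assms(3) by (auto simp: kids_def intro: order_trans)
  show "cmp par U' S" using assms cmp_mono by blast
qed (use assms in simp)

lemma n_not_kid: "i \<in> U \<Longrightarrow> n \<notin> kids par U i"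
  using top by (auto simp: kids_def)

lemma card_U: "card U = Suc (card (U - {n}))"
  by (rule card.remove[OF fU nU])

lemma strip:
  assumes "S \<subseteq> typs par U"
  shows "S - ({n} \<times> UNIV) \<subseteq> typs par (U - {n})"
  using assms n_not_kid by (fastforce simp: typs_def kids_def)

text \<open>Strings at \<open>n\<close> may miss only points of \<open>D\<close>, where
  \<open>S\<close> has no strings. In the applications \<open>D\<close> is \<open>n\<close> alone,
  or \<open>n\<close> with its child.\<close>

lemma extend_cmp:
  assumes S: "S \<subseteq> typs par (U - D)" "cmp par (U - D) S" and D: "n \<in> D" "\<And>d. \<lbrakk>d \<in> D; d \<in> U; d \<noteq> n\<rbrakk> \<Longrightarrow> par d = n"
    and T: "\<And>W. W \<in> T \<Longrightarrow> kids par U n - W \<subseteq> D - {n}" "\<And>W Y. \<lbrakk>W \<in> T; Y \<in> T\<rbrakk> \<Longrightarrow> card (Y - W) \<le> 1"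
  shows "cmp par U (S \<union> {n} \<times> T)"
proof (rule cmpI)
  fix i W k Y assume *: "(i, W) \<in> S \<union> {n} \<times> T" "(k, Y) \<in> S \<union> {n} \<times> T" "k \<in> kids par U i"
  have kU: "k \<notin> D \<or> k = n" using *(2) S(1) by (auto simp: typs_def)
  have kn: "k \<noteq> n" using n_not_kid *(1,3) S(1) nU by (auto simp: typs_def)
  show "k \<in> W"
  proof (cases "(i, W) \<in> S")
    case True
    moreover have "(k, Y) \<in> S" using *(2) kn by auto
    moreover have "k \<in> kids par (U - D) i" using *(3) kU kn by (auto simp: kids_def)
    ultimately show ?thesis using cmpD(1)[OF S(2)] by blast
  next
    case False
    then show ?thesis using *(1,3) T(1)[of W] kU kn by auto
  qed
next
  fix i W Y assume *: "(i, W) \<in> S \<union> {n} \<times> T" "(i, Y) \<in> S \<union> {n} \<times> T"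
  have "i \<noteq> n" if "(i, Z) \<in> S" for Z using that S(1) D(1) by (auto simp: typs_def)
  then show "card (Y - W) \<le> 1" using * cmpD(2)[OF S(2)] T(2) by auto
qed

text \<open>The simple module is the only string at \<open>n\<close>. It must occur, because by
  \<open>sub_bound\<close> the other strings number at most \<open>card U - 1\<close>.\<close>

lemma maxc_top_none:
  assumes k: "kids par U n = {}" shows "card (maxc par U) = card (maxc par (U - {n}))"
proof -
  let ?f = "\<lambda>S. S \<union> {n} \<times> {{}}"
  have nS: "({n} \<times> UNIV) \<inter> S = {}" if "S \<in> maxc par (U - {n})" for S
    using that by (auto simp: maxc_def typs_def)
  have inj: "inj_on ?f (maxc par (U - {n}))" by (rule inj_onI) (use nS in blast)
  have "?f ` maxc par (U - {n}) = maxc par U"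
  proof (rule equalityI; rule subsetI)
    fix S assume "S \<in> ?f ` maxc par (U - {n})"
    then obtain S' where S': "S' \<in> maxc par (U - {n})" "S = ?f S'" by blast
    have fS: "finite S'" using S' typs_finite[of "U - {n}"] fU by (auto simp: maxc_def intro: finite_subset)
    have "cmp par U S" unfolding S'(2)
      by (rule extend_cmp[of _ "{n}"]) (use S' k in \<open>auto simp: maxc_def\<close>)
    moreover have "S \<subseteq> typs par U" using S' nU by (fastforce simp: maxc_def typs_def kids_def)
    moreover have "card S = card U"
      using S' nS[OF S'(1)] fS card_U by (auto simp: maxc_def card_insert_if simp del: card_Diff_singleton)
    ultimately show "S \<in> maxc par U" by (simp add: maxc_def)
  next
    fix S assume S: "S \<in> maxc par U"
    let ?S = "S - {n} \<times> UNIV"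
    have fS: "finite S" using S typs_finite[OF fU] by (auto simp: maxc_def intro: finite_subset)
    have St: "?S \<subseteq> typs par (U - {n})" using S by (intro strip) (simp add: maxc_def)
    have Sc: "cmp par U ?S" using S cmp_mono[of par U S ?S U] by (auto simp: maxc_def)
    have le: "card ?S \<le> card (U - {n})" by (rule sub_bound[OF St Sc]) auto
    have sub: "S \<subseteq> ?S \<union> {n} \<times> {{}}" using S k by (auto simp: maxc_def typs_def)
    note cU = card_U
    have "(n, {}) \<in> S"
    proof (rule ccontr)
      assume "(n, {}) \<notin> S"
      then have "S = ?S" using sub by blast
      then show False using le cU S by (simp add: maxc_def)
    qed
    then have e: "S = ?f ?S" using sub by auto
    have "card S = card (insert (n, {}) ?S)" using e by simp
    then have "card S = Suc (card ?S)" using fS by simp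
    then have "?S \<in> maxc par (U - {n})"
      using St cmp_mono[OF Sc subset_refl, of "U - {n}"] cU S by (auto simp: maxc_def)
    then show "S \<in> ?f ` maxc par (U - {n})" using e by blast
  qed
  then show ?thesis using card_image[OF inj] by simp
qed

text \<open>Without a string at \<open>n\<close> the bound leaves one place unfilled. If the simple
  string at \<open>n\<close> occurs, it misses \<open>c\<close>, so no string starts at
  \<open>c\<close>; the bound then leaves two places, and both strings at \<open>n\<close> are
  needed.\<close>

lemma maxc_top_one:
  assumes k: "kids par U n = {c}"
  shows "card (maxc par U) = card (maxc par (U - {n})) + card (maxc par (U - {n, c}))"
proof -
  let ?f = "\<lambda>S. S \<union> {n} \<times> {{c}}" and ?g = "\<lambda>S. S \<union> {n} \<times> {{}, {c}}"
  have c: "c \<in> U" "par c = n" "c \<noteq> n" using k n_not_kid[OF nU] by (auto simp: kids_def)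
  have nS: "({n} \<times> UNIV) \<inter> S = {}" if "S \<in> maxc par (U - D)" "n \<in> D" for S D
    using that by (auto simp: maxc_def typs_def)
  have nm: "({n} \<times> UNIV) \<inter> S = {}" if "S \<in> maxc par (U - {n})" for S using nS[OF that] by simp
  have nm': "({n} \<times> UNIV) \<inter> S = {}" if "S \<in> maxc par (U - {n, c})" for S using nS[OF that] by simp
  have fS: "finite S" if "S \<in> maxc par (U - D)" for S D
    using that typs_finite[of "U - D"] fU by (auto simp: maxc_def intro: finite_subset)
  have inj: "inj_on ?f (maxc par (U - {n}))" by (rule inj_onI) (use nm in blast)
  have inj': "inj_on ?g (maxc par (U - {n, c}))" by (rule inj_onI) (use nm' in blast)
  have cU: "card U = Suc (card (U - {n}))" "card U = Suc (Suc (card (U - {n, c})))"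
  proof -
    show a: "card U = Suc (card (U - {n}))" by (rule card_U)
    have "card (U - {n}) = Suc (card (U - {n} - {c}))" using c fU by (intro card.remove) auto
    moreover have "U - {n} - {c} = U - {n, c}" by blast
    ultimately show "card U = Suc (Suc (card (U - {n, c})))" using a by simp
  qed
  have f: "?f S \<in> maxc par U" if S: "S \<in> maxc par (U - {n})" for S
  proof -
    have "cmp par U (?f S)"
      by (rule extend_cmp[of _ "{n}"]) (use S k in \<open>auto simp: maxc_def\<close>)
    moreover have "?f S \<subseteq> typs par U" using S nU k by (fastforce simp: maxc_def typs_def kids_def)
    moreover have "card (?f S) = card U"
      using S nm[OF S] fS[OF S] cU(1) by (auto simp: maxc_def card_insert_if simp del: card_Diff_singleton)
    ultimately show ?thesis by (simp add: maxc_def)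
  qed
  have g: "?g S \<in> maxc par U" if S: "S \<in> maxc par (U - {n, c})" for S
  proof -
    have "cmp par U (?g S)"
      by (rule extend_cmp[of _ "{n, c}"]) (use S k c in \<open>auto simp: maxc_def\<close>)
    moreover have "?g S \<subseteq> typs par U"
    proof -
      have "S \<subseteq> typs par U" using S by (fastforce simp: maxc_def typs_def kids_def)
      then show ?thesis using nU k by (auto simp: typs_def)
    qed
    moreover have "card (?g S) = card U"
    proof -
      have "(n, {}) \<notin> S" "(n, {c}) \<notin> S" using nm'[OF S] by auto
      moreover have "?g S = insert (n, {}) (insert (n, {c}) S)" by auto
      ultimately show ?thesis using S fS[OF S] cU(2) by (simp add: maxc_def)
    qed
    ultimately show ?thesis by (simp add: maxc_def)
  qed
  have h: "S \<in> ?f ` maxc par (U - {n}) \<union> ?g ` maxc par (U - {n, c})" if S: "S \<in> maxc par U" for S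
  proof -
    let ?S = "S - {n} \<times> UNIV"
    have fin: "finite S" using S typs_finite[OF fU] by (auto simp: maxc_def intro: finite_subset)
    have St: "?S \<subseteq> typs par (U - {n})" using S by (intro strip) (simp add: maxc_def)
    have Sc: "cmp par U ?S" using S cmp_mono[of par U S ?S U] by (auto simp: maxc_def)
    have le: "card ?S \<le> card (U - {n})" by (rule sub_bound[OF St Sc]) auto
    have W0: "W = {} \<or> W = {c}" if "(n, W) \<in> S" for W
    proof -
      have "(n, W) \<in> typs par U" using S that by (auto simp: maxc_def)
      then show ?thesis using k by (auto simp: typs_mem)
    qed
    then have sub: "S \<subseteq> ?S \<union> {n} \<times> {{}, {c}}" by auto
    have cS: "card S = card U" using S by (simp add: maxc_def)
    show ?thesis
    proof (cases "(n, {}) \<in> S")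
      case False
      have nc: "(n, {c}) \<in> S"
      proof (rule ccontr)
        assume "(n, {c}) \<notin> S"
        then have nW: "(n, W) \<notin> S" for W using W0[of W] False by auto
        have "S = ?S"
        proof (rule Set.set_eqI)
          fix x :: "nat \<times> nat set"
          obtain i W where x: "x = (i, W)" by fastforce
          show "x \<in> S \<longleftrightarrow> x \<in> ?S" unfolding x using nW[of W] by (cases "i = n") simp_all
        qed
        then have "card S = card ?S" by (rule arg_cong)
        then show False using le cU(1) cS by linarith
      qed
      have nW: "(n, W) \<in> S \<longleftrightarrow> W = {c}" for W using W0[of W] False nc by auto
      have e: "S = ?f ?S"
      proof (rule Set.set_eqI)
        fix x :: "nat \<times> nat set"
        obtain i W where x: "x = (i, W)" by fastforce
        show "x \<in> S \<longleftrightarrow> x \<in> ?f ?S" unfolding x using nW[of W] by (cases "i = n") simp_all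
      qed
      have "card S = card (insert (n, {c}) ?S)" using e by simp
      then have "card S = Suc (card ?S)" using fin by simp
      then have "?S \<in> maxc par (U - {n})"
        using St cmp_mono[OF Sc subset_refl, of "U - {n}"] cU(1) cS by (auto simp: maxc_def)
      then show ?thesis using e by blast
    next
      case True
      have cY: "(c, Y) \<notin> S" for Y using cmpD(1)[of par U S n "{}" c Y] S True k by (auto simp: maxc_def)
      have St': "?S \<subseteq> typs par (U - {n, c})"
      proof
        fix x assume x: "x \<in> ?S"
        obtain i W where iW: "x = (i, W)" by fastforce
        have "(i, W) \<in> typs par (U - {n})" using x St unfolding iW by (rule rev_subsetD)
        then have "i \<in> U - {n}" "W \<subseteq> kids par (U - {n}) i" by (simp_all add: typs_mem)
        moreover have "i \<noteq> c"
        proof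
          assume "i = c"
          then have "(c, W) \<in> S" using x unfolding iW by simp
          then show False using cY[of W] by contradiction
        qed
        ultimately show "x \<in> typs par (U - {n, c})" using iW c(2) by (auto simp: typs_mem kids_def)
      qed
      have le': "card ?S \<le> card (U - {n, c})" by (rule sub_bound[OF St' Sc]) auto
      have nc: "(n, {c}) \<in> S"
      proof (rule ccontr)
        assume "(n, {c}) \<notin> S"
        then have nW: "(n, W) \<in> S \<Longrightarrow> W = {}" for W using W0[of W] by auto
        have "S \<subseteq> insert (n, {}) ?S"
        proof
          fix x assume xS: "x \<in> S"
          obtain i W where x: "x = (i, W)" by fastforce
          show "x \<in> insert (n, {}) ?S" using xS nW[of W] unfolding x by (cases "i = n") simp_all
        qed
        then have "card S \<le> Suc (card ?S)" using fin card_mono[of "insert (n, {}) ?S" S] by (simp add: card_insert_if)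
        then show False using le' cU(2) cS by simp
      qed
      have nW: "(n, W) \<in> S \<longleftrightarrow> W = {} \<or> W = {c}" for W using W0[of W] True nc by auto
      have e: "S = ?g ?S"
      proof (rule Set.set_eqI)
        fix x :: "nat \<times> nat set"
        obtain i W where x: "x = (i, W)" by fastforce
        show "x \<in> S \<longleftrightarrow> x \<in> ?g ?S" unfolding x using nW[of W] by (cases "i = n") simp_all
      qed
      have "card S = card (insert (n, {}) (insert (n, {c}) ?S))" using e by simp
      then have "card S = Suc (Suc (card ?S))" using fin by simp
      then have "?S \<in> maxc par (U - {n, c})"
        using St' cmp_mono[OF Sc subset_refl, of "U - {n, c}"] cU(2) cS by (auto simp: maxc_def)
      then show ?thesis using e by blast
    qed
  qed
  have "maxc par U = ?f ` maxc par (U - {n}) \<union> ?g ` maxc par (U - {n, c})"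
    using f g h by blast
  moreover have "?f ` maxc par (U - {n}) \<inter> ?g ` maxc par (U - {n, c}) = {}"
  proof -
    have "(n, {}) \<notin> ?f S" if "S \<in> maxc par (U - {n})" for S using nm[OF that] by auto
    then show ?thesis by blast
  qed
  ultimately show ?thesis
    using card_Un_disjoint[of "?f ` maxc par (U - {n})" "?g ` maxc par (U - {n, c})"]
      card_image[OF inj] card_image[OF inj'] maxc_finite[of "U - {n}"] maxc_finite[of "U - {n, c}"] fU by simp
qed

end

text \<open>Supports are split by whether they contain \<open>n\<close>. Adding \<open>n\<close> to
  a support \<open>U\<close> reproduces the count of \<open>U\<close>, whence the factor 2; if
  \<open>c\<close> is in \<open>U\<close>, it also adds the count of \<open>U\<close> without
  \<open>c\<close>, and these sets run through the subsets of \<open>V - {c}\<close>.\<close>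

lemma smaxc_recurrence:
  assumes V: "finite V" "\<And>i. card (kids par (insert n V) i) \<le> 2" and n: "n \<notin> V" "par n \<notin> insert n V"
    and k: "kids par (insert n V) n = {c}"
  shows "card (smaxc par (insert n V)) = 2 * card (smaxc par V) + card (smaxc par (V - {c}))"
proof -
  let ?f = "\<lambda>U. card (maxc par U)"
  have "c \<in> kids par (insert n V) n" using k by simp
  then have c: "c \<in> V" using n by (auto simp: kids_def)
  have kl: "card (kids par U i) \<le> 2" if "U \<subseteq> insert n V" for U i
    using card_mono[of "kids par (insert n V) i" "kids par U i"] V that by (auto simp: kids_def intro: order_trans)
  have step: "?f (insert n U) = ?f U + (if c \<in> U then ?f (U - {c}) else 0)" if U: "U \<in> Pow V" for U
  proof -
    have fin: "finite (insert n U)" using U V(1) finite_subset by auto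
    have nn: "insert n U - {n} = U" using U n by auto
    have sub: "insert n U \<subseteq> insert n V" using U by auto
    have kU: "kids par (insert n U) n = kids par (insert n V) n \<inter> insert n U" using U by (auto simp: kids_def)
    have pt: "par n \<notin> insert n U" using n U by auto
    show ?thesis
    proof (cases "c \<in> U")
      case True
      then have "kids par (insert n U) n = {c}" unfolding kU k by auto
      from maxc_top_one[OF fin kl[OF sub] insertI1 pt this]
      have "?f (insert n U) = ?f (insert n U - {n}) + ?f (insert n U - {n, c})" .
      moreover have "insert n U - {n, c} = U - {c}" using U n by auto
      ultimately show ?thesis using True nn by simp
    next
      case False
      then have "kids par (insert n U) n = {}" unfolding kU k using c n by auto
      from maxc_top_none[OF fin kl[OF sub] insertI1 pt this]
      have "?f (insert n U) = ?f (insert n U - {n})" .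
      then show ?thesis using False nn by simp
    qed
  qed
  have fP: "finite (Pow V)" using V(1) by simp
  have "Pow (insert n V) = Pow V \<union> insert n ` Pow V" by (rule Pow_insert)
  then have "(\<Sum>U\<in>Pow (insert n V). ?f U) = (\<Sum>U\<in>Pow V. ?f U) + (\<Sum>U\<in>insert n ` Pow V. ?f U)"
    using fP n by (simp add: sum.union_disjoint disjoint_iff) (subst sum.union_disjoint; auto)
  also have "(\<Sum>U\<in>insert n ` Pow V. ?f U) = (\<Sum>U\<in>Pow V. ?f (insert n U))"
    using n by (subst sum.reindex) (auto simp: inj_on_def)
  also have "\<dots> = (\<Sum>U\<in>Pow V. ?f U) + (\<Sum>U\<in>Pow V. if c \<in> U then ?f (U - {c}) else 0)"
    using step by (simp add: sum.distrib)
  also have "(\<Sum>U\<in>Pow V. if c \<in> U then ?f (U - {c}) else 0) = (\<Sum>U\<in>{U \<in> Pow V. c \<in> U}. ?f (U - {c}))"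
    by (rule sum.inter_filter[OF fP, symmetric])
  also have "\<dots> = (\<Sum>U\<in>Pow (V - {c}). ?f U)"
    by (rule sum.reindex_bij_witness[of _ "insert c" "\<lambda>U. U - {c}"]) (use c in \<open>auto simp: insert_absorb\<close>)
  finally have "(\<Sum>U\<in>Pow (insert n V). ?f U) =
      2 * (\<Sum>U\<in>Pow V. ?f U) + (\<Sum>U\<in>Pow (V - {c}). ?f U)" by simp
  moreover have "card (smaxc par (insert n V)) = (\<Sum>U\<in>Pow (insert n V). ?f U)"
    using V by (intro smaxc_card(2)) auto
  moreover have "card (smaxc par V) = (\<Sum>U\<in>Pow V. ?f U)" using V(1) by (intro smaxc_card(2) kl) auto
  moreover have "card (smaxc par (V - {c})) = (\<Sum>U\<in>Pow (V - {c}). ?f U)" using V(1) by (intro smaxc_card(2) kl) auto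
  ultimately show ?thesis by simp
qed

section \<open>Counting tau-tilting modules\<close>

context rsz
begin

text \<open>\<open>S\<close> is the set of types of a basic module; injectivity excludes repeated
  summands.\<close>

definition has_types :: "('r, 'v) module \<Rightarrow> (nat \<times> nat set) set \<Rightarrow> bool" where
  "has_types M S \<longleftrightarrow> left_module A M \<and> (\<exists>(I :: nat set) v W u \<pi>. strings M I v W u \<pi> \<and>
     inj_on (\<lambda>s. (v s, W s)) I \<and> S = (\<lambda>s. (v s, W s)) ` I)"

lemma kids_ch: "kids par V = ch"
  by (auto simp: kids_def ch_def)

lemma has_types_typs: assumes "has_types M S" shows "S \<subseteq> typs par V" "finite S"
proof -
  obtain I :: "nat set" and v W u \<pi> where st: "strings M I v W u \<pi>" and "S = (\<lambda>s. (v s, W s)) ` I"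
    using assms by (auto simp: has_types_def)
  then show "S \<subseteq> typs par V" "finite S"
    using gen_point[OF strings_gen[OF st]] gen_sub[OF strings_gen[OF st]] strings_finite[OF st]
    by (auto simp: typs_mem kids_ch)
qed

lemma basic_iff_has_types:
  assumes M: "left_module A M" shows "basic_module A M \<longleftrightarrow> (\<exists>S. has_types M S)"
proof -
  interpret rsz_mod K A V par ev om M by (intro rsz_mod.intro rsz_axioms M)
  show ?thesis
  proof
    assume "basic_module A M"
    then obtain I :: "nat set" and v W u \<pi> where "strings M I v W u \<pi>" "inj_on (\<lambda>s. (v s, W s)) I"
      using basic_imp_strings by blast
    then show "\<exists>S. has_types M S" unfolding has_types_def
      using M by (intro exI[of _ "(\<lambda>s. (v s, W s)) ` I"] conjI exI[of _ I] exI[of _ v] exI[of _ W]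
          exI[of _ u] exI[of _ \<pi>]) simp_all
  next
    assume "\<exists>S. has_types M S"
    then obtain I :: "nat set" and v W u \<pi> where "strings M I v W u \<pi>" "inj_on (\<lambda>s. (v s, W s)) I"
      by (auto simp: has_types_def)
    then show "basic_module A M" by (rule strings_imp_basic)
  qed
qed

lemma has_types_subset:
  assumes M: "has_types M S" and N: "has_types N S'" and iso: "module_iso A M N" shows "S \<subseteq> S'"
proof
  interpret M: rsz_mod K A V par ev om M using M by (intro rsz_mod.intro rsz_axioms) (simp add: has_types_def)
  interpret N: rsz_mod K A V par ev om N using N by (intro rsz_mod.intro rsz_axioms) (simp add: has_types_def)
  obtain I :: "nat set" and v W u \<pi> where st: "strings M I v W u \<pi>" and S: "S = (\<lambda>s. (v s, W s)) ` I"
    using M by (auto simp: has_types_def)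
  obtain J :: "nat set" and v' W' u' \<pi>' where st': "strings N J v' W' u' \<pi>'" and S': "S' = (\<lambda>s. (v' s, W' s)) ` J"
    using N by (auto simp: has_types_def)
  fix t assume "t \<in> S"
  then obtain s where s: "s \<in> I" "t = (v s, W s)" using S by blast
  have "retract N (v s) (W s)"
    by (rule M.retract_iso[OF M.strings_retract[OF st s(1)] iso N.left_module_axioms])
  from N.retract_strings[OF st' this] obtain r where r: "r \<in> J" "v' r = v s" "W' r = W s" by blast
  have "t = (v' r, W' r)" using s(2) r(2,3) by simp
  then show "t \<in> S'" unfolding S' using r(1) by (rule image_eqI)
qed

lemma has_types_unique:
  assumes M: "has_types M S" and N: "has_types N S'" and iso: "module_iso A M N" shows "S = S'"
proof -
  have lN: "left_module A N" and lM: "left_module A M" using M N by (auto simp: has_types_def)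
  have iso': "module_iso A N M" by (rule left_module.module_iso_sym[OF lM iso lN])
  show ?thesis by (rule equalityI[OF has_types_subset[OF M N iso] has_types_subset[OF N M iso']])
qed

text \<open>Strings of equal type are matched by \<open>b\<close>; after reindexing, both modules
  have the same type functions and \<open>strings_iso\<close> applies.\<close>

lemma has_types_iso:
  assumes M: "has_types M S" and N: "has_types N S" shows "module_iso A M N"
proof -
  interpret M: rsz_mod K A V par ev om M using M by (intro rsz_mod.intro rsz_axioms) (simp add: has_types_def)
  interpret N: rsz_mod K A V par ev om N using N by (intro rsz_mod.intro rsz_axioms) (simp add: has_types_def)
  obtain I :: "nat set" and v W u \<pi> where st: "strings M I v W u \<pi>" and i: "inj_on (\<lambda>s. (v s, W s)) I"
    and S: "S = (\<lambda>s. (v s, W s)) ` I"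
    using M by (auto simp: has_types_def)
  obtain J :: "nat set" and v' W' u' \<pi>' where st': "strings N J v' W' u' \<pi>'" and i': "inj_on (\<lambda>s. (v' s, W' s)) J"
    and S': "S = (\<lambda>s. (v' s, W' s)) ` J"
    using N by (auto simp: has_types_def)
  let ?t = "\<lambda>s. (v s, W s)" and ?t' = "\<lambda>s. (v' s, W' s)"
  define b where "b s = inv_into J ?t' (?t s)" for s
  have tb: "?t' (b s) = ?t s" "b s \<in> J" if "s \<in> I" for s
  proof -
    have "?t s \<in> ?t' ` J" using that S S' by blast
    then show "?t' (b s) = ?t s" "b s \<in> J" unfolding b_def by (rule f_inv_into_f, rule inv_into_into)
  qed
  have "bij_betw b I J"
  proof (rule bij_betw_imageI)
    show "inj_on b I"
    proof (rule inj_onI)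
      fix s t assume st: "s \<in> I" "t \<in> I" "b s = b t"
      then have "?t s = ?t t" using tb(1)[OF st(1)] tb(1)[OF st(2)] by simp
      then show "s = t" using i st by (auto dest: inj_onD)
    qed
    show "b ` I = J"
    proof (rule equalityI; rule subsetI)
      fix r assume r: "r \<in> J"
      then have "?t' r \<in> ?t ` I" using S S' by blast
      then obtain s where s: "s \<in> I" "?t' r = ?t s" by blast
      then have "?t' (b s) = ?t' r" using tb(1) by simp
      then have "b s = r" using i' tb(2)[OF s(1)] r by (auto dest: inj_onD)
      then show "r \<in> b ` I" using s by blast
    qed (use tb(2) in auto)
  qed
  then have st'': "strings N I (v' \<circ> b) (W' \<circ> b) (u' \<circ> b) (\<pi>' \<circ> b)" by (rule N.strings_reindex[OF st'])
  have vw: "v' (b s) = v s" "W' (b s) = W s" if "s \<in> I" for s using tb(1)[OF that] by auto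
  have "strings N I v W (u' \<circ> b) (\<pi>' \<circ> b)"
    using st'' vw unfolding strings_def by simp
  then show ?thesis by (rule M.strings_iso[OF st N.left_module_axioms])
qed

lemma has_types_exists:
  assumes S: "S \<subseteq> typs par V" shows "\<exists>M :: ('r, nat \<Rightarrow> 'k) module. has_types M S"
proof -
  have fS: "finite S" using S typs_finite[OF finV] by (rule finite_subset)
  obtain b where b: "bij_betw b {0..<card S} S" using ex_bij_betw_nat_finite[OF fS] by blast
  let ?I = "{0..<card S}" and ?v = "\<lambda>s. fst (b s)" and ?W = "\<lambda>s. snd (b s)"
  have bS: "b s \<in> typs par V" if "s \<in> ?I" for s using b S that by (auto simp: bij_betw_def)
  have v: "?v s \<in> V" "?W s \<subseteq> ch (?v s)" if "s \<in> ?I" for s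
    using bS[OF that] by (auto simp: typs_def kids_ch)
  have "strings (Model ?I ?v ?W) ?I ?v ?W (ugen ?v) upr" by (rule Mod_strings[OF _ v]) auto
  moreover have "left_module A (Model ?I ?v ?W)" by (rule Mod_module[OF _ v]) auto
  moreover have "inj_on (\<lambda>s. (?v s, ?W s)) ?I" "S = (\<lambda>s. (?v s, ?W s)) ` ?I"
    using b by (simp_all add: bij_betw_def)
  ultimately show ?thesis unfolding has_types_def by blast
qed

lemma num_summands_types: assumes "has_types M S" shows "num_summands A M = card S"
proof -
  interpret rsz_mod K A V par ev om M using assms by (intro rsz_mod.intro rsz_axioms) (simp add: has_types_def)
  show ?thesis using assms num_summands_strings by (auto simp: has_types_def)
qed

text \<open>The algebra is the sum of the left ideals generated by the \<open>E i\<close>, with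
  right multiplication by \<open>E i\<close> as projection; as a string, such an ideal keeps all
  children of \<open>i\<close>.\<close>

lemma num_summands_regular: "num_summands A (regular_module A) = card V"
proof -
  let ?R = "regular_module A"
  interpret R: rsz_mod K A V par ev om ?R by (intro rsz_mod.intro rsz_axioms regular_left_module)
  have gen: "gen ?R i (ch i) (E i)" if i: "i \<in> V" for i
  proof -
    have "E i \<noteq> \<zero>"
    proof
      assume "E i = \<zero>"
      then have "ev i (E i) = ev i \<zero>" by simp
      then show False using i K.one_not_zero by simp
    qed
    moreover have "Ar j \<otimes> E i \<noteq> \<zero>" if j: "j \<in> ch i" for j
    proof
      have jV: "j \<in> V" "par j \<in> V" "par j = i" using j i by (auto simp: ch_def)
      assume "Ar j \<otimes> E i = \<zero>"
      then have "om j (Ar j) = om j \<zero>" using jV by (simp add: Ar_E)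
      then show False using jV K.one_not_zero by simp
    qed
    ultimately show ?thesis using i by (auto simp: gen_def vs_def regular_simps E_E)
  qed
  have "strings ?R V id ch E (\<lambda>i x. x \<otimes> E i)" unfolding strings_def
  proof (intro conjI ballI impI finV)
    fix i assume i: "i \<in> V"
    show "gen ?R (id i) (ch i) (E i)" using gen[OF i] by simp
    show "lin A ?R ?R (\<lambda>x. x \<otimes> E i)" by (rule linI) (simp_all add: regular_simps l_distr m_assoc)
    show "(\<lambda>x. x \<otimes> E i) ` carrier ?R \<subseteq> orb ?R (E i)" by (auto simp: orb_def regular_simps)
    show "E i \<otimes> E i = E i" by (simp add: E_E)
    show "E t \<otimes> E i = \<zero>\<^bsub>?R\<^esub>" if "t \<in> V" "t \<noteq> i" for t using that by (simp add: E_E regular_simps)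
  next
    fix x assume "x \<in> carrier ?R"
    then have x: "x \<in> carrier A" by (simp add: regular_simps)
    have "x \<otimes> finsum A E V = finsum A (\<lambda>i. x \<otimes> E i) V"
      using x finV by (intro finsum_rdistr) auto
    then show "x = finsum ?R (\<lambda>i. x \<otimes> E i) V" using x by (simp add: sum_E finsum_regular)
  qed
  then have "num_summands A ?R = card ((\<lambda>s. (id s, ch s)) ` V)" by (rule R.num_summands_strings)
  also have "\<dots> = card V" by (rule card_image) (auto simp: inj_on_def)
  finally show ?thesis .
qed

lemma tau_tilting_types:
  fixes M :: "('r, nat \<Rightarrow> 'k) module"
  assumes "has_types M S" shows "tau_tilting K A M \<longleftrightarrow> S \<in> maxc par V"
proof -
  obtain I :: "nat set" and v W u \<pi> where st: "strings M I v W u \<pi>" and S: "S = (\<lambda>s. (v s, W s)) ` I"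
    and M: "left_module A M"
    using assms by (auto simp: has_types_def)
  have "compat I v W \<longleftrightarrow> cmp par V S" unfolding compat_def cmp_def S kids_ch by auto
  then show ?thesis
    unfolding tau_tilting_def tau_rigid_iff[OF M st] num_summands_types[OF assms] num_summands_regular
    using has_types_typs[OF assms] by (auto simp: maxc_def)
qed

text \<open>Serves both counts: \<open>P\<close> is a property of modules that is read off from the
  set of types as membership in \<open>Q\<close>.\<close>

lemma iso_classes_types:
  fixes P :: "('r, nat \<Rightarrow> 'k) module \<Rightarrow> bool"
  assumes P: "\<And>M. P M \<Longrightarrow> left_module A M \<and> basic_module A M"
    and Q: "\<And>M S. has_types M S \<Longrightarrow> P M \<longleftrightarrow> S \<in> Q" and sub: "\<And>S. S \<in> Q \<Longrightarrow> S \<subseteq> typs par V"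
  shows "finite (iso_classes A {M. P M})" "card (iso_classes A {M. P M}) = card Q"
proof -
  define \<tau> where "\<tau> M = (THE S. has_types M S)" for M :: "('r, nat \<Rightarrow> 'k) module"
  have \<tau>: "\<tau> M = S" if "has_types M S" for M S
    unfolding \<tau>_def using that
    by (intro the_equality has_types_unique[OF _ that left_module.module_iso_refl]) (simp_all add: has_types_def)
  have ex: "\<exists>S. has_types M S" if "P M" for M using P[OF that] basic_iff_has_types by blast
  have iso: "module_iso A M N \<longleftrightarrow> \<tau> M = \<tau> N" if MN: "M \<in> {M. P M}" "N \<in> {M. P M}" for M N
  proof -
    obtain S S' where S: "has_types M S" "has_types N S'" using ex MN by blast
    have "S = S'" if "module_iso A M N" by (rule has_types_unique[OF S that])
    moreover have "module_iso A M N" if "S = S'" using has_types_iso[of M S' N] S that by simp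
    ultimately show ?thesis using \<tau>[OF S(1)] \<tau>[OF S(2)] by blast
  qed
  have im: "\<tau> ` {M. P M} = Q"
  proof (rule equalityI; rule subsetI)
    fix S assume "S \<in> \<tau> ` {M. P M}"
    then obtain M where M: "P M" "S = \<tau> M" by blast
    then obtain S' where "has_types M S'" using ex by blast
    then show "S \<in> Q" using \<tau> Q M by metis
  next
    fix S assume S: "S \<in> Q"
    obtain M :: "('r, nat \<Rightarrow> 'k) module" where M: "has_types M S" using has_types_exists[OF sub[OF S]] by blast
    then have "P M" using Q S by blast
    then show "S \<in> \<tau> ` {M. P M}" using \<tau>[OF M] by blast
  qed
  have "Q \<subseteq> Pow (typs par V)" using sub by blast
  then have "finite Q" using typs_finite[OF finV] finite_subset by blast
  then show "finite (iso_classes A {M. P M})" "card (iso_classes A {M. P M}) = card Q"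
    using iso_classes_count[of "{M. P M}" A \<tau>, OF iso] im by simp_all
qed

lemma tau_tilt_count: "finite (tau_tilt K A)" "card (tau_tilt K A) = card (maxc par V)"
proof -
  have P: "left_module A M \<and> basic_module A M" if "tau_tilting K A M \<and> basic_module A M"
    for M :: "('r, nat \<Rightarrow> 'k) module"
    using that by (simp add: tau_tilting_def tau_rigid_def fg_module_def)
  have Q: "tau_tilting K A M \<and> basic_module A M \<longleftrightarrow> S \<in> maxc par V" if "has_types M S"
    for M :: "('r, nat \<Rightarrow> 'k) module" and S
  proof -
    have "left_module A M" using that by (simp add: has_types_def)
    then show ?thesis using tau_tilting_types[OF that] basic_iff_has_types that by blast
  qed
  have sub: "S \<subseteq> typs par V" if "S \<in> maxc par V" for S using that by (simp add: maxc_def)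
  show "finite (tau_tilt K A)" "card (tau_tilt K A) = card (maxc par V)"
    unfolding tau_tilt_def
    by (rule iso_classes_types[where P = "\<lambda>M. tau_tilting K A M \<and> basic_module A M", OF P Q sub], assumption+)+
qed

end

section \<open>Quotients by idempotents and support tau-tilting modules\<close>

lemma extend_simps:
  "carrier (ring.extend R x) = carrier R" "zero (ring.extend R x) = zero R" "one (ring.extend R x) = one R"
  "add (ring.extend R x) = add R" "monoid.mult (ring.extend R x) = monoid.mult R"
  by (simp_all add: ring.defs)

lemma ring_extend: assumes "ring R" shows "ring (ring.extend R x)"
proof -
  interpret ring R by fact
  have "abelian_group (ring.extend R x)"
    by (rule abelian_groupI) (simp_all add: extend_simps a_ac add.l_inv_ex)
  moreover have "monoid (ring.extend R x)" by (rule monoidI) (simp_all add: extend_simps m_assoc)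
  ultimately show ?thesis by (rule ringI) (simp_all add: extend_simps l_distr r_distr)
qed

context pre_rsz
begin

text \<open>Two ideals have this form: the squared radical of the path algebra, and the ideal
  generated by an idempotent, where only the coordinates away from the points of the idempotent are
  kept.\<close>

definition KI :: "'r set" where
  "KI = {a \<in> carrier A. (\<forall>i\<in>V. ev i a = \<zero>\<^bsub>K\<^esub>) \<and> (\<forall>j\<in>V. par j \<in> V \<longrightarrow> om j a = \<zero>\<^bsub>K\<^esub>)}"

definition QA :: "('k, 'r set) module" where "QA = quotient_algebra A KI"

definition cl :: "'r \<Rightarrow> 'r set" where "cl a = KI +> a"

text \<open>Any representative gives the same value, because the coordinates vanish on
  \<open>KI\<close>.\<close>

definition evq :: "nat \<Rightarrow> 'r set \<Rightarrow> 'k" where "evq i C = ev i (SOME a. a \<in> C)"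

definition omq :: "nat \<Rightarrow> 'r set \<Rightarrow> 'k" where "omq j C = om j (SOME a. a \<in> C)"

lemma KI_ideal: "ideal KI A"
proof (rule idealI[OF ring_axioms])
  show "subgroup KI (add_monoid A)"
  proof (rule add.subgroupI)
    show "KI \<subseteq> carrier A" by (auto simp: KI_def)
    have "\<zero> \<in> KI" by (simp add: KI_def)
    then show "KI \<noteq> {}" by blast
    show "\<ominus> a \<in> KI" if "a \<in> KI" for a using that by (simp add: KI_def)
    show "a \<oplus> b \<in> KI" if "a \<in> KI" "b \<in> KI" for a b using that by (simp add: KI_def)
  qed
  show "x \<otimes> a \<in> KI" "a \<otimes> x \<in> KI" if "a \<in> KI" "x \<in> carrier A" for a x
    using that by (simp_all add: KI_def)
qed

interpretation I: ideal KI A by (rule KI_ideal)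

lemma QA_simps:
  "carrier QA = a_rcosets KI" "zero QA = KI" "one QA = cl \<one>" "add QA = set_add A" "monoid.mult QA = rcoset_mult A KI"
  "c \<odot>\<^bsub>QA\<^esub> C = (\<Union>x\<in>C. KI +> (c \<odot> x))"
  by (simp_all add: QA_def quotient_algebra_def FactRing_def ring.defs module.defs cl_def)

lemma QA_ring: "ring QA"
  unfolding QA_def quotient_algebra_def by (rule ring_extend[OF I.quotient_is_ring])

lemma cl_closed: "a \<in> carrier A \<Longrightarrow> cl a \<in> carrier QA"
  by (auto simp: QA_simps cl_def A_RCOSETS_def')

lemma QA_cl: "C \<in> carrier QA \<Longrightarrow> \<exists>a\<in>carrier A. C = cl a"
  by (auto simp: QA_simps cl_def A_RCOSETS_def')

lemma cl_add: "\<lbrakk>a \<in> carrier A; b \<in> carrier A\<rbrakk> \<Longrightarrow> cl a \<oplus>\<^bsub>QA\<^esub> cl b = cl (a \<oplus> b)"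
  using I.a_rcos_sum by (simp add: QA_simps cl_def)

lemma cl_mult: "\<lbrakk>a \<in> carrier A; b \<in> carrier A\<rbrakk> \<Longrightarrow> cl a \<otimes>\<^bsub>QA\<^esub> cl b = cl (a \<otimes> b)"
  using I.rcoset_mult_add by (simp add: QA_simps cl_def)

lemma cl_mem: "y \<in> cl a \<Longrightarrow> \<exists>n\<in>KI. y = n \<oplus> a"
  by (auto simp: cl_def a_r_coset_def')

lemma cl_self: "a \<in> carrier A \<Longrightarrow> a \<in> cl a"
  using I.a_rcos_self by (simp add: cl_def)

lemma cl_some: "a \<in> carrier A \<Longrightarrow> (SOME x. x \<in> cl a) \<in> cl a"
  using cl_self by (rule someI)

lemma cl_eqI:
  assumes "a \<in> carrier A" "b \<in> carrier A" "a \<ominus> b \<in> KI" shows "cl a = cl b"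
proof -
  have "a = (a \<ominus> b) \<oplus> b" using assms(1,2) by (simp add: a_minus_def a_assoc l_neg)
  then have "a \<in> KI +> b" using assms(3) by (auto simp: a_r_coset_def')
  then show ?thesis using I.a_repr_independence'[of a b] assms(2) by (simp add: cl_def)
qed

lemma evq_cl: assumes "a \<in> carrier A" "i \<in> V" shows "evq i (cl a) = ev i a"
proof -
  obtain n where n: "n \<in> KI" "(SOME x. x \<in> cl a) = n \<oplus> a" using cl_mem[OF cl_some[OF assms(1)]] by blast
  have "n \<in> carrier A" "ev i n = \<zero>\<^bsub>K\<^esub>" using n(1) assms(2-) unfolding KI_def by blast+
  then show ?thesis using assms n(2) by (simp add: evq_def)
qed

lemma omq_cl: assumes "a \<in> carrier A" "j \<in> V" "par j \<in> V" shows "omq j (cl a) = om j a"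
proof -
  obtain n where n: "n \<in> KI" "(SOME x. x \<in> cl a) = n \<oplus> a" using cl_mem[OF cl_some[OF assms(1)]] by blast
  have "n \<in> carrier A" "om j n = \<zero>\<^bsub>K\<^esub>" using n(1) assms(2-) unfolding KI_def by blast+
  then show ?thesis using assms n(2) by (simp add: omq_def)
qed

text \<open>The action of a scalar on a coset is defined as a union of cosets; they all
  coincide.\<close>

lemma scal_QA: assumes c: "c \<in> carrier K" shows "c \<odot>\<^bsub>QA\<^esub> \<one>\<^bsub>QA\<^esub> = cl (sc c)"
proof -
  have "KI +> (c \<odot> x) = cl (sc c)" if x: "x \<in> cl \<one>" for x
  proof -
    obtain n where n: "n \<in> KI" "x = n \<oplus> \<one>" using cl_mem[OF x] by blast
    have nc: "n \<in> carrier A" using n(1) by (rule I.Icarr)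
    have "c \<odot> x = sc c \<otimes> n \<oplus> sc c" using scal_mult[OF c, of x] n nc c by (simp add: r_distr flip: sc_def)
    moreover have "cl (sc c \<otimes> n \<oplus> sc c) = cl (sc c)"
    proof (rule cl_eqI)
      have "sc c \<otimes> n \<oplus> sc c \<ominus> sc c = sc c \<otimes> n" using nc c by (simp add: a_minus_def a_assoc r_neg)
      then show "sc c \<otimes> n \<oplus> sc c \<ominus> sc c \<in> KI" using I.I_l_closed[OF n(1), of "sc c"] c by simp
    qed (use nc c in auto)
    ultimately show ?thesis by (simp add: cl_def)
  qed
  then show ?thesis using cl_self[OF one_closed] by (auto simp: QA_simps)
qed

lemma scal_QA_mult:
  assumes c: "c \<in> carrier K" and C: "C \<in> carrier QA"
  shows "c \<odot>\<^bsub>QA\<^esub> C = (c \<odot>\<^bsub>QA\<^esub> \<one>\<^bsub>QA\<^esub>) \<otimes>\<^bsub>QA\<^esub> C"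
proof -
  obtain a where a: "a \<in> carrier A" "C = cl a" using QA_cl[OF C] by blast
  have "KI +> (c \<odot> x) = cl (sc c \<otimes> a)" if x: "x \<in> cl a" for x
  proof -
    obtain n where n: "n \<in> KI" "x = n \<oplus> a" using cl_mem[OF x] by blast
    have nc: "n \<in> carrier A" using n(1) by (rule I.Icarr)
    have "c \<odot> x = sc c \<otimes> n \<oplus> sc c \<otimes> a"
      using scal_mult[OF c, of x] n nc a(1) c by (simp add: r_distr flip: sc_def)
    moreover have "cl (sc c \<otimes> n \<oplus> sc c \<otimes> a) = cl (sc c \<otimes> a)"
    proof (rule cl_eqI)
      have "sc c \<otimes> n \<oplus> sc c \<otimes> a \<ominus> sc c \<otimes> a = sc c \<otimes> n"
        using nc a(1) c by (simp add: a_minus_def a_assoc r_neg)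
      then show "sc c \<otimes> n \<oplus> sc c \<otimes> a \<ominus> sc c \<otimes> a \<in> KI" using I.I_l_closed[OF n(1), of "sc c"] c by simp
    qed (use nc c a(1) in auto)
    ultimately show ?thesis by (simp add: cl_def)
  qed
  then have "c \<odot>\<^bsub>QA\<^esub> C = cl (sc c \<otimes> a)" using cl_self[OF a(1)] a(2) by (auto simp: QA_simps)
  then show ?thesis using c a by (simp add: scal_QA cl_mult)
qed

lemma QA_rsz: "rsz K QA V par evq omq"
proof -
  have fld: "field K" by unfold_locales
  show ?thesis
  proof (rule rsz.intro[OF pre_rsz.intro[OF fld QA_ring pre_rsz_axioms.intro] rsz_axioms.intro])
    show "finite V" by (rule finV)
    show "j < par j" if "j \<in> V" for j using par_gt that by simp
    show "card {j \<in> V. par j = i} \<le> 2" for i by (rule par_two)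
    fix C D
    show "evq i C \<in> carrier K" if "C \<in> carrier QA" "i \<in> V" for i
      using QA_cl[OF that(1)] that(2) by (auto simp: evq_cl)
    show "omq j C \<in> carrier K" if "C \<in> carrier QA" "j \<in> V" "par j \<in> V" for j
      using QA_cl[OF that(1)] that(2,3) by (auto simp: omq_cl)
    show "C = D" if C: "C \<in> carrier QA" "D \<in> carrier QA"
      and E: "\<And>i. i \<in> V \<Longrightarrow> evq i C = evq i D" "\<And>j. \<lbrakk>j \<in> V; par j \<in> V\<rbrakk> \<Longrightarrow> omq j C = omq j D"
    proof -
      obtain a b where a: "a \<in> carrier A" "C = cl a" and b: "b \<in> carrier A" "D = cl b"
        using QA_cl[OF C(1)] QA_cl[OF C(2)] by blast
      have e: "ev i a = ev i b" if "i \<in> V" for i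
        using E(1)[OF that] evq_cl[OF a(1) that] evq_cl[OF b(1) that] a(2) b(2) by simp
      have o: "om j a = om j b" if "j \<in> V" "par j \<in> V" for j
        using E(2)[OF that] omq_cl[OF a(1) that] omq_cl[OF b(1) that] a(2) b(2) by simp
      have "a \<ominus> b \<in> KI" unfolding KI_def using a(1) b(1) e o by (simp add: a_minus_def K.r_neg)
      then show ?thesis using cl_eqI a b by simp
    qed
    show "\<exists>C\<in>carrier QA. (\<forall>i\<in>V. evq i C = c i) \<and> (\<forall>j\<in>V. par j \<in> V \<longrightarrow> omq j C = d j)"
      if c: "\<And>i. i \<in> V \<Longrightarrow> c i \<in> carrier K" and d: "\<And>j. \<lbrakk>j \<in> V; par j \<in> V\<rbrakk> \<Longrightarrow> d j \<in> carrier K" for c d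
    proof -
      obtain a where a: "a \<in> carrier A" "\<forall>i\<in>V. ev i a = c i" "\<forall>j\<in>V. par j \<in> V \<longrightarrow> om j a = d j"
        using coord_ex[of c d] c d by blast
      then show ?thesis by (intro bexI[of _ "cl a"]) (simp_all add: evq_cl omq_cl cl_closed)
    qed
    show "evq i (C \<oplus>\<^bsub>QA\<^esub> D) = evq i C \<oplus>\<^bsub>K\<^esub> evq i D" "evq i (C \<otimes>\<^bsub>QA\<^esub> D) = evq i C \<otimes>\<^bsub>K\<^esub> evq i D"
      if "C \<in> carrier QA" "D \<in> carrier QA" "i \<in> V" for i
      using QA_cl[OF that(1)] QA_cl[OF that(2)] that(3) by (auto simp: cl_add cl_mult evq_cl)
    show "omq j (C \<oplus>\<^bsub>QA\<^esub> D) = omq j C \<oplus>\<^bsub>K\<^esub> omq j D"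
      "omq j (C \<otimes>\<^bsub>QA\<^esub> D) = evq j C \<otimes>\<^bsub>K\<^esub> omq j D \<oplus>\<^bsub>K\<^esub> omq j C \<otimes>\<^bsub>K\<^esub> evq (par j) D"
      if "C \<in> carrier QA" "D \<in> carrier QA" "j \<in> V" "par j \<in> V" for j
      using QA_cl[OF that(1)] QA_cl[OF that(2)] that(3,4) by (auto simp: cl_add cl_mult evq_cl omq_cl)
    show "evq i \<one>\<^bsub>QA\<^esub> = \<one>\<^bsub>K\<^esub>" if "i \<in> V" for i using evq_cl[OF one_closed that] that by (simp add: QA_simps)
    show "omq j \<one>\<^bsub>QA\<^esub> = \<zero>\<^bsub>K\<^esub>" if "j \<in> V" "par j \<in> V" for j
      using omq_cl[OF one_closed that] that by (simp add: QA_simps)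
    show "c \<odot>\<^bsub>QA\<^esub> \<one>\<^bsub>QA\<^esub> \<in> carrier QA" if "c \<in> carrier K" for c using scal_QA[OF that] that by (simp add: cl_closed)
    show "evq i (c \<odot>\<^bsub>QA\<^esub> \<one>\<^bsub>QA\<^esub>) = c" if "c \<in> carrier K" "i \<in> V" for c i
      using scal_QA[OF that(1)] evq_cl[OF _ that(2), of "sc c"] that by simp
    show "omq j (c \<odot>\<^bsub>QA\<^esub> \<one>\<^bsub>QA\<^esub>) = \<zero>\<^bsub>K\<^esub>" if "c \<in> carrier K" "j \<in> V" "par j \<in> V" for c j
      using scal_QA[OF that(1)] omq_cl[OF _ that(2,3), of "sc c"] that by simp
    show "c \<odot>\<^bsub>QA\<^esub> C = (c \<odot>\<^bsub>QA\<^esub> \<one>\<^bsub>QA\<^esub>) \<otimes>\<^bsub>QA\<^esub> C" if "c \<in> carrier K" "C \<in> carrier QA" for c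
      using that by (rule scal_QA_mult)
  qed
qed

end

text \<open>Forgetting the coordinates at \<open>Z\<close> keeps the laws of \<open>pre_rsz\<close>,
  because the coordinate of a product at an arrow involves only that arrow and its two ends.\<close>

locale rsz_quot = rsz K A V par ev om for K :: "('k, 'm) ring_scheme" and A :: "('k, 'r) module" (structure)
    and V par ev om +
  fixes Z :: "nat set"
  assumes ZV: "Z \<subseteq> V"
begin

sublocale q: pre_rsz K A "V - Z" par ev om
proof unfold_locales
  show "finite (V - Z)" using finV by simp
  show "card {j \<in> V - Z. par j = i} \<le> 2" for i
    using order_trans[OF card_mono par_two[of i], of "{j \<in> V - Z. par j = i}"] finV by auto
  fix C D
  assume "\<And>i. i \<in> V - Z \<Longrightarrow> C i \<in> carrier K" "\<And>j. \<lbrakk>j \<in> V - Z; par j \<in> V - Z\<rbrakk> \<Longrightarrow> D j \<in> carrier K"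
  \<comment> \<open>The coordinates at points of \<open>Z\<close> and at arrows that touch
    \<open>Z\<close> are filled with zeros.\<close>
  then have "\<exists>a\<in>carrier A. (\<forall>i\<in>V. ev i a = (if i \<in> Z then \<zero>\<^bsub>K\<^esub> else C i)) \<and>
      (\<forall>j\<in>V. par j \<in> V \<longrightarrow> om j a = (if j \<in> Z \<or> par j \<in> Z then \<zero>\<^bsub>K\<^esub> else D j))"
    by (intro coord_ex) auto
  then show "\<exists>a\<in>carrier A. (\<forall>i\<in>V - Z. ev i a = C i) \<and> (\<forall>j\<in>V - Z. par j \<in> V - Z \<longrightarrow> om j a = D j)"
    by (elim bexE, intro bexI) auto
qed (auto simp: par_gt scal_closed ev_scal om_scal intro: scal_mult)

lemma E_IZ: "i \<in> Z \<Longrightarrow> E i \<in> q.KI" and Ar_IZ: "j \<in> Z \<Longrightarrow> Ar j \<in> q.KI"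
  unfolding q.KI_def by auto

lemma IZ_D:
  assumes "a \<in> q.KI" shows "a \<in> carrier A" "i \<in> V - Z \<Longrightarrow> ev i a = \<zero>\<^bsub>K\<^esub>"
    "\<lbrakk>j \<in> V - Z; par j \<in> V - Z\<rbrakk> \<Longrightarrow> om j a = \<zero>\<^bsub>K\<^esub>"
  using assms unfolding q.KI_def by auto

text \<open>An idempotent \<open>e\<close> has the coordinate 1 at the points of \<open>Z\<close>
  and 0 at the other points, but it may have arrow coordinates as well. It generates the same ideal
  as the sum \<open>g\<close> of the idempotents at \<open>Z\<close>.\<close>

lemma idempotent_ideal:
  assumes e: "e \<in> carrier A" "e \<otimes> e = e" and Z: "Z = {i \<in> V. ev i e \<noteq> \<zero>\<^bsub>K\<^esub>}"
  shows "Idl {e} = q.KI"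
proof (rule equalityI)
  \<comment> \<open>Idempotency expresses this coordinate through \<open>ev j e\<close> and
    \<open>ev (par j) e\<close>, both zero here.\<close>
  have "om j e = \<zero>\<^bsub>K\<^esub>" if "j \<in> V - Z" "par j \<in> V - Z" for j
  proof -
    have j: "j \<in> V" "par j \<in> V" "ev j e = \<zero>\<^bsub>K\<^esub>" "ev (par j) e = \<zero>\<^bsub>K\<^esub>" using that Z by auto
    have "om j (e \<otimes> e) = \<zero>\<^bsub>K\<^esub>" using j e(1) by simp
    then show ?thesis using e(2) by simp
  qed
  moreover have "ev i e = \<zero>\<^bsub>K\<^esub>" if "i \<in> V - Z" for i using that Z by auto
  ultimately have "e \<in> q.KI" using e(1) unfolding q.KI_def by simp
  then show "Idl {e} \<subseteq> q.KI" by (intro genideal_minimal q.KI_ideal) simp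
next
  interpret I: ideal "Idl {e}" A using e by (intro genideal_ideal) simp
  have eI: "e \<in> Idl {e}" using e(1) by (rule genideal_self')
  have e1: "ev i e = \<one>\<^bsub>K\<^esub>" if "i \<in> Z" for i
  proof -
    have i: "i \<in> V" "ev i e \<noteq> \<zero>\<^bsub>K\<^esub>" using that Z by auto
    have "ev i e = ev i e \<otimes>\<^bsub>K\<^esub> ev i e" using ev_mult[OF e(1) e(1) i(1)] unfolding e(2) .
    from this[symmetric] have "ev i e \<otimes>\<^bsub>K\<^esub> ev i e = ev i e \<otimes>\<^bsub>K\<^esub> \<one>\<^bsub>K\<^esub>" using i e(1) by simp
    then show ?thesis
      by (rule K.m_lcancel[OF i(2) ev_closed[OF e(1) i(1)] ev_closed[OF e(1) i(1)] K.one_closed, THEN iffD1])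
  qed
  define g where "g = mk (\<lambda>i. if i \<in> Z then \<one>\<^bsub>K\<^esub> else \<zero>\<^bsub>K\<^esub>) (\<lambda>_. \<zero>\<^bsub>K\<^esub>)"
  have g: "g \<in> carrier A" "\<And>i. i \<in> V \<Longrightarrow> ev i g = (if i \<in> Z then \<one>\<^bsub>K\<^esub> else \<zero>\<^bsub>K\<^esub>)"
    "\<And>j. \<lbrakk>j \<in> V; par j \<in> V\<rbrakk> \<Longrightarrow> om j g = \<zero>\<^bsub>K\<^esub>"
    unfolding g_def by (simp_all add: mk)
  define h where "h = g \<otimes> e \<otimes> g"
  have hI: "h \<in> Idl {e}" unfolding h_def using g(1) eI by (intro I.I_r_closed I.I_l_closed)
  have h: "h \<in> carrier A" using g e by (simp add: h_def)
  text \<open>\<open>h\<close> is a unit of the corner ring \<open>g A g\<close>, with inverse \<open>2 g - h\<close>.\<close>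
  have "g = (g \<oplus> (g \<ominus> h)) \<otimes> h"
  proof (rule coord_eqI)
    show "ev i g = ev i ((g \<oplus> (g \<ominus> h)) \<otimes> h)" if "i \<in> V" for i
      using that g e(1) e1[of i] by (cases "i \<in> Z") (simp_all add: h_def a_minus_def K.r_neg)
    show "om j g = om j ((g \<oplus> (g \<ominus> h)) \<otimes> h)" if j: "j \<in> V" "par j \<in> V" for j
      using j g e(1) e1[of j] e1[of "par j"]
      by (cases "j \<in> Z"; cases "par j \<in> Z") (simp_all add: h_def a_minus_def K.r_neg)
  qed (use g h in auto)
  then have gI: "g \<in> Idl {e}" using I.I_l_closed[OF hI, of "g \<oplus> (g \<ominus> h)"] g h by simp
  show "q.KI \<subseteq> Idl {e}"
  proof
    fix a assume "a \<in> q.KI"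
    then have a: "a \<in> carrier A" "\<And>i. \<lbrakk>i \<in> V; i \<notin> Z\<rbrakk> \<Longrightarrow> ev i a = \<zero>\<^bsub>K\<^esub>"
      "\<And>j. \<lbrakk>j \<in> V; j \<notin> Z; par j \<in> V; par j \<notin> Z\<rbrakk> \<Longrightarrow> om j a = \<zero>\<^bsub>K\<^esub>"
      unfolding q.KI_def by auto
    \<comment> \<open>The corner of \<open>a\<close> away from \<open>Z\<close>, the product of
      \<open>\<one> \<ominus> g\<close>, \<open>a\<close> and \<open>\<one> \<ominus> g\<close>,
      vanishes.\<close>
    have "a = g \<otimes> a \<oplus> (a \<otimes> g \<ominus> g \<otimes> a \<otimes> g)"
    proof (rule coord_eqI)
      show "ev i a = ev i (g \<otimes> a \<oplus> (a \<otimes> g \<ominus> g \<otimes> a \<otimes> g))" if "i \<in> V" for i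
        using that g a by (cases "i \<in> Z") (simp_all add: a_minus_def K.r_neg)
      show "om j a = om j (g \<otimes> a \<oplus> (a \<otimes> g \<ominus> g \<otimes> a \<otimes> g))" if "j \<in> V" "par j \<in> V" for j
        using that g a by (cases "j \<in> Z"; cases "par j \<in> Z") (simp_all add: a_minus_def K.r_neg)
    qed (use g a in auto)
    moreover have "g \<otimes> a \<oplus> (a \<otimes> g \<ominus> g \<otimes> a \<otimes> g) \<in> Idl {e}"
      using gI g(1) a(1) unfolding a_minus_def
      by (intro I.a_closed I.a_inv_closed I.I_r_closed I.I_l_closed) auto
    ultimately show "a \<in> Idl {e}" by simp
  qed
qed

interpretation I: ideal q.KI A by (rule q.KI_ideal)

interpretation B: rsz K q.QA "V - Z" par q.evq q.omq by (rule q.QA_rsz)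

lemma B_E: assumes "i \<in> V - Z" shows "B.E i = q.cl (E i)"
  by (rule B.coord_eqI) (use assms in \<open>auto simp: q.evq_cl q.omq_cl q.cl_closed\<close>)

lemma B_Ar: assumes "j \<in> V - Z" shows "B.Ar j = q.cl (Ar j)"
  by (rule B.coord_eqI) (use assms in \<open>auto simp: q.evq_cl q.omq_cl q.cl_closed\<close>)

lemma desc_simps:
  "carrier (descend_module M) = carrier M" "zero (descend_module M) = zero M" "add (descend_module M) = add M"
  "smult (descend_module M) = (\<lambda>C x. (SOME a. a \<in> C) \<odot>\<^bsub>M\<^esub> x)"
  by (simp_all add: descend_module_def ring.defs module.defs)

lemma desc_finsum: "finsum (descend_module M) f S = finsum M f S"
  by (simp add: finsum_def finprod_def desc_simps)

text \<open>Since \<open>KI\<close> kills the module, every representative of a coset acts in the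
  same way. The idempotents at \<open>Z\<close> and the arrows into \<open>Z\<close> lie in
  \<open>KI\<close>, so the strings avoid \<open>Z\<close> and keep their types over the
  quotient.\<close>

lemma descend_types:
  assumes ht: "has_types M S" and kill: "\<And>a x. \<lbrakk>a \<in> q.KI; x \<in> carrier M\<rbrakk> \<Longrightarrow> a \<odot>\<^bsub>M\<^esub> x = \<zero>\<^bsub>M\<^esub>"
  shows "B.has_types (descend_module M) S"
proof -
  interpret M: rsz_mod K A V par ev om M using ht by (intro rsz_mod.intro rsz_axioms) (simp add: has_types_def)
  let ?D = "descend_module M"
  have act: "q.cl a \<odot>\<^bsub>?D\<^esub> x = a \<odot>\<^bsub>M\<^esub> x" if a: "a \<in> carrier A" and x: "x \<in> carrier M" for a x
  proof -
    obtain n where n: "n \<in> q.KI" "(SOME x. x \<in> q.cl a) = n \<oplus> a" using q.cl_mem[OF q.cl_some[OF a]] by blast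
    then show ?thesis using a x kill[OF n(1) x] I.Icarr[OF n(1)] by (simp add: desc_simps M.smult_l_distr)
  qed
  have ag: "abelian_group ?D"
    by (rule abelian_groupI) (auto simp: desc_simps M.M.a_ac intro: M.M.add.l_inv_ex)
  have lm: "left_module q.QA ?D"
  proof (intro left_module.intro left_module_axioms.intro q.QA_ring ag)
    fix C x assume C: "C \<in> carrier q.QA" and x: "x \<in> carrier ?D"
    obtain a where a: "a \<in> carrier A" "C = q.cl a" using q.QA_cl[OF C] by blast
    have xc: "x \<in> carrier M" using x by (simp add: desc_simps)
    show "C \<odot>\<^bsub>?D\<^esub> x \<in> carrier ?D" using a act[OF a(1) xc] xc by (simp add: desc_simps(1))
    show "C \<odot>\<^bsub>?D\<^esub> (x \<oplus>\<^bsub>?D\<^esub> y) = C \<odot>\<^bsub>?D\<^esub> x \<oplus>\<^bsub>?D\<^esub> C \<odot>\<^bsub>?D\<^esub> y" if "y \<in> carrier ?D" for y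
      using a xc that by (simp add: act desc_simps(1,3) M.smult_r_distr)
    show "(C \<oplus>\<^bsub>q.QA\<^esub> D) \<odot>\<^bsub>?D\<^esub> x = C \<odot>\<^bsub>?D\<^esub> x \<oplus>\<^bsub>?D\<^esub> D \<odot>\<^bsub>?D\<^esub> x" if "D \<in> carrier q.QA" for D
      using q.QA_cl[OF that] a xc by (auto simp: act q.cl_add desc_simps(1,3) M.smult_l_distr)
    show "(C \<otimes>\<^bsub>q.QA\<^esub> D) \<odot>\<^bsub>?D\<^esub> x = C \<odot>\<^bsub>?D\<^esub> (D \<odot>\<^bsub>?D\<^esub> x)" if "D \<in> carrier q.QA" for D
      using q.QA_cl[OF that] a xc by (auto simp: act q.cl_mult desc_simps(1,3) M.smult_assoc)
  next
    fix x assume "x \<in> carrier ?D"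
    then show "\<one>\<^bsub>q.QA\<^esub> \<odot>\<^bsub>?D\<^esub> x = x" by (simp add: q.QA_simps act desc_simps(1) M.smult_one)
  qed
  obtain I :: "nat set" and v W u \<pi> where st: "strings M I v W u \<pi>" and inj: "inj_on (\<lambda>s. (v s, W s)) I"
    and S: "S = (\<lambda>s. (v s, W s)) ` I"
    using ht by (auto simp: has_types_def)
  note EZ = E_IZ and AZ = Ar_IZ
  have gen: "B.gen ?D (v s) (W s) (u s)" if s: "s \<in> I" for s
  proof -
    note g = strings_gen[OF st s]
    have uc: "u s \<in> carrier M" by (rule gen_carr[OF g])
    have vZ: "v s \<in> V - Z"
    proof
      show "v s \<in> V" by (rule gen_point[OF g])
      show "v s \<notin> Z"
      proof
        assume "v s \<in> Z"
        from kill[OF EZ[OF this] uc] show False using M.vs_E[OF gen_vs[OF g]] gen_nz[OF g] by simp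
      qed
    qed
    have "W s = {j \<in> B.ch (v s). B.Ar j \<odot>\<^bsub>?D\<^esub> u s \<noteq> \<zero>\<^bsub>?D\<^esub>}"
    proof (rule equalityI; rule subsetI)
      fix j assume j: "j \<in> W s"
      have "j \<in> ch (v s)" using gen_sub[OF g] j by blast
      moreover have "j \<notin> Z"
      proof
        assume "j \<in> Z"
        from kill[OF AZ[OF this] uc] show False using gen_in[OF g j] by simp
      qed
      ultimately have "j \<in> V - Z" "par j = v s" by (auto simp: ch_def)
      then show "j \<in> {j \<in> B.ch (v s). B.Ar j \<odot>\<^bsub>?D\<^esub> u s \<noteq> \<zero>\<^bsub>?D\<^esub>}"
        using gen_in[OF g j] by (simp add: B.ch_def B_Ar act uc desc_simps(2))
    next
      fix j assume "j \<in> {j \<in> B.ch (v s). B.Ar j \<odot>\<^bsub>?D\<^esub> u s \<noteq> \<zero>\<^bsub>?D\<^esub>}"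
      then have "j \<in> V - Z" "par j = v s" "Ar j \<odot>\<^bsub>M\<^esub> u s \<noteq> \<zero>\<^bsub>M\<^esub>"
        by (auto simp: B.ch_def B_Ar act uc desc_simps(2))
      then show "j \<in> W s" using gen_out[OF g, of j] by (auto simp: ch_def)
    qed
    moreover have "u s \<in> B.vs ?D (v s)"
      using gen_vs[OF g] vZ uc by (simp add: B.vs_def B_E act desc_simps(1) vs_def)
    ultimately show ?thesis using vZ gen_nz[OF g] by (simp add: B.gen_def desc_simps(2))
  qed
  have lin: "lin q.QA ?D ?D (\<pi> s)" if s: "s \<in> I" for s
  proof (rule linI)
    note l = strings_lin[OF st s]
    fix x assume "x \<in> carrier ?D"
    then have x: "x \<in> carrier M" by (simp add: desc_simps)
    show "\<pi> s x \<in> carrier ?D" using lin_closed[OF l x] by (simp add: desc_simps)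
    show "\<pi> s (x \<oplus>\<^bsub>?D\<^esub> y) = \<pi> s x \<oplus>\<^bsub>?D\<^esub> \<pi> s y" if "y \<in> carrier ?D" for y
      using that lin_add[OF l x] by (simp add: desc_simps)
    show "\<pi> s (C \<odot>\<^bsub>?D\<^esub> x) = C \<odot>\<^bsub>?D\<^esub> \<pi> s x" if "C \<in> carrier q.QA" for C
      using q.QA_cl[OF that] lin_smult[OF l _ x] lin_closed[OF l x] x by (auto simp: act)
  qed
  have orb: "\<pi> s x \<in> B.orb ?D (u s)" if s: "s \<in> I" and x: "x \<in> carrier M" for s x
  proof -
    obtain a where a: "a \<in> carrier A" "\<pi> s x = a \<odot>\<^bsub>M\<^esub> u s" using strings_orb[OF st s x] by (auto simp: orb_def)
    then have "\<pi> s x = q.cl a \<odot>\<^bsub>?D\<^esub> u s" using act[OF a(1) gen_carr[OF strings_gen[OF st s]]] by simp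
    then show ?thesis using q.cl_closed[OF a(1)] by (simp add: B.orb_def)
  qed
  have "B.strings ?D I v W u \<pi>"
    unfolding B.strings_def
    using strings_finite[OF st] gen lin orb strings_same[OF st] strings_other[OF st] strings_sum[OF st]
    by (simp add: desc_simps(1,2) desc_finsum image_subset_iff)
  then show ?thesis unfolding B.has_types_def using lm inj S by blast
qed

text \<open>Elements of \<open>KI\<close> have zero coordinates at all points and arrows inside
  \<open>V - Z\<close>, so they annihilate generators whose types lie there.\<close>

lemma types_kill:
  assumes ht: "has_types M S" and S: "S \<subseteq> typs par (V - Z)" and a: "a \<in> q.KI" and x: "x \<in> carrier M"
  shows "a \<odot>\<^bsub>M\<^esub> x = \<zero>\<^bsub>M\<^esub>"
proof -
  interpret M: rsz_mod K A V par ev om M using ht by (intro rsz_mod.intro rsz_axioms) (simp add: has_types_def)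
  obtain I :: "nat set" and v W u \<pi> where st: "strings M I v W u \<pi>" and S': "S = (\<lambda>s. (v s, W s)) ` I"
    using ht by (auto simp: has_types_def)
  have aA: "a \<in> carrier A" using a by (rule I.Icarr)
  have pc: "\<pi> s x \<in> carrier M" if "s \<in> I" for s using lin_closed[OF strings_lin[OF st that] x] .
  have "a \<odot>\<^bsub>M\<^esub> \<pi> s x = \<zero>\<^bsub>M\<^esub>" if s: "s \<in> I" for s
  proof -
    note g = strings_gen[OF st s]
    obtain b where b: "b \<in> carrier A" "\<pi> s x = b \<odot>\<^bsub>M\<^esub> u s" using strings_orb[OF st s x] by (auto simp: orb_def)
    have ab: "a \<otimes> b \<in> q.KI" using I.I_r_closed[OF a b(1)] .
    have "(v s, W s) \<in> typs par (V - Z)" using S S' s by blast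
    then have t: "v s \<in> V - Z" "W s \<subseteq> kids par (V - Z) (v s)" by (simp_all add: typs_mem)
    have "(a \<otimes> b) \<odot>\<^bsub>M\<^esub> u s = \<zero>\<^bsub>M\<^esub>"
      using M.smult_gen_zero_iff[OF g IZ_D(1)[OF ab]] IZ_D(2)[OF ab t(1)] IZ_D(3)[OF ab] t
      by (auto simp: kids_def)
    then show ?thesis using b aA gen_carr[OF g] by (simp add: M.smult_mult)
  qed
  then have "finsum M (\<lambda>s. a \<odot>\<^bsub>M\<^esub> \<pi> s x) I = finsum M (\<lambda>s. \<zero>\<^bsub>M\<^esub>) I" by (intro M.M.finsum_cong') auto
  moreover have "a \<odot>\<^bsub>M\<^esub> finsum M (\<lambda>s. \<pi> s x) I = finsum M (\<lambda>s. a \<odot>\<^bsub>M\<^esub> \<pi> s x) I"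
    using pc by (intro M.smult_finsum[OF aA _ strings_finite[OF st]]) auto
  ultimately show ?thesis using strings_sum[OF st x] by simp
qed

lemma descend_tilting:
  fixes M :: "('r, nat \<Rightarrow> 'k) module"
  assumes "has_types M S" "\<And>a x. \<lbrakk>a \<in> q.KI; x \<in> carrier M\<rbrakk> \<Longrightarrow> a \<odot>\<^bsub>M\<^esub> x = \<zero>\<^bsub>M\<^esub>"
  shows "tau_tilting K q.QA (descend_module M) \<longleftrightarrow> S \<in> maxc par (V - Z)"
  by (rule B.tau_tilting_types[OF descend_types[OF assms]])

end

context rsz
begin

text \<open>An idempotent enters only through the set of points where its coordinate is nonzero, and
  every set of points occurs for some idempotent.\<close>

lemma stau_tilt_count: "finite (stau_tilt K A)" "card (stau_tilt K A) = card (smaxc par V)"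
proof -
  have rq: "rsz_quot K A V par ev om Z" if "Z \<subseteq> V" for Z
    by (intro rsz_quot.intro rsz_quot_axioms.intro rsz_axioms that)
  have P: "left_module A M \<and> basic_module A M" if "support_tau_tilting K A M \<and> basic_module A M"
    for M :: "('r, nat \<Rightarrow> 'k) module"
    using that by (simp add: support_tau_tilting_def fg_module_def)
  have Q: "support_tau_tilting K A M \<and> basic_module A M \<longleftrightarrow> S \<in> smaxc par V" if ht: "has_types M S"
    for M :: "('r, nat \<Rightarrow> 'k) module" and S
  proof -
    have M: "left_module A M" using ht by (simp add: has_types_def)
    interpret M: rsz_mod K A V par ev om M by (intro rsz_mod.intro rsz_axioms M)
    have bas: "basic_module A M" using basic_iff_has_types[OF M] ht by blast
    have "support_tau_tilting K A M \<longleftrightarrow> S \<in> smaxc par V"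
    proof
      assume "support_tau_tilting K A M"
      then obtain e where e: "e \<in> carrier A" "e \<otimes> e = e" "\<forall>a\<in>Idl {e}. \<forall>x\<in>carrier M. a \<odot>\<^bsub>M\<^esub> x = \<zero>\<^bsub>M\<^esub>"
        "tau_tilting K (quotient_algebra A (Idl {e})) (descend_module M)"
        by (auto simp: support_tau_tilting_def)
      define Z where "Z = {i \<in> V. ev i e \<noteq> \<zero>\<^bsub>K\<^esub>}"
      interpret z: rsz_quot K A V par ev om Z by (rule rq) (auto simp: Z_def)
      have I: "Idl {e} = z.q.KI" by (rule z.idempotent_ideal[OF e(1,2) Z_def])
      have "tau_tilting K z.q.QA (descend_module M)" using e(4) by (simp add: z.q.QA_def I)
      then have "S \<in> maxc par (V - Z)" using z.descend_tilting[OF ht] e(3) I by blast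
      then show "S \<in> smaxc par V" by (auto simp: smaxc_def)
    next
      assume "S \<in> smaxc par V"
      then obtain U where U: "U \<subseteq> V" "S \<in> maxc par U" by (auto simp: smaxc_def)
      define Z where "Z = V - U"
      have VZ: "V - Z = U" using U by (auto simp: Z_def)
      interpret z: rsz_quot K A V par ev om Z by (rule rq) (auto simp: Z_def)
      define e where "e = mk (\<lambda>i. if i \<in> Z then \<one>\<^bsub>K\<^esub> else \<zero>\<^bsub>K\<^esub>) (\<lambda>_. \<zero>\<^bsub>K\<^esub>)"
      have e: "e \<in> carrier A" "\<And>i. i \<in> V \<Longrightarrow> ev i e = (if i \<in> Z then \<one>\<^bsub>K\<^esub> else \<zero>\<^bsub>K\<^esub>)"
        "\<And>j. \<lbrakk>j \<in> V; par j \<in> V\<rbrakk> \<Longrightarrow> om j e = \<zero>\<^bsub>K\<^esub>"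
        unfolding e_def by (simp_all add: mk)
      have ee: "e \<otimes> e = e" by (rule coord_eqI) (use e in auto)
      have "Z = {i \<in> V. ev i e \<noteq> \<zero>\<^bsub>K\<^esub>}" using e(2) K.one_not_zero by (auto simp: Z_def)
      then have I: "Idl {e} = z.q.KI" by (rule z.idempotent_ideal[OF e(1) ee])
      have kill: "a \<odot>\<^bsub>M\<^esub> x = \<zero>\<^bsub>M\<^esub>" if "a \<in> z.q.KI" "x \<in> carrier M" for a x
        using z.types_kill[OF ht _ that] U(2) by (simp add: VZ maxc_def)
      have "tau_tilting K z.q.QA (descend_module M)" using z.descend_tilting[OF ht kill] U(2) VZ by simp
      moreover obtain I :: "nat set" and v W u \<pi> where "strings M I v W u \<pi>"
        using ht by (auto simp: has_types_def)
      then have "fg_module A M" by (rule M.strings_fg)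
      ultimately show "support_tau_tilting K A M"
        unfolding support_tau_tilting_def using e(1) ee kill I by (auto simp: z.q.QA_def intro!: bexI[of _ e])
    qed
    then show ?thesis using bas by blast
  qed
  have sub: "S \<subseteq> typs par V" if "S \<in> smaxc par V" for S
    using that by (auto simp: smaxc_def maxc_def typs_def kids_def)
  show "finite (stau_tilt K A)" "card (stau_tilt K A) = card (smaxc par V)"
    unfolding stau_tilt_def
    by (rule iso_classes_types[where P = "\<lambda>M. support_tau_tilting K A M \<and> basic_module A M", OF P Q sub], assumption+)+
qed

end

section \<open>Path algebras of finite acyclic quivers\<close>

text \<open>With finitely many paths every function supported on paths has finite support, and the
  ideal of paths of positive length is nilpotent.\<close>

locale path_alg = K: field K + wf_digraph Q for K :: "('k, 'm) ring_scheme" and Q :: "('v, 'e) pre_digraph" +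
  assumes fin_paths: "finite (quiver_paths Q)"
begin

declare split_paired_All [simp del] split_paired_Ex [simp del]

abbreviation "A \<equiv> path_algebra K Q"
abbreviation "F \<equiv> path_factorizations Q"
abbreviation "\<P> \<equiv> quiver_paths Q"

lemma paths_mem: "(u, p, w) \<in> \<P> \<longleftrightarrow> awalk u p w" by (simp add: quiver_paths_def)

lemma triv_path: "i \<in> verts Q \<Longrightarrow> (i, [], i) \<in> \<P>" by (simp add: paths_mem awalk_Nil_iff)

lemma F_mem: "(x, y) \<in> F p \<longleftrightarrow> (\<exists>u a v b w. x = (v, b, w) \<and> y = (u, a, v) \<and> awalk u a v \<and> awalk v b w \<and> p = (u, a @ b, w))"
  by (auto simp: path_factorizations_def)

lemma F_fst: "x \<in> F p \<Longrightarrow> fst x \<in> \<P>" and F_snd: "x \<in> F p \<Longrightarrow> snd x \<in> \<P>"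
  by (auto simp: path_factorizations_def paths_mem)

lemma F_fin [simp]: "finite (F p)"
proof (rule finite_subset)
  show "F p \<subseteq> \<P> \<times> \<P>" by (auto simp: path_factorizations_def paths_mem)
qed (use fin_paths in simp)

lemma F_path: "x \<in> F p \<Longrightarrow> p \<in> \<P>"
  by (auto simp: path_factorizations_def paths_mem dest: awalk_appendI)

lemma F_unique: "\<lbrakk>x \<in> F p; x \<in> F q\<rbrakk> \<Longrightarrow> p = q"
  by (auto simp: path_factorizations_def)

lemma A_simps: "zero A = (\<lambda>p. \<zero>\<^bsub>K\<^esub>)" "f \<oplus>\<^bsub>A\<^esub> g = (\<lambda>p. f p \<oplus>\<^bsub>K\<^esub> g p)" "c \<odot>\<^bsub>A\<^esub> f = (\<lambda>p. c \<otimes>\<^bsub>K\<^esub> f p)"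
  "(f \<otimes>\<^bsub>A\<^esub> g) p = (\<Oplus>\<^bsub>K\<^esub>x\<in>F p. f (fst x) \<otimes>\<^bsub>K\<^esub> g (snd x))"
  by (simp_all add: path_algebra_def)

lemma A_one: "\<one>\<^bsub>A\<^esub> (u, p, v) = (if u \<in> verts Q \<and> p = [] \<and> u = v then \<one>\<^bsub>K\<^esub> else \<zero>\<^bsub>K\<^esub>)"
  by (simp add: path_algebra_def)

lemma A_carrier: "f \<in> carrier A \<longleftrightarrow> (\<forall>p. f p \<in> carrier K) \<and> (\<forall>p. p \<notin> \<P> \<longrightarrow> f p = \<zero>\<^bsub>K\<^esub>)"
proof -
  have "finite {p. f p \<noteq> \<zero>\<^bsub>K\<^esub>}" if "{p. f p \<noteq> \<zero>\<^bsub>K\<^esub>} \<subseteq> \<P>" using that fin_paths by (rule finite_subset)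
  then show ?thesis by (auto simp: path_algebra_def)
qed

lemma A_carr [simp]: "f \<in> carrier A \<Longrightarrow> f p \<in> carrier K" by (simp add: A_carrier)

lemma A_off: "\<lbrakk>f \<in> carrier A; p \<notin> \<P>\<rbrakk> \<Longrightarrow> f p = \<zero>\<^bsub>K\<^esub>" by (simp add: A_carrier)

lemma A_mult_closed: assumes "f \<in> carrier A" "g \<in> carrier A" shows "f \<otimes>\<^bsub>A\<^esub> g \<in> carrier A"
proof -
  have "F p = {}" if "p \<notin> \<P>" for p using that F_path by blast
  then show ?thesis using assms unfolding A_carrier[of "f \<otimes>\<^bsub>A\<^esub> g"] by (auto simp: A_simps)
qed

lemma A_one_closed: "\<one>\<^bsub>A\<^esub> \<in> carrier A"
  unfolding A_carrier by (auto simp: A_one triv_path)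

lemma finsum_Sigma:
  assumes "finite S" "\<And>x. x \<in> S \<Longrightarrow> finite (B x)" "\<And>x y. \<lbrakk>x \<in> S; y \<in> B x\<rbrakk> \<Longrightarrow> t (x, y) \<in> carrier K"
  shows "(\<Oplus>\<^bsub>K\<^esub>x\<in>S. \<Oplus>\<^bsub>K\<^esub>y\<in>B x. t (x, y)) = finsum K t (Sigma S B)"
proof -
  have S: "Sigma S B = (\<Union>x\<in>S. Pair x ` B x)" by auto
  have "finsum K t (Sigma S B) = (\<Oplus>\<^bsub>K\<^esub>x\<in>S. finsum K t (Pair x ` B x))"
    unfolding S by (rule K.add.finprod_UN_disjoint) (use assms in \<open>auto simp: pairwise_def disjnt_def\<close>)
  also have "\<dots> = (\<Oplus>\<^bsub>K\<^esub>x\<in>S. \<Oplus>\<^bsub>K\<^esub>y\<in>B x. t (x, y))"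
  proof (rule K.finsum_cong')
    fix x assume x: "x \<in> S"
    show "finsum K t (Pair x ` B x) = (\<Oplus>\<^bsub>K\<^esub>y\<in>B x. t (x, y))"
      by (rule K.finsum_reindex) (use assms x in \<open>auto simp: inj_on_def\<close>)
  qed (use assms in \<open>auto intro!: K.finsum_closed\<close>)
  finally show ?thesis by simp
qed

text \<open>In the order of \<open>path_factorizations\<close>: first \<open>y\<close>, then
  \<open>x\<close>. The endpoints are not compared, as only composable paths are inserted.\<close>

definition comp :: "('v, 'e) path \<Rightarrow> ('v, 'e) path \<Rightarrow> ('v, 'e) path" where
  "comp x y = (fst y, fst (snd y) @ fst (snd x), snd (snd x))"

text \<open>Both sides are sums over the factorizations of \<open>p\<close> into three paths, and
  \<open>?h\<close> exchanges the two ways of bracketing them.\<close>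

lemma A_assoc:
  assumes "f \<in> carrier A" "g \<in> carrier A" "h \<in> carrier A"
  shows "(f \<otimes>\<^bsub>A\<^esub> g) \<otimes>\<^bsub>A\<^esub> h = f \<otimes>\<^bsub>A\<^esub> (g \<otimes>\<^bsub>A\<^esub> h)"
proof
  fix p
  let ?S1 = "SIGMA x:F p. F (fst x)" and ?S2 = "SIGMA x:F p. F (snd x)"
  let ?t1 = "\<lambda>(x, y). f (fst y) \<otimes>\<^bsub>K\<^esub> g (snd y) \<otimes>\<^bsub>K\<^esub> h (snd x)"
  let ?t2 = "\<lambda>(x, y). f (fst x) \<otimes>\<^bsub>K\<^esub> (g (fst y) \<otimes>\<^bsub>K\<^esub> h (snd y))"
  let ?h = "\<lambda>(x, y). ((comp (fst x) (fst y), snd y), (fst x, fst y))"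
  have "((f \<otimes>\<^bsub>A\<^esub> g) \<otimes>\<^bsub>A\<^esub> h) p = (\<Oplus>\<^bsub>K\<^esub>x\<in>F p. \<Oplus>\<^bsub>K\<^esub>y\<in>F (fst x). ?t1 (x, y))"
    unfolding A_simps(4)
    by (rule K.finsum_cong') (use assms in \<open>auto simp: K.finsum_ldistr intro!: K.finsum_closed\<close>)
  also have "\<dots> = finsum K ?t1 ?S1" by (rule finsum_Sigma) (use assms in auto)
  also have "?S1 = ?h ` ?S2"
  proof (rule equalityI; rule subsetI)
    fix z assume "z \<in> ?S1"
    then obtain u a v b w v' b' where z: "z = (((v, b @ b', w), (u, a, v)), ((v', b', w), (v, b, v')))"
      and "awalk u a v" "awalk v b v'" "awalk v' b' w" "p = (u, a @ b @ b', w)"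
      by (auto simp: path_factorizations_def)
    then have "(((v', b', w), (u, a @ b, v')), ((v, b, v'), (u, a, v))) \<in> ?S2"
      by (auto simp: F_mem intro: awalk_appendI simp del: awalk_append_iff)
    moreover have "z = ?h (((v', b', w), (u, a @ b, v')), ((v, b, v'), (u, a, v)))" by (simp add: z comp_def)
    ultimately show "z \<in> ?h ` ?S2" by blast
  next
    fix z assume "z \<in> ?h ` ?S2"
    then obtain y where y: "y \<in> ?S2" "z = ?h y" by blast
    then obtain u a v b w v' b' where y': "y = (((v', b', w), (u, a @ b, v')), ((v, b, v'), (u, a, v)))"
      and "awalk u a v" "awalk v b v'" "awalk v' b' w" "p = (u, a @ b @ b', w)"
      by (auto simp: path_factorizations_def)
    then show "z \<in> ?S1"
      unfolding y(2) y' by (auto simp: F_mem comp_def intro: awalk_appendI simp del: awalk_append_iff)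
  qed
  also have "finsum K ?t1 (?h ` ?S2) = finsum K (\<lambda>z. ?t1 (?h z)) ?S2"
  proof (rule K.finsum_reindex)
    show "inj_on ?h ?S2"
      by (rule inj_onI) (auto simp: path_factorizations_def comp_def)
  qed (use assms in auto)
  also have "\<dots> = finsum K ?t2 ?S2"
    by (rule K.finsum_cong') (use assms in \<open>auto simp: K.m_assoc\<close>)
  also have "\<dots> = (\<Oplus>\<^bsub>K\<^esub>x\<in>F p. \<Oplus>\<^bsub>K\<^esub>y\<in>F (snd x). ?t2 (x, y))" by (rule finsum_Sigma[symmetric]) (use assms in auto)
  also have "\<dots> = (f \<otimes>\<^bsub>A\<^esub> (g \<otimes>\<^bsub>A\<^esub> h)) p"
    unfolding A_simps(4)
    by (rule K.finsum_cong') (use assms in \<open>auto simp: K.finsum_rdistr intro!: K.finsum_closed\<close>)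
  finally show "((f \<otimes>\<^bsub>A\<^esub> g) \<otimes>\<^bsub>A\<^esub> h) p = (f \<otimes>\<^bsub>A\<^esub> (g \<otimes>\<^bsub>A\<^esub> h)) p" .
qed

lemma mult_at_one_term:
  assumes "f \<in> carrier A" "g \<in> carrier A" "(x, y) \<in> F p"
    "\<And>z. \<lbrakk>z \<in> F p; z \<noteq> (x, y)\<rbrakk> \<Longrightarrow> f (fst z) \<otimes>\<^bsub>K\<^esub> g (snd z) = \<zero>\<^bsub>K\<^esub>"
  shows "(f \<otimes>\<^bsub>A\<^esub> g) p = f x \<otimes>\<^bsub>K\<^esub> g y"
proof -
  have "(f \<otimes>\<^bsub>A\<^esub> g) p = (\<Oplus>\<^bsub>K\<^esub>z\<in>{(x, y)}. f (fst z) \<otimes>\<^bsub>K\<^esub> g (snd z))"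
    unfolding A_simps(4) by (rule K.add.finprod_mono_neutral_cong_right) (use assms in auto)
  then show ?thesis using assms by simp
qed

lemma mult_vanish:
  assumes "\<And>z. z \<in> F p \<Longrightarrow> f (fst z) \<otimes>\<^bsub>K\<^esub> g (snd z) = \<zero>\<^bsub>K\<^esub>" shows "(f \<otimes>\<^bsub>A\<^esub> g) p = \<zero>\<^bsub>K\<^esub>"
proof -
  have "(f \<otimes>\<^bsub>A\<^esub> g) p = (\<Oplus>\<^bsub>K\<^esub>z\<in>F p. \<zero>\<^bsub>K\<^esub>)" unfolding A_simps(4) by (rule K.finsum_cong') (use assms in auto)
  then show ?thesis by simp
qed

text \<open>Only the factorization with a trivial path at the target contributes. The left unit law
  is the case of the scalar 1.\<close>

lemma scal_mult: assumes c: "c \<in> carrier K" and f: "f \<in> carrier A"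
  shows "(c \<odot>\<^bsub>A\<^esub> \<one>\<^bsub>A\<^esub>) \<otimes>\<^bsub>A\<^esub> f = c \<odot>\<^bsub>A\<^esub> f"
proof
  fix p
  have s: "c \<odot>\<^bsub>A\<^esub> \<one>\<^bsub>A\<^esub> \<in> carrier A" using c A_one_closed by (auto simp: A_carrier A_simps)
  show "((c \<odot>\<^bsub>A\<^esub> \<one>\<^bsub>A\<^esub>) \<otimes>\<^bsub>A\<^esub> f) p = (c \<odot>\<^bsub>A\<^esub> f) p"
  proof (cases "p \<in> \<P>")
    case True
    then obtain u q w where p: "p = (u, q, w)" "awalk u q w" by (auto simp: quiver_paths_def)
    then have w: "w \<in> verts Q" by blast
    have "((c \<odot>\<^bsub>A\<^esub> \<one>\<^bsub>A\<^esub>) \<otimes>\<^bsub>A\<^esub> f) p = (c \<odot>\<^bsub>A\<^esub> \<one>\<^bsub>A\<^esub>) (w, [], w) \<otimes>\<^bsub>K\<^esub> f p"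
    proof (rule mult_at_one_term[OF s f])
      show "((w, [], w), p) \<in> F p" using p w by (auto simp: F_mem awalk_Nil_iff)
      show "(c \<odot>\<^bsub>A\<^esub> \<one>\<^bsub>A\<^esub>) (fst z) \<otimes>\<^bsub>K\<^esub> f (snd z) = \<zero>\<^bsub>K\<^esub>" if "z \<in> F p" "z \<noteq> ((w, [], w), p)" for z
        using that c f by (auto simp: p path_factorizations_def A_simps(3) A_one awalk_Nil_iff split: if_splits)
    qed
    then show ?thesis using c w f by (simp add: A_simps(3) A_one)
  next
    case False
    then show ?thesis using A_off[OF A_mult_closed[OF s f]] A_off[OF f] c by (simp add: A_simps(3))
  qed
qed

lemma A_r_one: assumes f: "f \<in> carrier A" shows "f \<otimes>\<^bsub>A\<^esub> \<one>\<^bsub>A\<^esub> = f"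
proof
  fix p
  show "(f \<otimes>\<^bsub>A\<^esub> \<one>\<^bsub>A\<^esub>) p = f p"
  proof (cases "p \<in> \<P>")
    case True
    then obtain u q w where p: "p = (u, q, w)" "awalk u q w" by (auto simp: quiver_paths_def)
    then have u: "u \<in> verts Q" by blast
    have "(f \<otimes>\<^bsub>A\<^esub> \<one>\<^bsub>A\<^esub>) p = f p \<otimes>\<^bsub>K\<^esub> \<one>\<^bsub>A\<^esub> (u, [], u)"
    proof (rule mult_at_one_term[OF f A_one_closed])
      show "(p, (u, [], u)) \<in> F p" using p u by (auto simp: F_mem awalk_Nil_iff)
      show "f (fst z) \<otimes>\<^bsub>K\<^esub> \<one>\<^bsub>A\<^esub> (snd z) = \<zero>\<^bsub>K\<^esub>" if "z \<in> F p" "z \<noteq> (p, (u, [], u))" for z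
        using that f by (auto simp: p path_factorizations_def A_one awalk_Nil_iff split: if_splits)
    qed
    then show ?thesis using u f by (simp add: A_one)
  next
    case False
    then show ?thesis using A_off[OF A_mult_closed[OF f A_one_closed]] A_off[OF f] by simp
  qed
qed

lemma A_ring: "ring A"
proof -
  have "abelian_group A"
  proof (rule abelian_groupI)
    show "\<exists>g\<in>carrier A. g \<oplus>\<^bsub>A\<^esub> f = \<zero>\<^bsub>A\<^esub>" if "f \<in> carrier A" for f
      using that by (intro bexI[of _ "\<lambda>p. \<ominus>\<^bsub>K\<^esub> f p"]) (auto simp: A_carrier A_simps K.l_neg)
  qed (auto simp: A_carrier A_simps K.a_ac)
  moreover have "monoid A"
  proof (rule monoidI)
    show "\<one>\<^bsub>A\<^esub> \<otimes>\<^bsub>A\<^esub> f = f" if "f \<in> carrier A" for f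
    proof -
      have "\<one>\<^bsub>K\<^esub> \<odot>\<^bsub>A\<^esub> g = g" if "g \<in> carrier A" for g using that by (simp add: A_simps)
      then show ?thesis using scal_mult[OF K.one_closed that] that A_one_closed by simp
    qed
  qed (auto simp: A_assoc A_mult_closed A_one_closed A_r_one)
  ultimately show ?thesis
  proof (rule ringI)
    fix f g h assume *: "f \<in> carrier A" "g \<in> carrier A" "h \<in> carrier A"
    show "(f \<oplus>\<^bsub>A\<^esub> g) \<otimes>\<^bsub>A\<^esub> h = f \<otimes>\<^bsub>A\<^esub> h \<oplus>\<^bsub>A\<^esub> g \<otimes>\<^bsub>A\<^esub> h"
    proof
      fix p
      have "((f \<oplus>\<^bsub>A\<^esub> g) \<otimes>\<^bsub>A\<^esub> h) p = (\<Oplus>\<^bsub>K\<^esub>x\<in>F p. f (fst x) \<otimes>\<^bsub>K\<^esub> h (snd x) \<oplus>\<^bsub>K\<^esub> g (fst x) \<otimes>\<^bsub>K\<^esub> h (snd x))"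
        unfolding A_simps(4) by (rule K.finsum_cong') (use * in \<open>auto simp: A_simps(2) K.l_distr\<close>)
      then show "((f \<oplus>\<^bsub>A\<^esub> g) \<otimes>\<^bsub>A\<^esub> h) p = (f \<otimes>\<^bsub>A\<^esub> h \<oplus>\<^bsub>A\<^esub> g \<otimes>\<^bsub>A\<^esub> h) p"
        using * by (simp add: A_simps(2,4) K.finsum_addf)
    qed
    show "h \<otimes>\<^bsub>A\<^esub> (f \<oplus>\<^bsub>A\<^esub> g) = h \<otimes>\<^bsub>A\<^esub> f \<oplus>\<^bsub>A\<^esub> h \<otimes>\<^bsub>A\<^esub> g"
    proof
      fix p
      have "(h \<otimes>\<^bsub>A\<^esub> (f \<oplus>\<^bsub>A\<^esub> g)) p = (\<Oplus>\<^bsub>K\<^esub>x\<in>F p. h (fst x) \<otimes>\<^bsub>K\<^esub> f (snd x) \<oplus>\<^bsub>K\<^esub> h (fst x) \<otimes>\<^bsub>K\<^esub> g (snd x))"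
        unfolding A_simps(4) by (rule K.finsum_cong') (use * in \<open>auto simp: A_simps(2) K.r_distr\<close>)
      then show "(h \<otimes>\<^bsub>A\<^esub> (f \<oplus>\<^bsub>A\<^esub> g)) p = (h \<otimes>\<^bsub>A\<^esub> f \<oplus>\<^bsub>A\<^esub> h \<otimes>\<^bsub>A\<^esub> g) p"
        using * by (simp add: A_simps(2,4) K.finsum_addf)
    qed
  qed
qed

end

section \<open>The radical of the path algebra and its square\<close>

context path_alg
begin

lemma mult_triv: assumes "f \<in> carrier A" "g \<in> carrier A" "i \<in> verts Q"
  shows "(f \<otimes>\<^bsub>A\<^esub> g) (i, [], i) = f (i, [], i) \<otimes>\<^bsub>K\<^esub> g (i, [], i)"
proof (rule mult_at_one_term[OF assms(1,2)])
  show "((i, [], i), (i, [], i)) \<in> F (i, [], i)" using assms(3) by (simp add: F_mem awalk_Nil_iff)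
  show "f (fst z) \<otimes>\<^bsub>K\<^esub> g (snd z) = \<zero>\<^bsub>K\<^esub>" if "z \<in> F (i, [], i)" "z \<noteq> ((i, [], i), (i, [], i))" for z
    using that by (auto simp: path_factorizations_def awalk_Nil_iff)
qed

lemma mult_arrow: assumes "f \<in> carrier A" "g \<in> carrier A" "e \<in> arcs Q"
  shows "(f \<otimes>\<^bsub>A\<^esub> g) (tail Q e, [e], head Q e) =
    f (head Q e, [], head Q e) \<otimes>\<^bsub>K\<^esub> g (tail Q e, [e], head Q e) \<oplus>\<^bsub>K\<^esub>
    f (tail Q e, [e], head Q e) \<otimes>\<^bsub>K\<^esub> g (tail Q e, [], tail Q e)"
proof -
  let ?u = "tail Q e" and ?w = "head Q e"
  have F: "F (?u, [e], ?w) = {((?w, [], ?w), (?u, [e], ?w)), ((?u, [e], ?w), (?u, [], ?u))}"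
  proof (rule equalityI; rule subsetI)
    fix z assume "z \<in> F (?u, [e], ?w)"
    then obtain a v b where z: "z = ((v, b, ?w), (?u, a, v))" "awalk ?u a v" "awalk v b ?w" "[e] = a @ b"
      by (auto simp: path_factorizations_def)
    then consider "a = []" "b = [e]" | "a = [e]" "b = []" by (auto simp: Cons_eq_append_conv)
    then show "z \<in> {((?w, [], ?w), (?u, [e], ?w)), ((?u, [e], ?w), (?u, [], ?u))}"
    proof cases
      case 1
      then have "?u = v" using z(2) by (simp add: awalk_Nil_iff)
      then show ?thesis using z(1) 1 by simp
    next
      case 2
      then have "v = ?w" using z(3) by (simp add: awalk_Nil_iff)
      then show ?thesis using z(1) 2 by simp
    qed
  qed (use assms(3) in \<open>auto simp: F_mem awalk_Nil_iff awalk_Cons_iff\<close>)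
  have "finsum K t {x, y} = t x \<oplus>\<^bsub>K\<^esub> t y" if "x \<noteq> y" "t x \<in> carrier K" "t y \<in> carrier K"
    for t and x y :: "('v, 'e) path \<times> ('v, 'e) path"
    using that by (subst K.finsum_insert) auto
  then show ?thesis unfolding A_simps(4) F using assms(1,2) by simp
qed

lemma sc_carr: "c \<in> carrier K \<Longrightarrow> c \<odot>\<^bsub>A\<^esub> \<one>\<^bsub>A\<^esub> \<in> carrier A"
  using A_one_closed by (auto simp: A_carrier A_simps(3))

definition J where "J = {f \<in> carrier A. \<forall>i\<in>verts Q. f (i, [], i) = \<zero>\<^bsub>K\<^esub>}"

definition dl :: "('v, 'e) path \<Rightarrow> 'k \<Rightarrow> ('v, 'e) path \<Rightarrow> 'k" where "dl p c = (\<lambda>q. if q = p then c else \<zero>\<^bsub>K\<^esub>)"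

lemma dl_apply: "dl p c q = (if q = p then c else \<zero>\<^bsub>K\<^esub>)" by (simp add: dl_def)

lemma dl_carr [simp]: "\<lbrakk>c \<in> carrier K; p \<in> \<P>\<rbrakk> \<Longrightarrow> dl p c \<in> carrier A"
  by (auto simp: A_carrier dl_def)

lemma dl_mult:
  assumes "c \<in> carrier K" "(x, y) \<in> F p" shows "dl x c \<otimes>\<^bsub>A\<^esub> dl y \<one>\<^bsub>K\<^esub> = dl p c"
proof
  fix q
  have xy: "x \<in> \<P>" "y \<in> \<P>" using F_fst[OF assms(2)] F_snd[OF assms(2)] by auto
  note dc = dl_carr[OF assms(1) xy(1)] dl_carr[OF K.one_closed xy(2)]
  show "(dl x c \<otimes>\<^bsub>A\<^esub> dl y \<one>\<^bsub>K\<^esub>) q = dl p c q"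
  proof (cases "q = p")
    case True
    have "(dl x c \<otimes>\<^bsub>A\<^esub> dl y \<one>\<^bsub>K\<^esub>) p = dl x c x \<otimes>\<^bsub>K\<^esub> dl y \<one>\<^bsub>K\<^esub> y"
      by (rule mult_at_one_term[OF dc assms(2)]) (use assms(1) in \<open>auto simp: dl_def prod_eq_iff\<close>)
    then show ?thesis using True assms(1) by (simp add: dl_def)
  next
    case False
    have "(x, y) \<notin> F q" using F_unique[OF assms(2)] False by blast
    then have "(dl x c \<otimes>\<^bsub>A\<^esub> dl y \<one>\<^bsub>K\<^esub>) q = \<zero>\<^bsub>K\<^esub>"
      by (intro mult_vanish) (use assms(1) in \<open>auto simp: dl_def\<close>)
    then show ?thesis using False by (simp add: dl_def)
  qed
qed

interpretation A: ring A by (rule A_ring)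

lemma A_diff: "\<lbrakk>f \<in> carrier A; g \<in> carrier A\<rbrakk> \<Longrightarrow> (f \<ominus>\<^bsub>A\<^esub> g) p = f p \<ominus>\<^bsub>K\<^esub> g p"
proof -
  assume f: "f \<in> carrier A" and g: "g \<in> carrier A"
  have "(\<ominus>\<^bsub>A\<^esub> g) p \<oplus>\<^bsub>K\<^esub> g p = \<zero>\<^bsub>K\<^esub>" using A.l_neg[OF g] by (metis A_simps(1,2))
  then have "(\<ominus>\<^bsub>A\<^esub> g) p = \<ominus>\<^bsub>K\<^esub> g p" using g by (intro K.minus_equality[symmetric]) auto
  then show ?thesis by (simp add: a_minus_def A_simps(2))
qed

lemma J_l_closed: "\<lbrakk>f \<in> carrier A; z \<in> J\<rbrakk> \<Longrightarrow> f \<otimes>\<^bsub>A\<^esub> z \<in> J"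
  by (auto simp: J_def mult_triv)

text \<open>Each factor from \<open>J\<close> uses up at least one arrow.\<close>

lemma J_pow_vanish:
  assumes z: "z \<in> J" and "length (fst (snd p)) < m" shows "(z [^]\<^bsub>A\<^esub> (m::nat)) p = \<zero>\<^bsub>K\<^esub>"
  using assms(2)
proof (induction m arbitrary: p)
  case (Suc m)
  have zA: "z \<in> carrier A" using z by (simp add: J_def)
  have "(z [^]\<^bsub>A\<^esub> m \<otimes>\<^bsub>A\<^esub> z) p = \<zero>\<^bsub>K\<^esub>"
  proof (rule mult_vanish)
    fix x assume "x \<in> F p"
    then obtain u a v b w where x: "x = ((v, b, w), (u, a, v))" "awalk u a v" "p = (u, a @ b, w)"
      by (auto simp: path_factorizations_def)
    show "(z [^]\<^bsub>A\<^esub> m) (fst x) \<otimes>\<^bsub>K\<^esub> z (snd x) = \<zero>\<^bsub>K\<^esub>"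
    proof (cases "a = []")
      case True
      then show ?thesis using x z zA by (auto simp: awalk_Nil_iff J_def)
    next
      case False
      then have "length b < m" using Suc.prems x(3) by (cases a) auto
      then show ?thesis using Suc.IH[of "(v, b, w)"] x(1) zA by simp
    qed
  qed
  then show ?case by simp
qed simp

lemma J_nilpotent: assumes z: "z \<in> J" shows "\<exists>m::nat. z [^]\<^bsub>A\<^esub> m = \<zero>\<^bsub>A\<^esub>"
proof -
  have zA: "z \<in> carrier A" using z by (simp add: J_def)
  \<comment> \<open>One more than the length of the longest path.\<close>
  define m where "m = Suc (Max ((\<lambda>p. length (fst (snd p))) ` \<P>))"
  have "(z [^]\<^bsub>A\<^esub> m) p = \<zero>\<^bsub>K\<^esub>" for p
  proof (cases "p \<in> \<P>")
    case True
    then have "length (fst (snd p)) < m" using fin_paths by (simp add: m_def less_Suc_eq_le)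
    then show ?thesis by (rule J_pow_vanish[OF z])
  next
    case False
    then show ?thesis using A_off[of "z [^]\<^bsub>A\<^esub> m"] zA by simp
  qed
  then show ?thesis by (intro exI[of _ m]) (auto simp: A_simps(1))
qed

abbreviation "AA \<equiv> regular_module A"

text \<open>The difference of 1 and any power of \<open>y\<close> is a left multiple of the
  difference of 1 and \<open>y\<close>, and some power of \<open>y\<close> is zero.\<close>

lemma left_ideal_one:
  assumes I: "submodule I A AA" and y: "y \<in> J" "\<one>\<^bsub>A\<^esub> \<ominus>\<^bsub>A\<^esub> y \<in> I" shows "\<one>\<^bsub>A\<^esub> \<in> I"
proof -
  interpret L: left_module A AA by (rule A.regular_left_module)
  have yA: "y \<in> carrier A" using y by (simp add: J_def)
  have Isub: "I \<subseteq> carrier A" using L.submodule_carr[OF I] by (auto simp: A.regular_simps)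
  have Iadd: "a \<oplus>\<^bsub>A\<^esub> b \<in> I" if "a \<in> I" "b \<in> I" for a b
    using submodule.axioms(1)[OF I] that subgroup.m_closed[of I "add_monoid AA" a b] by (simp add: A.regular_simps)
  have Imul: "a \<otimes>\<^bsub>A\<^esub> b \<in> I" if "a \<in> carrier A" "b \<in> I" for a b
    using submodule.smult_closed[OF I that] by (simp add: A.regular_simps)
  have "\<one>\<^bsub>A\<^esub> \<ominus>\<^bsub>A\<^esub> y [^]\<^bsub>A\<^esub> m \<in> I" for m :: nat
  proof (induction m)
    case 0
    have "\<zero>\<^bsub>A\<^esub> \<otimes>\<^bsub>A\<^esub> (\<one>\<^bsub>A\<^esub> \<ominus>\<^bsub>A\<^esub> y) \<in> I" by (rule Imul) (use y in auto)
    then show ?case using yA by (simp add: a_minus_def A.r_neg)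
  next
    case (Suc m)
    have "\<one>\<^bsub>A\<^esub> \<ominus>\<^bsub>A\<^esub> y [^]\<^bsub>A\<^esub> Suc m = y [^]\<^bsub>A\<^esub> m \<otimes>\<^bsub>A\<^esub> (\<one>\<^bsub>A\<^esub> \<ominus>\<^bsub>A\<^esub> y) \<oplus>\<^bsub>A\<^esub> (\<one>\<^bsub>A\<^esub> \<ominus>\<^bsub>A\<^esub> y [^]\<^bsub>A\<^esub> m)"
      using yA by (simp add: A.ring_simprules)
    then show ?case using Iadd[OF Imul[OF _ y(2)] Suc] yA by simp
  qed
  moreover obtain m :: nat where "y [^]\<^bsub>A\<^esub> m = \<zero>\<^bsub>A\<^esub>" using J_nilpotent[OF y(1)] by blast
  ultimately have "\<one>\<^bsub>A\<^esub> \<ominus>\<^bsub>A\<^esub> \<zero>\<^bsub>A\<^esub> \<in> I" by metis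
  then show ?thesis by (simp add: a_minus_def)
qed

text \<open>The coordinate at a trivial path is a ring homomorphism onto the field, so this kernel
  has codimension one: modulo it, every \<open>h\<close> is a scalar multiple of any
  \<open>g\<close> outside it.\<close>

lemma vertex_ideal_maximal:
  assumes i: "i \<in> verts Q" shows "maximal_left_ideal A {f \<in> carrier A. f (i, [], i) = \<zero>\<^bsub>K\<^esub>}" (is "maximal_left_ideal A ?M")
  unfolding maximal_left_ideal_def
proof (intro conjI allI impI)
  interpret L: left_module A AA by (rule A.regular_left_module)
  show "submodule ?M A AA"
  proof (rule L.submoduleI)
    have "\<zero>\<^bsub>A\<^esub> \<in> ?M" using A.zero_closed by (simp add: A_simps(1))
    then show "?M \<noteq> {}" by blast
    show "a \<odot>\<^bsub>AA\<^esub> x \<in> ?M" if "a \<in> carrier A" "x \<in> ?M" for a x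
      using that i by (simp add: A.regular_simps mult_triv)
    show "x \<oplus>\<^bsub>AA\<^esub> y \<in> ?M" if "x \<in> ?M" "y \<in> ?M" for x y
    proof -
      have "(x \<oplus>\<^bsub>A\<^esub> y) (i, [], i) = \<zero>\<^bsub>K\<^esub>" using that unfolding A_simps(2) by simp
      then show ?thesis using that A.a_closed[of x y] by (simp add: A.regular_simps)
    qed
  qed (auto simp: A.regular_simps)
  show "?M \<noteq> carrier A" using A_one_closed i A_one[of i "[]" i] K.one_not_zero by force
  fix I assume I: "submodule I A AA \<and> ?M \<subseteq> I"
  then have sI: "submodule I A AA" by simp
  have Isub: "I \<subseteq> carrier A" using L.submodule_carr[OF sI] by (auto simp: A.regular_simps)
  have Iadd: "a \<oplus>\<^bsub>A\<^esub> b \<in> I" if "a \<in> I" "b \<in> I" for a b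
    using submodule.axioms(1)[OF sI] that subgroup.m_closed[of I "add_monoid AA" a b] by (simp add: A.regular_simps)
  have Imul: "a \<otimes>\<^bsub>A\<^esub> b \<in> I" if "a \<in> carrier A" "b \<in> I" for a b
    using submodule.smult_closed[OF sI that] by (simp add: A.regular_simps)
  show "I = ?M \<or> I = carrier A"
  proof (rule disjCI)
    assume "I \<noteq> carrier A"
    have "g \<in> ?M" if g: "g \<in> I" for g
    proof (rule ccontr)
      assume "g \<notin> ?M"
      have gA: "g \<in> carrier A" using g Isub by blast
      let ?c = "g (i, [], i)"
      have c: "?c \<in> carrier K" "?c \<noteq> \<zero>\<^bsub>K\<^esub>" using \<open>g \<notin> ?M\<close> gA by auto
      then have inv: "inv\<^bsub>K\<^esub> ?c \<in> carrier K" "inv\<^bsub>K\<^esub> ?c \<otimes>\<^bsub>K\<^esub> ?c = \<one>\<^bsub>K\<^esub>" by (auto simp: K.field_Units)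
      have "h \<in> I" if h: "h \<in> carrier A" for h
      proof -
        let ?d = "h (i, [], i) \<otimes>\<^bsub>K\<^esub> inv\<^bsub>K\<^esub> ?c"
        let ?g = "(?d \<odot>\<^bsub>A\<^esub> \<one>\<^bsub>A\<^esub>) \<otimes>\<^bsub>A\<^esub> g"
        have d: "?d \<in> carrier K" using h inv by simp
        have gI: "?g \<in> I" by (rule Imul[OF sc_carr[OF d] g])
        then have g'A: "?g \<in> carrier A" using Isub by blast
        have "(?d \<odot>\<^bsub>A\<^esub> g) (i, [], i) = h (i, [], i)"
          unfolding A_simps(3) using h inv c by (simp add: K.m_assoc)
        then have "?g (i, [], i) = h (i, [], i)" by (simp only: scal_mult[OF d gA])
        then have "h \<ominus>\<^bsub>A\<^esub> ?g \<in> ?M" using h g'A by (simp add: A_diff a_minus_def[of K] K.r_neg)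
        then have "h \<ominus>\<^bsub>A\<^esub> ?g \<oplus>\<^bsub>A\<^esub> ?g \<in> I" using I gI by (intro Iadd) auto
        then show "h \<in> I" using h g'A by (simp add: a_minus_def A.a_assoc A.l_neg)
      qed
      then show False using Isub \<open>I \<noteq> carrier A\<close> by blast
    qed
    then show "I = ?M" using I by blast
  qed
qed

text \<open>\<open>J\<close> is the intersection of the maximal left ideals at the points.
  Conversely, if \<open>z\<close> in \<open>J\<close> were outside a maximal left ideal
  \<open>I\<close>, then \<open>I\<close> and \<open>z\<close> would generate the algebra, 1 would
  be the sum of some \<open>x\<close> in \<open>I\<close> and a left multiple of \<open>z\<close>,
  and \<open>left_ideal_one\<close> would put 1 into \<open>I\<close>.\<close>

lemma radical: "jacobson_radical A = J"
proof (rule equalityI; rule subsetI)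
  fix f assume f: "f \<in> jacobson_radical A"
  then show "f \<in> J" using vertex_ideal_maximal by (force simp: jacobson_radical_def J_def)
next
  interpret L: left_module A AA by (rule A.regular_left_module)
  fix z assume z: "z \<in> J"
  then have zA: "z \<in> carrier A" by (simp add: J_def)
  have "z \<in> I" if I: "maximal_left_ideal A I" for I
  proof (rule ccontr)
    assume zI: "z \<notin> I"
    have sI: "submodule I A AA" and ne: "I \<noteq> carrier A"
      and mx: "\<And>N. \<lbrakk>submodule N A AA; I \<subseteq> N\<rbrakk> \<Longrightarrow> N = I \<or> N = carrier A"
      using I by (auto simp: maximal_left_ideal_def)
    have Isub: "I \<subseteq> carrier A" using L.submodule_carr[OF sI] by (auto simp: A.regular_simps)
    have Iadd: "a \<oplus>\<^bsub>A\<^esub> b \<in> I" if "a \<in> I" "b \<in> I" for a b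
      using submodule.axioms(1)[OF sI] that subgroup.m_closed[of I "add_monoid AA" a b] by (simp add: A.regular_simps)
    have Imul: "a \<otimes>\<^bsub>A\<^esub> b \<in> I" if "a \<in> carrier A" "b \<in> I" for a b
      using submodule.smult_closed[OF sI that] by (simp add: A.regular_simps)
    have I0: "\<zero>\<^bsub>A\<^esub> \<in> I" using submodule.axioms(1)[OF sI] subgroup.one_closed[of I "add_monoid AA"] by (simp add: A.regular_simps)
    define N where "N = {x \<oplus>\<^bsub>A\<^esub> a \<otimes>\<^bsub>A\<^esub> z |x a. x \<in> I \<and> a \<in> carrier A}"
    have NI: "x \<oplus>\<^bsub>A\<^esub> a \<otimes>\<^bsub>A\<^esub> z \<in> N" if "x \<in> I" "a \<in> carrier A" for x a using that by (auto simp: N_def)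
    have sN: "submodule N A AA"
    proof (rule L.submoduleI)
      show "N \<subseteq> carrier AA" using Isub zA by (auto simp: N_def A.regular_simps)
      show "N \<noteq> {}" using NI[OF I0 A.zero_closed] by blast
      fix p assume "p \<in> N"
      then obtain x a where p: "x \<in> I" "a \<in> carrier A" "p = x \<oplus>\<^bsub>A\<^esub> a \<otimes>\<^bsub>A\<^esub> z" by (auto simp: N_def)
      have xA: "x \<in> carrier A" using p Isub by blast
      show "b \<odot>\<^bsub>AA\<^esub> p \<in> N" if b: "b \<in> carrier A" for b
      proof -
        have "b \<odot>\<^bsub>AA\<^esub> p = b \<otimes>\<^bsub>A\<^esub> x \<oplus>\<^bsub>A\<^esub> (b \<otimes>\<^bsub>A\<^esub> a) \<otimes>\<^bsub>A\<^esub> z"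
          using p b xA zA by (simp add: A.regular_simps A.r_distr A.m_assoc)
        then show ?thesis using NI[OF Imul[OF b p(1)], of "b \<otimes>\<^bsub>A\<^esub> a"] b p by simp
      qed
      fix q assume "q \<in> N"
      then obtain y b where q: "y \<in> I" "b \<in> carrier A" "q = y \<oplus>\<^bsub>A\<^esub> b \<otimes>\<^bsub>A\<^esub> z" by (auto simp: N_def)
      have yA: "y \<in> carrier A" using q Isub by blast
      have "p \<oplus>\<^bsub>A\<^esub> q = (x \<oplus>\<^bsub>A\<^esub> y) \<oplus>\<^bsub>A\<^esub> (a \<oplus>\<^bsub>A\<^esub> b) \<otimes>\<^bsub>A\<^esub> z"
        using p(2,3) q(2,3) xA yA zA by (simp add: A.l_distr A.a_ac)
      then show "p \<oplus>\<^bsub>AA\<^esub> q \<in> N" using NI[OF Iadd[OF p(1) q(1)], of "a \<oplus>\<^bsub>A\<^esub> b"] p q by (simp add: A.regular_simps)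
    qed
    have "x \<in> N" if "x \<in> I" for x
      using NI[OF that A.zero_closed] that Isub zA by (auto simp: subset_iff)
    moreover have "z \<in> N" using NI[OF I0 A.one_closed] zA by simp
    ultimately have "N = carrier A" using mx[OF sN] zI by blast
    then have "\<one>\<^bsub>A\<^esub> \<in> N" by simp
    then obtain x a where x: "x \<in> I" "a \<in> carrier A" "\<one>\<^bsub>A\<^esub> = x \<oplus>\<^bsub>A\<^esub> a \<otimes>\<^bsub>A\<^esub> z" by (auto simp: N_def)
    have xA: "x \<in> carrier A" using x Isub by blast
    have "\<one>\<^bsub>A\<^esub> \<ominus>\<^bsub>A\<^esub> a \<otimes>\<^bsub>A\<^esub> z = x" unfolding x(3) using x(2) xA zA by (simp add: a_minus_def A.a_assoc A.r_neg)
    then have 1: "\<one>\<^bsub>A\<^esub> \<in> I" using left_ideal_one[OF sI J_l_closed[OF x(2) z]] x(1) by simp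
    have "b \<in> I" if "b \<in> carrier A" for b using Imul[OF that 1] that by simp
    then show False using Isub ne by blast
  qed
  then show "z \<in> jacobson_radical A" using zA by (auto simp: jacobson_radical_def)
qed

text \<open>A path of length at least two is the product of its first arrow and the remaining path,
  both in \<open>J\<close>. An element is treated one path at a time, by induction on a finite set
  that contains its support.\<close>

lemma radical_square:
  "J \<cdot>\<^bsub>A\<^esub> J = {f \<in> carrier A. \<forall>p. length (fst (snd p)) \<le> 1 \<longrightarrow> f p = \<zero>\<^bsub>K\<^esub>}"
proof (rule equalityI; rule subsetI)
  fix f assume "f \<in> J \<cdot>\<^bsub>A\<^esub> J"
  then show "f \<in> {f \<in> carrier A. \<forall>p. length (fst (snd p)) \<le> 1 \<longrightarrow> f p = \<zero>\<^bsub>K\<^esub>}"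
  proof (induction rule: ideal_prod.induct)
    case (prod g h)
    then have gh: "g \<in> carrier A" "h \<in> carrier A" by (auto simp: J_def)
    have "(g \<otimes>\<^bsub>A\<^esub> h) p = \<zero>\<^bsub>K\<^esub>" if "length (fst (snd p)) \<le> 1" for p
    proof (rule mult_vanish)
      fix x assume "x \<in> F p"
      then obtain u a v b w where x: "x = ((v, b, w), (u, a, v))" "awalk u a v" "awalk v b w" "p = (u, a @ b, w)"
        by (auto simp: path_factorizations_def)
      then have "a = [] \<or> b = []" using that by (cases a; cases b) auto
      then show "g (fst x) \<otimes>\<^bsub>K\<^esub> h (snd x) = \<zero>\<^bsub>K\<^esub>" using x prod gh by (auto simp: J_def awalk_Nil_iff)
    qed
    then show ?case using gh by simp
  next
    case (sum g h)
    then have "(g \<oplus>\<^bsub>A\<^esub> h) p = \<zero>\<^bsub>K\<^esub>" if "length (fst (snd p)) \<le> 1" for p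
      using that unfolding A_simps(2) by simp
    then show ?case using sum by simp
  qed
next
  fix f assume "f \<in> {f \<in> carrier A. \<forall>p. length (fst (snd p)) \<le> 1 \<longrightarrow> f p = \<zero>\<^bsub>K\<^esub>}"
  then have f: "f \<in> carrier A" "\<And>p. length (fst (snd p)) \<le> 1 \<Longrightarrow> f p = \<zero>\<^bsub>K\<^esub>" by auto
  have "g \<in> J \<cdot>\<^bsub>A\<^esub> J" if "finite S" "S \<subseteq> \<P>" "g \<in> carrier A" "\<And>p. length (fst (snd p)) \<le> 1 \<Longrightarrow> g p = \<zero>\<^bsub>K\<^esub>"
    "\<And>p. p \<notin> S \<Longrightarrow> g p = \<zero>\<^bsub>K\<^esub>" for S g
    using that
  proof (induction S arbitrary: g rule: finite_induct)
    case empty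
    then have g: "g = \<zero>\<^bsub>A\<^esub>" by (auto simp: A_simps(1))
    have "\<zero>\<^bsub>A\<^esub> \<in> J" unfolding J_def using A.zero_closed by (simp add: A_simps(1))
    from ideal_prod.prod[OF this this, of A] show ?case by (simp add: g)
  next
    case (insert p S)
    let ?g = "\<lambda>q. if q = p then \<zero>\<^bsub>K\<^esub> else g q"
    have g': "?g \<in> carrier A" using insert.prems(2) by (auto simp: A_carrier)
    have rest: "?g \<in> J \<cdot>\<^bsub>A\<^esub> J"
      by (rule insert.IH) (use insert.prems g' in auto)
    show ?case
    proof (cases "length (fst (snd p)) \<le> 1")
      case True
      then have "?g q = g q" for q using insert.prems(3)[of p] by simp
      then have "?g = g" by (rule ext)
      then show ?thesis using rest by simp
    next
      case False
      obtain u q w where p: "p = (u, q, w)" "awalk u q w" using insert.prems(1) by (auto simp: quiver_paths_def)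
      obtain e es where q: "q = e # es" "es \<noteq> []" using False p(1) by (cases q) auto
      have e: "e \<in> arcs Q" "u = tail Q e" "awalk (head Q e) es w" using p(2) q by (auto simp: awalk_Cons_iff)
      let ?x = "(head Q e, es, w)" and ?y = "(u, [e], head Q e)"
      have y: "awalk u [e] (head Q e)" using e by (auto simp: awalk_Cons_iff awalk_Nil_iff)
      have xy: "(?x, ?y) \<in> F p" using e(3) y p(1) q(1) by (auto simp: F_mem)
      have gp: "g p \<in> carrier K" using insert.prems(2) by simp
      have "dl ?x (g p) \<in> J" "dl ?y \<one>\<^bsub>K\<^esub> \<in> J"
        using q(2) dl_carr[OF gp, of ?x] dl_carr[OF K.one_closed, of ?y] e(3) y
        by (simp_all add: J_def dl_apply paths_mem)
      then have "dl p (g p) \<in> J \<cdot>\<^bsub>A\<^esub> J" using ideal_prod.prod dl_mult[OF gp xy] by metis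
      then have "?g \<oplus>\<^bsub>A\<^esub> dl p (g p) \<in> J \<cdot>\<^bsub>A\<^esub> J" by (rule ideal_prod.sum[OF rest])
      moreover have "?g \<oplus>\<^bsub>A\<^esub> dl p (g p) = g" using insert.prems(2) by (auto simp: A_simps(2) dl_def)
      ultimately show ?thesis by simp
    qed
  qed
  from this[OF fin_paths subset_refl f] show "f \<in> J \<cdot>\<^bsub>A\<^esub> J" using A_off[OF f(1)] by blast
qed

end

section \<open>The quivers of type A and D\<close>

definition forest_quiver :: "nat set \<Rightarrow> (nat \<Rightarrow> nat) \<Rightarrow> (nat, nat \<times> nat) pre_digraph" where
  "forest_quiver V par = \<lparr>verts = V, arcs = {(par j, j) | j. j \<in> V \<and> par j \<in> V}, tail = fst, head = snd\<rparr>"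

locale forest = K: field K for K :: "('k, 'm) ring_scheme" +
  fixes V :: "nat set" and par :: "nat \<Rightarrow> nat"
  assumes finV: "finite V" and par_gt: "j \<in> V \<Longrightarrow> j < par j" and par_two: "card {j \<in> V. par j = i} \<le> 2"
begin

abbreviation "Q \<equiv> forest_quiver V par"

lemma Q_simps [simp]:
  "verts Q = V" "arcs Q = {(par j, j) | j. j \<in> V \<and> par j \<in> V}" "tail Q = fst" "head Q = snd"
  by (simp_all add: forest_quiver_def)

text \<open>Arrows lead from larger to smaller numbers. This bounds the lengths of the paths, and
  hence their number.\<close>

lemma path_length:
  assumes "set p \<subseteq> arcs Q" "pre_digraph.cas Q u p v" shows "length p \<le> u"
  using assms
proof (induction p arbitrary: u)
  case (Cons e p)
  then obtain j where j: "e = (par j, j)" "j \<in> V" by auto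
  have "length p \<le> j" using Cons j by (simp add: pre_digraph.cas.simps)
  then show ?case using par_gt[OF j(2)] Cons.prems(2) j(1) by (simp add: pre_digraph.cas.simps)
qed simp

sublocale wf_digraph Q by unfold_locales auto

sublocale path_alg K Q
proof unfold_locales
  have "quiver_paths Q \<subseteq> V \<times> {p. set p \<subseteq> arcs Q \<and> length p \<le> Max V} \<times> V"
  proof
    fix x assume "x \<in> quiver_paths Q"
    then obtain u p v where x: "x = (u, p, v)" "awalk u p v" by (auto simp: quiver_paths_def)
    have "u \<in> V" "v \<in> V" using awalk_hd_in_verts[OF x(2)] awalk_last_in_verts[OF x(2)] by auto
    moreover have p: "set p \<subseteq> arcs Q" "cas u p v" using x(2) by (simp_all add: awalk_def)
    moreover have "length p \<le> Max V" using path_length[OF p] Max_ge[OF finV \<open>u \<in> V\<close>] by simp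
    ultimately show "x \<in> V \<times> {p. set p \<subseteq> arcs Q \<and> length p \<le> Max V} \<times> V" using x(1) by simp
  qed
  moreover have "finite (arcs Q)" using finV by simp
  then have "finite {p. set p \<subseteq> arcs Q \<and> length p \<le> Max V}" by (rule finite_lists_length_le)
  ultimately show "finite (quiver_paths Q)" using finV by (auto intro: finite_subset)
qed

abbreviation "ev \<equiv> \<lambda>i f. f (i, [], i)"
abbreviation "om \<equiv> \<lambda>j f. f (par j, [(par j, j)], j)"

lemma arrow: assumes "j \<in> V" "par j \<in> V" shows "(par j, [(par j, j)], j) \<in> \<P>"
  using assms by (simp add: paths_mem awalk_Cons_iff awalk_Nil_iff)

text \<open>The values at trivial paths and at arrows serve as coordinates; the longer paths are
  invisible to them and span the common kernel.\<close>

sublocale pre_rsz K "path_algebra K Q" V par ev om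
proof (intro pre_rsz.intro pre_rsz_axioms.intro K.field_axioms A_ring)
  fix C D
  assume C: "\<And>i. i \<in> V \<Longrightarrow> C i \<in> carrier K" and D: "\<And>j. \<lbrakk>j \<in> V; par j \<in> V\<rbrakk> \<Longrightarrow> D j \<in> carrier K"
  define f where "f = (\<lambda>(u, p, v). if u \<in> V \<and> p = [] \<and> u = v then C u
    else if v \<in> V \<and> par v \<in> V \<and> u = par v \<and> p = [(par v, v)] then D v else \<zero>\<^bsub>K\<^esub>)"
  have "f \<in> carrier A"
    unfolding A_carrier
  proof (intro conjI allI impI)
    fix p :: "(nat, nat \<times> nat) path"
    obtain u q v where p: "p = (u, q, v)" by (cases p)
    show "f p \<in> carrier K" using C[of u] D[of v] by (auto simp: f_def p)
    assume "p \<notin> \<P>"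
    then show "f p = \<zero>\<^bsub>K\<^esub>" using triv_path[of u] arrow[of v] by (auto simp: f_def p)
  qed
  then show "\<exists>a\<in>carrier A. (\<forall>i\<in>V. a (i, [], i) = C i) \<and> (\<forall>j\<in>V. par j \<in> V \<longrightarrow> a (par j, [(par j, j)], j) = D j)"
    by (intro bexI[of _ f]) (auto simp: f_def)
next
  show "(f \<otimes>\<^bsub>A\<^esub> g) (par j, [(par j, j)], j) =
      f (j, [], j) \<otimes>\<^bsub>K\<^esub> g (par j, [(par j, j)], j) \<oplus>\<^bsub>K\<^esub> f (par j, [(par j, j)], j) \<otimes>\<^bsub>K\<^esub> g (par j, [], par j)"
    if "f \<in> carrier A" "g \<in> carrier A" "j \<in> V" "par j \<in> V" for f g j
    using mult_arrow[OF that(1,2), of "(par j, j)"] that(3,4) by simp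
  show "c \<odot>\<^bsub>A\<^esub> f = (c \<odot>\<^bsub>A\<^esub> \<one>\<^bsub>A\<^esub>) \<otimes>\<^bsub>A\<^esub> f" if "c \<in> carrier K" "f \<in> carrier A" for c f
    using scal_mult[OF that] by simp
  show "c \<odot>\<^bsub>A\<^esub> \<one>\<^bsub>A\<^esub> \<in> carrier A" if "c \<in> carrier K" for c using that by (rule sc_carr)
  show "(c \<odot>\<^bsub>A\<^esub> \<one>\<^bsub>A\<^esub>) (i, [], i) = c" if "c \<in> carrier K" "i \<in> V" for c i
    using that by (simp add: A_simps(3) A_one)
  show "(c \<odot>\<^bsub>A\<^esub> \<one>\<^bsub>A\<^esub>) (par j, [(par j, j)], j) = \<zero>\<^bsub>K\<^esub>" if "c \<in> carrier K" for c j
    using that by (simp add: A_simps(3) A_one)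
qed (auto simp: finV par_gt par_two A_simps(2) A_one mult_triv)

text \<open>\<open>KI\<close> tests the values at trivial paths and arrows, which are all the paths
  of length at most one; triples that are not paths carry the value zero.\<close>

lemma radical_square_KI: "jacobson_radical A \<cdot>\<^bsub>A\<^esub> jacobson_radical A = KI"
proof -
  have "f p = \<zero>\<^bsub>K\<^esub>" if f: "f \<in> carrier A" "\<forall>i\<in>V. f (i, [], i) = \<zero>\<^bsub>K\<^esub>"
    "\<forall>j\<in>V. par j \<in> V \<longrightarrow> f (par j, [(par j, j)], j) = \<zero>\<^bsub>K\<^esub>" and l: "length (fst (snd p)) \<le> 1" for f p
  proof (cases "p \<in> \<P>")
    case True
    then obtain u q w where p: "p = (u, q, w)" "awalk u q w" by (auto simp: quiver_paths_def)
    then consider "q = []" | e where "q = [e]" using l by (cases q) auto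
    then show ?thesis
    proof cases
      case 1
      then have "u = w" "w \<in> V" using p(2) by (auto simp: awalk_Nil_iff)
      then show ?thesis using f(2) p(1) 1 by simp
    next
      case 2
      then have "\<exists>j. e = (par j, j) \<and> j \<in> V \<and> par j \<in> V" "u = fst e" "w = snd e"
        using p(2) by (auto simp: awalk_Cons_iff awalk_Nil_iff)
      then show ?thesis using f(3) p(1) 2 by auto
    qed
  qed (use A_off f(1) in blast)
  then show ?thesis unfolding radical radical_square KI_def by (auto simp del: split_paired_All)
qed

lemma mod_rad_square: "mod_rad_square A = QA"
  by (simp add: mod_rad_square_def QA_def radical_square_KI)

lemma rsz_mod_rad_square: "rsz K (mod_rad_square A) V par evq omq"
  unfolding mod_rad_square by (rule QA_rsz)

lemmas tilt_counts = rsz.tau_tilt_count[OF rsz_mod_rad_square] rsz.stau_tilt_count[OF rsz_mod_rad_square]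

end

text \<open>In type D only the point 1 is exceptional, as 2 has the parent 3 in any case. The parent
  of the largest point falls outside the quiver.\<close>

definition parent :: "quiver_type \<Rightarrow> nat \<Rightarrow> nat" where
  "parent T j = (if T = TypeD \<and> j = 1 then 3 else Suc j)"

lemma linear_quiver_eq: "linear_quiver T n = forest_quiver {1..n} (parent T)"
proof (cases T)
  case TypeA
  then show ?thesis by (auto simp: linear_quiver_def forest_quiver_def parent_def)
next
  case TypeD
  have "quiver_arrows TypeD n = {(parent TypeD j, j) | j. j \<in> {1..n} \<and> parent TypeD j \<in> {1..n}}"
  proof (rule equalityI; rule subsetI)
    fix x assume "x \<in> quiver_arrows TypeD n"
    then have "x = (parent TypeD (snd x), snd x) \<and> snd x \<in> {1..n} \<and> parent TypeD (snd x) \<in> {1..n}"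
      by (auto simp: parent_def split: if_splits)
    then show "x \<in> {(parent TypeD j, j) | j. j \<in> {1..n} \<and> parent TypeD j \<in> {1..n}}" by blast
  next
    fix x assume "x \<in> {(parent TypeD j, j) | j. j \<in> {1..n} \<and> parent TypeD j \<in> {1..n}}"
    then obtain j where j: "x = (parent TypeD j, j)" "1 \<le> j" "parent TypeD j \<le> n" by auto
    consider "j = 1" | "j = 2" | "3 \<le> j" using j(2) by linarith
    then show "x \<in> quiver_arrows TypeD n" using j by cases (auto simp: parent_def)
  qed
  then show ?thesis using TypeD by (simp add: linear_quiver_def forest_quiver_def)
qed

lemma parent_kids_card: "card {j \<in> U. parent T j = i} \<le> 2"
proof -
  \<comment> \<open>One child is \<open>i - 1\<close>; a second one can only be 1, attached to 3 in
    type D.\<close>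
  have "{j \<in> U. parent T j = i} \<subseteq> {1, i - 1}" by (auto simp: parent_def)
  from card_mono[OF _ this] show ?thesis by (simp add: card_insert_if split: if_splits)
qed

lemma Lambda2_counts:
  assumes "field K"
  shows "finite (tau_tilt K (Lambda2 K T n))" "card (tau_tilt K (Lambda2 K T n)) = card (maxc (parent T) {1..n})"
    "finite (stau_tilt K (Lambda2 K T n))" "card (stau_tilt K (Lambda2 K T n)) = card (smaxc (parent T) {1..n})"
proof -
  have "forest K {1..n} (parent T)"
  proof (intro forest.intro forest_axioms.intro assms parent_kids_card)
    show "j < parent T j" for j by (simp add: parent_def)
  qed simp
  from forest.tilt_counts[OF this]
  show "finite (tau_tilt K (Lambda2 K T n))" "card (tau_tilt K (Lambda2 K T n)) = card (maxc (parent T) {1..n})"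
    "finite (stau_tilt K (Lambda2 K T n))" "card (stau_tilt K (Lambda2 K T n)) = card (smaxc (parent T) {1..n})"
    unfolding Lambda2_def linear_quiver_eq by blast+
qed

theorem theorem2p12:
  fixes K :: "('k, 'm) ring_scheme" and T :: quiver_type and n :: nat
  assumes "algebraically_closed K"
    and "case T of TypeA \<Rightarrow> n \<ge> 2 | TypeD \<Rightarrow> n \<ge> 4"
  shows
    "(\<forall>m \<in> {n, n - 1, n - 2}.
        finite (tau_tilt K (Lambda2 K T m)) \<and> finite (stau_tilt K (Lambda2 K T m))) \<and>
     card (tau_tilt K (Lambda2 K T n)) =
       card (tau_tilt K (Lambda2 K T (n - 1))) + card (tau_tilt K (Lambda2 K T (n - 2))) \<and>
     card (stau_tilt K (Lambda2 K T n)) =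
       2 * card (stau_tilt K (Lambda2 K T (n - 1))) + card (stau_tilt K (Lambda2 K T (n - 2)))"
proof -
  have "field K" using assms(1) by (simp add: algebraically_closed_def)
  note c = Lambda2_counts[OF this]
  have n: "n \<ge> 2" "T = TypeD \<Longrightarrow> n \<ge> 4" using assms(2) by (cases T; simp)+
  \<comment> \<open>For \<open>n = 2\<close> in type A the set of the first \<open>n - 2\<close>
    points is empty; it corresponds to the zero algebra, whose count is 1.\<close>
  have U: "{1..n} - {n} = {1..n - 1}" "{1..n} - {n, n - 1} = {1..n - 2}" "{1..n - 1} - {n - 1} = {1..n - 2}"
    "{1..n} = insert n {1..n - 1}" using n(1) by auto
  \<comment> \<open>In type D the bound \<open>n \<ge> 4\<close> enters here: for
    \<open>n = 3\<close> the point \<open>n\<close> would have the two children 1 and 2.\<close>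
  have k: "kids (parent T) {1..n} n = {n - 1}"
  proof -
    have "parent T (n - 1) = n" using n by (cases T) (auto simp: parent_def)
    then have "n - 1 \<in> kids (parent T) {1..n} n" using n(1) by (simp add: kids_def)
    moreover have "kids (parent T) {1..n} n \<subseteq> {n - 1}"
    proof
      fix j assume "j \<in> kids (parent T) {1..n} n"
      then have "parent T j = n" by (simp add: kids_def)
      then show "j \<in> {n - 1}" using n by (auto simp: parent_def split: if_splits)
    qed
    ultimately show ?thesis by blast
  qed
  have two: "card (kids (parent T) V i) \<le> 2" for V i unfolding kids_def by (rule parent_kids_card)
  have pn: "parent T n \<notin> {1..n}" by (simp add: parent_def)
  have 1: "card (maxc (parent T) {1..n}) = card (maxc (parent T) {1..n - 1}) + card (maxc (parent T) {1..n - 2})"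
    using maxc_top_one[OF _ _ _ _ k] two pn n(1) unfolding U(1,2) by simp
  have 2: "card (smaxc (parent T) {1..n}) = 2 * card (smaxc (parent T) {1..n - 1}) + card (smaxc (parent T) {1..n - 2})"
    using smaxc_recurrence[of "{1..n - 1}" "parent T" n "n - 1"] two pn k n(1) unfolding U(4)[symmetric] U(3) by simp
  show ?thesis using c 1 2 by simp
qed

end
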